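(* Let $K$ be an algebraically closed field of characteristic $p>0$ and let $R$ be a normal two-dimensional standard graded $K$-algebra. Let $f_1,f_2,f_3\in R$ be homogeneous elements of degrees $d_1,d_2,d_3$ which are pairwise primary. Let $g_1,g_2,g_3\in R$ be a primary homogeneous relation (for $f_1,f_2,f_3$) of total degree $k$. Then for $m=\max(k,\,d_1+d_2+d_3-k)$ we have $$R_{\geq m}\subseteq (f_1,f_2,f_3)^{+\mathrm{gr}}.$$
   Context: A standard graded $K$-algebra is an $\mathbb{N}$-graded ring $R=\bigoplus_{k\ge 0}R_k$ with $R_0=K$, generated over $K$ by finitely many elements of degree one; $R_+=\bigoplus_{k\ge1}R_k$ and $R_{\ge m}=\bigoplus_{k\ge m}R_k$. Normal means integrally closed domain. Homogeneous elements $h_1,\dots,h_r\in R$ are called primary if $R_+$ is contained in the radical of $(h_1,\dots,h_r)$; $f_1,f_2,f_3$ are pairwise primary if each pair $f_i,f_j$ ($i\ne j$) is primary. A primary homogeneous relation for $f_1,f_2,f_3$ of total degree $k$ consists of homogeneous elements $g_1,g_2,g_3$ with $f_1g_1+f_2g_2+f_3g_3=0$, $\deg g_i+\deg f_i=k$ for $i=1,2,3$, such that $g_1,g_2,g_3$ are primary. An element $f_0\in R$ belongs to $(f_1,\dots,f_n)^{+\mathrm{gr}}$ if there exists a finite graded extension $R\subseteq R'$ with $f_0\in(f_1,\dots,f_n)R'$. *)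

theory Defs
  imports "HOL-Algebra.Algebra" "HOL-Library.Extended_Nat"
begin

section \<open>Characteristic, radical, Krull dimension\<close>

text \<open>The order of an element of infinite order is 0, as usual for the characteristic.\<close>

definition ring_char :: "('a, 'm) ring_scheme \<Rightarrow> nat" where
  "ring_char R = group.ord (add_monoid R) \<one>\<^bsub>R\<^esub>"

definition ideal_radical :: "('a, 'm) ring_scheme \<Rightarrow> 'a set \<Rightarrow> 'a set" where
  "ideal_radical R I = {x \<in> carrier R. \<exists>n::nat. x [^]\<^bsub>R\<^esub> n \<in> I}"

definition krull_dim :: "('a, 'm) ring_scheme \<Rightarrow> enat" where
  "krull_dim R =
     Sup {enat n | n. \<exists>P. (\<forall>i\<le>n. primeideal (P i) R) \<and> (\<forall>i<n. P i \<subset> P (Suc i))}"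


section \<open>Fraction fields and normality\<close>

text \<open>The fraction a/b is the class of all pairs (c,d) with d nonzero and ad = cb.\<close>

definition fraction :: "('a, 'm) ring_scheme \<Rightarrow> 'a \<Rightarrow> 'a \<Rightarrow> ('a \<times> 'a) set" where
  "fraction R a b =
     {(c, d). c \<in> carrier R \<and> d \<in> carrier R - {\<zero>\<^bsub>R\<^esub>} \<and> a \<otimes>\<^bsub>R\<^esub> d = c \<otimes>\<^bsub>R\<^esub> b}"

definition fraction_field :: "('a, 'm) ring_scheme \<Rightarrow> ('a \<times> 'a) set ring" where
  "fraction_field R =
     \<lparr> carrier = {fraction R a b | a b. a \<in> carrier R \<and> b \<in> carrier R - {\<zero>\<^bsub>R\<^esub>}},
       monoid.mult = (\<lambda>x y. \<Union>(a, b)\<in>x. \<Union>(c, d)\<in>y. fraction R (a \<otimes>\<^bsub>R\<^esub> c) (b \<otimes>\<^bsub>R\<^esub> d)),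
       one = fraction R \<one>\<^bsub>R\<^esub> \<one>\<^bsub>R\<^esub>,
       ring.zero = fraction R \<zero>\<^bsub>R\<^esub> \<one>\<^bsub>R\<^esub>,
       ring.add = (\<lambda>x y. \<Union>(a, b)\<in>x. \<Union>(c, d)\<in>y.
                fraction R (a \<otimes>\<^bsub>R\<^esub> d \<oplus>\<^bsub>R\<^esub> c \<otimes>\<^bsub>R\<^esub> b) (b \<otimes>\<^bsub>R\<^esub> d)) \<rparr>"

definition fraction_embed :: "('a, 'm) ring_scheme \<Rightarrow> 'a \<Rightarrow> ('a \<times> 'a) set" where
  "fraction_embed R a = fraction R a \<one>\<^bsub>R\<^esub>"

context "domain" begin

lemma fraction_eq_iff:
  assumes "a \<in> carrier R" "b \<in> carrier R - {\<zero>}" "c \<in> carrier R" "d \<in> carrier R - {\<zero>}"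
  shows "fraction R a b = fraction R c d \<longleftrightarrow> a \<otimes> d = c \<otimes> b"
proof
  assume "fraction R a b = fraction R c d"
  moreover have "(c, d) \<in> fraction R c d"
    using assms by (simp add: fraction_def)
  ultimately show "a \<otimes> d = c \<otimes> b"
    by (auto simp: fraction_def)
next
  have sub: "fraction R a b \<subseteq> fraction R c d"
    if "a \<otimes> d = c \<otimes> b" and mem: "a \<in> carrier R" "b \<in> carrier R - {\<zero>}" "c \<in> carrier R" "d \<in> carrier R - {\<zero>}"
    for a b c d
  proof
    fix z assume "z \<in> fraction R a b"
    then obtain x y where z: "z = (x, y)" "x \<in> carrier R" "y \<in> carrier R - {\<zero>}" "a \<otimes> y = x \<otimes> b"
      by (auto simp: fraction_def)
    have "b \<otimes> (c \<otimes> y) = b \<otimes> (x \<otimes> d)"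
    proof -
      have "b \<otimes> (c \<otimes> y) = (c \<otimes> b) \<otimes> y" using mem z by (simp add: m_ac)
      also have "\<dots> = (a \<otimes> d) \<otimes> y" using that(1) by simp
      also have "\<dots> = (a \<otimes> y) \<otimes> d" using mem z(2,3) by (simp add: m_ac)
      also have "\<dots> = (x \<otimes> b) \<otimes> d" using z(4) by simp
      also have "\<dots> = b \<otimes> (x \<otimes> d)" using mem z(2,3) by (simp add: m_ac)
      finally show ?thesis .
    qed
    then have "c \<otimes> y = x \<otimes> d" using mem z by (auto simp: m_lcancel)
    then show "z \<in> fraction R c d" using z by (simp add: fraction_def)
  qed
  assume eq: "a \<otimes> d = c \<otimes> b"
  show "fraction R a b = fraction R c d"
    using sub[OF eq assms] sub[OF eq[symmetric] assms(3,4,1,2)] by blast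
qed

lemma fraction_self:
  "a \<in> carrier R \<Longrightarrow> b \<in> carrier R - {\<zero>} \<Longrightarrow> (a, b) \<in> fraction R a b"
  by (simp add: fraction_def)

lemma nonzero_mult:
  "a \<in> carrier R - {\<zero>} \<Longrightarrow> b \<in> carrier R - {\<zero>} \<Longrightarrow> a \<otimes> b \<in> carrier R - {\<zero>}"
  using integral by auto

lemma fraction_mult:
  assumes "a \<in> carrier R" "b \<in> carrier R - {\<zero>}" "c \<in> carrier R" "d \<in> carrier R - {\<zero>}"
  shows "fraction R a b \<otimes>\<^bsub>fraction_field R\<^esub> fraction R c d = fraction R (a \<otimes> c) (b \<otimes> d)"
proof -
  have "fraction R (x \<otimes> z) (y \<otimes> w) = fraction R (a \<otimes> c) (b \<otimes> d)"
    if "(x, y) \<in> fraction R a b" "(z, w) \<in> fraction R c d" for x y z w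
  proof -
    have m: "x \<in> carrier R" "y \<in> carrier R - {\<zero>}" "z \<in> carrier R" "w \<in> carrier R - {\<zero>}"
      and e: "a \<otimes> y = x \<otimes> b" "c \<otimes> w = z \<otimes> d"
      using that by (auto simp: fraction_def)
    have "(x \<otimes> z) \<otimes> (b \<otimes> d) = (x \<otimes> b) \<otimes> (z \<otimes> d)" using m assms by (simp add: m_ac)
    also have "\<dots> = (a \<otimes> y) \<otimes> (c \<otimes> w)" using e by simp
    also have "\<dots> = (a \<otimes> c) \<otimes> (y \<otimes> w)" using m assms by (simp add: m_ac)
    finally show ?thesis
      using m assms nonzero_mult by (subst fraction_eq_iff) auto
  qed
  then have "(\<Union>(x, y)\<in>fraction R a b. \<Union>(z, w)\<in>fraction R c d. fraction R (x \<otimes> z) (y \<otimes> w))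
     = (\<Union>u\<in>fraction R a b. \<Union>v\<in>fraction R c d. fraction R (a \<otimes> c) (b \<otimes> d))"
    by (intro SUP_cong refl) (auto split: prod.splits)
  also have "\<dots> = fraction R (a \<otimes> c) (b \<otimes> d)"
    using fraction_self[OF assms(1,2)] fraction_self[OF assms(3,4)] by blast
  finally show ?thesis by (simp add: fraction_field_def)
qed

lemma fraction_add:
  assumes "a \<in> carrier R" "b \<in> carrier R - {\<zero>}" "c \<in> carrier R" "d \<in> carrier R - {\<zero>}"
  shows "fraction R a b \<oplus>\<^bsub>fraction_field R\<^esub> fraction R c d
    = fraction R (a \<otimes> d \<oplus> c \<otimes> b) (b \<otimes> d)"
proof -
  have "fraction R (x \<otimes> w \<oplus> z \<otimes> y) (y \<otimes> w) = fraction R (a \<otimes> d \<oplus> c \<otimes> b) (b \<otimes> d)"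
    if "(x, y) \<in> fraction R a b" "(z, w) \<in> fraction R c d" for x y z w
  proof -
    have m: "x \<in> carrier R" "y \<in> carrier R - {\<zero>}" "z \<in> carrier R" "w \<in> carrier R - {\<zero>}"
      and e: "a \<otimes> y = x \<otimes> b" "c \<otimes> w = z \<otimes> d"
      using that by (auto simp: fraction_def)
    have "(x \<otimes> w \<oplus> z \<otimes> y) \<otimes> (b \<otimes> d) = (x \<otimes> b) \<otimes> (w \<otimes> d) \<oplus> (z \<otimes> d) \<otimes> (y \<otimes> b)"
      using m assms by (simp add: m_ac l_distr r_distr)
    also have "\<dots> = (a \<otimes> y) \<otimes> (w \<otimes> d) \<oplus> (c \<otimes> w) \<otimes> (y \<otimes> b)" using e by simp
    also have "\<dots> = (a \<otimes> d \<oplus> c \<otimes> b) \<otimes> (y \<otimes> w)"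
      using m assms by (simp add: m_ac l_distr r_distr)
    finally show ?thesis
      using m assms nonzero_mult by (subst fraction_eq_iff) auto
  qed
  then have "(\<Union>(x, y)\<in>fraction R a b. \<Union>(z, w)\<in>fraction R c d. fraction R (x \<otimes> w \<oplus> z \<otimes> y) (y \<otimes> w))
     = (\<Union>u\<in>fraction R a b. \<Union>v\<in>fraction R c d. fraction R (a \<otimes> d \<oplus> c \<otimes> b) (b \<otimes> d))"
    by (intro SUP_cong refl) (auto split: prod.splits)
  also have "\<dots> = fraction R (a \<otimes> d \<oplus> c \<otimes> b) (b \<otimes> d)"
    using fraction_self[OF assms(1,2)] fraction_self[OF assms(3,4)] by blast
  finally show ?thesis by (simp add: fraction_field_def)
qed

lemma fraction_carrier:
  "x \<in> carrier (fraction_field R) \<longleftrightarrow>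
     (\<exists>a b. x = fraction R a b \<and> a \<in> carrier R \<and> b \<in> carrier R - {\<zero>})"
  by (auto simp: fraction_field_def)

lemma fraction_closed:
  "a \<in> carrier R \<Longrightarrow> b \<in> carrier R - {\<zero>} \<Longrightarrow> fraction R a b \<in> carrier (fraction_field R)"
  unfolding fraction_carrier by blast

lemma fraction_zero: "\<zero>\<^bsub>fraction_field R\<^esub> = fraction R \<zero> \<one>"
  and fraction_one: "\<one>\<^bsub>fraction_field R\<^esub> = fraction R \<one> \<one>"
  by (simp_all add: fraction_field_def)

lemma fraction_field_cring: "cring (fraction_field R)"
proof (rule cringI)
  show "abelian_group (fraction_field R)"
  proof (rule abelian_groupI)
    fix x y z assume "x \<in> carrier (fraction_field R)" "y \<in> carrier (fraction_field R)"
      "z \<in> carrier (fraction_field R)"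
    then obtain a b c d e f where
      x: "x = fraction R a b" "a \<in> carrier R" "b \<in> carrier R - {\<zero>}" and
      y: "y = fraction R c d" "c \<in> carrier R" "d \<in> carrier R - {\<zero>}" and
      z: "z = fraction R e f" "e \<in> carrier R" "f \<in> carrier R - {\<zero>}"
      unfolding fraction_carrier by blast
    have nz: "b \<otimes> d \<in> carrier R - {\<zero>}" "d \<otimes> f \<in> carrier R - {\<zero>}"
      using x y z nonzero_mult by auto
    show "x \<oplus>\<^bsub>fraction_field R\<^esub> y \<in> carrier (fraction_field R)"
      using x y nz by (auto simp: fraction_add fraction_carrier)
    show "x \<oplus>\<^bsub>fraction_field R\<^esub> y \<oplus>\<^bsub>fraction_field R\<^esub> z =
          x \<oplus>\<^bsub>fraction_field R\<^esub> (y \<oplus>\<^bsub>fraction_field R\<^esub> z)"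
      using x y z nz by (simp add: fraction_add l_distr r_distr m_ac a_ac)
    show "x \<oplus>\<^bsub>fraction_field R\<^esub> y = y \<oplus>\<^bsub>fraction_field R\<^esub> x"
      using x y by (simp add: fraction_add a_ac m_ac)
  next
    show "\<zero>\<^bsub>fraction_field R\<^esub> \<in> carrier (fraction_field R)"
      by (simp add: fraction_closed fraction_zero)
  next
    fix x assume "x \<in> carrier (fraction_field R)"
    then obtain a b where x: "x = fraction R a b" "a \<in> carrier R" "b \<in> carrier R - {\<zero>}"
      unfolding fraction_carrier by blast
    show "\<zero>\<^bsub>fraction_field R\<^esub> \<oplus>\<^bsub>fraction_field R\<^esub> x = x"
      using x by (simp add: fraction_zero fraction_add)
    have bb: "b \<otimes> b \<in> carrier R - {\<zero>}" using x nonzero_mult by auto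
    have "fraction R (\<ominus> a) b \<oplus>\<^bsub>fraction_field R\<^esub> x = fraction R (\<ominus> a \<otimes> b \<oplus> a \<otimes> b) (b \<otimes> b)"
      using x by (simp add: fraction_add)
    also have "\<dots> = fraction R \<zero> \<one>"
      using x bb by (subst fraction_eq_iff) (auto simp: l_minus l_neg)
    finally show "\<exists>y\<in>carrier (fraction_field R). y \<oplus>\<^bsub>fraction_field R\<^esub> x = \<zero>\<^bsub>fraction_field R\<^esub>"
      using x by (intro bexI[of _ "fraction R (\<ominus> a) b"]) (auto simp: fraction_carrier fraction_zero)
  qed
  show "comm_monoid (fraction_field R)"
  proof (rule comm_monoidI)
    fix x y z assume "x \<in> carrier (fraction_field R)" "y \<in> carrier (fraction_field R)"
      "z \<in> carrier (fraction_field R)"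
    then obtain a b c d e f where
      x: "x = fraction R a b" "a \<in> carrier R" "b \<in> carrier R - {\<zero>}" and
      y: "y = fraction R c d" "c \<in> carrier R" "d \<in> carrier R - {\<zero>}" and
      z: "z = fraction R e f" "e \<in> carrier R" "f \<in> carrier R - {\<zero>}"
      unfolding fraction_carrier by blast
    have nz: "b \<otimes> d \<in> carrier R - {\<zero>}" "d \<otimes> f \<in> carrier R - {\<zero>}"
      using x y z nonzero_mult by auto
    show "x \<otimes>\<^bsub>fraction_field R\<^esub> y \<in> carrier (fraction_field R)"
      using x y nz by (auto simp: fraction_mult fraction_carrier)
    show "x \<otimes>\<^bsub>fraction_field R\<^esub> y \<otimes>\<^bsub>fraction_field R\<^esub> z =
          x \<otimes>\<^bsub>fraction_field R\<^esub> (y \<otimes>\<^bsub>fraction_field R\<^esub> z)"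
      using x y z nz by (simp add: fraction_mult m_ac)
    show "x \<otimes>\<^bsub>fraction_field R\<^esub> y = y \<otimes>\<^bsub>fraction_field R\<^esub> x"
      using x y by (simp add: fraction_mult m_ac)
  next
    show "\<one>\<^bsub>fraction_field R\<^esub> \<in> carrier (fraction_field R)"
      by (simp add: fraction_closed fraction_one)
    fix x assume "x \<in> carrier (fraction_field R)"
    then show "\<one>\<^bsub>fraction_field R\<^esub> \<otimes>\<^bsub>fraction_field R\<^esub> x = x"
      unfolding fraction_carrier by (auto simp: fraction_one fraction_mult)
  qed
next
  fix x y z assume "x \<in> carrier (fraction_field R)" "y \<in> carrier (fraction_field R)"
    "z \<in> carrier (fraction_field R)"
  then obtain a b c d e f where
    x: "x = fraction R a b" "a \<in> carrier R" "b \<in> carrier R - {\<zero>}" and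
    y: "y = fraction R c d" "c \<in> carrier R" "d \<in> carrier R - {\<zero>}" and
    z: "z = fraction R e f" "e \<in> carrier R" "f \<in> carrier R - {\<zero>}"
    unfolding fraction_carrier by blast
  have nz: "b \<otimes> d \<in> carrier R - {\<zero>}" "b \<otimes> f \<in> carrier R - {\<zero>}" "d \<otimes> f \<in> carrier R - {\<zero>}"
    "(b \<otimes> d) \<otimes> f \<in> carrier R - {\<zero>}" "(b \<otimes> f) \<otimes> (d \<otimes> f) \<in> carrier R - {\<zero>}"
    using x y z nonzero_mult by auto
  have "(x \<oplus>\<^bsub>fraction_field R\<^esub> y) \<otimes>\<^bsub>fraction_field R\<^esub> z
      = fraction R ((a \<otimes> d \<oplus> c \<otimes> b) \<otimes> e) ((b \<otimes> d) \<otimes> f)"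
    using x y z nz by (simp add: fraction_add fraction_mult)
  also have "\<dots> = fraction R ((a \<otimes> e) \<otimes> (d \<otimes> f) \<oplus> (c \<otimes> e) \<otimes> (b \<otimes> f)) ((b \<otimes> f) \<otimes> (d \<otimes> f))"
    using x y z nz by (subst fraction_eq_iff) (auto simp: l_distr r_distr m_ac)
  also have "\<dots> = x \<otimes>\<^bsub>fraction_field R\<^esub> z \<oplus>\<^bsub>fraction_field R\<^esub> y \<otimes>\<^bsub>fraction_field R\<^esub> z"
    using x y z nz by (simp add: fraction_add fraction_mult)
  finally show "(x \<oplus>\<^bsub>fraction_field R\<^esub> y) \<otimes>\<^bsub>fraction_field R\<^esub> z
    = x \<otimes>\<^bsub>fraction_field R\<^esub> z \<oplus>\<^bsub>fraction_field R\<^esub> y \<otimes>\<^bsub>fraction_field R\<^esub> z" .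
qed

lemma fraction_field_is_field: "field (fraction_field R)"
proof (rule cring.cring_fieldI2[OF fraction_field_cring])
  show "\<zero>\<^bsub>fraction_field R\<^esub> \<noteq> \<one>\<^bsub>fraction_field R\<^esub>"
    by (simp add: fraction_zero fraction_one fraction_eq_iff)
  fix x assume "x \<in> carrier (fraction_field R)" "x \<noteq> \<zero>\<^bsub>fraction_field R\<^esub>"
  then obtain a b where x: "x = fraction R a b" "a \<in> carrier R" "b \<in> carrier R - {\<zero>}"
    and "fraction R a b \<noteq> fraction R \<zero> \<one>"
    unfolding fraction_carrier fraction_zero by blast
  then have a: "a \<in> carrier R - {\<zero>}" by (auto simp: fraction_eq_iff)
  then have "x \<otimes>\<^bsub>fraction_field R\<^esub> fraction R b a = fraction R \<one> \<one>"
    using x nonzero_mult[OF a x(3)] nonzero_mult[OF x(3) a]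
    by (simp add: fraction_mult fraction_eq_iff m_comm)
  then show "\<exists>y\<in>carrier (fraction_field R). x \<otimes>\<^bsub>fraction_field R\<^esub> y = \<one>\<^bsub>fraction_field R\<^esub>"
    using x a by (intro bexI[of _ "fraction R b a"]) (auto simp: fraction_carrier fraction_one)
qed

lemma fraction_embed_hom: "fraction_embed R \<in> ring_hom R (fraction_field R)"
  by (rule ring_hom_memI)
     (simp_all add: fraction_embed_def fraction_closed fraction_mult fraction_add fraction_one)

lemma fraction_embed_inj: "inj_on (fraction_embed R) (carrier R)"
  by (rule inj_onI) (simp add: fraction_embed_def fraction_eq_iff)

end

text \<open>Polynomials in HOL-Algebra are coefficient lists, leading coefficient first.\<close>

definition integral_over :: "('a, 'm) ring_scheme \<Rightarrow> 'a set \<Rightarrow> 'a \<Rightarrow> bool" where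
  "integral_over F A x \<longleftrightarrow>
     (\<exists>p \<in> carrier (univ_poly F A). p \<noteq> [] \<and> hd p = \<one>\<^bsub>F\<^esub> \<and> ring.eval F p x = \<zero>\<^bsub>F\<^esub>)"

definition normal_domain :: "('a, 'm) ring_scheme \<Rightarrow> bool" where
  "normal_domain R \<longleftrightarrow> domain R \<and>
     (\<forall>x \<in> carrier (fraction_field R).
        integral_over (fraction_field R) (fraction_embed R ` carrier R) x
          \<longrightarrow> x \<in> fraction_embed R ` carrier R)"


section \<open>Graded rings\<close>

locale graded_cring = cring R for R (structure) +
  fixes G :: "nat \<Rightarrow> 'a set"
  assumes component_subgroup: "additive_subgroup (G n) R"
    and one_component: "\<one> \<in> G 0"
    and mult_component: "a \<in> G i \<Longrightarrow> b \<in> G j \<Longrightarrow> a \<otimes> b \<in> G (i + j)"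
    and decomposition: "x \<in> carrier R \<Longrightarrow>
      \<exists>!c. (\<forall>n. c n \<in> G n) \<and> finite {n. c n \<noteq> \<zero>} \<and> x = (\<Oplus>n\<in>{n. c n \<noteq> \<zero>}. c n)"

locale standard_graded_algebra = graded_cring R G for K and R (structure) and G +
  assumes subfield_base: "subfield K R"
    and degree_zero: "G 0 = K"
    and generated_in_degree_one:
      "\<exists>A. finite A \<and> A \<subseteq> G 1 \<and> generate_ring R (K \<union> A) = carrier R"

text \<open>The graded ideal of all elements with components in degrees at least \<open>m\<close>; \<open>m = 1\<close> gives the
  irrelevant ideal.\<close>

definition graded_ge :: "('a, 'm) ring_scheme \<Rightarrow> (nat \<Rightarrow> 'a set) \<Rightarrow> nat \<Rightarrow> 'a set" where
  "graded_ge R G m =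
     {(\<Oplus>\<^bsub>R\<^esub>n\<in>F. c n) | F c. finite F \<and> F \<subseteq> {m..} \<and> (\<forall>n\<in>F. c n \<in> G n)}"

text \<open>Components in negative degrees are zero.\<close>

definition component :: "('a, 'm) ring_scheme \<Rightarrow> (nat \<Rightarrow> 'a set) \<Rightarrow> int \<Rightarrow> 'a set" where
  "component R G z = (if z < 0 then {\<zero>\<^bsub>R\<^esub>} else G (nat z))"

definition primary :: "('a, 'm) ring_scheme \<Rightarrow> (nat \<Rightarrow> 'a set) \<Rightarrow> 'a set \<Rightarrow> bool" where
  "primary R G H \<longleftrightarrow>
     (\<forall>h\<in>H. \<exists>d. h \<in> G d) \<and> graded_ge R G 1 \<subseteq> ideal_radical R (Idl\<^bsub>R\<^esub> H)"

text \<open>Since \<open>component\<close> is used, \<open>k < d\<^sub>i\<close> is possible, with \<open>g\<^sub>i = 0\<close>.\<close>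

definition primary_relation ::
  "('a, 'm) ring_scheme \<Rightarrow> (nat \<Rightarrow> 'a set) \<Rightarrow> 'a \<times> 'a \<times> 'a \<Rightarrow> nat \<times> nat \<times> nat \<Rightarrow> nat
     \<Rightarrow> 'a \<times> 'a \<times> 'a \<Rightarrow> bool" where
  "primary_relation R G = (\<lambda>(f1, f2, f3) (d1, d2, d3) k (g1, g2, g3).
     g1 \<in> component R G (int k - int d1) \<and>
     g2 \<in> component R G (int k - int d2) \<and>
     g3 \<in> component R G (int k - int d3) \<and>
     f1 \<otimes>\<^bsub>R\<^esub> g1 \<oplus>\<^bsub>R\<^esub> f2 \<otimes>\<^bsub>R\<^esub> g2 \<oplus>\<^bsub>R\<^esub> f3 \<otimes>\<^bsub>R\<^esub> g3 = \<zero>\<^bsub>R\<^esub> \<and>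
     primary R G {g1, g2, g3})"


section \<open>Finite graded extensions and graded plus closure\<close>

text \<open>An extension of \<open>R\<close> is a ring \<open>S\<close> with an injective homomorphism from \<open>R\<close>; it is finite if
  \<open>S\<close> is a finitely generated \<open>R\<close>-module.\<close>

locale finite_graded_extension =
  R: graded_cring R G + S: graded_cring S G'
  for R (structure) and G and S (structure) and G' +
  fixes \<phi>
  assumes embed_hom: "\<phi> \<in> ring_hom R S"
    and embed_inj: "inj_on \<phi> (carrier R)"
    and embed_graded: "\<phi> ` G n \<subseteq> G' n"
    and module_finite: "\<exists>B. finite B \<and> B \<subseteq> carrier S \<and>
      (\<forall>s \<in> carrier S. \<exists>c. c \<in> B \<rightarrow> carrier R \<and> s = (\<Oplus>\<^bsub>S\<^esub>b\<in>B. \<phi> (c b) \<otimes>\<^bsub>S\<^esub> b))"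

text \<open>HOL cannot quantify over the type of \<open>S\<close>.  A finite extension generated by \<open>n\<close> elements is
  isomorphic to a quotient module of the \<open>n\<close>-fold direct sum of \<open>R\<close>, whose elements are cosets
  consisting of lists of length \<open>n\<close>; so the type \<open>'a list set\<close> suffices for the carrier.  The lemma
  \<open>gr_plus_closureI\<close> below confirms that extensions over any other type give nothing more.\<close>

definition gr_plus_closure :: "('a, 'm) ring_scheme \<Rightarrow> (nat \<Rightarrow> 'a set) \<Rightarrow> 'a set \<Rightarrow> 'a set" where
  "gr_plus_closure R G H =
     {x \<in> carrier R. \<exists>(S :: 'a list set ring) G' \<phi>.
        finite_graded_extension R G S G' \<phi> \<and> \<phi> x \<in> Idl\<^bsub>S\<^esub> (\<phi> ` H)}"

lemma graded_cring_iso: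
  assumes "graded_cring S G" "cring T" and h: "h \<in> ring_iso S T"
  shows "graded_cring T (\<lambda>n. h ` G n)"
proof -
  interpret S: graded_cring S G by fact
  interpret T: cring T by fact
  have hom: "h \<in> ring_hom S T" and inj: "inj_on h (carrier S)" and surj: "h ` carrier S = carrier T"
    using h by (auto simp: ring_iso_def bij_betw_def)
  interpret H: ring_hom_cring S T h by unfold_locales (rule hom)
  interpret RH: ring_hom_ring S T h
    using S.ring_axioms T.ring_axioms hom by (rule ring_hom_ringI2)
  have sub: "G n \<subseteq> carrier S" for n
    using S.component_subgroup additive_subgroup.a_subset by blast
  have zero_iff: "h a = \<zero>\<^bsub>T\<^esub> \<longleftrightarrow> a = \<zero>\<^bsub>S\<^esub>" if "a \<in> carrier S" for a
    using inj_onD[OF inj, of a "\<zero>\<^bsub>S\<^esub>"] that by auto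
  show ?thesis
  proof (intro graded_cring.intro graded_cring_axioms.intro)
    show "cring T" by fact
  next
    fix n
    have "group_hom (add_monoid S) (add_monoid T) h"
      using hom by (simp add: group_hom_def group_hom_axioms_def hom_def ring_hom_def S.a_group T.a_group)
    then have "subgroup (h ` G n) (add_monoid T)"
      by (rule group_hom.subgroup_img_is_subgroup)
         (rule additive_subgroup.a_subgroup[OF S.component_subgroup])
    then show "additive_subgroup (h ` G n) T" by (rule additive_subgroupI)
  next
    show "\<one>\<^bsub>T\<^esub> \<in> h ` G 0" using S.one_component H.hom_one by (metis imageI)
  next
    fix a i b j assume "a \<in> h ` G i" "b \<in> h ` G j"
    then obtain a' b' where ab: "a = h a'" "a' \<in> G i" "b = h b'" "b' \<in> G j" by blast
    then have "a' \<in> carrier S" "b' \<in> carrier S" using sub by blast+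
    then have "a \<otimes>\<^bsub>T\<^esub> b = h (a' \<otimes>\<^bsub>S\<^esub> b')" using ab by simp
    then show "a \<otimes>\<^bsub>T\<^esub> b \<in> h ` G (i + j)"
      using S.mult_component[OF ab(2,4)] by blast
  next
    fix x assume "x \<in> carrier T"
    then obtain y where y: "y \<in> carrier S" "x = h y" using surj by blast
    define Q where "Q c \<longleftrightarrow> (\<forall>n. c n \<in> G n) \<and> finite {n. c n \<noteq> \<zero>\<^bsub>S\<^esub>} \<and>
            y = (\<Oplus>\<^bsub>S\<^esub>n\<in>{n. c n \<noteq> \<zero>\<^bsub>S\<^esub>}. c n)" for c
    have "\<exists>!c. Q c" using S.decomposition[OF y(1)] unfolding Q_def .
    then obtain c where Qc: "Q c" and uniq: "\<And>c'. Q c' \<Longrightarrow> c' = c" by blast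
    have c: "c n \<in> G n" "finite {n. c n \<noteq> \<zero>\<^bsub>S\<^esub>}"
      "y = (\<Oplus>\<^bsub>S\<^esub>n\<in>{n. c n \<noteq> \<zero>\<^bsub>S\<^esub>}. c n)" for n
      using Qc unfolding Q_def by blast+
    have supp: "{n. (h \<circ> c) n \<noteq> \<zero>\<^bsub>T\<^esub>} = {n. c n \<noteq> \<zero>\<^bsub>S\<^esub>}" if "\<And>n. c n \<in> G n" for c
      using zero_iff that sub by (auto simp: subset_iff)
    have img: "h (\<Oplus>\<^bsub>S\<^esub>n\<in>{n. c n \<noteq> \<zero>\<^bsub>S\<^esub>}. c n) = (\<Oplus>\<^bsub>T\<^esub>n\<in>{n. (h \<circ> c) n \<noteq> \<zero>\<^bsub>T\<^esub>}. (h \<circ> c) n)"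
      if "\<And>n. c n \<in> G n" for c
      unfolding supp[OF that] by (rule H.hom_finsum) (use that sub in blast)
    show "\<exists>!c. (\<forall>n. c n \<in> h ` G n) \<and> finite {n. c n \<noteq> \<zero>\<^bsub>T\<^esub>} \<and>
            x = (\<Oplus>\<^bsub>T\<^esub>n\<in>{n. c n \<noteq> \<zero>\<^bsub>T\<^esub>}. c n)"
    proof (rule ex1I[of _ "h \<circ> c"])
      show "(\<forall>n. (h \<circ> c) n \<in> h ` G n) \<and> finite {n. (h \<circ> c) n \<noteq> \<zero>\<^bsub>T\<^esub>} \<and>
            x = (\<Oplus>\<^bsub>T\<^esub>n\<in>{n. (h \<circ> c) n \<noteq> \<zero>\<^bsub>T\<^esub>}. (h \<circ> c) n)"
        using c(1,2) img[OF c(1)] y(2) c(3) unfolding supp[OF c(1)] by auto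
    next
      fix e assume e: "(\<forall>n. e n \<in> h ` G n) \<and> finite {n. e n \<noteq> \<zero>\<^bsub>T\<^esub>} \<and>
            x = (\<Oplus>\<^bsub>T\<^esub>n\<in>{n. e n \<noteq> \<zero>\<^bsub>T\<^esub>}. e n)"
      then have "\<forall>n. \<exists>u. u \<in> G n \<and> e n = h u" by blast
      then obtain c' where c': "\<And>n. c' n \<in> G n" "\<And>n. e n = h (c' n)" by metis
      then have ee: "e = h \<circ> c'" by auto
      have c'_carr: "c' \<in> {n. c' n \<noteq> \<zero>\<^bsub>S\<^esub>} \<rightarrow> carrier S" using c' sub by blast
      have "h y = h (\<Oplus>\<^bsub>S\<^esub>n\<in>{n. c' n \<noteq> \<zero>\<^bsub>S\<^esub>}. c' n)"
        using img[OF c'(1)] e y(2) unfolding ee by simp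
      then have "y = (\<Oplus>\<^bsub>S\<^esub>n\<in>{n. c' n \<noteq> \<zero>\<^bsub>S\<^esub>}. c' n)"
        using inj_onD[OF inj] y(1) S.finsum_closed[OF c'_carr] by blast
      moreover have "finite {n. c' n \<noteq> \<zero>\<^bsub>S\<^esub>}" using e supp[OF c'(1)] unfolding ee by simp
      ultimately have "Q c'" using c'(1) unfolding Q_def by blast
      then have "c' = c" by (rule uniq)
      then show "e = h \<circ> c" using ee by simp
    qed
  qed
qed

lemma gr_plus_closureI:
  fixes R :: "('a, 'm) ring_scheme" and S :: "('b, 'n) ring_scheme"
  assumes ext: "finite_graded_extension R G S G' \<phi>"
    and x: "x \<in> carrier R" and H: "H \<subseteq> carrier R" and mem: "\<phi> x \<in> Idl\<^bsub>S\<^esub> (\<phi> ` H)"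
  shows "x \<in> gr_plus_closure R G H"
proof -
  interpret E: finite_graded_extension R G S G' \<phi> by fact
  obtain B where B: "finite B" "B \<subseteq> carrier S"
    and gen: "\<And>s. s \<in> carrier S \<Longrightarrow> \<exists>c. c \<in> B \<rightarrow> carrier R \<and> s = (\<Oplus>\<^bsub>S\<^esub>b\<in>B. \<phi> (c b) \<otimes>\<^bsub>S\<^esub> b)"
    using E.module_finite by blast
  obtain bs where bs: "set bs = B" using finite_list[OF B(1)] by blast
  interpret P: ring_hom_cring R S \<phi> by unfold_locales (rule E.embed_hom)
  define h :: "'b \<Rightarrow> 'a list set" where
    "h s = {map c bs | c. c \<in> B \<rightarrow> carrier R \<and> s = (\<Oplus>\<^bsub>S\<^esub>b\<in>B. \<phi> (c b) \<otimes>\<^bsub>S\<^esub> b)}" for s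
  have inj: "inj_on h (carrier S)"
  proof (rule inj_onI)
    fix s t assume st: "s \<in> carrier S" "t \<in> carrier S" "h s = h t"
    obtain c where c: "c \<in> B \<rightarrow> carrier R" "s = (\<Oplus>\<^bsub>S\<^esub>b\<in>B. \<phi> (c b) \<otimes>\<^bsub>S\<^esub> b)"
      using gen[OF st(1)] by blast
    then have "map c bs \<in> h t" using st(3) unfolding h_def by blast
    then obtain c' where c': "map c bs = map c' bs" "c' \<in> B \<rightarrow> carrier R"
      "t = (\<Oplus>\<^bsub>S\<^esub>b\<in>B. \<phi> (c' b) \<otimes>\<^bsub>S\<^esub> b)"
      unfolding h_def by blast
    then have "c b = c' b" if "b \<in> B" for b using that bs by (auto)
    then show "s = t"
      unfolding c(2) c'(3) using B(2) c'(2) P.hom_closed by (intro E.S.finsum_cong') (auto simp: subset_iff Pi_iff)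
  qed
  define T where "T = image_ring h S"
  have iso: "h \<in> ring_iso S T"
    unfolding T_def by (rule inj_imp_image_ring_iso[OF inj])
  then have hom: "h \<in> ring_hom S T" and surj: "h ` carrier S = carrier T"
    by (auto simp: ring_iso_def bij_betw_def)
  have "T\<lparr>zero := h \<zero>\<^bsub>S\<^esub>\<rparr> = T"
    by (simp add: T_def image_ring_def image_group_def monoid.defs)
  then have T: "cring T"
    using E.S.ring_iso_imp_img_cring[OF iso] by simp
  interpret T: graded_cring T "\<lambda>n. h ` G' n"
    by (rule graded_cring_iso[OF E.S.graded_cring_axioms T iso])
  interpret H: ring_hom_cring S T h by unfold_locales (rule hom)
  have "finite_graded_extension R G T (\<lambda>n. h ` G' n) (h \<circ> \<phi>)"
  proof (intro finite_graded_extension.intro finite_graded_extension_axioms.intro)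
    show "graded_cring R G" "graded_cring T (\<lambda>n. h ` G' n)"
      by unfold_locales
    show "h \<circ> \<phi> \<in> ring_hom R T"
      using E.embed_hom hom by (rule ring_hom_trans)
    show "inj_on (h \<circ> \<phi>) (carrier R)"
      using E.embed_inj inj P.hom_closed by (intro comp_inj_on) (auto intro: inj_on_subset)
    show "(h \<circ> \<phi>) ` G n \<subseteq> h ` G' n" for n
      using E.embed_graded[of n] by (auto simp: image_comp[symmetric])
    show "\<exists>B. finite B \<and> B \<subseteq> carrier T \<and>
      (\<forall>s\<in>carrier T. \<exists>c. c \<in> B \<rightarrow> carrier R \<and> s = (\<Oplus>\<^bsub>T\<^esub>b\<in>B. (h \<circ> \<phi>) (c b) \<otimes>\<^bsub>T\<^esub> b))"
    proof (intro exI[of _ "h ` B"] conjI ballI)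
      show "finite (h ` B)" "h ` B \<subseteq> carrier T" using B surj by auto
      fix t assume "t \<in> carrier T"
      then obtain s where s: "s \<in> carrier S" "t = h s" using surj by blast
      then obtain c where c: "c \<in> B \<rightarrow> carrier R" "s = (\<Oplus>\<^bsub>S\<^esub>b\<in>B. \<phi> (c b) \<otimes>\<^bsub>S\<^esub> b)"
        using gen by blast
      have injB: "inj_on h B" using inj B(2) by (rule inj_on_subset)
      define c' where "c' = c \<circ> the_inv_into B h"
      have c': "c' (h b) = c b" if "b \<in> B" for b
        using that injB by (simp add: c'_def the_inv_into_f_f)
      have cB: "c b \<in> carrier R" if "b \<in> B" for b using c(1) that by blast
      have hB: "h b \<in> carrier T" if "b \<in> B" for b using B(2) that surj by blast
      have "t = (\<Oplus>\<^bsub>T\<^esub>b\<in>B. h (\<phi> (c b) \<otimes>\<^bsub>S\<^esub> b))"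
        using s c B(2) by (subst s(2), subst c(2), subst H.hom_finsum) (auto simp: comp_def)
      also have "\<dots> = (\<Oplus>\<^bsub>T\<^esub>b\<in>B. (h \<circ> \<phi>) (c' (h b)) \<otimes>\<^bsub>T\<^esub> h b)"
        using B(2) cB c' hB by (intro T.finsum_cong') (auto simp: subset_iff)
      also have "\<dots> = (\<Oplus>\<^bsub>T\<^esub>b\<in>h ` B. (h \<circ> \<phi>) (c' b) \<otimes>\<^bsub>T\<^esub> b)"
        using injB cB c' hB by (intro T.finsum_reindex[symmetric]) auto
      finally show "\<exists>c. c \<in> h ` B \<rightarrow> carrier R \<and> t = (\<Oplus>\<^bsub>T\<^esub>b\<in>h ` B. (h \<circ> \<phi>) (c b) \<otimes>\<^bsub>T\<^esub> b)"
        using c' cB by (intro exI[of _ c']) auto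
    qed
  qed
  moreover have "(h \<circ> \<phi>) x \<in> Idl\<^bsub>T\<^esub> ((h \<circ> \<phi>) ` H)"
  proof -
    have "(h \<circ> \<phi>) x \<in> J" if J: "ideal J T" "(h \<circ> \<phi>) ` H \<subseteq> J" for J
    proof -
      have "ideal {r \<in> carrier S. h r \<in> J} S"
        using ring_hom_ring.ideal_vimage[OF ring_hom_ringI2[OF E.S.ring_axioms T.ring_axioms hom] J(1)] .
      moreover have "\<phi> ` H \<subseteq> {r \<in> carrier S. h r \<in> J}" using H J(2) by auto
      ultimately show ?thesis using mem by (auto simp: genideal_def)
    qed
    then show ?thesis unfolding genideal_def by blast
  qed
  ultimately show ?thesis
    using x unfolding gr_plus_closure_def by blast
qed

end

theory Submission
  imports Defs
begin

text \<open>On the punctured spectrum, covered by \<open>f1 \<noteq> 0\<close> and \<open>f2 \<noteq> 0\<close>, the syzygies of \<open>f1, f2, f3\<close> form a bundle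
  of rank two.  The primary relation \<open>g\<close> spans a line subbundle \<open>O(- k)\<close> with quotient
  \<open>O(k - d1 - d2 - d3)\<close>.  A form \<open>x\<close> of degree \<open>n\<close> lies in \<open>(f1, f2, f3)\<close> on each chart; two local
  solutions differ by a syzygy, so the obstruction to a global solution is built from classes of degrees
  \<open>n + k - d1 - d2 - d3\<close> and \<open>n - k\<close> in \<open>H\<^sup>1\<close> of the graded structure sheaf.  Both degrees are
  nonnegative when \<open>n \<ge> m\<close>, and there a class is annihilated by a monic additive polynomial in Frobenius,
  since \<open>H\<^sup>1\<close> is finite-dimensional in degree \<open>0\<close> and vanishes in large degrees.  Adjoining a root of
  this polynomial trivialises the class.  The global sections over the extended charts form a finite
  graded extension of \<open>R\<close> in which \<open>x\<close> lies in the ideal.\<close>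

section \<open>Frobenius and linear algebra over subfields\<close>

text \<open>The sign of the two degrees is what lets the construction be repeated. A root
  \<open>y\<close> of degree \<open>e\<close> contributes coefficients of degree
  \<open>n - i e\<close> to degree \<open>n\<close>; for \<open>e \<ge> 0\<close> these are negative
  when \<open>n\<close> is, so the extended sections still vanish in negative degrees, and the
  extended \<open>H^1\<close> still vanishes in large ones. The extension is free over the old
  ambient ring but may have zero divisors, so nothing about it can be derived from a fraction field
  again. Hence the facts that survive an adjunction are collected as assumptions of
  \<open>chart_cover\<close>: they are proved once, for localisations of \<open>R\<close>, and
  transported from ring to ring. Each form needs two adjunctions, an element of
  \<open>graded_ge\<close> has finitely many components, and all of them must be solved in one ring.
  For the localisations the hard fact is finiteness of the sections. It comes from a homogeneous
  conductor, found by comparing \<open>R\<close> with its subring \<open>K[f1, f2]\<close>, on which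
  \<open>f1, f2\<close> is a regular sequence. Dimension two enters through the growth of the
  Hilbert function, which keeps powers of \<open>f2\<close> out of the ideal
  \<open>(f1)\<close>.\<close>

lemma (in ring) Span_Cons_mem:
  "u \<in> Span K (v # Vs) \<longleftrightarrow> (\<exists>k\<in>K. \<exists>w\<in>Span K Vs. u = k \<otimes> v \<oplus> w)"
  by (simp add: line_extension_mem_iff)

context cring begin

lemma binomial_sum:
  assumes [simp]: "a \<in> carrier R" "b \<in> carrier R"
  shows "(a \<oplus> b) [^] n = (\<Oplus>i\<in>{..n}. add_pow R (n choose i) (a [^] i \<otimes> b [^] (n - i)))"
proof (induction n)
  case 0
  then show ?case by simp
next
  case (Suc n)
  define t where "t m i = a [^] i \<otimes> b [^] (m - i)" for m i :: nat
  have [simp]: "t m i \<in> carrier R" for m i by (simp add: t_def)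
  have "(\<Oplus>i\<in>{..Suc n}. add_pow R (Suc n choose i) (t (Suc n) i))
      = (\<Oplus>i\<in>{..n}. add_pow R (Suc n choose Suc i) (t (Suc n) (Suc i))) \<oplus> t (Suc n) 0"
    by (subst finsum_Suc2) (auto simp: Pi_def)
  also have "(\<Oplus>i\<in>{..n}. add_pow R (Suc n choose Suc i) (t (Suc n) (Suc i)))
      = (\<Oplus>i\<in>{..n}. add_pow R (n choose i) (t (Suc n) (Suc i)) \<oplus> add_pow R (n choose Suc i) (t (Suc n) (Suc i)))"
    by (intro finsum_cong') (auto simp: add.nat_pow_mult)
  also have "\<dots> = (\<Oplus>i\<in>{..n}. add_pow R (n choose i) (t (Suc n) (Suc i)))
      \<oplus> (\<Oplus>i\<in>{..n}. add_pow R (n choose Suc i) (t (Suc n) (Suc i)))"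
    by (subst finsum_addf) (auto simp: Pi_def)
  also have "\<dots> \<oplus> t (Suc n) 0 = (\<Oplus>i\<in>{..n}. add_pow R (n choose i) (t (Suc n) (Suc i)))
      \<oplus> ((\<Oplus>i\<in>{..n}. add_pow R (n choose Suc i) (t (Suc n) (Suc i))) \<oplus> add_pow R (n choose 0) (t (Suc n) 0))"
    by (simp add: a_assoc)
  \<comment> \<open>After Pascal's rule this sum is shifted back by one: the term for
    \<open>n choose 0\<close> completes it below, and the one for \<open>n choose Suc n\<close>
    vanishes.\<close>
  also have "(\<Oplus>i\<in>{..n}. add_pow R (n choose Suc i) (t (Suc n) (Suc i))) \<oplus> add_pow R (n choose 0) (t (Suc n) 0)
      = (\<Oplus>i\<in>{..Suc n}. add_pow R (n choose i) (t (Suc n) i))"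
    by (subst finsum_Suc2) (auto simp: Pi_def)
  also have "\<dots> = (\<Oplus>i\<in>{..n}. add_pow R (n choose i) (t (Suc n) i))"
    by (subst finsum_Suc) (auto simp: Pi_def binomial_eq_0)
  also have "\<dots> = (\<Oplus>i\<in>{..n}. b \<otimes> (add_pow R (n choose i) (t n i)))"
    by (intro finsum_cong') (auto simp: t_def Suc_diff_le add_pow_rdistr m_ac)
  also have "(\<Oplus>i\<in>{..n}. add_pow R (n choose i) (t (Suc n) (Suc i))) = (\<Oplus>i\<in>{..n}. a \<otimes> (add_pow R (n choose i) (t n i)))"
    by (intro finsum_cong') (auto simp: t_def add_pow_rdistr m_ac)
  also have "\<dots> \<oplus> (\<Oplus>i\<in>{..n}. b \<otimes> (add_pow R (n choose i) (t n i)))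
     = (a \<oplus> b) \<otimes> (\<Oplus>i\<in>{..n}. add_pow R (n choose i) (t n i))"
    by (subst (1 2) finsum_rdistr[symmetric]) (auto simp: l_distr Pi_def)
  also have "\<dots> = (a \<oplus> b) [^] Suc n"
    using Suc by (simp add: t_def m_comm)
  finally show ?case by (simp add: t_def)
qed

text \<open>The binomial coefficients strictly between \<open>0\<close> and \<open>p\<close> are
  divisible by \<open>p\<close>, and multiples of \<open>p\<close> act as zero. The ring may have
  zero divisors, as may the extensions to which this is applied.\<close>

lemma frobenius_add:
  assumes p: "Factorial_Ring.prime (p::nat)" "add_pow R p \<one> = \<zero>" and [simp]: "a \<in> carrier R" "b \<in> carrier R"
  shows "(a \<oplus> b) [^] (p :: nat) = a [^] p \<oplus> b [^] p"
proof -
  have p0: "p > 0" using p(1) by (rule prime_gt_0_nat)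
  have kill: "add_pow R k x = \<zero>" if dvd: "p dvd k" and x: "x \<in> carrier R" for k x
  proof -
    obtain j where j: "k = p * j" using dvd by (rule dvdE)
    have "add_pow R k x = (add_pow R k \<one>) \<otimes> x" using x by (simp add: add_pow_ldistr)
    also have "add_pow R k \<one> = \<zero>" unfolding j by (simp add: add.nat_pow_pow[symmetric] p(2))
    finally show ?thesis using x by simp
  qed
  let ?t = "\<lambda>i. add_pow R (p choose i) (a [^] i \<otimes> b [^] (p - i))"
  have "(\<Oplus>i\<in>{..p}. ?t i) = (\<Oplus>i\<in>{0, p}. ?t i)"
  proof (rule add.finprod_mono_neutral_cong_right)
    fix i assume i: "i \<in> {..p} - {0, p}"
    then have "i < p" "i \<noteq> 0" by auto
    then have "p dvd p choose i" using p0 p(1) by (rule dvd_choose_prime[OF _ _ gr_implies_not0])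
    then show "?t i = \<zero>" by (rule kill) simp
  qed (auto simp: Pi_def)
  also have "\<dots> = b [^] p \<oplus> a [^] p"
    using p0 by simp
  finally show ?thesis by (simp add: binomial_sum a_comm)
qed

lemma frobenius_pow_add:
  assumes p: "Factorial_Ring.prime (p::nat)" "add_pow R p \<one> = \<zero>" and [simp]: "a \<in> carrier R" "b \<in> carrier R"
  shows "(a \<oplus> b) [^] (p ^ i :: nat) = a [^] (p ^ i) \<oplus> b [^] (p ^ i)"
proof (induction i)
  case (Suc i)
  have "(a \<oplus> b) [^] (p ^ Suc i) = ((a \<oplus> b) [^] (p ^ i)) [^] p"
    by (simp add: nat_pow_pow mult.commute)
  also have "\<dots> = (a [^] (p ^ i)) [^] p \<oplus> (b [^] (p ^ i)) [^] p"
    unfolding Suc by (rule frobenius_add[OF p]) simp_all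
  finally show ?case by (simp add: nat_pow_pow mult.commute)
qed simp

text \<open>Gaussian elimination along the list \<open>Vs\<close>. The vectors form a family indexed
  by \<open>I\<close>, so that equal values at different indices count as dependent; this suits the
  later counts of Frobenius powers and of monomials.\<close>

lemma dependent_if_card_gt:
  assumes K: "subfield K R" and "finite I" "set Vs \<subseteq> carrier R" "length Vs < card I"
    and "u \<in> I \<rightarrow> Span K Vs"
  shows "\<exists>k\<in>I \<rightarrow> K. (\<exists>i\<in>I. k i \<noteq> \<zero>) \<and> (\<Oplus>i\<in>I. k i \<otimes> u i) = \<zero>"
  using assms(2-)
proof (induction Vs arbitrary: I u)
  case Nil
  then obtain i where i: "i \<in> I" by fastforce
  have "u j = \<zero>" if "j \<in> I" for j using Nil(4) that by auto
  then have "(\<Oplus>j\<in>I. \<one> \<otimes> u j) = (\<Oplus>j\<in>I. \<zero>)" by (intro finsum_cong') auto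
  moreover have "\<one> \<in> K" "\<one> \<noteq> \<zero>"
    using subringE(3)[OF subfieldE(1)[OF K]] subfieldE(5,6)[OF K] by auto
  ultimately show ?case using i by (intro bexI[of _ "\<lambda>_. \<one>"]) auto
next
  case (Cons v Vs)
  have Kc: "K \<subseteq> carrier R" by (rule subfieldE(3)[OF K])
  have [simp]: "v \<in> carrier R" and Vs: "set Vs \<subseteq> carrier R" using Cons.prems by auto
  have sp: "Span K Vs \<subseteq> carrier R" using Span_in_carrier[OF Kc Vs] .
  have "\<forall>i\<in>I. \<exists>a w. a \<in> K \<and> w \<in> Span K Vs \<and> u i = a \<otimes> v \<oplus> w"
    using Cons.prems(4) unfolding Pi_def Span_Cons_mem by blast
  then obtain a w where aw: "\<And>i. i \<in> I \<Longrightarrow> a i \<in> K" "\<And>i. i \<in> I \<Longrightarrow> w i \<in> Span K Vs"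
      "\<And>i. i \<in> I \<Longrightarrow> u i = a i \<otimes> v \<oplus> w i" by metis
  have awc: "a i \<in> carrier R" "w i \<in> carrier R" if "i \<in> I" for i using aw that Kc sp by blast+
  show ?case
  proof (cases "\<forall>i\<in>I. a i = \<zero>")
    case True
    then have "u \<in> I \<rightarrow> Span K Vs" using aw awc by auto
    then show ?thesis using Cons.IH[of I u] Cons.prems by auto
  next
    case False
    then obtain i0 where i0: "i0 \<in> I" "a i0 \<noteq> \<zero>" by blast
    define c where "c = inv (a i0)"
    have c: "c \<in> K" "c \<otimes> a i0 = \<one>"
      using subfield_m_inv[OF K, of "a i0"] aw(1)[OF i0(1)] i0(2) by (auto simp: c_def)
    have [simp]: "c \<in> carrier R" using c Kc by blast
    \<comment> \<open>\<open>i0\<close> is the pivot: subtracting \<open>b i\<close> times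
      \<open>u i0\<close> removes \<open>v\<close> from every other vector, so that one vector and
      one spanning element are given up together.\<close>
    define J where "J = I - {i0}"
    define b where "b i = a i \<otimes> c" for i
    define u' where "u' i = w i \<ominus> b i \<otimes> w i0" for i
    have bK: "b i \<in> K" if "i \<in> I" for i
      using aw(1)[OF that] c subringE(6)[OF subfieldE(1)[OF K]] by (simp add: b_def)
    have bc: "b i \<in> carrier R" if "i \<in> I" for i using bK that Kc by blast
    have ba: "b i \<otimes> a i0 = a i" if "i \<in> I" for i
      using c awc that i0 by (simp add: b_def m_assoc)
    have u': "u' i = u i \<ominus> b i \<otimes> u i0" if i: "i \<in> I" for i
    proof -
      have "u i \<ominus> b i \<otimes> u i0 = (a i \<ominus> b i \<otimes> a i0) \<otimes> v \<oplus> (w i \<ominus> b i \<otimes> w i0)"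
        unfolding aw(3)[OF i] aw(3)[OF i0(1)]
        using awc[OF i] awc[OF i0(1)] bc[OF i] \<open>v \<in> carrier R\<close> by algebra
      then show ?thesis using ba[OF i] awc[OF i] awc[OF i0(1)] bc[OF i]
        by (simp add: u'_def minus_eq r_neg)
    qed
    have "u' i \<in> Span K Vs" if "i \<in> I" for i
      unfolding u'_def minus_eq
      using Span_subgroup_props(3,4)[OF K Vs] Span_smult_closed[OF K Vs] aw(2) bK that i0 by metis
    then have "u' \<in> J \<rightarrow> Span K Vs" by (auto simp: J_def)
    moreover have "length Vs < card J" using Cons.prems(1,3) i0 by (simp add: J_def)
    ultimately obtain k where k: "k \<in> J \<rightarrow> K" "\<exists>i\<in>J. k i \<noteq> \<zero>" "(\<Oplus>i\<in>J. k i \<otimes> u' i) = \<zero>"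
      using Cons.IH[of J u'] Vs Cons.prems(1) by (auto simp: J_def)
    have kc: "k i \<in> carrier R" if "i \<in> J" for i using k(1) that Kc by blast
    have uc: "u i \<in> carrier R" if "i \<in> I" for i using awc[OF that] aw(3)[OF that] by simp
    define s where "s = (\<Oplus>i\<in>J. k i \<otimes> b i)"
    have fin: "finite J" and JI: "J \<subseteq> I" using Cons.prems(1) by (auto simp: J_def)
    have s: "s \<in> K"
    proof -
      have "(\<Oplus>i\<in>F. k i \<otimes> b i) \<in> K" if "finite F" "F \<subseteq> J" for F
        using that
      proof (induction F rule: finite_induct)
        case empty
        then show ?case using subringE(2)[OF subfieldE(1)[OF K]] by simp
      next
        case (insert x F)
        have "(\<Oplus>i\<in>insert x F. k i \<otimes> b i) = k x \<otimes> b x \<oplus> (\<Oplus>i\<in>F. k i \<otimes> b i)"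
          using insert kc bc JI by (intro finsum_insert) (auto simp: subset_iff)
        then show ?case
          using insert k(1) bK JI subringE(6,7)[OF subfieldE(1)[OF K]] by (auto simp: Pi_iff subset_iff)
      qed
      then show ?thesis using fin by (simp add: s_def)
    qed
    have [simp]: "s \<in> carrier R" using s Kc by blast
    \<comment> \<open>A relation among the \<open>u' i\<close> becomes one among the
      \<open>u i\<close> once the pivot receives the coefficient that collects all subtracted
      multiples.\<close>
    define k' where "k' = k(i0 := \<ominus> s)"
    have "(\<Oplus>i\<in>I. k' i \<otimes> u i) = (\<Oplus>i\<in>insert i0 J. k' i \<otimes> u i)"
      using i0 by (simp add: J_def insert_absorb)
    also have "\<dots> = k' i0 \<otimes> u i0 \<oplus> (\<Oplus>i\<in>J. k' i \<otimes> u i)"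
      using fin uc kc JI i0 by (intro finsum_insert) (auto simp: J_def k'_def)
    also have "(\<Oplus>i\<in>J. k' i \<otimes> u i) = (\<Oplus>i\<in>J. k i \<otimes> u' i \<oplus> k i \<otimes> b i \<otimes> u i0)"
    proof (intro finsum_cong' refl)
      fix i assume i: "i \<in> J"
      then have m: "i \<in> I" "i \<noteq> i0" by (auto simp: J_def)
      have "k i \<otimes> u i = k i \<otimes> (u i \<ominus> b i \<otimes> u i0) \<oplus> k i \<otimes> b i \<otimes> u i0"
        using kc[OF i] uc[OF m(1)] uc[OF i0(1)] bc[OF m(1)] by algebra
      then show "k' i \<otimes> u i = k i \<otimes> u' i \<oplus> k i \<otimes> b i \<otimes> u i0" using m by (simp add: k'_def u')
    qed (use kc uc bc JI i0 in \<open>auto simp: u' subset_iff\<close>)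
    also have "\<dots> = (\<Oplus>i\<in>J. k i \<otimes> u' i) \<oplus> (\<Oplus>i\<in>J. k i \<otimes> b i \<otimes> u i0)"
      using kc uc bc JI i0 by (intro finsum_addf) (auto simp: u' subset_iff)
    also have "(\<Oplus>i\<in>J. k i \<otimes> b i \<otimes> u i0) = s \<otimes> u i0"
      unfolding s_def using fin kc bc JI uc[OF i0(1)] by (intro finsum_ldistr[symmetric]) (auto simp: subset_iff)
    finally have "(\<Oplus>i\<in>I. k' i \<otimes> u i) = \<zero>"
      using k(3) uc[OF i0(1)] by (simp add: k'_def l_minus l_neg)
    moreover have "k' \<in> I \<rightarrow> K"
      using k(1) s subringE(5)[OF subfieldE(1)[OF K]] by (auto simp: k'_def J_def)
    moreover have "\<exists>i\<in>I. k' i \<noteq> \<zero>" using k(2) by (auto simp: k'_def J_def)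
    ultimately show ?thesis by blast
  qed
qed

end

text \<open>In \<open>subalgebra K E R\<close> the set \<open>E\<close> is only a
  \<open>K\<close>-subspace, so this is the usual passage from a finite-dimensional space to a
  spanning list of a subspace.\<close>

lemma (in ring) subalgebra_in_Span_obtain:
  assumes K: "subfield K R" and "subalgebra K E R" "set Us \<subseteq> carrier R" "E \<subseteq> Span K Us"
  obtains Vs where "set Vs \<subseteq> E" "Span K Vs = E"
proof -
  have "finite_dimension K E"
    using subalbegra_incl_imp_finite_dimension[OF K Span_finite_dimension[OF K assms(3)] assms(2,4)] .
  then obtain Vs where Vs: "set Vs \<subseteq> carrier R" "Span K Vs = E"
    using exists_base[OF K] by (metis finite_dimensionE')
  then show thesis using that Span_base_incl[OF K Vs(1)] by blast
qed

text \<open>Lifts of a spanning list of the image, together with a spanning list of the kernel, span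
  the source. Source and target lie in different rings and \<open>L\<close> is linear along
  \<open>\<psi>\<close>, because \<open>L\<close> will be the leading coefficient in the adjoined
  root.\<close>

lemma span_from_kernel_image:
  assumes R: "ring R" and S: "ring S" and K: "subfield K R" and \<psi>: "\<psi> \<in> ring_hom R S"
    and K': "subfield (\<psi> ` K) S" and E: "subalgebra (\<psi> ` K) E S"
    and L: "\<And>x. x \<in> E \<Longrightarrow> L x \<in> carrier R"
      "\<And>x y. x \<in> E \<Longrightarrow> y \<in> E \<Longrightarrow> L (x \<oplus>\<^bsub>S\<^esub> y) = L x \<oplus>\<^bsub>R\<^esub> L y"
      "\<And>k x. k \<in> K \<Longrightarrow> x \<in> E \<Longrightarrow> L (\<psi> k \<otimes>\<^bsub>S\<^esub> x) = k \<otimes>\<^bsub>R\<^esub> L x"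
    and Vs: "set Vs \<subseteq> carrier R" "L ` E \<subseteq> ring.Span R K Vs"
    and Us: "set Us \<subseteq> carrier S" "{x \<in> E. L x = \<zero>\<^bsub>R\<^esub>} \<subseteq> ring.Span S (\<psi> ` K) Us"
  shows "\<exists>Ws. set Ws \<subseteq> carrier S \<and> E \<subseteq> ring.Span S (\<psi> ` K) Ws"
proof -
  interpret R: ring R by fact
  interpret S: ring S by fact
  have Es: "subgroup E (add_monoid S)" using E by (simp add: subalgebra_def)
  have Ec: "E \<subseteq> carrier S" by (rule S.subalgebra_in_carrier[OF E])
  have E0: "\<zero>\<^bsub>S\<^esub> \<in> E" and Eadd: "\<And>x y. x \<in> E \<Longrightarrow> y \<in> E \<Longrightarrow> x \<oplus>\<^bsub>S\<^esub> y \<in> E"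
    and Eneg: "\<And>x. x \<in> E \<Longrightarrow> \<ominus>\<^bsub>S\<^esub> x \<in> E"
    using subgroup.one_closed[OF Es] subgroup.m_closed[OF Es] subgroup.m_inv_closed[OF Es]
    by (auto simp: a_inv_def)
  have Esm: "\<psi> k \<otimes>\<^bsub>S\<^esub> x \<in> E" if "k \<in> K" "x \<in> E" for k x
    using subalgebra.smult_closed[OF E] that by blast
  have l0: "L \<zero>\<^bsub>S\<^esub> = \<zero>\<^bsub>R\<^esub>"
    using L(2)[OF E0 E0] L(1)[OF E0] by (metis R.add.l_cancel_one' S.l_zero S.zero_closed)
  have lneg: "L (\<ominus>\<^bsub>S\<^esub> x) = \<ominus>\<^bsub>R\<^esub> L x" if "x \<in> E" for x
  proof -
    have "L x \<oplus>\<^bsub>R\<^esub> L (\<ominus>\<^bsub>S\<^esub> x) = \<zero>\<^bsub>R\<^esub>"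
      using L(2)[OF that Eneg[OF that]] l0 that Ec by (metis S.r_neg subsetD)
    then show ?thesis using L(1) that Eneg R.minus_equality R.a_comm by metis
  qed
  have "subalgebra K (L ` E) R"
  proof (intro subalgebra.intro subalgebra_axioms.intro R.add.subgroupI)
    show "L ` E \<subseteq> carrier R" using L(1) by blast
    show "L ` E \<noteq> {}" using E0 by blast
    fix a b assume "a \<in> L ` E" "b \<in> L ` E"
    then obtain x y where xy: "x \<in> E" "a = L x" "y \<in> E" "b = L y" by blast
    show "\<ominus>\<^bsub>R\<^esub> a \<in> L ` E"
      using lneg[OF xy(1)] Eneg[OF xy(1)] unfolding xy(2) by (metis imageI)
    show "a \<oplus>\<^bsub>R\<^esub> b \<in> L ` E"
      using L(2)[OF xy(1,3)] Eadd[OF xy(1,3)] unfolding xy(2,4) by (metis imageI)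
  next
    fix k v assume kv: "k \<in> K" "v \<in> L ` E"
    then obtain x where x: "x \<in> E" "v = L x" by blast
    show "k \<otimes>\<^bsub>R\<^esub> v \<in> L ` E"
      using L(3)[OF kv(1) x(1)] Esm[OF kv(1) x(1)] unfolding x(2) by (metis imageI)
  qed
  from R.subalgebra_in_Span_obtain[OF K this Vs]
  obtain Bs where Bs: "set Bs \<subseteq> L ` E" "R.Span K Bs = L ` E" .
  define l where "l b = (SOME x. x \<in> E \<and> L x = b)" for b
  have l: "l b \<in> E \<and> L (l b) = b" if "b \<in> L ` E" for b
    unfolding l_def by (rule someI_ex) (use that in blast)
  let ?Ls = "map l Bs"
  have Ls: "set ?Ls \<subseteq> E" using l Bs(1) by auto
  have lift: "\<exists>x\<in>S.Span (\<psi> ` K) (map l Cs). x \<in> E \<and> L x = u"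
    if "u \<in> R.Span K Cs" "set Cs \<subseteq> set Bs" for u Cs
    using that
  proof (induction Cs arbitrary: u)
    case Nil
    then have "u = \<zero>\<^bsub>R\<^esub>" by simp
    then show ?case using E0 l0 by (intro bexI[of _ "\<zero>\<^bsub>S\<^esub>"]) simp_all
  next
    case (Cons c Cs)
    obtain k w where kw: "k \<in> K" "w \<in> R.Span K Cs" "u = k \<otimes>\<^bsub>R\<^esub> c \<oplus>\<^bsub>R\<^esub> w"
      using Cons.prems(1) unfolding R.Span_Cons_mem by blast
    have CB: "set Cs \<subseteq> set Bs" "c \<in> L ` E" using Cons.prems(2) Bs(1) by auto
    obtain x where x: "x \<in> S.Span (\<psi> ` K) (map l Cs)" "x \<in> E" "L x = w"
      using Cons.IH[OF kw(2) CB(1)] by blast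
    have lc: "l c \<in> E" "L (l c) = c" using CB(2) l by blast+
    have kl: "\<psi> k \<otimes>\<^bsub>S\<^esub> l c \<in> E" using Esm kw(1) lc(1) by blast
    have "\<psi> k \<otimes>\<^bsub>S\<^esub> l c \<oplus>\<^bsub>S\<^esub> x \<in> S.Span (\<psi> ` K) (map l (c # Cs))"
      using kw(1) x(1) unfolding list.map S.Span_Cons_mem by blast
    moreover have "L (\<psi> k \<otimes>\<^bsub>S\<^esub> l c \<oplus>\<^bsub>S\<^esub> x) = u"
      using L(2)[OF kl x(2)] L(3)[OF kw(1) lc(1)] kw(3) x(3) lc(2) by simp
    ultimately show ?case using Eadd[OF kl x(2)] by blast
  qed
  have "E \<subseteq> S.Span (\<psi> ` K) (?Ls @ Us)"
  proof
    fix x assume x: "x \<in> E"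
    obtain z where z: "z \<in> S.Span (\<psi> ` K) ?Ls" "z \<in> E" "L z = L x"
      using lift[of "L x" Bs] x unfolding Bs(2) by blast
    have "L (x \<oplus>\<^bsub>S\<^esub> \<ominus>\<^bsub>S\<^esub> z) = \<zero>\<^bsub>R\<^esub>"
      using L(2)[OF x Eneg[OF z(2)]] lneg[OF z(2)] L(1)[OF x] z(3) by (simp add: R.r_neg)
    then have "x \<oplus>\<^bsub>S\<^esub> \<ominus>\<^bsub>S\<^esub> z \<in> S.Span (\<psi> ` K) Us"
      using Us(2) Eadd Eneg x z by blast
    moreover have "x = z \<oplus>\<^bsub>S\<^esub> (x \<oplus>\<^bsub>S\<^esub> \<ominus>\<^bsub>S\<^esub> z)"
    proof -
      have "x \<in> carrier S" "z \<in> carrier S" using x z Ec by auto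
      then show ?thesis by (simp add: S.a_lcomm S.r_neg)
    qed
    ultimately show "x \<in> S.Span (\<psi> ` K) (?Ls @ Us)"
      using z S.Span_append_eq_set_add[OF K', of ?Ls Us] Ls Ec Us(1)
      unfolding set_add_def' by blast
  qed
  moreover have "set (?Ls @ Us) \<subseteq> carrier S" using Ls Ec Us(1) by auto
  ultimately show ?thesis by blast
qed

section \<open>Adjoining a root of a monic polynomial\<close>

context UP_cring
begin

text \<open>These are the normal forms modulo a monic polynomial of degree \<open>q\<close>.\<close>

definition low_poly :: "nat \<Rightarrow> (nat \<Rightarrow> 'a) \<Rightarrow> nat \<Rightarrow> 'a" where
  "low_poly q t = (\<Oplus>\<^bsub>P\<^esub>i\<in>{..<q}. up_ring.monom P (t i) i)"

lemma low_poly_closed: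
  "t \<in> {..<q} \<rightarrow> carrier R \<Longrightarrow> low_poly q t \<in> carrier P"
  unfolding low_poly_def by (rule P.finsum_closed) (auto simp: Pi_iff)

lemma coeff_low_poly:
  assumes t: "t \<in> {..<q} \<rightarrow> carrier R"
  shows "up_ring.coeff P (low_poly q t) j = (if j < q then t j else \<zero>)"
proof -
  have tc: "t i \<in> carrier R" if "i < q" for i using t that by auto
  have "up_ring.coeff P (low_poly q t) j = (\<Oplus>i\<in>{..<q}. up_ring.coeff P (up_ring.monom P (t i) i) j)"
    unfolding low_poly_def by (rule coeff_finsum) (use tc in auto)
  also have "\<dots> = (\<Oplus>i\<in>{..<q}. if j = i then t i else \<zero>)"
    by (rule R.finsum_cong') (use tc in auto)
  also have "\<dots> = (if j < q then t j else \<zero>)"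
  proof (cases "j < q")
    case True
    then show ?thesis using R.finsum_singleton[of j "{..<q}" t] t by simp
  next
    case False
    then have "(\<Oplus>i\<in>{..<q}. if j = i then t i else \<zero>) = (\<Oplus>i\<in>{..<q}. \<zero>)"
      by (intro R.finsum_cong') auto
    then show ?thesis using False by simp
  qed
  finally show ?thesis .
qed

text \<open>Multiplication by a monic polynomial raises the degree by exactly \<open>q\<close>, even
  over a ring with zero divisors, since the leading coefficient of the cofactor survives. This makes
  remainders unique.\<close>

lemma monic_multiple_low_degree:
  assumes g: "g \<in> carrier P" "up_ring.coeff P g q = \<one>" "\<And>j. j > q \<Longrightarrow> up_ring.coeff P g j = \<zero>"
    and f: "f \<in> PIdl\<^bsub>P\<^esub> g" "\<And>j. j \<ge> q \<Longrightarrow> up_ring.coeff P f j = \<zero>"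
  shows "f = \<zero>\<^bsub>P\<^esub>"
proof -
  obtain x where x: "x \<in> carrier P" "f = x \<otimes>\<^bsub>P\<^esub> g"
    using f(1) unfolding cgenideal_def by blast
  have "x = \<zero>\<^bsub>P\<^esub>"
  proof (rule ccontr)
    assume nz: "x \<noteq> \<zero>\<^bsub>P\<^esub>"
    define d where "d = deg R x"
    \<comment> \<open>In degree \<open>d + q\<close> only the product of the two leading terms
      contributes.\<close>
    have term0: "up_ring.coeff P x i \<otimes> up_ring.coeff P g (d + q - i) = (if d = i then up_ring.coeff P x i else \<zero>)" for i
    proof -
      consider "i < d" | "i = d" | "d < i" by linarith
      then show ?thesis
      proof cases
        case 1
        then show ?thesis using g x by simp
      next
        case 2
        then show ?thesis using g x by simp
      next
        case 3
        then have "up_ring.coeff P x i = \<zero>" using deg_aboveD[of x i] x unfolding d_def by blast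
        then show ?thesis using 3 g(1) by simp
      qed
    qed
    have "up_ring.coeff P f (d + q) = (\<Oplus>i\<in>{..d + q}. up_ring.coeff P x i \<otimes> up_ring.coeff P g (d + q - i))"
      unfolding x(2) using x g by (intro coeff_mult)
    also have "\<dots> = up_ring.coeff P x d"
      unfolding term0 using x by (intro R.finsum_singleton) auto
    finally have "up_ring.coeff P x d = \<zero>" using f(2)[of "d + q"] by simp
    then show False using lcoeff_nonzero2[OF x(1) nz] unfolding d_def by simp
  qed
  then show ?thesis using x g by simp
qed

text \<open>\<open>long_div_theorem\<close> divides up to a power of the leading coefficient, which
  is \<open>\<one>\<close> here.\<close>

lemma monic_division:
  assumes g: "g \<in> carrier P" "up_ring.coeff P g q = \<one>" "\<And>j. j > q \<Longrightarrow> up_ring.coeff P g j = \<zero>" and "q > 0"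
    and one: "\<one> \<noteq> \<zero>" and f: "f \<in> carrier P"
  shows "\<exists>r\<in>carrier P. (\<forall>j\<ge>q. up_ring.coeff P r j = \<zero>) \<and> f \<ominus>\<^bsub>P\<^esub> r \<in> PIdl\<^bsub>P\<^esub> g"
proof -
  have dg: "deg R g = q"
    using g one by (intro le_antisym deg_aboveI deg_belowI) auto
  have "g \<noteq> \<zero>\<^bsub>P\<^esub>" using g(2) one by auto
  from long_div_theorem[OF g(1) f this] obtain x r and k :: nat
    where x: "x \<in> carrier P" and r: "r \<in> carrier P" "r = \<zero>\<^bsub>P\<^esub> \<or> deg R r < deg R g"
      and eq: "up_ring.coeff P g (deg R g) [^] k \<odot>\<^bsub>P\<^esub> f = g \<otimes>\<^bsub>P\<^esub> x \<oplus>\<^bsub>P\<^esub> r"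
    by blast
  have "f = x \<otimes>\<^bsub>P\<^esub> g \<oplus>\<^bsub>P\<^esub> r"
    using eq f g x unfolding dg by (simp add: P.m_comm)
  then have "f \<ominus>\<^bsub>P\<^esub> r = x \<otimes>\<^bsub>P\<^esub> g"
    using x r g by (simp add: P.minus_eq P.a_assoc P.r_neg)
  then have "f \<ominus>\<^bsub>P\<^esub> r \<in> PIdl\<^bsub>P\<^esub> g" unfolding cgenideal_def using x by blast
  moreover have "up_ring.coeff P r j = \<zero>" if "j \<ge> q" for j
    using r that deg_aboveD[of r j] unfolding dg by auto
  ultimately show ?thesis using r(1) by blast
qed

end

text \<open>The parameter \<open>enc\<close> allows the extension to be realised on a prescribed type, so that the
  construction can be iterated without changing types.\<close>

lemma monic_extension:
  fixes T :: "('t, 'm) ring_scheme" and enc :: "(nat \<Rightarrow> 't) \<Rightarrow> 'u" and q :: nat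
  assumes T: "cring T" "\<one>\<^bsub>T\<^esub> \<noteq> \<zero>\<^bsub>T\<^esub>" and enc: "inj enc" and q: "q > 0"
    and m: "m \<in> {..<q} \<rightarrow> carrier T"
  obtains T' :: "'u ring" and \<psi> y where "cring T'" "\<psi> \<in> ring_hom T T'" "y \<in> carrier T'"
    "y [^]\<^bsub>T'\<^esub> q = (\<Oplus>\<^bsub>T'\<^esub>i\<in>{..<q}. \<psi> (m i) \<otimes>\<^bsub>T'\<^esub> y [^]\<^bsub>T'\<^esub> i)"
    "\<And>t. t \<in> {..<q} \<rightarrow> carrier T \<Longrightarrow>
      (\<Oplus>\<^bsub>T'\<^esub>i\<in>{..<q}. \<psi> (t i) \<otimes>\<^bsub>T'\<^esub> y [^]\<^bsub>T'\<^esub> i) = \<zero>\<^bsub>T'\<^esub> \<Longrightarrow> \<forall>i<q. t i = \<zero>\<^bsub>T\<^esub>"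
proof -
  interpret T: cring T by fact
  define P where "P = UP T"
  interpret UP_cring T P by unfold_locales (simp add: P_def)
  define g where "g = up_ring.monom P \<one>\<^bsub>T\<^esub> q \<ominus>\<^bsub>P\<^esub> low_poly q m"
  have lm: "low_poly q m \<in> carrier P" by (rule low_poly_closed[OF m])
  have g: "g \<in> carrier P" "up_ring.coeff P g q = \<one>\<^bsub>T\<^esub>" "\<And>j. j > q \<Longrightarrow> up_ring.coeff P g j = \<zero>\<^bsub>T\<^esub>"
    using lm by (simp_all add: g_def coeff_low_poly[OF m] T.minus_eq)
  define I where "I = PIdl\<^bsub>P\<^esub> g"
  have I: "ideal I P" unfolding I_def by (rule P.cgenideal_ideal[OF g(1)])
  interpret I: ideal I P by (rule I)
  \<comment> \<open>Remainders serve as representatives of the classes modulo \<open>g\<close>.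
    Elements of \<open>UP T\<close> are coefficient functions of type
    \<open>nat \<Rightarrow> 't\<close>, so \<open>enc \<circ> rm\<close> realises the quotient ring
    on the prescribed type.\<close>
  define rm where "rm f = (SOME r. r \<in> carrier P \<and> (\<forall>j\<ge>q. up_ring.coeff P r j = \<zero>\<^bsub>T\<^esub>) \<and> f \<ominus>\<^bsub>P\<^esub> r \<in> I)" for f
  have rm: "rm f \<in> carrier P \<and> (\<forall>j\<ge>q. up_ring.coeff P (rm f) j = \<zero>\<^bsub>T\<^esub>) \<and> f \<ominus>\<^bsub>P\<^esub> rm f \<in> I"
    if "f \<in> carrier P" for f
  proof -
    have "\<exists>r. r \<in> carrier P \<and> (\<forall>j\<ge>q. up_ring.coeff P r j = \<zero>\<^bsub>T\<^esub>) \<and> f \<ominus>\<^bsub>P\<^esub> r \<in> I"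
      using monic_division[OF g q T(2) that] unfolding I_def by blast
    then show ?thesis unfolding rm_def by (rule someI_ex)
  qed
  have zeroI: "f = \<zero>\<^bsub>P\<^esub>" if "f \<in> I" "\<And>j. j \<ge> q \<Longrightarrow> up_ring.coeff P f j = \<zero>\<^bsub>T\<^esub>" for f
    using monic_multiple_low_degree[OF g that(1)[unfolded I_def] that(2)] by blast
  have rm_eq_iff: "rm a = rm b \<longleftrightarrow> a \<ominus>\<^bsub>P\<^esub> b \<in> I" if ab: "a \<in> carrier P" "b \<in> carrier P" for a b
  proof
    assume eq: "rm a = rm b"
    have "a \<ominus>\<^bsub>P\<^esub> b = (a \<ominus>\<^bsub>P\<^esub> rm a) \<ominus>\<^bsub>P\<^esub> (b \<ominus>\<^bsub>P\<^esub> rm a)"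
    proof -
      have "rm a \<in> carrier P" using rm ab by blast
      then show ?thesis using ab by algebra
    qed
    then show "a \<ominus>\<^bsub>P\<^esub> b \<in> I"
      using rm[OF ab(1)] rm[OF ab(2)] eq by (simp add: P.minus_eq I.a_inv_closed)
  next
    assume mem: "a \<ominus>\<^bsub>P\<^esub> b \<in> I"
    have r: "rm a \<in> carrier P" "rm b \<in> carrier P" using rm ab by auto
    have "rm a \<ominus>\<^bsub>P\<^esub> rm b = (a \<ominus>\<^bsub>P\<^esub> b) \<ominus>\<^bsub>P\<^esub> (a \<ominus>\<^bsub>P\<^esub> rm a) \<oplus>\<^bsub>P\<^esub> (b \<ominus>\<^bsub>P\<^esub> rm b)"
      using ab r by algebra
    then have "rm a \<ominus>\<^bsub>P\<^esub> rm b \<in> I"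
      using mem rm[OF ab(1)] rm[OF ab(2)] by (simp add: P.minus_eq I.a_inv_closed)
    then have "rm a \<ominus>\<^bsub>P\<^esub> rm b = \<zero>\<^bsub>P\<^esub>"
      using rm[OF ab(1)] rm[OF ab(2)] by (intro zeroI) (auto simp: T.minus_eq)
    then show "rm a = rm b" using r by (simp add: P.r_right_minus_eq)
  qed
  define h where "h = enc \<circ> rm"
  have wm: "weak_ring_morphism h I P"
    by (rule weak_ring_morphismI[OF I]) (use enc rm_eq_iff in \<open>auto simp: h_def inj_eq\<close>)
  define T' where "T' = image_ring h P"
  have hom: "h \<in> ring_hom P T'" unfolding T'_def by (rule P.weak_ring_morphism_is_hom[OF wm])
  have T'_ring: "ring T'" unfolding T'_def by (rule P.image_ring_is_ring[OF wm])
  interpret T': ring T' by (rule T'_ring)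
  have surj: "carrier T' = h ` carrier P" unfolding T'_def by (rule image_ring_carrier)
  interpret T': cring T'
  proof (rule cring.intro[OF T'_ring], unfold_locales)
    fix x y assume "x \<in> carrier T'" "y \<in> carrier T'"
    then obtain a b where "a \<in> carrier P" "x = h a" "b \<in> carrier P" "y = h b"
      unfolding surj by blast
    then show "x \<otimes>\<^bsub>T'\<^esub> y = y \<otimes>\<^bsub>T'\<^esub> x"
      using ring_hom_mult[OF hom, of a b] ring_hom_mult[OF hom, of b a] P.m_comm[of a b] by simp
  qed
  interpret H: ring_hom_cring P T' h by unfold_locales (rule hom)
  have ker: "h f = \<zero>\<^bsub>T'\<^esub> \<longleftrightarrow> f \<in> I" if "f \<in> carrier P" for f
  proof -
    have "h f = h \<zero>\<^bsub>P\<^esub> \<longleftrightarrow> f \<ominus>\<^bsub>P\<^esub> \<zero>\<^bsub>P\<^esub> \<in> I"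
      using enc rm_eq_iff[OF that P.zero_closed] by (simp add: h_def inj_eq)
    then show ?thesis using that by (simp add: P.minus_eq)
  qed
  define \<psi> where "\<psi> a = h (up_ring.monom P a 0)" for a
  define y where "y = h (up_ring.monom P \<one>\<^bsub>T\<^esub> 1)"
  have \<psi>: "\<psi> \<in> ring_hom T T'"
    using ring_hom_trans[OF const_ring_hom hom] by (simp add: \<psi>_def[abs_def] comp_def)
  have y: "y \<in> carrier T'" unfolding y_def by simp
  have ypow: "y [^]\<^bsub>T'\<^esub> i = h (up_ring.monom P \<one>\<^bsub>T\<^esub> i)" for i :: nat
    unfolding y_def by (simp add: H.hom_pow[symmetric] monom_pow)
  have hmon: "h (up_ring.monom P a i) = \<psi> a \<otimes>\<^bsub>T'\<^esub> y [^]\<^bsub>T'\<^esub> i" if "a \<in> carrier T" for a i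
    using that monom_mult[of a "\<one>\<^bsub>T\<^esub>" 0 i] by (simp add: \<psi>_def ypow flip: H.hom_mult)
  have hlow: "h (low_poly q t) = (\<Oplus>\<^bsub>T'\<^esub>i\<in>{..<q}. \<psi> (t i) \<otimes>\<^bsub>T'\<^esub> y [^]\<^bsub>T'\<^esub> i)"
    if t: "t \<in> {..<q} \<rightarrow> carrier T" for t
  proof -
    have "h (low_poly q t) = (\<Oplus>\<^bsub>T'\<^esub>i\<in>{..<q}. h (up_ring.monom P (t i) i))"
      unfolding low_poly_def using t by (subst H.hom_finsum) (auto simp: Pi_iff comp_def)
    also have "\<dots> = (\<Oplus>\<^bsub>T'\<^esub>i\<in>{..<q}. \<psi> (t i) \<otimes>\<^bsub>T'\<^esub> y [^]\<^bsub>T'\<^esub> i)"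
      using t y ring_hom_closed[OF \<psi>] hmon by (intro T'.finsum_cong') (auto simp: Pi_iff)
    finally show ?thesis .
  qed
  show thesis
  proof (rule that[of T' \<psi> y])
    show "cring T'" by unfold_locales
    show "\<psi> \<in> ring_hom T T'" "y \<in> carrier T'" by fact+
    have "h g = \<zero>\<^bsub>T'\<^esub>" using ker g P.cgenideal_self unfolding I_def by blast
    then have "h (up_ring.monom P \<one>\<^bsub>T\<^esub> q) \<ominus>\<^bsub>T'\<^esub> h (low_poly q m) = \<zero>\<^bsub>T'\<^esub>"
      using lm by (simp add: g_def P.minus_eq T'.minus_eq)
    then have "h (up_ring.monom P \<one>\<^bsub>T\<^esub> q) = h (low_poly q m)"
      using lm by (simp add: T'.r_right_minus_eq)
    then show "y [^]\<^bsub>T'\<^esub> q = (\<Oplus>\<^bsub>T'\<^esub>i\<in>{..<q}. \<psi> (m i) \<otimes>\<^bsub>T'\<^esub> y [^]\<^bsub>T'\<^esub> i)"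
      using hlow[OF m] ypow by simp
  next
    fix t assume t: "t \<in> {..<q} \<rightarrow> carrier T"
      "(\<Oplus>\<^bsub>T'\<^esub>i\<in>{..<q}. \<psi> (t i) \<otimes>\<^bsub>T'\<^esub> y [^]\<^bsub>T'\<^esub> i) = \<zero>\<^bsub>T'\<^esub>"
    \<comment> \<open>A vanishing expression of degree below \<open>q\<close> is a multiple of
      \<open>g\<close> of degree below \<open>q\<close>, hence the zero polynomial.\<close>
    have "low_poly q t \<in> I" using t(2) hlow[OF t(1)] ker low_poly_closed[OF t(1)] by simp
    then have "low_poly q t = \<zero>\<^bsub>P\<^esub>"
      by (rule zeroI) (simp add: coeff_low_poly[OF t(1)])
    then have "up_ring.coeff P (low_poly q t) i = \<zero>\<^bsub>T\<^esub>" for i by simp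
    then show "\<forall>i<q. t i = \<zero>\<^bsub>T\<^esub>" using coeff_low_poly[OF t(1)] by metis
  qed
qed

section \<open>Graded families and bounded polynomial expressions\<close>

text \<open>Degrees are integers because localisation produces negative ones. Directness of the sum
  is deliberately left out: the constant family with value \<open>carrier R\<close>, which forgets
  degrees, should qualify as well.\<close>

definition (in ring) graded_family :: "(int \<Rightarrow> 'a set) \<Rightarrow> bool" where
  "graded_family E \<longleftrightarrow> (\<forall>n. additive_subgroup (E n) R) \<and> \<one> \<in> E 0 \<and>
     (\<forall>m n. \<forall>a\<in>E m. \<forall>b\<in>E n. a \<otimes> b \<in> E (m + n))"

context ring
begin

lemma additive_subgroupI':
  assumes "H \<subseteq> carrier R" "\<zero> \<in> H" "\<And>a. a \<in> H \<Longrightarrow> \<ominus> a \<in> H" "\<And>a b. a \<in> H \<Longrightarrow> b \<in> H \<Longrightarrow> a \<oplus> b \<in> H"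
  shows "additive_subgroup H R"
  using assms by (intro additive_subgroup.intro add.subgroupI) auto

lemma additive_subgroup_finsum:
  assumes H: "additive_subgroup H R" and "finite F" "\<And>i. i \<in> F \<Longrightarrow> x i \<in> H"
  shows "(\<Oplus>i\<in>F. x i) \<in> H"
  using assms(2-)
proof (induction F rule: finite_induct)
  case empty
  then show ?case using additive_subgroup.zero_closed[OF H] by simp
next
  case (insert i F)
  have "(\<Oplus>i\<in>insert i F. x i) = x i \<oplus> (\<Oplus>i\<in>F. x i)"
    using insert additive_subgroup.a_subset[OF H] by (intro finsum_insert) auto
  then show ?case using insert additive_subgroup.a_closed[OF H] by simp
qed

lemma graded_familyD:
  assumes "graded_family E"
  shows "additive_subgroup (E n) R" "\<one> \<in> E 0"
    "a \<in> E i \<Longrightarrow> b \<in> E j \<Longrightarrow> a \<otimes> b \<in> E (i + j)"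
    "\<zero> \<in> E n" "a \<in> E n \<Longrightarrow> a \<in> carrier R" "a \<in> E n \<Longrightarrow> \<ominus> a \<in> E n"
    "a \<in> E n \<Longrightarrow> b \<in> E n \<Longrightarrow> a \<oplus> b \<in> E n" "a \<in> E n \<Longrightarrow> b \<in> E n \<Longrightarrow> a \<ominus> b \<in> E n"
proof -
  show "additive_subgroup (E n) R" for n using assms unfolding graded_family_def by blast
  then interpret additive_subgroup "E n" R for n .
  show "\<one> \<in> E 0" "a \<in> E i \<Longrightarrow> b \<in> E j \<Longrightarrow> a \<otimes> b \<in> E (i + j)"
    using assms unfolding graded_family_def by blast+
  show "\<zero> \<in> E n" "a \<in> E n \<Longrightarrow> a \<in> carrier R" "a \<in> E n \<Longrightarrow> \<ominus> a \<in> E n"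
    "a \<in> E n \<Longrightarrow> b \<in> E n \<Longrightarrow> a \<oplus> b \<in> E n" by (auto simp: a_inv_closed)
  then show "a \<in> E n \<Longrightarrow> b \<in> E n \<Longrightarrow> a \<ominus> b \<in> E n"
    by (simp add: minus_eq a_inv_closed)
qed

lemma graded_family_carrier: "graded_family (\<lambda>_. carrier R)"
  unfolding graded_family_def by (auto intro!: additive_subgroupI')

lemma graded_family_pow:
  assumes "graded_family E" "a \<in> E n"
  shows "a [^] (k :: nat) \<in> E (int k * n)"
proof (induction k)
  case 0
  then show ?case using graded_familyD(2)[OF assms(1)] by simp
next
  case (Suc k)
  have "a [^] k \<otimes> a \<in> E (int k * n + n)" by (rule graded_familyD(3)[OF assms(1) Suc assms(2)])
  then show ?case by (simp add: algebra_simps)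
qed

end

context ring_hom_cring
begin

text \<open>The expressions \<open>\<Sum>\<^sub>i\<^sub><\<^sub>s h(t\<^sub>i) z\<^sup>i\<close> that are homogeneous of degree \<open>n\<close> when \<open>z\<close> has degree \<open>e\<close>.\<close>

primrec pol :: "(int \<Rightarrow> 'a set) \<Rightarrow> 'c \<Rightarrow> int \<Rightarrow> nat \<Rightarrow> int \<Rightarrow> 'c set" where
  "pol E z e 0 n = {\<zero>\<^bsub>S\<^esub>}"
| "pol E z e (Suc s) n =
    {h t \<otimes>\<^bsub>S\<^esub> z [^]\<^bsub>S\<^esub> s \<oplus>\<^bsub>S\<^esub> x | t x. t \<in> E (n - int s * e) \<and> x \<in> pol E z e s n}"

lemma pol_SucE:
  assumes "x \<in> pol E z e (Suc s) n"
  obtains t x' where "t \<in> E (n - int s * e)" "x' \<in> pol E z e s n"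
    "x = h t \<otimes>\<^bsub>S\<^esub> z [^]\<^bsub>S\<^esub> s \<oplus>\<^bsub>S\<^esub> x'"
  using assms by auto

lemma pol_SucI:
  "t \<in> E (n - int s * e) \<Longrightarrow> x \<in> pol E z e s n \<Longrightarrow> h t \<otimes>\<^bsub>S\<^esub> z [^]\<^bsub>S\<^esub> s \<oplus>\<^bsub>S\<^esub> x \<in> pol E z e (Suc s) n"
  by auto

declare pol.simps(2) [simp del]

context
  fixes E :: "int \<Rightarrow> 'a set" and z :: 'c and e :: int
  assumes E: "R.graded_family E" and z [simp]: "z \<in> carrier S"
begin

lemma Ec: "a \<in> E n \<Longrightarrow> a \<in> carrier R"
  by (rule R.graded_familyD(5)[OF E])

lemma pol_closed: "x \<in> pol E z e s n \<Longrightarrow> x \<in> carrier S"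
  by (induction s arbitrary: x) (auto elim!: pol_SucE dest: Ec)

lemma pol_zero: "\<zero>\<^bsub>S\<^esub> \<in> pol E z e s n"
proof (induction s)
  case (Suc s)
  then show ?case
    using pol_SucI[of \<zero> E n s e "\<zero>\<^bsub>S\<^esub>" z] R.graded_familyD(4)[OF E] by simp
qed simp

lemma pol_neg: "x \<in> pol E z e s n \<Longrightarrow> \<ominus>\<^bsub>S\<^esub> x \<in> pol E z e s n"
proof (induction s arbitrary: x)
  case (Suc s)
  then obtain t x' where t: "t \<in> E (n - int s * e)" "x' \<in> pol E z e s n"
    "x = h t \<otimes>\<^bsub>S\<^esub> z [^]\<^bsub>S\<^esub> s \<oplus>\<^bsub>S\<^esub> x'" by (elim pol_SucE)
  have "\<ominus>\<^bsub>S\<^esub> x = h (\<ominus> t) \<otimes>\<^bsub>S\<^esub> z [^]\<^bsub>S\<^esub> s \<oplus>\<^bsub>S\<^esub> (\<ominus>\<^bsub>S\<^esub> x')"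
    using t Ec pol_closed[OF t(2)] by (simp add: S.minus_add S.l_minus)
  then show ?case using pol_SucI[OF R.graded_familyD(6)[OF E t(1)] Suc.IH[OF t(2)]] by simp
qed simp

lemma pol_add: "x \<in> pol E z e s n \<Longrightarrow> y \<in> pol E z e s n \<Longrightarrow> x \<oplus>\<^bsub>S\<^esub> y \<in> pol E z e s n"
proof (induction s arbitrary: x y)
  case (Suc s)
  obtain t x' where t: "t \<in> E (n - int s * e)" "x' \<in> pol E z e s n"
    "x = h t \<otimes>\<^bsub>S\<^esub> z [^]\<^bsub>S\<^esub> s \<oplus>\<^bsub>S\<^esub> x'" using Suc.prems(1) by (elim pol_SucE)
  obtain u y' where u: "u \<in> E (n - int s * e)" "y' \<in> pol E z e s n"
    "y = h u \<otimes>\<^bsub>S\<^esub> z [^]\<^bsub>S\<^esub> s \<oplus>\<^bsub>S\<^esub> y'" using Suc.prems(2) by (elim pol_SucE)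
  note [simp] = Ec[OF t(1)] Ec[OF u(1)] pol_closed[OF t(2)] pol_closed[OF u(2)]
  have "x \<oplus>\<^bsub>S\<^esub> y = h (t \<oplus> u) \<otimes>\<^bsub>S\<^esub> z [^]\<^bsub>S\<^esub> s \<oplus>\<^bsub>S\<^esub> (x' \<oplus>\<^bsub>S\<^esub> y')"
    unfolding t(3) u(3) by (simp add: S.l_distr S.a_ac)
  then show ?case using pol_SucI[OF R.graded_familyD(7)[OF E t(1) u(1)] Suc.IH[OF t(2) u(2)]] by simp
qed simp

lemma pol_subgroup: "additive_subgroup (pol E z e s n) S"
  by (rule S.additive_subgroupI') (auto intro: pol_closed pol_zero pol_neg pol_add)

lemma pol_mono: "s \<le> s' \<Longrightarrow> pol E z e s n \<subseteq> pol E z e s' n"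
proof (induction s' rule: nat_induct_at_least)
  case (Suc s')
  have "pol E z e s' n \<subseteq> pol E z e (Suc s') n"
  proof
    fix x assume x: "x \<in> pol E z e s' n"
    show "x \<in> pol E z e (Suc s') n"
      using pol_SucI[OF R.graded_familyD(4)[OF E] x] pol_closed[OF x] by simp
  qed
  with Suc show ?case by blast
qed simp

lemma pol_monom: "t \<in> E m \<Longrightarrow> s < s' \<Longrightarrow> n = m + int s * e \<Longrightarrow> h t \<otimes>\<^bsub>S\<^esub> z [^]\<^bsub>S\<^esub> s \<in> pol E z e s' n"
  using pol_SucI[OF _ pol_zero, of t n s] pol_mono[of "Suc s" s' n] Ec[of t] by auto

lemma pol_smult: "a \<in> E m \<Longrightarrow> x \<in> pol E z e s n \<Longrightarrow> h a \<otimes>\<^bsub>S\<^esub> x \<in> pol E z e s (m + n)"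
proof (induction s arbitrary: x)
  case 0
  then show ?case using Ec[of a] by simp
next
  case (Suc s)
  then obtain t x' where t: "t \<in> E (n - int s * e)" "x' \<in> pol E z e s n"
    "x = h t \<otimes>\<^bsub>S\<^esub> z [^]\<^bsub>S\<^esub> s \<oplus>\<^bsub>S\<^esub> x'" by (elim pol_SucE)
  have "a \<otimes> t \<in> E (m + n - int s * e)"
    using R.graded_familyD(3)[OF E Suc.prems(1) t(1)] by (simp add: algebra_simps)
  moreover have "h a \<otimes>\<^bsub>S\<^esub> x = h (a \<otimes> t) \<otimes>\<^bsub>S\<^esub> z [^]\<^bsub>S\<^esub> s \<oplus>\<^bsub>S\<^esub> h a \<otimes>\<^bsub>S\<^esub> x'"
    using t Ec[OF t(1)] Ec[OF Suc.prems(1)] pol_closed[OF t(2)] by (simp add: S.r_distr S.m_assoc)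
  ultimately show ?case using pol_SucI Suc.IH[OF Suc.prems(1) t(2)] by simp
qed

lemma pol_shift: "x \<in> pol E z e s n \<Longrightarrow> z \<otimes>\<^bsub>S\<^esub> x \<in> pol E z e (Suc s) (n + e)"
proof (induction s arbitrary: x)
  case 0
  then show ?case using pol_zero by simp
next
  case (Suc s)
  then obtain t x' where t: "t \<in> E (n - int s * e)" "x' \<in> pol E z e s n"
    "x = h t \<otimes>\<^bsub>S\<^esub> z [^]\<^bsub>S\<^esub> s \<oplus>\<^bsub>S\<^esub> x'" by (elim pol_SucE)
  have "z \<otimes>\<^bsub>S\<^esub> x = h t \<otimes>\<^bsub>S\<^esub> z [^]\<^bsub>S\<^esub> Suc s \<oplus>\<^bsub>S\<^esub> z \<otimes>\<^bsub>S\<^esub> x'"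
    using t Ec[OF t(1)] pol_closed[OF t(2)] by (simp add: S.r_distr S.m_ac)
  moreover have "t \<in> E (n + e - int (Suc s) * e)" using t(1) by (simp add: algebra_simps)
  ultimately show ?case using pol_SucI[of t E "n + e" "Suc s" e _ z] Suc.IH[OF t(2)] by simp
qed

text \<open>Translates the recursive description into a sum over exponents, the form in which
  \<open>monic_extension\<close> provides independence of the powers of the adjoined
  element.\<close>

lemma pol_finsum:
  assumes "x \<in> pol E z e s n"
  shows "\<exists>t. (\<forall>i. t i \<in> E (n - int i * e)) \<and> (\<forall>i\<ge>s. t i = \<zero>) \<and>
    x = (\<Oplus>\<^bsub>S\<^esub>i\<in>{..<s}. h (t i) \<otimes>\<^bsub>S\<^esub> z [^]\<^bsub>S\<^esub> i)"
  using assms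
proof (induction s arbitrary: x)
  case 0
  then show ?case using R.graded_familyD(4)[OF E] by (intro exI[of _ "\<lambda>_. \<zero>"]) simp
next
  case (Suc s)
  then obtain t x' where t: "t \<in> E (n - int s * e)" "x' \<in> pol E z e s n"
    "x = h t \<otimes>\<^bsub>S\<^esub> z [^]\<^bsub>S\<^esub> s \<oplus>\<^bsub>S\<^esub> x'" by (elim pol_SucE)
  from Suc.IH[OF t(2)] obtain u where u: "\<And>i. u i \<in> E (n - int i * e)" "\<And>i. i \<ge> s \<Longrightarrow> u i = \<zero>"
    "x' = (\<Oplus>\<^bsub>S\<^esub>i\<in>{..<s}. h (u i) \<otimes>\<^bsub>S\<^esub> z [^]\<^bsub>S\<^esub> i)" by blast
  have uc: "u i \<in> carrier R" for i using u(1) Ec by blast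
  define v where "v = u(s := t)"
  have "(\<Oplus>\<^bsub>S\<^esub>i\<in>{..<Suc s}. h (v i) \<otimes>\<^bsub>S\<^esub> z [^]\<^bsub>S\<^esub> i)
     = h (v s) \<otimes>\<^bsub>S\<^esub> z [^]\<^bsub>S\<^esub> s \<oplus>\<^bsub>S\<^esub> (\<Oplus>\<^bsub>S\<^esub>i\<in>{..<s}. h (v i) \<otimes>\<^bsub>S\<^esub> z [^]\<^bsub>S\<^esub> i)"
    unfolding lessThan_Suc using uc Ec[OF t(1)] by (intro S.finsum_insert) (auto simp: v_def)
  also have "(\<Oplus>\<^bsub>S\<^esub>i\<in>{..<s}. h (v i) \<otimes>\<^bsub>S\<^esub> z [^]\<^bsub>S\<^esub> i) = x'"
    unfolding u(3) using uc by (intro S.finsum_cong') (auto simp: v_def)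
  finally have "x = (\<Oplus>\<^bsub>S\<^esub>i\<in>{..<Suc s}. h (v i) \<otimes>\<^bsub>S\<^esub> z [^]\<^bsub>S\<^esub> i)" using t(3) by (simp add: v_def)
  moreover have "v i \<in> E (n - int i * e)" for i using u(1) t(1) by (simp add: v_def)
  moreover have "v i = \<zero>" if "i \<ge> Suc s" for i using u(2) that by (simp add: v_def)
  ultimately show ?case by blast
qed

context
  fixes q :: nat
  assumes q: "q > 0" and zq: "z [^]\<^bsub>S\<^esub> q \<in> pol E z e q (int q * e)"
begin

text \<open>Only the term of exponent \<open>q - 1\<close> is pushed out of the range. Its power
  \<open>z^q\<close> is rewritten by \<open>zq\<close>, which is homogeneous of the right degree.
  This is what closes \<open>pol E z e q\<close> under products.\<close>

lemma pol_z_mult: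
  assumes x: "x \<in> pol E z e q n"
  shows "z \<otimes>\<^bsub>S\<^esub> x \<in> pol E z e q (n + e)"
proof -
  obtain s where s: "q = Suc s" using q by (cases q) auto
  obtain t x' where t: "t \<in> E (n - int s * e)" "x' \<in> pol E z e s n"
    "x = h t \<otimes>\<^bsub>S\<^esub> z [^]\<^bsub>S\<^esub> s \<oplus>\<^bsub>S\<^esub> x'" using x unfolding s by (elim pol_SucE)
  have "z \<otimes>\<^bsub>S\<^esub> x = h t \<otimes>\<^bsub>S\<^esub> z [^]\<^bsub>S\<^esub> q \<oplus>\<^bsub>S\<^esub> z \<otimes>\<^bsub>S\<^esub> x'"
    using t Ec[OF t(1)] pol_closed[OF t(2)] by (simp add: s S.r_distr S.m_ac)
  moreover have "h t \<otimes>\<^bsub>S\<^esub> z [^]\<^bsub>S\<^esub> q \<in> pol E z e q (n + e)"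
    using pol_smult[OF t(1) zq] by (simp add: s algebra_simps)
  ultimately show ?thesis using pol_shift[OF t(2)] pol_add unfolding s by simp
qed

lemma pol_z_pow_mult:
  assumes x: "x \<in> pol E z e q n"
  shows "z [^]\<^bsub>S\<^esub> (j :: nat) \<otimes>\<^bsub>S\<^esub> x \<in> pol E z e q (n + int j * e)"
proof (induction j)
  case 0
  then show ?case using x pol_closed by simp
next
  case (Suc j)
  have "z [^]\<^bsub>S\<^esub> Suc j \<otimes>\<^bsub>S\<^esub> x = z \<otimes>\<^bsub>S\<^esub> (z [^]\<^bsub>S\<^esub> j \<otimes>\<^bsub>S\<^esub> x)" using pol_closed[OF x] by (simp add: S.m_ac)
  then show ?case using pol_z_mult[OF Suc] by (simp add: algebra_simps)
qed

lemma pol_mult: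
  "x \<in> pol E z e s m \<Longrightarrow> y \<in> pol E z e q n \<Longrightarrow> x \<otimes>\<^bsub>S\<^esub> y \<in> pol E z e q (m + n)"
proof (induction s arbitrary: x)
  case 0
  then show ?case using pol_zero pol_closed[OF 0(2)] by simp
next
  case (Suc s)
  then obtain t x' where t: "t \<in> E (m - int s * e)" "x' \<in> pol E z e s m"
    "x = h t \<otimes>\<^bsub>S\<^esub> z [^]\<^bsub>S\<^esub> s \<oplus>\<^bsub>S\<^esub> x'" by (elim pol_SucE)
  have "x \<otimes>\<^bsub>S\<^esub> y = h t \<otimes>\<^bsub>S\<^esub> (z [^]\<^bsub>S\<^esub> s \<otimes>\<^bsub>S\<^esub> y) \<oplus>\<^bsub>S\<^esub> x' \<otimes>\<^bsub>S\<^esub> y"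
    using t Ec[OF t(1)] pol_closed[OF t(2)] pol_closed[OF Suc.prems(2)] by (simp add: S.l_distr S.m_assoc)
  moreover have "h t \<otimes>\<^bsub>S\<^esub> (z [^]\<^bsub>S\<^esub> s \<otimes>\<^bsub>S\<^esub> y) \<in> pol E z e q (m + n)"
    using pol_smult[OF t(1) pol_z_pow_mult[OF Suc.prems(2), of s]] by (simp add: algebra_simps)
  ultimately show ?case using pol_add Suc.IH[OF t(2) Suc.prems(2)] by simp
qed

lemma pol_graded_family: "S.graded_family (pol E z e q)"
  unfolding S.graded_family_def
proof (intro conjI allI ballI)
  show "\<one>\<^bsub>S\<^esub> \<in> pol E z e q 0"
    using pol_monom[OF R.graded_familyD(2)[OF E] q, of 0] by simp
qed (auto intro: pol_subgroup pol_mult)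

lemma hom_image_pol: "t \<in> E n \<Longrightarrow> h t \<in> pol E z e q n"
  using pol_monom[of t n 0 q n] q Ec by simp

end

end

lemma pol_mono_family:
  "(\<And>n. E n \<subseteq> E' n) \<Longrightarrow> pol E z e s n \<subseteq> pol E' z e s n"
proof (induction s)
  case (Suc s)
  show ?case
  proof
    fix x assume "x \<in> pol E z e (Suc s) n"
    then obtain t x' where t: "t \<in> E (n - int s * e)" "x' \<in> pol E z e s n"
      "x = h t \<otimes>\<^bsub>S\<^esub> z [^]\<^bsub>S\<^esub> s \<oplus>\<^bsub>S\<^esub> x'" by (elim pol_SucE)
    then show "x \<in> pol E' z e (Suc s) n" using pol_SucI[of t E' n s e x' z] Suc by blast
  qed
qed simp

lemma pol_carrier_degree: "pol (\<lambda>_. carrier R) z e s n = pol (\<lambda>_. carrier R) z e s m"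
  by (induction s) (simp_all add: pol.simps(2))

text \<open>Substituting \<open>y - c\<close> for \<open>y\<close> is unitriangular for the filtration by the degree in \<open>y\<close>.\<close>

context
  fixes H :: "int \<Rightarrow> 'a set" and y :: 'c and e :: int and c :: 'a
  assumes H: "R.graded_family H" and y [simp]: "y \<in> carrier S" and c: "c \<in> H e"
begin

lemma translate_pow:
  "\<exists>x\<in>pol H y e s (int s * e). (y \<ominus>\<^bsub>S\<^esub> h c) [^]\<^bsub>S\<^esub> s = y [^]\<^bsub>S\<^esub> s \<oplus>\<^bsub>S\<^esub> x"
proof (induction s)
  case 0
  then show ?case by simp
next
  case (Suc s)
  have [simp]: "c \<in> carrier R" using R.graded_familyD(5)[OF H c] .
  from Suc obtain x where x: "x \<in> pol H y e s (int s * e)"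
    "(y \<ominus>\<^bsub>S\<^esub> h c) [^]\<^bsub>S\<^esub> s = y [^]\<^bsub>S\<^esub> s \<oplus>\<^bsub>S\<^esub> x" by blast
  have [simp]: "x \<in> carrier S" using pol_closed[OF H y x(1)] .
  \<comment> \<open>All terms of the product of \<open>y^s + x\<close> and \<open>y - c\<close>
    except \<open>y^(s+1)\<close>.\<close>
  define x' where "x' = y \<otimes>\<^bsub>S\<^esub> x \<oplus>\<^bsub>S\<^esub> \<ominus>\<^bsub>S\<^esub> (h c \<otimes>\<^bsub>S\<^esub> y [^]\<^bsub>S\<^esub> s) \<oplus>\<^bsub>S\<^esub> \<ominus>\<^bsub>S\<^esub> (h c \<otimes>\<^bsub>S\<^esub> x)"
  have deg: "int (Suc s) * e = e + int s * e" by (simp only: of_nat_Suc int_distrib mult_1_left)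
  then have deg': "int (Suc s) * e = int s * e + e" by linarith
  have "y \<otimes>\<^bsub>S\<^esub> x \<in> pol H y e (Suc s) (int (Suc s) * e)"
    using pol_shift[OF H y x(1)] unfolding deg' .
  moreover have "h c \<otimes>\<^bsub>S\<^esub> y [^]\<^bsub>S\<^esub> s \<in> pol H y e (Suc s) (int (Suc s) * e)"
    by (rule pol_monom[OF H y c _ deg]) simp
  moreover have "h c \<otimes>\<^bsub>S\<^esub> x \<in> pol H y e (Suc s) (int (Suc s) * e)"
    using pol_smult[OF H y c x(1)] pol_mono[OF H y, of s "Suc s"] unfolding deg by auto
  ultimately have "x' \<in> pol H y e (Suc s) (int (Suc s) * e)"
    unfolding x'_def by (intro pol_add[OF H y] pol_neg[OF H y])
  moreover have "(y \<ominus>\<^bsub>S\<^esub> h c) [^]\<^bsub>S\<^esub> Suc s = y [^]\<^bsub>S\<^esub> Suc s \<oplus>\<^bsub>S\<^esub> x'"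
  proof -
    have cS: "h c \<in> carrier S" "y [^]\<^bsub>S\<^esub> s \<in> carrier S" "x \<in> carrier S" "y \<in> carrier S" by simp_all
    have "(y [^]\<^bsub>S\<^esub> s \<oplus>\<^bsub>S\<^esub> x) \<otimes>\<^bsub>S\<^esub> (y \<ominus>\<^bsub>S\<^esub> h c) = y [^]\<^bsub>S\<^esub> s \<otimes>\<^bsub>S\<^esub> y \<oplus>\<^bsub>S\<^esub> x'"
      unfolding x'_def using cS by algebra
    then show ?thesis by (simp add: x(2))
  qed
  ultimately show ?case by blast
qed

text \<open>Coefficients move from \<open>E\<close> to \<open>H\<close>, since \<open>c\<close> is
  only known to lie in \<open>H\<close>: an expression in \<open>y - c\<close> over the second chart
  is seen as an expression in \<open>y\<close> over the intersection of the charts.\<close>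

lemma translate_pol:
  assumes E: "\<And>n. E n \<subseteq> H n"
  shows "pol E (y \<ominus>\<^bsub>S\<^esub> h c) e s n \<subseteq> pol H y e s n"
proof (induction s)
  case (Suc s)
  show ?case
  proof
    fix w assume "w \<in> pol E (y \<ominus>\<^bsub>S\<^esub> h c) e (Suc s) n"
    then obtain t x' where t: "t \<in> E (n - int s * e)" "x' \<in> pol E (y \<ominus>\<^bsub>S\<^esub> h c) e s n"
      "w = h t \<otimes>\<^bsub>S\<^esub> (y \<ominus>\<^bsub>S\<^esub> h c) [^]\<^bsub>S\<^esub> s \<oplus>\<^bsub>S\<^esub> x'" by (elim pol_SucE)
    obtain x where x: "x \<in> pol H y e s (int s * e)"
      "(y \<ominus>\<^bsub>S\<^esub> h c) [^]\<^bsub>S\<^esub> s = y [^]\<^bsub>S\<^esub> s \<oplus>\<^bsub>S\<^esub> x" using translate_pow by blast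
    have tH: "t \<in> H (n - int s * e)" using t(1) E by blast
    have x': "x' \<in> pol H y e s n" using t(2) Suc by blast
    have "h t \<otimes>\<^bsub>S\<^esub> x \<in> pol H y e s n" using pol_smult[OF H y tH x(1)] by simp
    then have "h t \<otimes>\<^bsub>S\<^esub> x \<oplus>\<^bsub>S\<^esub> x' \<in> pol H y e s n" by (rule pol_add[OF H y _ x'])
    moreover have "w = h t \<otimes>\<^bsub>S\<^esub> y [^]\<^bsub>S\<^esub> s \<oplus>\<^bsub>S\<^esub> (h t \<otimes>\<^bsub>S\<^esub> x \<oplus>\<^bsub>S\<^esub> x')"
      unfolding t(3) x(2)
      using R.graded_familyD(5)[OF H tH] pol_closed[OF H y x(1)] pol_closed[OF H y x']
      by (simp add: S.r_distr S.a_assoc)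
    ultimately show "w \<in> pol H y e (Suc s) n" using pol_SucI[of t H n s e _ y, OF tH] by simp
  qed
qed simp

end

end

section \<open>Graded rings covered by two charts\<close>

text \<open>\<open>Us\<close> represents a spanning set of the cokernel of
  \<open>U \<times> V \<rightarrow> W\<close>, that is, of the first Cech cohomology of a cover by
  two pieces. The empty list expresses vanishing.\<close>

definition (in ring) cech_spanned ::
  "'a set \<Rightarrow> 'a set \<Rightarrow> 'a set \<Rightarrow> 'a set \<Rightarrow> 'a list \<Rightarrow> bool" where
  "cech_spanned K W U V Us \<longleftrightarrow> set Us \<subseteq> W \<and>
     (\<forall>t\<in>W. \<exists>u\<in>U. \<exists>v\<in>V. \<exists>w\<in>Span K Us. t = u \<oplus> v \<oplus> w)"

text \<open>\<open>D1\<close>, \<open>D2\<close> and \<open>H\<close> are the graded rings of sections over the two basic open sets \<open>f1 \<noteq> 0\<close>,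
  \<open>f2 \<noteq> 0\<close> and over their intersection, all inside the ambient ring \<open>T\<close>; thus \<open>D1 n \<inter> D2 n\<close> and
  \<open>H n / (D1 n + D2 n)\<close> are the cohomology groups of the degree \<open>n\<close> part of the structure sheaf.\<close>

locale chart_cover = cring T for T (structure) +
  fixes K :: "'a set" and p :: nat and H D1 D2 :: "int \<Rightarrow> 'a set"
    and f1 f2 i1 i2 :: 'a and d1 d2 :: nat
  assumes K: "subfield K T"
    and p: "Factorial_Ring.prime p" "add_pow T p \<one> = \<zero>"
    and H: "graded_family H" and D1: "graded_family D1" and D2: "graded_family D2"
    and D1_H: "D1 n \<subseteq> H n" and D2_H: "D2 n \<subseteq> H n"
    and K_D1: "K \<subseteq> D1 0" and K_D2: "K \<subseteq> D2 0"
    and indep: "finite F \<Longrightarrow> (\<And>n. n \<in> F \<Longrightarrow> x n \<in> H n) \<Longrightarrow> (\<Oplus>n\<in>F. x n) = \<zero> \<Longrightarrow> n \<in> F \<Longrightarrow> x n = \<zero>"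
    and f1: "f1 \<in> D1 (int d1)" "f1 \<in> D2 (int d1)" and f2: "f2 \<in> D1 (int d2)" "f2 \<in> D2 (int d2)"
    and d_pos: "0 < d1" "0 < d2"
    and i1: "i1 \<in> D1 (- int d1)" "f1 \<otimes> i1 = \<one>" and i2: "i2 \<in> D2 (- int d2)" "f2 \<otimes> i2 = \<one>"
    and negative: "n < 0 \<Longrightarrow> D1 n \<inter> D2 n \<subseteq> {\<zero>}"
    and sections_finite: "\<exists>Us. set Us \<subseteq> carrier T \<and> D1 n \<inter> D2 n \<subseteq> Span K Us"
    and cech_finite: "\<exists>Us. cech_spanned K (H n) (D1 n) (D2 n) Us"
    and cech_vanish: "\<exists>n0. \<forall>n\<ge>n0. cech_spanned K (H n) (D1 n) (D2 n) []"
begin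

lemma K_carrier: "K \<subseteq> carrier T"
  by (rule subfieldE(3)[OF K])

lemma one_neq_zero: "\<one> \<noteq> \<zero>"
  using subfieldE(6)[OF K] by simp

end

lemma (in ring) Span_mult_right:
  assumes S: "cring S" and h: "h \<in> ring_hom R S" and "z \<in> carrier S" "set Us \<subseteq> carrier R" "K \<subseteq> carrier R"
    and "w \<in> Span K Us"
  shows "h w \<otimes>\<^bsub>S\<^esub> z \<in> ring.Span S (h ` K) (map (\<lambda>u. h u \<otimes>\<^bsub>S\<^esub> z) Us)"
  using assms(4,6)
proof (induction Us arbitrary: w)
  interpret S: cring S by fact
  {
    case Nil
    then show ?case
      using ring_hom_zero[OF h ring_axioms S.ring_axioms] assms(3) by simp
  next
    case (Cons u Us)
    obtain k v where kv: "k \<in> K" "v \<in> Span K Us" "w = k \<otimes> u \<oplus> v"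
      using Cons.prems(2) unfolding Span_Cons_mem by blast
    have c: "k \<in> carrier R" "u \<in> carrier R" "v \<in> carrier R"
      using kv(1,2) Cons.prems(1) assms(5) Span_in_carrier[OF assms(5), of Us] by auto
    have "h w \<otimes>\<^bsub>S\<^esub> z = h k \<otimes>\<^bsub>S\<^esub> (h u \<otimes>\<^bsub>S\<^esub> z) \<oplus>\<^bsub>S\<^esub> h v \<otimes>\<^bsub>S\<^esub> z"
      using c assms(3) ring_hom_closed[OF h] unfolding kv(3)
      by (simp add: ring_hom_add[OF h] ring_hom_mult[OF h] S.l_distr S.m_assoc)
    then show ?case
      using Cons.IH[OF _ kv(2)] Cons.prems(1) kv(1) unfolding list.map S.Span_Cons_mem by auto
  }
qed

text \<open>The situation after a root \<open>y\<close> of degree \<open>e\<close> has been adjoined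
  to kill the class of \<open>c\<close>. By \<open>rel1\<close> the element \<open>y\<close> is
  integral over the first chart, by \<open>rel2\<close> the element \<open>y - c\<close> is integral
  over the second, and \<open>free\<close> says that the powers of \<open>y\<close> below
  \<open>q\<close> are independent over \<open>R\<close>. The latter is phrased through the top
  coefficient because the arguments below go by induction on the degree in \<open>y\<close>.\<close>

locale adjoined_root =
  ring_hom_cring R S h + C: chart_cover R K p H D1 D2 f1 f2 i1 i2 d1 d2
  for R (structure) and S (structure) and h and K p H D1 D2 f1 f2 i1 i2 d1 d2 +
  fixes y :: 'c and q :: nat and e :: int and c :: 'a
  assumes q: "q > 0" and e: "e \<ge> 0" and y [simp]: "y \<in> carrier S" and c: "c \<in> H e"
    and rel1: "y [^]\<^bsub>S\<^esub> q \<in> pol D1 y e q (int q * e)"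
    and rel2: "(y \<ominus>\<^bsub>S\<^esub> h c) [^]\<^bsub>S\<^esub> q \<in> pol D2 (y \<ominus>\<^bsub>S\<^esub> h c) e q (int q * e)"
    and free: "s < q \<Longrightarrow> t \<in> carrier R \<Longrightarrow> x \<in> pol (\<lambda>_. carrier R) y e s 0 \<Longrightarrow>
      h t \<otimes>\<^bsub>S\<^esub> y [^]\<^bsub>S\<^esub> s \<oplus>\<^bsub>S\<^esub> x = \<zero>\<^bsub>S\<^esub> \<Longrightarrow> t = \<zero>"
begin

definition y' where "y' = y \<ominus>\<^bsub>S\<^esub> h c"

lemma c_carrier [simp]: "c \<in> carrier R"
  using R.graded_familyD(5)[OF C.H c] .

lemma y' [simp]: "y' \<in> carrier S"
  unfolding y'_def by simp

abbreviation "carr \<equiv> \<lambda>_ :: int. carrier R"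

lemma pol_carr: "R.graded_family E \<Longrightarrow> x \<in> pol E y e s n \<Longrightarrow> x \<in> pol carr y e s m"
  using pol_mono_family[of E carr y e s n] R.graded_familyD(5)[of E] pol_carrier_degree[of y e s n m]
  by blast

lemma lead_unique:
  assumes "s < q" "t \<in> carrier R" "t' \<in> carrier R" "x \<in> pol carr y e s 0" "x' \<in> pol carr y e s 0"
    and eq: "h t \<otimes>\<^bsub>S\<^esub> y [^]\<^bsub>S\<^esub> s \<oplus>\<^bsub>S\<^esub> x = h t' \<otimes>\<^bsub>S\<^esub> y [^]\<^bsub>S\<^esub> s \<oplus>\<^bsub>S\<^esub> x'"
  shows "t = t'" "x = x'"
proof -
  note carrE = R.graded_family_carrier
  note [simp] = assms(2,3) pol_closed[OF carrE y assms(4)] pol_closed[OF carrE y assms(5)]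
  have "x \<ominus>\<^bsub>S\<^esub> x' \<in> pol carr y e s 0"
    unfolding S.minus_eq using assms by (intro pol_add[OF carrE y] pol_neg[OF carrE y])
  moreover have "h (t \<ominus> t') \<otimes>\<^bsub>S\<^esub> y [^]\<^bsub>S\<^esub> s \<oplus>\<^bsub>S\<^esub> (x \<ominus>\<^bsub>S\<^esub> x') = \<zero>\<^bsub>S\<^esub>"
  proof -
    have cl: "h t \<in> carrier S" "h t' \<in> carrier S" "y [^]\<^bsub>S\<^esub> s \<in> carrier S" "x \<in> carrier S" "x' \<in> carrier S"
      by simp_all
    have "h (t \<ominus> t') \<otimes>\<^bsub>S\<^esub> y [^]\<^bsub>S\<^esub> s \<oplus>\<^bsub>S\<^esub> (x \<ominus>\<^bsub>S\<^esub> x')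
        = (h t \<ominus>\<^bsub>S\<^esub> h t') \<otimes>\<^bsub>S\<^esub> y [^]\<^bsub>S\<^esub> s \<oplus>\<^bsub>S\<^esub> (x \<ominus>\<^bsub>S\<^esub> x')" by (simp add: R.minus_eq S.minus_eq)
    also have "\<dots> = (h t \<otimes>\<^bsub>S\<^esub> y [^]\<^bsub>S\<^esub> s \<oplus>\<^bsub>S\<^esub> x) \<ominus>\<^bsub>S\<^esub> (h t' \<otimes>\<^bsub>S\<^esub> y [^]\<^bsub>S\<^esub> s \<oplus>\<^bsub>S\<^esub> x')"
      using cl by algebra
    also have "\<dots> = \<zero>\<^bsub>S\<^esub>" unfolding eq by (simp add: S.minus_eq S.r_neg)
    finally show ?thesis .
  qed
  ultimately have "t \<ominus> t' = \<zero>" using free[OF assms(1)] by simp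
  then show tt: "t = t'" by (simp add: R.r_right_minus_eq)
  show "x = x'" using eq unfolding tt by simp
qed

lemma D1_closed: "t \<in> D1 n \<Longrightarrow> t \<in> carrier R" and D2_closed: "t \<in> D2 n \<Longrightarrow> t \<in> carrier R"
  and H_closed: "t \<in> H n \<Longrightarrow> t \<in> carrier R"
  using R.graded_familyD(5) C.D1 C.D2 C.H by blast+

lemma translate_D2: "pol D2 y' e s n \<subseteq> pol H y e s n"
  unfolding y'_def by (rule translate_pol[OF C.H y c C.D2_H])

text \<open>Passing from \<open>y\<close> to \<open>y - c\<close> does not change the top
  coefficient, so the one read off on the first chart equals the one read off on the second and lies
  in both.\<close>

lemma lead_in_both:
  assumes s: "s < q" and x: "x \<in> pol D1 y e (Suc s) n" "x \<in> pol D2 y' e (Suc s) n"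
  obtains t x1 x2 where "t \<in> D1 (n - int s * e)" "t \<in> D2 (n - int s * e)"
    "x1 \<in> pol D1 y e s n" "x = h t \<otimes>\<^bsub>S\<^esub> y [^]\<^bsub>S\<^esub> s \<oplus>\<^bsub>S\<^esub> x1"
    "x2 \<in> pol D2 y' e s n" "x = h t \<otimes>\<^bsub>S\<^esub> y' [^]\<^bsub>S\<^esub> s \<oplus>\<^bsub>S\<^esub> x2"
proof -
  obtain t x1 where t: "t \<in> D1 (n - int s * e)" "x1 \<in> pol D1 y e s n"
    "x = h t \<otimes>\<^bsub>S\<^esub> y [^]\<^bsub>S\<^esub> s \<oplus>\<^bsub>S\<^esub> x1" using x(1) by (rule pol_SucE)
  obtain u x2 where u: "u \<in> D2 (n - int s * e)" "x2 \<in> pol D2 y' e s n"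
    "x = h u \<otimes>\<^bsub>S\<^esub> y' [^]\<^bsub>S\<^esub> s \<oplus>\<^bsub>S\<^esub> x2" using x(2) by (rule pol_SucE)
  obtain w where w: "w \<in> pol H y e s (int s * e)" "y' [^]\<^bsub>S\<^esub> s = y [^]\<^bsub>S\<^esub> s \<oplus>\<^bsub>S\<^esub> w"
    using translate_pow[OF C.H y c] unfolding y'_def by blast
  have uH: "u \<in> H (n - int s * e)" using u(1) C.D2_H by blast
  have x2H: "x2 \<in> pol H y e s n" using u(2) translate_D2 by blast
  note [simp] = D1_closed[OF t(1)] D2_closed[OF u(1)] pol_closed[OF C.H y w(1)] pol_closed[OF C.H y x2H]
  have "h u \<otimes>\<^bsub>S\<^esub> w \<in> pol H y e s n" using pol_smult[OF C.H y uH w(1)] by simp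
  then have "h u \<otimes>\<^bsub>S\<^esub> w \<oplus>\<^bsub>S\<^esub> x2 \<in> pol H y e s n" by (rule pol_add[OF C.H y _ x2H])
  moreover have "x = h u \<otimes>\<^bsub>S\<^esub> y [^]\<^bsub>S\<^esub> s \<oplus>\<^bsub>S\<^esub> (h u \<otimes>\<^bsub>S\<^esub> w \<oplus>\<^bsub>S\<^esub> x2)"
    unfolding u(3) w(2) by (simp add: S.r_distr S.a_assoc)
  ultimately have "t = u"
    using lead_unique(1)[OF s, of t u x1 "h u \<otimes>\<^bsub>S\<^esub> w \<oplus>\<^bsub>S\<^esub> x2"] t(3) pol_carr[OF C.H] pol_carr[OF C.D1 t(2)]
    by simp
  then show thesis using that[of t x1 x2] t u by blast
qed

text \<open>Meaningful for \<open>s < q\<close>, by \<open>lead_unique\<close>, on expressions of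
  degree at most \<open>s\<close> in \<open>y\<close>.\<close>

definition lead :: "nat \<Rightarrow> 'c \<Rightarrow> 'a" where
  "lead s x = (THE t. t \<in> carrier R \<and> (\<exists>x'\<in>pol carr y e s 0. x = h t \<otimes>\<^bsub>S\<^esub> y [^]\<^bsub>S\<^esub> s \<oplus>\<^bsub>S\<^esub> x'))"

lemma lead_eq:
  assumes "s < q" "t \<in> carrier R" "x' \<in> pol carr y e s 0" "x = h t \<otimes>\<^bsub>S\<^esub> y [^]\<^bsub>S\<^esub> s \<oplus>\<^bsub>S\<^esub> x'"
  shows "lead s x = t"
  unfolding lead_def using assms lead_unique(1)[OF assms(1)] by (intro the_equality) blast+

abbreviation "K' \<equiv> h ` K"

lemma S_one_neq_zero: "\<one>\<^bsub>S\<^esub> \<noteq> \<zero>\<^bsub>S\<^esub>"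
proof
  assume "\<one>\<^bsub>S\<^esub> = \<zero>\<^bsub>S\<^esub>"
  then have "h \<one> \<otimes>\<^bsub>S\<^esub> y [^]\<^bsub>S\<^esub> (0::nat) \<oplus>\<^bsub>S\<^esub> \<zero>\<^bsub>S\<^esub> = \<zero>\<^bsub>S\<^esub>" by simp
  then have "\<one> = \<zero>" using free[of 0 \<one> "\<zero>\<^bsub>S\<^esub>"] q by simp
  then show False using C.one_neq_zero by simp
qed

lemma hom_ring: "ring_hom_ring R S h"
  by (rule ring_hom_ringI2[OF R.ring_axioms S.ring_axioms homh])

lemma K'_subfield: "subfield K' S"
  by (rule ring_hom_ring.img_is_subfield(2)[OF hom_ring C.K S_one_neq_zero])

text \<open>A filtration of the new global sections of degree \<open>n\<close> by the degree in the
  adjoined root. Through \<open>lead\<close>, its successive quotients embed into the old global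
  sections of degree \<open>n - s e\<close>.\<close>

definition sections :: "nat \<Rightarrow> int \<Rightarrow> 'c set" where
  "sections s n = pol D1 y e s n \<inter> pol D2 y' e s n"

lemma sections_subalgebra: "subalgebra K' (sections s n) S"
proof (intro subalgebra.intro subalgebra_axioms.intro)
  have "additive_subgroup (sections s n) S"
    unfolding sections_def
    by (rule S.additive_subgroupI')
      (auto intro: pol_closed[OF C.D1 y] pol_zero[OF C.D1 y] pol_zero[OF C.D2 y'] pol_neg[OF C.D1 y]
        pol_neg[OF C.D2 y'] pol_add[OF C.D1 y] pol_add[OF C.D2 y'])
  then show "subgroup (sections s n) (add_monoid S)" by (rule additive_subgroup.a_subgroup)
  fix k v assume "k \<in> K'" "v \<in> sections s n"
  then obtain k0 where "k0 \<in> D1 0" "k0 \<in> D2 0" "k = h k0" "v \<in> pol D1 y e s n" "v \<in> pol D2 y' e s n"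
    using C.K_D1 C.K_D2 unfolding sections_def by blast
  then show "k \<otimes>\<^bsub>S\<^esub> v \<in> sections s n"
    unfolding sections_def using pol_smult[OF C.D1 y, of k0 0 v] pol_smult[OF C.D2 y', of k0 0 v] by simp
qed

text \<open>The top coefficient is the same on both charts, so when it vanishes the degree drops on
  both. This describes the kernel of \<open>lead\<close>.\<close>

lemma sections_Suc_lead_zero:
  assumes "s < q" "x \<in> sections (Suc s) n" "lead s x = \<zero>"
  shows "x \<in> sections s n"
proof -
  obtain t x1 x2 where t: "t \<in> D1 (n - int s * e)" "t \<in> D2 (n - int s * e)"
    "x1 \<in> pol D1 y e s n" "x = h t \<otimes>\<^bsub>S\<^esub> y [^]\<^bsub>S\<^esub> s \<oplus>\<^bsub>S\<^esub> x1"
    "x2 \<in> pol D2 y' e s n" "x = h t \<otimes>\<^bsub>S\<^esub> y' [^]\<^bsub>S\<^esub> s \<oplus>\<^bsub>S\<^esub> x2"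
    using assms(2) lead_in_both[OF assms(1), of x n] unfolding sections_def by blast
  have "t = \<zero>" using lead_eq[OF assms(1) D1_closed[OF t(1)] pol_carr[OF C.D1 t(3)] t(4)] assms(3) by simp
  then have "x = x1" "x = x2"
    using t(4,6) pol_closed[OF C.D1 y t(3)] pol_closed[OF C.D2 y' t(5)] by simp_all
  then show ?thesis using t(3,5) unfolding sections_def by simp
qed

lemma lead_sections:
  assumes "s < q" "x \<in> sections (Suc s) n"
  shows "lead s x \<in> D1 (n - int s * e) \<inter> D2 (n - int s * e)"
    "\<exists>x'\<in>pol carr y e s 0. x = h (lead s x) \<otimes>\<^bsub>S\<^esub> y [^]\<^bsub>S\<^esub> s \<oplus>\<^bsub>S\<^esub> x'"
proof -
  obtain t x1 x2 where t: "t \<in> D1 (n - int s * e)" "t \<in> D2 (n - int s * e)"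
    "x1 \<in> pol D1 y e s n" "x = h t \<otimes>\<^bsub>S\<^esub> y [^]\<^bsub>S\<^esub> s \<oplus>\<^bsub>S\<^esub> x1"
    using assms(2) lead_in_both[OF assms(1), of x n] unfolding sections_def by blast
  note x1 = pol_carr[OF C.D1 t(3)]
  have "lead s x = t" by (rule lead_eq[OF assms(1) D1_closed[OF t(1)] x1 t(4)])
  then show "lead s x \<in> D1 (n - int s * e) \<inter> D2 (n - int s * e)"
    "\<exists>x'\<in>pol carr y e s 0. x = h (lead s x) \<otimes>\<^bsub>S\<^esub> y [^]\<^bsub>S\<^esub> s \<oplus>\<^bsub>S\<^esub> x'"
    using t x1 by blast+
qed

text \<open>As \<open>e \<ge> 0\<close>, the top coefficient of a section of negative degree is an
  old section of negative degree and vanishes; the degree in \<open>y\<close> then drops until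
  nothing is left.\<close>

lemma sections_negative: "s \<le> q \<Longrightarrow> n < 0 \<Longrightarrow> sections s n \<subseteq> {\<zero>\<^bsub>S\<^esub>}"
proof (induction s)
  case 0
  then show ?case by (simp add: sections_def)
next
  case (Suc s)
  have s: "s < q" using Suc.prems by simp
  have "n - int s * e < 0" using Suc.prems(2) e by (smt (verit) mult_nonneg_nonneg of_nat_0_le_iff)
  then have "lead s x = \<zero>" if "x \<in> sections (Suc s) n" for x
    using lead_sections(1)[OF s that] C.negative by blast
  then show ?case using sections_Suc_lead_zero[OF s] Suc by auto
qed

text \<open>\<open>lead\<close> takes values in a finite-dimensional space and its kernel lies in
  the previous step of the filtration, so \<open>span_from_kernel_image\<close> applies.\<close>

lemma sections_fin_dim: "s \<le> q \<Longrightarrow> \<exists>Us. set Us \<subseteq> carrier S \<and> sections s n \<subseteq> S.Span K' Us"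
proof (induction s)
  case 0
  then show ?case by (intro exI[of _ "[]"]) (simp add: sections_def)
next
  case (Suc s)
  then have s: "s < q" by simp
  obtain Us where Us: "set Us \<subseteq> carrier S" "sections s n \<subseteq> S.Span K' Us" using Suc by auto
  obtain Vs where Vs: "set Vs \<subseteq> carrier R"
    "D1 (n - int s * e) \<inter> D2 (n - int s * e) \<subseteq> R.Span K Vs" using C.sections_finite by blast
  note carrE = R.graded_family_carrier
  note sub = sections_subalgebra[of "Suc s" n]
  have lc: "lead s x \<in> carrier R" if "x \<in> sections (Suc s) n" for x
    using lead_sections(1)[OF s that] D1_closed by blast
  show ?case
  proof (rule span_from_kernel_image[OF R.ring_axioms S.ring_axioms C.K homh K'_subfield sub lc])
    fix x z assume xz: "x \<in> sections (Suc s) n" "z \<in> sections (Suc s) n"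
    obtain x' z' where x': "x' \<in> pol carr y e s 0" "x = h (lead s x) \<otimes>\<^bsub>S\<^esub> y [^]\<^bsub>S\<^esub> s \<oplus>\<^bsub>S\<^esub> x'"
      and z': "z' \<in> pol carr y e s 0" "z = h (lead s z) \<otimes>\<^bsub>S\<^esub> y [^]\<^bsub>S\<^esub> s \<oplus>\<^bsub>S\<^esub> z'"
      using lead_sections(2)[OF s] xz by meson
    note [simp] = lc[OF xz(1)] lc[OF xz(2)] pol_closed[OF carrE y x'(1)] pol_closed[OF carrE y z'(1)]
    have "x \<oplus>\<^bsub>S\<^esub> z = h (lead s x \<oplus> lead s z) \<otimes>\<^bsub>S\<^esub> y [^]\<^bsub>S\<^esub> s \<oplus>\<^bsub>S\<^esub> (x' \<oplus>\<^bsub>S\<^esub> z')"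
      by (subst x'(2), subst z'(2)) (simp add: S.l_distr S.a_ac)
    then show "lead s (x \<oplus>\<^bsub>S\<^esub> z) = lead s x \<oplus> lead s z"
      by (intro lead_eq[OF s _ pol_add[OF carrE y x'(1) z'(1)]]) simp_all
  next
    fix k x assume k: "k \<in> K" and x: "x \<in> sections (Suc s) n"
    obtain x' where x': "x' \<in> pol carr y e s 0" "x = h (lead s x) \<otimes>\<^bsub>S\<^esub> y [^]\<^bsub>S\<^esub> s \<oplus>\<^bsub>S\<^esub> x'"
      using lead_sections(2)[OF s x] by blast
    have kc [simp]: "k \<in> carrier R" using k C.K_carrier by blast
    note [simp] = lc[OF x] pol_closed[OF carrE y x'(1)]
    have "h k \<otimes>\<^bsub>S\<^esub> x = h (k \<otimes> lead s x) \<otimes>\<^bsub>S\<^esub> y [^]\<^bsub>S\<^esub> s \<oplus>\<^bsub>S\<^esub> h k \<otimes>\<^bsub>S\<^esub> x'"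
      by (subst x'(2)) (simp add: S.r_distr S.m_assoc)
    then show "lead s (h k \<otimes>\<^bsub>S\<^esub> x) = k \<otimes> lead s x"
      using pol_smult[OF carrE y kc x'(1)] by (intro lead_eq[OF s]) simp_all
  next
    show "set Vs \<subseteq> carrier R" "set Us \<subseteq> carrier S" by fact+
    show "lead s ` sections (Suc s) n \<subseteq> R.Span K Vs" using lead_sections(1)[OF s] Vs(2) by blast
    show "{x \<in> sections (Suc s) n. lead s x = \<zero>} \<subseteq> S.Span K' Us"
      using sections_Suc_lead_zero[OF s] Us(2) by blast
  qed
qed

end

context ring_hom_cring
begin

lemma hom_add_pow_one: "h (add_pow R (k :: nat) \<one>) = add_pow S k \<one>\<^bsub>S\<^esub>"
proof (induction k)
  case (Suc k)
  have "add_pow R k \<one> \<in> carrier R" by simp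
  with Suc show ?case by simp
qed simp

end

section \<open>The extended families form a cover again\<close>

context adjoined_root
begin

abbreviation "H' \<equiv> pol H y e q"
abbreviation "D1' \<equiv> pol D1 y e q"
abbreviation "D2' \<equiv> pol D2 y' e q"

lemma D1'_H': "D1' n \<subseteq> H' n"
  by (rule pol_mono_family) (rule C.D1_H)

lemma D2'_H': "D2' n \<subseteq> H' n"
  by (rule translate_D2)

lemma H': "S.graded_family H'"
  using pol_graded_family[OF C.H y q] rel1 D1'_H' by blast

lemma D1': "S.graded_family D1'"
  by (rule pol_graded_family[OF C.D1 y q rel1])

lemma D2': "S.graded_family D2'"
  by (rule pol_graded_family[OF C.D2 y' q]) (use rel2 in \<open>simp add: y'_def\<close>)

text \<open>By \<open>free\<close>, the top coefficients of a vanishing sum add up to zero; having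
  distinct degrees \<open>n - s e\<close>, they vanish one by one, and the degree in
  \<open>y\<close> drops.\<close>

lemma indep_pol:
  assumes "s \<le> q" "finite F" "\<And>n. n \<in> F \<Longrightarrow> x n \<in> pol H y e s n" "(\<Oplus>\<^bsub>S\<^esub>n\<in>F. x n) = \<zero>\<^bsub>S\<^esub>" "n \<in> F"
  shows "x n = \<zero>\<^bsub>S\<^esub>"
  using assms
proof (induction s arbitrary: x n)
  case 0
  then show ?case by simp
next
  case (Suc s)
  then have s: "s < q" by simp
  have "\<forall>n\<in>F. \<exists>t x'. t \<in> H (n - int s * e) \<and> x' \<in> pol H y e s n \<and> x n = h t \<otimes>\<^bsub>S\<^esub> y [^]\<^bsub>S\<^esub> s \<oplus>\<^bsub>S\<^esub> x'"
    using Suc.prems(3) by (blast elim: pol_SucE)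
  then obtain t x' where t: "\<And>n. n \<in> F \<Longrightarrow> t n \<in> H (n - int s * e)"
    and x': "\<And>n. n \<in> F \<Longrightarrow> x' n \<in> pol H y e s n"
    and eq: "\<And>n. n \<in> F \<Longrightarrow> x n = h (t n) \<otimes>\<^bsub>S\<^esub> y [^]\<^bsub>S\<^esub> s \<oplus>\<^bsub>S\<^esub> x' n" by metis
  note carrE = R.graded_family_carrier
  have tc: "t n \<in> carrier R" if "n \<in> F" for n using t[OF that] by (rule H_closed)
  have x'c: "x' n \<in> carrier S" if "n \<in> F" for n using x'[OF that] by (rule pol_closed[OF C.H y])
  have "(\<Oplus>\<^bsub>S\<^esub>n\<in>F. x n) = (\<Oplus>\<^bsub>S\<^esub>n\<in>F. h (t n) \<otimes>\<^bsub>S\<^esub> y [^]\<^bsub>S\<^esub> s \<oplus>\<^bsub>S\<^esub> x' n)"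
    using tc x'c eq by (intro S.finsum_cong') auto
  also have "\<dots> = (\<Oplus>\<^bsub>S\<^esub>n\<in>F. h (t n) \<otimes>\<^bsub>S\<^esub> y [^]\<^bsub>S\<^esub> s) \<oplus>\<^bsub>S\<^esub> (\<Oplus>\<^bsub>S\<^esub>n\<in>F. x' n)"
    using tc x'c by (intro S.finsum_addf) auto
  also have "(\<Oplus>\<^bsub>S\<^esub>n\<in>F. h (t n) \<otimes>\<^bsub>S\<^esub> y [^]\<^bsub>S\<^esub> s) = (\<Oplus>\<^bsub>S\<^esub>n\<in>F. h (t n)) \<otimes>\<^bsub>S\<^esub> y [^]\<^bsub>S\<^esub> s"
    using tc Suc.prems(2) by (intro S.finsum_ldistr[symmetric]) auto
  also have "(\<Oplus>\<^bsub>S\<^esub>n\<in>F. h (t n)) = h (\<Oplus>n\<in>F. t n)"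
    using tc by (subst hom_finsum) (auto simp: comp_def)
  finally have sum0: "h (\<Oplus>n\<in>F. t n) \<otimes>\<^bsub>S\<^esub> y [^]\<^bsub>S\<^esub> s \<oplus>\<^bsub>S\<^esub> (\<Oplus>\<^bsub>S\<^esub>n\<in>F. x' n) = \<zero>\<^bsub>S\<^esub>"
    using Suc.prems(4) by simp
  have "(\<Oplus>\<^bsub>S\<^esub>n\<in>F. x' n) \<in> pol carr y e s 0"
    using x' by (intro S.additive_subgroup_finsum[OF pol_subgroup[OF carrE y] Suc.prems(2)] pol_carr[OF C.H])
  then have t0: "(\<Oplus>n\<in>F. t n) = \<zero>" using free[OF s _ _ sum0] tc by auto
  \<comment> \<open>\<open>C.indep\<close> expects a family indexed by its own degree, hence the
    shift.\<close>
  have "(\<Oplus>m\<in>(\<lambda>n. n - int s * e) ` F. t (m + int s * e)) = (\<Oplus>n\<in>F. t (n - int s * e + int s * e))"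
    using tc by (intro R.finsum_reindex) (auto simp: inj_on_def)
  then have "(\<Oplus>m\<in>(\<lambda>n. n - int s * e) ` F. t (m + int s * e)) = \<zero>" using t0 by simp
  then have "t (n - int s * e + int s * e) = \<zero>" if "n \<in> F" for n
    using Suc.prems(2) t that
    by (intro C.indep[of "(\<lambda>n. n - int s * e) ` F" "\<lambda>m. t (m + int s * e)" "n - int s * e"]) auto
  then have tz: "t n = \<zero>" if "n \<in> F" for n using that by simp
  then have "(\<Oplus>\<^bsub>S\<^esub>n\<in>F. x' n) = \<zero>\<^bsub>S\<^esub>"
    using sum0 t0 x'c by (simp add: S.finsum_closed Pi_iff)
  then have "x' n = \<zero>\<^bsub>S\<^esub>" using Suc.IH[of x' n] x' Suc.prems by simp
  then show ?case using eq[OF Suc.prems(5)] tz[OF Suc.prems(5)] by simp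
qed

text \<open>The top coefficient splits as \<open>u + v + w\<close> in the old cover. On the second
  chart \<open>v\<close> has to multiply a power of \<open>y'\<close> instead of \<open>y\<close>;
  the error has smaller degree in \<open>y\<close> and is absorbed into the rest before the
  induction hypothesis is used. So old spanning classes times powers of \<open>y\<close> span the
  new cohomology.\<close>

lemma cech_pol:
  assumes "s \<le> q" and Us: "\<And>i. R.cech_spanned K (H (n - int i * e)) (D1 (n - int i * e)) (D2 (n - int i * e)) (Us i)"
  shows "set (concat (map (\<lambda>i. map (\<lambda>u. h u \<otimes>\<^bsub>S\<^esub> y [^]\<^bsub>S\<^esub> i) (Us i)) [0..<s])) \<subseteq> H' n \<and>
    (\<forall>t\<in>pol H y e s n. \<exists>u\<in>D1' n. \<exists>v\<in>D2' n.
      \<exists>w\<in>S.Span K' (concat (map (\<lambda>i. map (\<lambda>u. h u \<otimes>\<^bsub>S\<^esub> y [^]\<^bsub>S\<^esub> i) (Us i)) [0..<s])). t = u \<oplus>\<^bsub>S\<^esub> v \<oplus>\<^bsub>S\<^esub> w)"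
  using assms(1)
proof (induction s)
  case 0
  then show ?case
    using S.graded_familyD(4)[OF D1'] S.graded_familyD(4)[OF D2'] by (auto intro!: bexI[of _ "\<zero>\<^bsub>S\<^esub>"])
next
  case (Suc s)
  then have s: "s < q" by simp
  let ?m = "n - int s * e"
  let ?L = "\<lambda>s. concat (map (\<lambda>i. map (\<lambda>u. h u \<otimes>\<^bsub>S\<^esub> y [^]\<^bsub>S\<^esub> i) (Us i)) [0..<s])"
  let ?N = "map (\<lambda>u. h u \<otimes>\<^bsub>S\<^esub> y [^]\<^bsub>S\<^esub> s) (Us s)"
  have L: "?L (Suc s) = ?L s @ ?N" by simp
  have UsH: "set (Us s) \<subseteq> H ?m" and sp: "\<And>t. t \<in> H ?m \<Longrightarrow> \<exists>u\<in>D1 ?m. \<exists>v\<in>D2 ?m. \<exists>w\<in>R.Span K (Us s). t = u \<oplus> v \<oplus> w"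
    using Us[of s] unfolding R.cech_spanned_def by blast+
  have IH: "set (?L s) \<subseteq> H' n" and IHs: "\<And>t. t \<in> pol H y e s n \<Longrightarrow>
    \<exists>u\<in>D1' n. \<exists>v\<in>D2' n. \<exists>w\<in>S.Span K' (?L s). t = u \<oplus>\<^bsub>S\<^esub> v \<oplus>\<^bsub>S\<^esub> w"
    using Suc by auto
  have N: "set ?N \<subseteq> H' n" using UsH pol_monom[OF C.H y _ s, of _ ?m n] by auto
  have H'c: "H' n \<subseteq> carrier S" using S.graded_familyD(5)[OF H'] by blast
  have Lc: "set (?L s) \<subseteq> carrier S" and Nc: "set ?N \<subseteq> carrier S" using IH N H'c by blast+
  have "\<exists>u\<in>D1' n. \<exists>v\<in>D2' n. \<exists>w\<in>S.Span K' (?L (Suc s)). t = u \<oplus>\<^bsub>S\<^esub> v \<oplus>\<^bsub>S\<^esub> w"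
    if tmem: "t \<in> pol H y e (Suc s) n" for t
  proof -
    obtain a x' where a: "a \<in> H ?m" "x' \<in> pol H y e s n" "t = h a \<otimes>\<^bsub>S\<^esub> y [^]\<^bsub>S\<^esub> s \<oplus>\<^bsub>S\<^esub> x'"
      using tmem by (rule pol_SucE)
    obtain u v w where uvw: "u \<in> D1 ?m" "v \<in> D2 ?m" "w \<in> R.Span K (Us s)" "a = u \<oplus> v \<oplus> w"
      using sp[OF a(1)] by blast
    obtain z where z: "z \<in> pol H y e s (int s * e)" "y' [^]\<^bsub>S\<^esub> s = y [^]\<^bsub>S\<^esub> s \<oplus>\<^bsub>S\<^esub> z"
      using translate_pow[OF C.H y c] unfolding y'_def by blast
    have vH: "v \<in> H ?m" using uvw(2) C.D2_H by blast
    have "h v \<otimes>\<^bsub>S\<^esub> z \<in> pol H y e s n" using pol_smult[OF C.H y vH z(1)] by simp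
    then have "x' \<ominus>\<^bsub>S\<^esub> h v \<otimes>\<^bsub>S\<^esub> z \<in> pol H y e s n"
      unfolding S.minus_eq using a(2) by (intro pol_add[OF C.H y] pol_neg[OF C.H y])
    from IHs[OF this] obtain u' v' w' where uvw': "u' \<in> D1' n" "v' \<in> D2' n" "w' \<in> S.Span K' (?L s)"
      "x' \<ominus>\<^bsub>S\<^esub> h v \<otimes>\<^bsub>S\<^esub> z = u' \<oplus>\<^bsub>S\<^esub> v' \<oplus>\<^bsub>S\<^esub> w'" by blast
    have Usc: "set (Us s) \<subseteq> carrier R" using UsH H_closed by blast
    have wc: "w \<in> carrier R" using uvw(3) R.Span_in_carrier[OF C.K_carrier Usc] by blast
    have w'c: "w' \<in> carrier S" using uvw'(3) S.Span_in_carrier[OF _ Lc, of K'] C.K_carrier by auto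
    have cl: "h u \<in> carrier S" "h v \<in> carrier S" "h w \<in> carrier S" "y [^]\<^bsub>S\<^esub> s \<in> carrier S"
      "x' \<in> carrier S" "z \<in> carrier S" "u' \<in> carrier S" "v' \<in> carrier S" "w' \<in> carrier S"
      using D1_closed[OF uvw(1)] D2_closed[OF uvw(2)] wc w'c pol_closed[OF C.H y a(2)] pol_closed[OF C.H y z(1)]
        S.graded_familyD(5)[OF D1' uvw'(1)] S.graded_familyD(5)[OF D2' uvw'(2)] by simp_all
    have "t = (h u \<oplus>\<^bsub>S\<^esub> h v \<oplus>\<^bsub>S\<^esub> h w) \<otimes>\<^bsub>S\<^esub> y [^]\<^bsub>S\<^esub> s \<oplus>\<^bsub>S\<^esub> x'"
      unfolding a(3) uvw(4) using D1_closed[OF uvw(1)] D2_closed[OF uvw(2)] wc by simp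
    also have "\<dots> = h u \<otimes>\<^bsub>S\<^esub> y [^]\<^bsub>S\<^esub> s \<oplus>\<^bsub>S\<^esub> h v \<otimes>\<^bsub>S\<^esub> (y [^]\<^bsub>S\<^esub> s \<oplus>\<^bsub>S\<^esub> z)
        \<oplus>\<^bsub>S\<^esub> h w \<otimes>\<^bsub>S\<^esub> y [^]\<^bsub>S\<^esub> s \<oplus>\<^bsub>S\<^esub> (x' \<ominus>\<^bsub>S\<^esub> h v \<otimes>\<^bsub>S\<^esub> z)"
      using cl(1-6) by algebra
    also have "\<dots> = (h u \<otimes>\<^bsub>S\<^esub> y [^]\<^bsub>S\<^esub> s \<oplus>\<^bsub>S\<^esub> u') \<oplus>\<^bsub>S\<^esub> (h v \<otimes>\<^bsub>S\<^esub> y' [^]\<^bsub>S\<^esub> s \<oplus>\<^bsub>S\<^esub> v')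
        \<oplus>\<^bsub>S\<^esub> (w' \<oplus>\<^bsub>S\<^esub> h w \<otimes>\<^bsub>S\<^esub> y [^]\<^bsub>S\<^esub> s)"
      unfolding uvw'(4) z(2) using cl by algebra
    finally have "t = (h u \<otimes>\<^bsub>S\<^esub> y [^]\<^bsub>S\<^esub> s \<oplus>\<^bsub>S\<^esub> u') \<oplus>\<^bsub>S\<^esub> (h v \<otimes>\<^bsub>S\<^esub> y' [^]\<^bsub>S\<^esub> s \<oplus>\<^bsub>S\<^esub> v')
        \<oplus>\<^bsub>S\<^esub> (w' \<oplus>\<^bsub>S\<^esub> h w \<otimes>\<^bsub>S\<^esub> y [^]\<^bsub>S\<^esub> s)" .
    moreover have "h u \<otimes>\<^bsub>S\<^esub> y [^]\<^bsub>S\<^esub> s \<oplus>\<^bsub>S\<^esub> u' \<in> D1' n"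
      using pol_monom[OF C.D1 y uvw(1) s, where n = n and e = e] uvw'(1) by (intro pol_add[OF C.D1 y]) simp_all
    moreover have "h v \<otimes>\<^bsub>S\<^esub> y' [^]\<^bsub>S\<^esub> s \<oplus>\<^bsub>S\<^esub> v' \<in> D2' n"
      using pol_monom[OF C.D2 y' uvw(2) s, where n = n and e = e] uvw'(2) by (intro pol_add[OF C.D2 y']) simp_all
    moreover have "w' \<oplus>\<^bsub>S\<^esub> h w \<otimes>\<^bsub>S\<^esub> y [^]\<^bsub>S\<^esub> s \<in> S.Span K' (?L (Suc s))"
    proof -
      have "h w \<otimes>\<^bsub>S\<^esub> y [^]\<^bsub>S\<^esub> s \<in> S.Span K' ?N"
        by (rule R.Span_mult_right[OF S.is_cring homh cl(4) Usc C.K_carrier uvw(3)])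
      then show ?thesis
        using S.Span_append_eq_set_add[OF K'_subfield Lc Nc] uvw'(3) unfolding L set_add_def' by blast
    qed
    ultimately show ?thesis by blast
  qed
  moreover have "set (?L (Suc s)) \<subseteq> H' n" unfolding L using IH N by simp
  ultimately show ?case by blast
qed

lemma cech_spanned_pol:
  assumes "\<And>i. R.cech_spanned K (H (n - int i * e)) (D1 (n - int i * e)) (D2 (n - int i * e)) (Us i)"
  shows "S.cech_spanned K' (H' n) (D1' n) (D2' n)
    (concat (map (\<lambda>i. map (\<lambda>u. h u \<otimes>\<^bsub>S\<^esub> y [^]\<^bsub>S\<^esub> i) (Us i)) [0..<q]))"
  using cech_pol[of q n Us] assms unfolding S.cech_spanned_def by simp

text \<open>Makes the construction repeatable: ring, charts and base field change, while the prime
  \<open>p\<close> and the degrees \<open>d1\<close>, \<open>d2\<close> stay.\<close>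

lemma extended_cover:
  "chart_cover S K' p H' D1' D2' (h f1) (h f2) (h i1) (h i2) d1 d2"
proof (intro chart_cover.intro chart_cover_axioms.intro)
  show "cring S" by (rule S.is_cring)
  show "subfield K' S" by (rule K'_subfield)
  show "Factorial_Ring.prime p" by (rule C.p)
  show "add_pow S p \<one>\<^bsub>S\<^esub> = \<zero>\<^bsub>S\<^esub>" using hom_add_pow_one[of p] C.p by simp
  show "S.graded_family H'" "S.graded_family D1'" "S.graded_family D2'" by (rule H' D1' D2')+
  show "D1' n \<subseteq> H' n" "D2' n \<subseteq> H' n" for n by (rule D1'_H' D2'_H')+
  show "K' \<subseteq> D1' 0" using C.K_D1 hom_image_pol[OF C.D1 y q rel1] by blast
  have rel2': "y' [^]\<^bsub>S\<^esub> q \<in> D2' (int q * e)" using rel2 by (simp add: y'_def)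
  show "K' \<subseteq> D2' 0" using C.K_D2 hom_image_pol[OF C.D2 y' q rel2'] by blast
  show "x n = \<zero>\<^bsub>S\<^esub>" if "finite F" "\<And>n. n \<in> F \<Longrightarrow> x n \<in> H' n" "(\<Oplus>\<^bsub>S\<^esub>n\<in>F. x n) = \<zero>\<^bsub>S\<^esub>" "n \<in> F" for F x n
    by (rule indep_pol[OF order.refl that])
  show "h f1 \<in> D1' (int d1)" "h f2 \<in> D1' (int d2)" "h i1 \<in> D1' (- int d1)"
    using hom_image_pol[OF C.D1 y q rel1] C.f1 C.f2 C.i1 by blast+
  show "h f1 \<in> D2' (int d1)" "h f2 \<in> D2' (int d2)" "h i2 \<in> D2' (- int d2)"
    using hom_image_pol[OF C.D2 y' q rel2'] C.f1 C.f2 C.i2 by blast+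
  show "0 < d1" "0 < d2" by (rule C.d_pos)+
  have "f1 \<in> carrier R" "i1 \<in> carrier R" "f2 \<in> carrier R" "i2 \<in> carrier R"
    using C.f1 C.i1 C.f2 C.i2 D1_closed D2_closed by blast+
  then show "h f1 \<otimes>\<^bsub>S\<^esub> h i1 = \<one>\<^bsub>S\<^esub>" "h f2 \<otimes>\<^bsub>S\<^esub> h i2 = \<one>\<^bsub>S\<^esub>"
    using C.i1(2) C.i2(2) by (metis hom_mult hom_one)+
  show "D1' n \<inter> D2' n \<subseteq> {\<zero>\<^bsub>S\<^esub>}" if "n < 0" for n
    using sections_negative[OF order.refl that] unfolding sections_def .
  show "\<exists>Us. set Us \<subseteq> carrier S \<and> D1' n \<inter> D2' n \<subseteq> S.Span K' Us" for n
    using sections_fin_dim[OF order.refl] unfolding sections_def .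
  show "\<exists>Us. S.cech_spanned K' (H' n) (D1' n) (D2' n) Us" for n
  proof -
    have "\<forall>i. \<exists>Us. R.cech_spanned K (H (n - int i * e)) (D1 (n - int i * e)) (D2 (n - int i * e)) Us"
      using C.cech_finite by blast
    then obtain Us where "\<And>i. R.cech_spanned K (H (n - int i * e)) (D1 (n - int i * e)) (D2 (n - int i * e)) (Us i)"
      by metis
    from cech_spanned_pol[OF this] show ?thesis by blast
  qed
  show "\<exists>n0. \<forall>n\<ge>n0. S.cech_spanned K' (H' n) (D1' n) (D2' n) []"
  proof -
    obtain n0 where n0: "\<And>n. n \<ge> n0 \<Longrightarrow> R.cech_spanned K (H n) (D1 n) (D2 n) []"
      using C.cech_vanish by blast
    \<comment> \<open>Beyond this bound every coefficient degree \<open>n - i e\<close> with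
      \<open>i < q\<close> is still at least \<open>n0\<close>, so no spanning classes are
      needed.\<close>
    have "S.cech_spanned K' (H' n) (D1' n) (D2' n) []" if n: "n \<ge> n0 + int q * e" for n
    proof -
      have "\<exists>Us. R.cech_spanned K (H (n - int i * e)) (D1 (n - int i * e)) (D2 (n - int i * e)) Us \<and>
          (i \<le> q \<longrightarrow> Us = [])" for i
      proof (cases "i \<le> q")
        case True
        then have "int i * e \<le> int q * e" using e by (intro mult_right_mono) auto
        then show ?thesis using n0[of "n - int i * e"] n by auto
      next
        case False
        then show ?thesis using C.cech_finite by auto
      qed
      then obtain Us where Us: "\<And>i. R.cech_spanned K (H (n - int i * e)) (D1 (n - int i * e)) (D2 (n - int i * e)) (Us i)"
        and Nil: "\<And>i. i \<le> q \<Longrightarrow> Us i = []" by metis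
      have "concat (map (\<lambda>i. map (\<lambda>u. h u \<otimes>\<^bsub>S\<^esub> y [^]\<^bsub>S\<^esub> i) (Us i)) [0..<q]) = []"
        using Nil by simp
      then show ?thesis using cech_spanned_pol[OF Us] by metis
    qed
    then show ?thesis by blast
  qed
qed

end

section \<open>Annihilating a cohomology class\<close>

context chart_cover
begin

text \<open>Frobenius acts on the finite-dimensional group \<open>H 0 / (D1 0 + D2 0)\<close> and raises degrees, so
  every class of degree \<open>\<ge> 0\<close> is killed by a monic additive polynomial over \<open>K\<close>.\<close>

lemma additive_relation:
  assumes c: "c \<in> H e" and e: "e \<ge> 0"
  obtains r a w1 w2 where "\<And>i. i < r \<Longrightarrow> a i \<in> K" "e \<noteq> 0 \<Longrightarrow> \<forall>i<r. a i = \<zero>"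
    "w1 \<in> D1 (int (p ^ r) * e)" "w2 \<in> D2 (int (p ^ r) * e)"
    "c [^] (p ^ r) = w1 \<oplus> w2 \<oplus> (\<Oplus>i\<in>{..<r}. a i \<otimes> c [^] (p ^ i))"
proof (cases "e = 0")
  case False
  obtain n0 where n0: "\<And>n. n \<ge> n0 \<Longrightarrow> cech_spanned K (H n) (D1 n) (D2 n) []"
    using cech_vanish by blast
  \<comment> \<open>Since \<open>p^r \<ge> r \<ge> n0\<close> and \<open>e \<ge> 1\<close>, the
    \<open>p^r\<close>-th power of \<open>c\<close> lies in a degree without cohomology. The
    coefficients of the lower Frobenius powers can then be zero.\<close>
  define r where "r = nat n0"
  have "2 \<le> p" by (rule prime_ge_2_nat[OF p(1)])
  then have "2 ^ r \<le> p ^ r" by (rule power_mono) simp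
  then have "r \<le> p ^ r" using less_exp[of r] by linarith
  then have "n0 \<le> int (p ^ r)" unfolding r_def by linarith
  moreover have "int (p ^ r) \<le> int (p ^ r) * e" using False e by (simp add: mult_le_cancel_left1)
  ultimately have sp: "cech_spanned K (H (int (p ^ r) * e)) (D1 (int (p ^ r) * e)) (D2 (int (p ^ r) * e)) []"
    by (intro n0) linarith
  have "c [^] (p ^ r) \<in> H (int (p ^ r) * e)" by (rule graded_family_pow[OF H c])
  then obtain w1 w2 where w: "w1 \<in> D1 (int (p ^ r) * e)" "w2 \<in> D2 (int (p ^ r) * e)" "c [^] (p ^ r) = w1 \<oplus> w2 \<oplus> \<zero>"
    using sp unfolding cech_spanned_def by auto
  have [simp]: "c \<in> carrier T" by (rule graded_familyD(5)[OF H c])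
  have "(\<Oplus>i\<in>{..<r}. \<zero> \<otimes> c [^] (p ^ i)) = (\<Oplus>i\<in>{..<r}. \<zero>)" by (intro finsum_cong') auto
  then have "c [^] (p ^ r) = w1 \<oplus> w2 \<oplus> (\<Oplus>i\<in>{..<r}. \<zero> \<otimes> c [^] (p ^ i))" using w(3) by simp
  moreover have "\<zero> \<in> K" by (rule subringE(2)[OF subfieldE(1)[OF K]])
  ultimately show thesis using that[of r "\<lambda>_. \<zero>" w1 w2] w by blast
next
  case True
  have [simp]: "c \<in> carrier T" by (rule graded_familyD(5)[OF H c])
  note subr = subringE[OF subfieldE(1)[OF K]]
  obtain Us where Us: "set Us \<subseteq> H 0" and
    sp: "\<And>t. t \<in> H 0 \<Longrightarrow> \<exists>u\<in>D1 0. \<exists>v\<in>D2 0. \<exists>s\<in>Span K Us. t = u \<oplus> v \<oplus> s"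
    using cech_finite[of 0] unfolding cech_spanned_def by blast
  have cp: "c [^] (p ^ i) \<in> H 0" for i
    using graded_family_pow[OF H c, of "p ^ i"] True by simp
  have "\<forall>i. \<exists>u v s. u \<in> D1 0 \<and> v \<in> D2 0 \<and> s \<in> Span K Us \<and> c [^] (p ^ i) = u \<oplus> v \<oplus> s"
    using sp[OF cp] by blast
  then obtain u v s where u: "\<And>i. u i \<in> D1 0" and v: "\<And>i. v i \<in> D2 0" and s: "\<And>i. s i \<in> Span K Us"
    and dec: "\<And>i. c [^] (p ^ i) = u i \<oplus> v i \<oplus> s i" by metis
  have Usc: "set Us \<subseteq> carrier T" using Us graded_familyD(5)[OF H] by blast
  have cl [simp]: "u i \<in> carrier T" "v i \<in> carrier T" "s i \<in> carrier T" for i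
    using graded_familyD(5)[OF D1 u] graded_familyD(5)[OF D2 v] s Span_in_carrier[OF K_carrier Usc] by auto
  \<comment> \<open>The remainders \<open>s i\<close> of the first \<open>length Us + 1\<close>
    Frobenius powers outnumber the spanning classes, hence are dependent over
    \<open>K\<close>.\<close>
  obtain k where k: "k \<in> {..length Us} \<rightarrow> K" "\<exists>i\<in>{..length Us}. k i \<noteq> \<zero>"
      "(\<Oplus>i\<in>{..length Us}. k i \<otimes> s i) = \<zero>"
    using dependent_if_card_gt[OF K _ Usc, of "{..length Us}" s] s by auto
  \<comment> \<open>Dividing by the last nonzero coefficient makes the relation monic of degree
    \<open>p^r\<close>.\<close>
  define r where "r = Max {i. i \<le> length Us \<and> k i \<noteq> \<zero>}"
  have fin: "finite {i. i \<le> length Us \<and> k i \<noteq> \<zero>}" by simp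
  have "r \<in> {i. i \<le> length Us \<and> k i \<noteq> \<zero>}"
    unfolding r_def by (rule Max_in[OF fin]) (use k(2) in auto)
  then have r: "r \<le> length Us" "k r \<noteq> \<zero>" by auto
  have kz: "k i = \<zero>" if "i \<le> length Us" "r < i" for i
    using Max_ge[OF fin, of i] that unfolding r_def[symmetric] by auto
  have kK: "k i \<in> K" if "i \<le> r" for i using k(1) that r(1) by auto
  have kc: "k i \<in> carrier T" if "i \<le> r" for i using kK[OF that] K_carrier by blast
  define b where "b = inv (k r)"
  have b: "b \<in> K" "b \<otimes> k r = \<one>" using subfield_m_inv[OF K, of "k r"] kK r(2) by (auto simp: b_def)
  have bc [simp]: "b \<in> carrier T" using b K_carrier by blast
  have s0: "(\<Oplus>i\<in>{..r}. k i \<otimes> s i) = \<zero>"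
  proof -
    have "(\<Oplus>i\<in>{..length Us}. k i \<otimes> s i) = (\<Oplus>i\<in>{..r}. k i \<otimes> s i)"
      using r(1) kz k(1) K_carrier by (intro add.finprod_mono_neutral_cong_right) (auto simp: Pi_iff subset_iff)
    then show ?thesis using k(3) by simp
  qed
  define U where "U = (\<Oplus>i\<in>{..r}. k i \<otimes> u i)"
  define V where "V = (\<Oplus>i\<in>{..r}. k i \<otimes> v i)"
  have UD: "b \<otimes> U \<in> D1 0"
  proof -
    have "U \<in> D1 0" unfolding U_def
    proof (rule additive_subgroup_finsum[OF graded_familyD(1)[OF D1]])
      fix i assume "i \<in> {..r}"
      then have "k i \<in> D1 0" using kK K_D1 by auto
      then show "k i \<otimes> u i \<in> D1 0" using graded_familyD(3)[OF D1, of "k i" 0 "u i" 0] u by simp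
    qed simp
    then show ?thesis using graded_familyD(3)[OF D1, of b 0 U 0] b(1) K_D1 by auto
  qed
  have VD: "b \<otimes> V \<in> D2 0"
  proof -
    have "V \<in> D2 0" unfolding V_def
    proof (rule additive_subgroup_finsum[OF graded_familyD(1)[OF D2]])
      fix i assume "i \<in> {..r}"
      then have "k i \<in> D2 0" using kK K_D2 by auto
      then show "k i \<otimes> v i \<in> D2 0" using graded_familyD(3)[OF D2, of "k i" 0 "v i" 0] v by simp
    qed simp
    then show ?thesis using graded_familyD(3)[OF D2, of b 0 V 0] b(1) K_D2 by auto
  qed
  have UVc [simp]: "U \<in> carrier T" "V \<in> carrier T" unfolding U_def V_def using kc by auto
  have "(\<Oplus>i\<in>{..r}. k i \<otimes> c [^] (p ^ i)) = (\<Oplus>i\<in>{..r}. k i \<otimes> u i \<oplus> k i \<otimes> v i \<oplus> k i \<otimes> s i)"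
    using kc by (intro finsum_cong') (auto simp: dec r_distr)
  also have "\<dots> = (\<Oplus>i\<in>{..r}. k i \<otimes> u i \<oplus> k i \<otimes> v i) \<oplus> (\<Oplus>i\<in>{..r}. k i \<otimes> s i)"
    using kc by (intro finsum_addf) auto
  also have "(\<Oplus>i\<in>{..r}. k i \<otimes> u i \<oplus> k i \<otimes> v i) = U \<oplus> V"
    unfolding U_def V_def using kc by (intro finsum_addf) auto
  finally have "(\<Oplus>i\<in>{..r}. k i \<otimes> c [^] (p ^ i)) = U \<oplus> V" using s0 by simp
  moreover have "(\<Oplus>i\<in>{..r}. k i \<otimes> c [^] (p ^ i))
      = k r \<otimes> c [^] (p ^ r) \<oplus> (\<Oplus>i\<in>{..<r}. k i \<otimes> c [^] (p ^ i))"
  proof -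
    have "{..r} = insert r {..<r}" by auto
    then show ?thesis using kc by (simp add: Pi_iff)
  qed
  moreover define A where "A = (\<Oplus>i\<in>{..<r}. k i \<otimes> c [^] (p ^ i))"
  ultimately have eq: "k r \<otimes> c [^] (p ^ r) \<oplus> A = U \<oplus> V" by simp
  have Ac [simp]: "A \<in> carrier T" unfolding A_def using kc by auto
  define a where "a i = \<ominus> b \<otimes> k i" for i
  have "(\<Oplus>i\<in>{..<r}. a i \<otimes> c [^] (p ^ i)) = (\<Oplus>i\<in>{..<r}. \<ominus> b \<otimes> (k i \<otimes> c [^] (p ^ i)))"
    using kc by (intro finsum_cong') (auto simp: a_def m_assoc)
  also have "\<dots> = \<ominus> b \<otimes> A"
    unfolding A_def using kc by (intro finsum_rdistr[symmetric]) auto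
  finally have sum_a: "(\<Oplus>i\<in>{..<r}. a i \<otimes> c [^] (p ^ i)) = \<ominus> b \<otimes> A" .
  have "c [^] (p ^ r) = (b \<otimes> k r) \<otimes> c [^] (p ^ r)" using b(2) by simp
  also have "\<dots> = b \<otimes> (k r \<otimes> c [^] (p ^ r) \<oplus> A) \<oplus> \<ominus> b \<otimes> A"
  proof -
    have "c [^] (p ^ r) \<in> carrier T" "k r \<in> carrier T" using kc by simp_all
    then show ?thesis using bc Ac by algebra
  qed
  also have "\<dots> = b \<otimes> U \<oplus> b \<otimes> V \<oplus> (\<Oplus>i\<in>{..<r}. a i \<otimes> c [^] (p ^ i))"
    unfolding eq sum_a by (simp add: r_distr)
  finally show thesis
    using that[of r a "b \<otimes> U" "b \<otimes> V"] UD VD True kK b(1) subr(5,6) by (simp add: a_def)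
qed

text \<open>If \<open>c [^] q = w1 + w2 + F c\<close> and \<open>y [^] q = w1 + F y\<close> with \<open>F\<close> additive and \<open>q\<close> a power of \<open>p\<close>, then
  \<open>y - c\<close> is a root of the same equation with \<open>- w2\<close> in place of \<open>w1\<close>.  So \<open>y\<close> is integral over the first
  chart, \<open>y - c\<close> over the second, and \<open>c = y - (y - c)\<close>.\<close>

lemma kill_class:
  fixes enc :: "(nat \<Rightarrow> 'a) \<Rightarrow> 'u"
  assumes enc: "inj enc" and c: "c \<in> H e" and e: "e \<ge> 0"
  obtains S :: "'u ring" and h H' D1' D2' where "h \<in> ring_hom T S" "inj_on h (carrier T)"
    "chart_cover S (h ` K) p H' D1' D2' (h f1) (h f2) (h i1) (h i2) d1 d2"
    "\<And>n. h ` D1 n \<subseteq> D1' n" "\<And>n. h ` D2 n \<subseteq> D2' n"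
    "\<exists>u\<in>D1' e. \<exists>v\<in>D2' e. h c = u \<oplus>\<^bsub>S\<^esub> v"
proof -
  obtain r a w1 w2 where aK: "\<And>i. i < r \<Longrightarrow> a i \<in> K" and a0: "e \<noteq> 0 \<Longrightarrow> \<forall>i<r. a i = \<zero>"
    and w: "w1 \<in> D1 (int (p ^ r) * e)" "w2 \<in> D2 (int (p ^ r) * e)"
    and rel: "c [^] (p ^ r) = w1 \<oplus> w2 \<oplus> (\<Oplus>i\<in>{..<r}. a i \<otimes> c [^] (p ^ i))"
    using additive_relation[OF c e] by blast
  define q where "q = p ^ r"
  have p2: "2 \<le> p" by (rule prime_ge_2_nat[OF p(1)])
  then have q: "q > 0" by (simp add: q_def)
  have lt: "p ^ i < q" if "i < r" for i using that p2 unfolding q_def by (intro power_strict_increasing) auto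
  have injp: "inj_on (\<lambda>i. p ^ i) {..<r}" using p2 by (auto simp: inj_on_def)
  have [simp]: "c \<in> carrier T" "w1 \<in> carrier T" "w2 \<in> carrier T"
    using graded_familyD(5) H D1 D2 c w by blast+
  have ac: "a i \<in> carrier T" if "i < r" for i using aK[OF that] K_carrier by blast
  \<comment> \<open>The coefficients of \<open>w1\<close> plus the additive polynomial with
    coefficients \<open>a i\<close> at the exponents \<open>p^i\<close>. The constant term does not
    collide with the others because \<open>p^i \<ge> 1\<close>.\<close>
  define m where "m j = (if j = 0 then w1 else if j \<in> (\<lambda>i. p ^ i) ` {..<r}
    then a (the_inv_into {..<r} (\<lambda>i. p ^ i) j) else \<zero>)" for j
  have mp: "m (p ^ i) = a i" if "i < r" for i
    using that p2 the_inv_into_f_f[OF injp, of i] by (auto simp: m_def)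
  have mc: "m \<in> {..<q} \<rightarrow> carrier T" using ac mp by (auto simp: m_def the_inv_into_f_f[OF injp])
  obtain S :: "'u ring" and h y where S: "cring S" and h: "h \<in> ring_hom T S" and y: "y \<in> carrier S"
    and yq: "y [^]\<^bsub>S\<^esub> q = (\<Oplus>\<^bsub>S\<^esub>i\<in>{..<q}. h (m i) \<otimes>\<^bsub>S\<^esub> y [^]\<^bsub>S\<^esub> i)"
    and free: "\<And>t. t \<in> {..<q} \<rightarrow> carrier T \<Longrightarrow>
      (\<Oplus>\<^bsub>S\<^esub>i\<in>{..<q}. h (t i) \<otimes>\<^bsub>S\<^esub> y [^]\<^bsub>S\<^esub> i) = \<zero>\<^bsub>S\<^esub> \<Longrightarrow> \<forall>i<q. t i = \<zero>"
    by (rule monic_extension[OF is_cring one_neq_zero enc q mc], rule that)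
  interpret S: cring S by (rule S)
  interpret h: ring_hom_cring T S h by unfold_locales (rule h)
  define F where "F z = (\<Oplus>\<^bsub>S\<^esub>i\<in>{..<r}. h (a i) \<otimes>\<^bsub>S\<^esub> z [^]\<^bsub>S\<^esub> (p ^ i))" for z
  have Fc: "F z \<in> carrier S" if "z \<in> carrier S" for z unfolding F_def using ac that by auto
  have yF: "y [^]\<^bsub>S\<^esub> q = h w1 \<oplus>\<^bsub>S\<^esub> F y"
  proof -
    have "(\<Oplus>\<^bsub>S\<^esub>i\<in>{..<q}. h (m i) \<otimes>\<^bsub>S\<^esub> y [^]\<^bsub>S\<^esub> i)
       = (\<Oplus>\<^bsub>S\<^esub>i\<in>insert 0 ((\<lambda>i. p ^ i) ` {..<r}). h (m i) \<otimes>\<^bsub>S\<^esub> y [^]\<^bsub>S\<^esub> i)"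
    proof (rule S.add.finprod_mono_neutral_cong_right)
      show "insert 0 ((\<lambda>i. p ^ i) ` {..<r}) \<subseteq> {..<q}" using q lt by auto
      show "(\<lambda>i. h (m i) \<otimes>\<^bsub>S\<^esub> y [^]\<^bsub>S\<^esub> i) \<in> {..<q} \<rightarrow> carrier S" using mc y by auto
      fix i assume "i \<in> {..<q} - insert 0 ((\<lambda>i. p ^ i) ` {..<r})"
      then have "m i = \<zero>" unfolding m_def by simp
      then show "h (m i) \<otimes>\<^bsub>S\<^esub> y [^]\<^bsub>S\<^esub> i = \<zero>\<^bsub>S\<^esub>" using y by simp
    qed simp_all
    also have "\<dots> = h (m 0) \<otimes>\<^bsub>S\<^esub> y [^]\<^bsub>S\<^esub> (0::nat) \<oplus>\<^bsub>S\<^esub>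
        (\<Oplus>\<^bsub>S\<^esub>i\<in>(\<lambda>i. p ^ i) ` {..<r}. h (m i) \<otimes>\<^bsub>S\<^esub> y [^]\<^bsub>S\<^esub> i)"
      using p2 y ac mp by (intro S.finsum_insert) (auto simp: m_def)
    also have "(\<Oplus>\<^bsub>S\<^esub>i\<in>(\<lambda>i. p ^ i) ` {..<r}. h (m i) \<otimes>\<^bsub>S\<^esub> y [^]\<^bsub>S\<^esub> i)
       = (\<Oplus>\<^bsub>S\<^esub>i\<in>{..<r}. h (m (p ^ i)) \<otimes>\<^bsub>S\<^esub> y [^]\<^bsub>S\<^esub> (p ^ i))"
      using y ac mp by (intro S.finsum_reindex[OF _ injp]) auto
    also have "\<dots> = F y" unfolding F_def using y ac mp by (intro S.finsum_cong') auto
    finally show ?thesis using yq y by (simp add: m_def)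
  qed
  define y' where "y' = y \<ominus>\<^bsub>S\<^esub> h c"
  have y' [simp]: "y' \<in> carrier S" using y by (simp add: y'_def)
  have yy': "y = y' \<oplus>\<^bsub>S\<^esub> h c" using y by (simp add: y'_def S.minus_eq S.a_assoc S.l_neg)
  have pS: "add_pow S p \<one>\<^bsub>S\<^esub> = \<zero>\<^bsub>S\<^esub>" using h.hom_add_pow_one[of p] p(2) by simp
  note frob = S.frobenius_pow_add[OF p(1) pS]
  have Fadd: "F (x \<oplus>\<^bsub>S\<^esub> z) = F x \<oplus>\<^bsub>S\<^esub> F z" if xz: "x \<in> carrier S" "z \<in> carrier S" for x z
  proof -
    have "F (x \<oplus>\<^bsub>S\<^esub> z) = (\<Oplus>\<^bsub>S\<^esub>i\<in>{..<r}. h (a i) \<otimes>\<^bsub>S\<^esub> x [^]\<^bsub>S\<^esub> (p ^ i) \<oplus>\<^bsub>S\<^esub> h (a i) \<otimes>\<^bsub>S\<^esub> z [^]\<^bsub>S\<^esub> (p ^ i))"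
      unfolding F_def using xz ac by (intro S.finsum_cong') (auto simp: frob S.r_distr)
    then show ?thesis unfolding F_def using xz ac by (simp add: S.finsum_addf Pi_iff)
  qed
  have Fc': "F (h c) = h (\<Oplus>i\<in>{..<r}. a i \<otimes> c [^] (p ^ i))"
  proof -
    have "h (\<Oplus>i\<in>{..<r}. a i \<otimes> c [^] (p ^ i)) = (\<Oplus>\<^bsub>S\<^esub>i\<in>{..<r}. h (a i \<otimes> c [^] (p ^ i)))"
      using ac by (subst h.hom_finsum) (auto simp: comp_def)
    then show ?thesis unfolding F_def using ac by (simp add: h.hom_pow cong: S.finsum_cong)
  qed
  have y'F: "y' [^]\<^bsub>S\<^esub> q = h (\<ominus> w2) \<oplus>\<^bsub>S\<^esub> F y'"
  proof -
    define A where "A = (\<Oplus>i\<in>{..<r}. a i \<otimes> c [^] (p ^ i))"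
    have [simp]: "A \<in> carrier T" unfolding A_def using ac by auto
    have "y' [^]\<^bsub>S\<^esub> q \<oplus>\<^bsub>S\<^esub> h c [^]\<^bsub>S\<^esub> q = h w1 \<oplus>\<^bsub>S\<^esub> (F y' \<oplus>\<^bsub>S\<^esub> h A)"
      using yF frob[of y' "h c" r] Fadd[of y' "h c"] Fc' unfolding yy'[symmetric] A_def q_def by simp
    moreover have "h c [^]\<^bsub>S\<^esub> q = h w1 \<oplus>\<^bsub>S\<^esub> h w2 \<oplus>\<^bsub>S\<^esub> h A"
      using arg_cong[OF rel, of h] unfolding A_def[symmetric] by (simp add: q_def h.hom_pow)
    ultimately have eq: "y' [^]\<^bsub>S\<^esub> q \<oplus>\<^bsub>S\<^esub> (h w1 \<oplus>\<^bsub>S\<^esub> h w2 \<oplus>\<^bsub>S\<^esub> h A) = h w1 \<oplus>\<^bsub>S\<^esub> (F y' \<oplus>\<^bsub>S\<^esub> h A)" by simp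
    have cl: "y' [^]\<^bsub>S\<^esub> q \<in> carrier S" "h w1 \<in> carrier S" "h w2 \<in> carrier S" "h A \<in> carrier S" "F y' \<in> carrier S"
      using Fc by simp_all
    have "y' [^]\<^bsub>S\<^esub> q = (y' [^]\<^bsub>S\<^esub> q \<oplus>\<^bsub>S\<^esub> (h w1 \<oplus>\<^bsub>S\<^esub> h w2 \<oplus>\<^bsub>S\<^esub> h A)) \<ominus>\<^bsub>S\<^esub> (h w1 \<oplus>\<^bsub>S\<^esub> h w2 \<oplus>\<^bsub>S\<^esub> h A)"
      using cl by algebra
    also have "\<dots> = \<ominus>\<^bsub>S\<^esub> h w2 \<oplus>\<^bsub>S\<^esub> F y'" unfolding eq using cl by algebra
    finally show ?thesis by simp
  qed
  have in_pol: "h u \<oplus>\<^bsub>S\<^esub> F z \<in> h.pol D z e q (int q * e)"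
    if D: "graded_family D" "K \<subseteq> D 0" and z: "z \<in> carrier S" and u: "u \<in> D (int q * e)" for D z u
  proof (rule h.pol_add[OF D(1) z])
    show "h u \<in> h.pol D z e q (int q * e)"
      using h.pol_monom[OF D(1) z u q, where n = "int q * e" and e = e] graded_familyD(5)[OF D(1) u] by simp
    \<comment> \<open>Homogeneity of the equation: in degree zero the coefficients are constants
      from \<open>K\<close>, in positive degree they are zero.\<close>
    have aD: "a i \<in> D (int q * e - int (p ^ i) * e)" if "i < r" for i
    proof (cases "e = 0")
      case True
      then show ?thesis using aK[OF that] D(2) by auto
    next
      case False
      then show ?thesis using a0 that graded_familyD(4)[OF D(1)] by simp
    qed
    show "F z \<in> h.pol D z e q (int q * e)"
      unfolding F_def using aD lt
      by (intro S.additive_subgroup_finsum[OF h.pol_subgroup[OF D(1) z]] h.pol_monom[OF D(1) z]) auto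
  qed
  \<comment> \<open>The family \<open>v\<close> below extends the coefficients of \<open>x\<close>
    by \<open>t\<close> at the exponent \<open>s\<close> and by zeros above, so independence of all
    powers below \<open>q\<close> applies.\<close>
  have free': "t = \<zero>" if st: "s < q" "t \<in> carrier T" and x: "x \<in> h.pol (\<lambda>_. carrier T) y e s 0"
    and z: "h t \<otimes>\<^bsub>S\<^esub> y [^]\<^bsub>S\<^esub> s \<oplus>\<^bsub>S\<^esub> x = \<zero>\<^bsub>S\<^esub>" for s t x
  proof -
    obtain t' where t': "\<And>i. t' i \<in> carrier T" "\<And>i. i \<ge> s \<Longrightarrow> t' i = \<zero>"
      "x = (\<Oplus>\<^bsub>S\<^esub>i\<in>{..<s}. h (t' i) \<otimes>\<^bsub>S\<^esub> y [^]\<^bsub>S\<^esub> i)"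
      using h.pol_finsum[OF graded_family_carrier y x] by blast
    define v where "v = t'(s := t)"
    have vc: "v i \<in> carrier T" for i using t' st by (simp add: v_def)
    have "(\<Oplus>\<^bsub>S\<^esub>i\<in>{..<q}. h (v i) \<otimes>\<^bsub>S\<^esub> y [^]\<^bsub>S\<^esub> i) = (\<Oplus>\<^bsub>S\<^esub>i\<in>insert s {..<s}. h (v i) \<otimes>\<^bsub>S\<^esub> y [^]\<^bsub>S\<^esub> i)"
      using st vc y t'(2) by (intro S.add.finprod_mono_neutral_cong_right) (auto simp: v_def)
    also have "\<dots> = h (v s) \<otimes>\<^bsub>S\<^esub> y [^]\<^bsub>S\<^esub> s \<oplus>\<^bsub>S\<^esub> (\<Oplus>\<^bsub>S\<^esub>i\<in>{..<s}. h (v i) \<otimes>\<^bsub>S\<^esub> y [^]\<^bsub>S\<^esub> i)"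
      using vc y by (intro S.finsum_insert) auto
    also have "(\<Oplus>\<^bsub>S\<^esub>i\<in>{..<s}. h (v i) \<otimes>\<^bsub>S\<^esub> y [^]\<^bsub>S\<^esub> i) = x"
      unfolding t'(3) using t'(1) y by (intro S.finsum_cong') (auto simp: v_def)
    finally have "(\<Oplus>\<^bsub>S\<^esub>i\<in>{..<q}. h (v i) \<otimes>\<^bsub>S\<^esub> y [^]\<^bsub>S\<^esub> i) = \<zero>\<^bsub>S\<^esub>" using z by (simp add: v_def)
    then show ?thesis using free[of v] vc st(1) by (auto simp: v_def)
  qed
  interpret A: adjoined_root T S h K p H D1 D2 f1 f2 i1 i2 d1 d2 y q e c
  proof (intro adjoined_root.intro adjoined_root_axioms.intro)
    show "ring_hom_cring T S h" "chart_cover T K p H D1 D2 f1 f2 i1 i2 d1 d2" by unfold_locales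
    show "q > 0" "e \<ge> 0" "y \<in> carrier S" "c \<in> H e" by fact+
    show "y [^]\<^bsub>S\<^esub> q \<in> h.pol D1 y e q (int q * e)"
      unfolding yF using w(1) by (intro in_pol D1 K_D1 y) (simp add: q_def)
    show "(y \<ominus>\<^bsub>S\<^esub> h c) [^]\<^bsub>S\<^esub> q \<in> h.pol D2 (y \<ominus>\<^bsub>S\<^esub> h c) e q (int q * e)"
      unfolding y'_def[symmetric] y'F using w(2) graded_familyD(6)[OF D2]
      by (intro in_pol D2 K_D2 y') (simp add: q_def)
  qed (rule free')
  have hD1: "h ` D1 n \<subseteq> A.D1' n" for n using h.hom_image_pol[OF D1 y q A.rel1] by blast
  have rel2': "A.y' [^]\<^bsub>S\<^esub> q \<in> A.D2' (int q * e)" using A.rel2 by (simp add: A.y'_def)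
  have hD2: "h ` D2 n \<subseteq> A.D2' n" for n using h.hom_image_pol[OF D2 A.y' q rel2'] by blast
  have yD1: "y \<in> A.D1' e"
    using h.pol_z_mult[OF D1 y q A.rel1 S.graded_familyD(2)[OF A.D1']] y by simp
  have y'D2: "A.y' \<in> A.D2' e"
    using h.pol_z_mult[OF D2 A.y' q rel2' S.graded_familyD(2)[OF A.D2']] by simp
  have "h c = y \<oplus>\<^bsub>S\<^esub> \<ominus>\<^bsub>S\<^esub> A.y'"
  proof -
    have "h c \<in> carrier S" by simp
    then show ?thesis unfolding A.y'_def using y by algebra
  qed
  then have dec: "\<exists>u\<in>A.D1' e. \<exists>v\<in>A.D2' e. h c = u \<oplus>\<^bsub>S\<^esub> v"
    using yD1 S.graded_familyD(6)[OF A.D2' y'D2] by blast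
  \<comment> \<open>The case \<open>s = 0\<close> of \<open>free'\<close>.\<close>
  have inj: "inj_on h (carrier T)"
  proof (rule inj_onI)
    fix a b assume ab: "a \<in> carrier T" "b \<in> carrier T" "h a = h b"
    then have "h (a \<ominus> b) \<otimes>\<^bsub>S\<^esub> y [^]\<^bsub>S\<^esub> (0::nat) \<oplus>\<^bsub>S\<^esub> \<zero>\<^bsub>S\<^esub> = \<zero>\<^bsub>S\<^esub>"
      by (simp add: minus_eq S.r_neg)
    then have "a \<ominus> b = \<zero>" using free'[of 0 "a \<ominus> b" "\<zero>\<^bsub>S\<^esub>"] q ab by simp
    then show "a = b" using ab by (simp add: r_right_minus_eq)
  qed
  show thesis by (rule that[OF h inj A.extended_cover hD1 hD2 dec])
qed

end

section \<open>Solving the syzygy equation\<close>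

lemma (in ring) graded_family_mult:
  "graded_family E \<Longrightarrow> a \<in> E i \<Longrightarrow> b \<in> E j \<Longrightarrow> m = i + j \<Longrightarrow> a \<otimes> b \<in> E m"
  using graded_familyD(3) by blast

context chart_cover
begin

text \<open>Local solutions \<open>x\<close>, \<open>y\<close> of \<open>f = f1 s1 + f2 s2 + f3 s3\<close> on the two charts, corrected by syzygies
  that are lifted from the decomposition \<open>f g3 / (f1 f2) = u + v\<close>, so that the difference is a multiple of
  the given syzygy \<open>g\<close>.  Here \<open>x\<close> lifts \<open>u\<close> along \<open>\<sigma> \<mapsto> (\<sigma>2 g3 - \<sigma>3 g2) / f1\<close>, and \<open>y\<close> lifts \<open>v\<close> along
  \<open>\<sigma> \<mapsto> (\<sigma>3 g1 - \<sigma>1 g3) / f2\<close>.\<close>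

lemma local_solutions:
  fixes n k e3 :: int
  assumes f: "f \<in> D1 n" "f \<in> D2 n" and f3: "f3 \<in> D1 e3" "f3 \<in> D2 e3"
    and g1: "g1 \<in> D1 (k - int d1)" "g1 \<in> D2 (k - int d1)"
    and g2: "g2 \<in> D1 (k - int d2)" "g2 \<in> D2 (k - int d2)"
    and g3: "g3 \<in> D1 (k - e3)" "g3 \<in> D2 (k - e3)"
    and rel: "f1 \<otimes> g1 \<oplus> f2 \<otimes> g2 \<oplus> f3 \<otimes> g3 = \<zero>"
    and b: "b \<in> D1 (int d2 - k)" and c: "c \<in> D1 (e3 - k)" and bc: "b \<otimes> g2 \<oplus> c \<otimes> g3 = \<one>"
    and b': "b' \<in> D2 (int d1 - k)" and c': "c' \<in> D2 (e3 - k)" and bc': "b' \<otimes> g1 \<oplus> c' \<otimes> g3 = \<one>"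
    and u: "u \<in> D1 (n + k - int d1 - int d2 - e3)" and v: "v \<in> D2 (n + k - int d1 - int d2 - e3)"
    and uv: "i1 \<otimes> i2 \<otimes> f \<otimes> g3 = u \<oplus> v"
  obtains x1 x2 x3 y1 y2 y3 z where
    "x1 \<in> D1 (n - int d1)" "x2 \<in> D1 (n - int d2)" "x3 \<in> D1 (n - e3)"
    "y1 \<in> D2 (n - int d1)" "y2 \<in> D2 (n - int d2)" "y3 \<in> D2 (n - e3)" "z \<in> H (n - k)"
    "f = f1 \<otimes> x1 \<oplus> f2 \<otimes> x2 \<oplus> f3 \<otimes> x3"
    "x1 = y1 \<oplus> z \<otimes> g1" "x2 = y2 \<oplus> z \<otimes> g2" "x3 = y3 \<oplus> z \<otimes> g3"
proof -
  note c1 = graded_familyD(5)[OF D1] and c2 = graded_familyD(5)[OF D2]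
  note cl = c1[OF f(1)] c1[OF f3(1)] c1[OF g1(1)] c1[OF g2(1)] c1[OF g3(1)] c1[OF b] c1[OF c] c2[OF b'] c2[OF c']
    c1[OF u] c2[OF v] c1[OF f1(1)] c1[OF f2(1)] c1[OF i1(1)] c2[OF i2(1)]
  note m1 = graded_family_mult[OF D1] and m2 = graded_family_mult[OF D2]
  \<comment> \<open>The starting points are the solutions \<open>(f / f1, 0, 0)\<close> and
    \<open>(0, f / f2, 0)\<close>. Their difference has image \<open>- (u + v)\<close> in the
    quotient line bundle. The pairs \<open>b, c\<close> and \<open>b', c'\<close> provide syzygies
    with image \<open>1\<close> and \<open>- 1\<close>; adding \<open>u\<close> times the first to
    \<open>x\<close> and \<open>v\<close> times the second to \<open>y\<close> cancels that
    image.\<close>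
  define x1 where "x1 = i1 \<otimes> f \<ominus> u \<otimes> (f2 \<otimes> c \<ominus> f3 \<otimes> b)"
  define x2 where "x2 = u \<otimes> (f1 \<otimes> c)"
  define x3 where "x3 = \<ominus> (u \<otimes> (f1 \<otimes> b))"
  define y1 where "y1 = v \<otimes> (f2 \<otimes> c')"
  define y2 where "y2 = i2 \<otimes> f \<ominus> v \<otimes> (f1 \<otimes> c' \<ominus> f3 \<otimes> b')"
  define y3 where "y3 = \<ominus> (v \<otimes> (f2 \<otimes> b'))"
  have "f2 \<otimes> c \<in> D1 (int d2 + e3 - k)" "f3 \<otimes> b \<in> D1 (int d2 + e3 - k)"
    by (rule m1[OF f2(1) c] m1[OF f3(1) b], simp)+
  then have "f2 \<otimes> c \<ominus> f3 \<otimes> b \<in> D1 (int d2 + e3 - k)" by (rule graded_familyD(8)[OF D1])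
  then have "u \<otimes> (f2 \<otimes> c \<ominus> f3 \<otimes> b) \<in> D1 (n - int d1)" by (rule m1[OF u]) simp
  moreover have "i1 \<otimes> f \<in> D1 (n - int d1)" by (rule m1[OF i1(1) f(1)]) simp
  ultimately have x1: "x1 \<in> D1 (n - int d1)" unfolding x1_def by (intro graded_familyD(8)[OF D1])
  have "f1 \<otimes> c \<in> D1 (int d1 + (e3 - k))" "f1 \<otimes> b \<in> D1 (int d1 + (int d2 - k))"
    by (rule m1[OF f1(1) c refl] m1[OF f1(1) b refl])+
  then have x2: "x2 \<in> D1 (n - int d2)" and x3: "x3 \<in> D1 (n - e3)"
    unfolding x2_def x3_def by (auto intro!: m1[OF u] graded_familyD(6)[OF D1])
  have "f2 \<otimes> c' \<in> D2 (int d2 + (e3 - k))" "f2 \<otimes> b' \<in> D2 (int d2 + (int d1 - k))"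
    by (rule m2[OF f2(2) c' refl] m2[OF f2(2) b' refl])+
  then have y1: "y1 \<in> D2 (n - int d1)" and y3: "y3 \<in> D2 (n - e3)"
    unfolding y1_def y3_def by (auto intro!: m2[OF v] graded_familyD(6)[OF D2])
  have "f1 \<otimes> c' \<in> D2 (int d1 + e3 - k)" "f3 \<otimes> b' \<in> D2 (int d1 + e3 - k)"
    by (rule m2[OF f1(2) c'] m2[OF f3(2) b'], simp)+
  then have "f1 \<otimes> c' \<ominus> f3 \<otimes> b' \<in> D2 (int d1 + e3 - k)" by (rule graded_familyD(8)[OF D2])
  then have "v \<otimes> (f1 \<otimes> c' \<ominus> f3 \<otimes> b') \<in> D2 (n - int d2)" by (rule m2[OF v]) simp
  moreover have "i2 \<otimes> f \<in> D2 (n - int d2)" by (rule m2[OF i2(1) f(2)]) simp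
  ultimately have y2: "y2 \<in> D2 (n - int d2)" unfolding y2_def by (intro graded_familyD(8)[OF D2])
  note cxy = c1[OF x1] c1[OF x2] c1[OF x3] c2[OF y1] c2[OF y2] c2[OF y3]
  have sumx: "f1 \<otimes> x1 \<oplus> f2 \<otimes> x2 \<oplus> f3 \<otimes> x3 = f"
  proof -
    have "f1 \<otimes> x1 \<oplus> f2 \<otimes> x2 \<oplus> f3 \<otimes> x3 = (f1 \<otimes> i1) \<otimes> f"
      unfolding x1_def x2_def x3_def using cl by algebra
    then show ?thesis using i1(2) cl by simp
  qed
  have sumy: "f1 \<otimes> y1 \<oplus> f2 \<otimes> y2 \<oplus> f3 \<otimes> y3 = f"
  proof -
    have "f1 \<otimes> y1 \<oplus> f2 \<otimes> y2 \<oplus> f3 \<otimes> y3 = (f2 \<otimes> i2) \<otimes> f"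
      unfolding y1_def y2_def y3_def using cl by algebra
    then show ?thesis using i2(2) cl by simp
  qed
  define t1 where "t1 = x1 \<ominus> y1"
  define t2 where "t2 = x2 \<ominus> y2"
  define t3 where "t3 = x3 \<ominus> y3"
  have t: "t1 \<in> carrier T" "t2 \<in> carrier T" "t3 \<in> carrier T"
    unfolding t1_def t2_def t3_def using cxy by simp_all
  \<comment> \<open>The difference \<open>t\<close> of the two corrected solutions has image zero in
    the quotient, so it should be a multiple of \<open>g\<close>.\<close>
  have t23: "t2 \<otimes> g3 = t3 \<otimes> g2"
  proof -
    have "t2 \<otimes> g3 \<ominus> t3 \<otimes> g2 = u \<otimes> f1 \<otimes> (b \<otimes> g2 \<oplus> c \<otimes> g3) \<oplus> v \<otimes> f1 \<otimes> (b' \<otimes> g1 \<oplus> c' \<otimes> g3)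
        \<ominus> v \<otimes> b' \<otimes> (f1 \<otimes> g1 \<oplus> f2 \<otimes> g2 \<oplus> f3 \<otimes> g3) \<ominus> i2 \<otimes> f \<otimes> g3"
      unfolding t2_def t3_def x2_def x3_def y2_def y3_def using cl by algebra
    also have "\<dots> = f1 \<otimes> (u \<oplus> v) \<ominus> i2 \<otimes> f \<otimes> g3"
      unfolding bc bc' rel using cl by algebra
    also have "\<dots> = (f1 \<otimes> i1) \<otimes> (i2 \<otimes> f \<otimes> g3) \<ominus> i2 \<otimes> f \<otimes> g3"
      unfolding uv[symmetric] using cl by algebra
    also have "\<dots> = \<zero>" unfolding i1(2) using cl by algebra
    finally show ?thesis using t cl by (simp add: r_right_minus_eq)
  qed
  \<comment> \<open>Since \<open>b g2 + c g3 = 1\<close>, the same combination of \<open>t2\<close>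
    and \<open>t3\<close> gives the factor of proportionality.\<close>
  define z where "z = b \<otimes> t2 \<oplus> c \<otimes> t3"
  have zc: "z \<in> carrier T" unfolding z_def using cl t by simp
  have z2: "z \<otimes> g2 = t2"
  proof -
    have "z \<otimes> g2 = b \<otimes> g2 \<otimes> t2 \<oplus> c \<otimes> (t3 \<otimes> g2)" unfolding z_def using cl t by algebra
    also have "\<dots> = (b \<otimes> g2 \<oplus> c \<otimes> g3) \<otimes> t2" unfolding t23[symmetric] using cl t by algebra
    finally show ?thesis using bc t by simp
  qed
  have z3: "z \<otimes> g3 = t3"
  proof -
    have "z \<otimes> g3 = b \<otimes> (t2 \<otimes> g3) \<oplus> c \<otimes> g3 \<otimes> t3" unfolding z_def using cl t by algebra
    also have "\<dots> = (b \<otimes> g2 \<oplus> c \<otimes> g3) \<otimes> t3" unfolding t23 using cl t by algebra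
    finally show ?thesis using bc t by simp
  qed
  \<comment> \<open>Both \<open>t\<close> and \<open>z g\<close> are syzygies with equal second and
    third entries, and \<open>f1\<close> is invertible.\<close>
  have z1: "z \<otimes> g1 = t1"
  proof -
    have sumt: "f1 \<otimes> t1 \<oplus> f2 \<otimes> t2 \<oplus> f3 \<otimes> t3 = \<zero>"
    proof -
      have "f1 \<otimes> t1 \<oplus> f2 \<otimes> t2 \<oplus> f3 \<otimes> t3
          = (f1 \<otimes> x1 \<oplus> f2 \<otimes> x2 \<oplus> f3 \<otimes> x3) \<ominus> (f1 \<otimes> y1 \<oplus> f2 \<otimes> y2 \<oplus> f3 \<otimes> y3)"
        unfolding t1_def t2_def t3_def using cl cxy by algebra
      then show ?thesis unfolding sumx sumy using cl by (simp add: minus_eq r_neg)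
    qed
    have "z \<otimes> g1 = (f1 \<otimes> i1) \<otimes> (z \<otimes> g1)" unfolding i1(2) using zc cl by simp
    also have "\<dots> = i1 \<otimes> (z \<otimes> (f1 \<otimes> g1 \<oplus> f2 \<otimes> g2 \<oplus> f3 \<otimes> g3) \<ominus> f2 \<otimes> (z \<otimes> g2) \<ominus> f3 \<otimes> (z \<otimes> g3))"
      using zc cl by algebra
    also have "\<dots> = (f1 \<otimes> i1) \<otimes> t1 \<ominus> i1 \<otimes> (f1 \<otimes> t1 \<oplus> f2 \<otimes> t2 \<oplus> f3 \<otimes> t3)"
      unfolding rel z2 z3 using t cl zc by algebra
    also have "\<dots> = t1" unfolding sumt i1(2) using t cl by algebra
    finally show ?thesis .
  qed
  have zH: "z \<in> H (n - k)"
  proof -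
    note mH = graded_family_mult[OF H]
    have "t2 \<in> H (n - int d2)" "t3 \<in> H (n - e3)"
      unfolding t2_def t3_def using x2 x3 y2 y3 D1_H D2_H by (auto intro!: graded_familyD(8)[OF H])
    moreover have "b \<in> H (int d2 - k)" "c \<in> H (e3 - k)" using b c D1_H by blast+
    ultimately show ?thesis unfolding z_def by (intro graded_familyD(7)[OF H] mH) auto
  qed
  show thesis
  proof (rule that[OF x1 x2 x3 y1 y2 y3 zH sumx[symmetric]])
    show "x1 = y1 \<oplus> z \<otimes> g1" "x2 = y2 \<oplus> z \<otimes> g2" "x3 = y3 \<oplus> z \<otimes> g3"
      unfolding z1 z2 z3 t1_def t2_def t3_def using cxy by algebra+
  qed
qed

text \<open>When the discrepancy \<open>z\<close> splits as \<open>u + v\<close>, the triple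
  \<open>x - u g = y + v g\<close> is defined on both charts, and it still solves the equation
  because \<open>g\<close> is a syzygy.\<close>

lemma glue_solutions:
  fixes n k e3 :: int
  assumes g1: "g1 \<in> D1 (k - int d1)" "g1 \<in> D2 (k - int d1)"
    and g2: "g2 \<in> D1 (k - int d2)" "g2 \<in> D2 (k - int d2)"
    and g3: "g3 \<in> D1 (k - e3)" "g3 \<in> D2 (k - e3)"
    and f3: "f3 \<in> D1 e3" and rel: "f1 \<otimes> g1 \<oplus> f2 \<otimes> g2 \<oplus> f3 \<otimes> g3 = \<zero>"
    and x: "x1 \<in> D1 (n - int d1)" "x2 \<in> D1 (n - int d2)" "x3 \<in> D1 (n - e3)"
    and y: "y1 \<in> D2 (n - int d1)" "y2 \<in> D2 (n - int d2)" "y3 \<in> D2 (n - e3)"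
    and f: "f = f1 \<otimes> x1 \<oplus> f2 \<otimes> x2 \<oplus> f3 \<otimes> x3"
    and xy: "x1 = y1 \<oplus> z \<otimes> g1" "x2 = y2 \<oplus> z \<otimes> g2" "x3 = y3 \<oplus> z \<otimes> g3"
    and z: "z = u \<oplus> v" "u \<in> D1 (n - k)" "v \<in> D2 (n - k)"
  shows "\<exists>s1\<in>D1 (n - int d1) \<inter> D2 (n - int d1). \<exists>s2\<in>D1 (n - int d2) \<inter> D2 (n - int d2).
    \<exists>s3\<in>D1 (n - e3) \<inter> D2 (n - e3). f = f1 \<otimes> s1 \<oplus> f2 \<otimes> s2 \<oplus> f3 \<otimes> s3"
proof -
  note c1 = graded_familyD(5)[OF D1] and c2 = graded_familyD(5)[OF D2]
  have step: "x \<ominus> u \<otimes> g \<in> D1 (n - j) \<inter> D2 (n - j)"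
    if "x \<in> D1 (n - j)" "y \<in> D2 (n - j)" "x = y \<oplus> z \<otimes> g" "g \<in> D1 (k - j)" "g \<in> D2 (k - j)" for x y g j
  proof -
    have "u \<otimes> g \<in> D1 (n - j)" by (rule graded_family_mult[OF D1 z(2) that(4)]) simp
    then have 1: "x \<ominus> u \<otimes> g \<in> D1 (n - j)" by (rule graded_familyD(8)[OF D1 that(1)])
    have "v \<otimes> g \<in> D2 (n - j)" by (rule graded_family_mult[OF D2 z(3) that(5)]) simp
    then have "y \<oplus> v \<otimes> g \<in> D2 (n - j)" by (rule graded_familyD(7)[OF D2 that(2)])
    moreover have "x \<ominus> u \<otimes> g = y \<oplus> v \<otimes> g"
      unfolding that(3) z(1) using c2[OF that(2)] c1[OF z(2)] c2[OF z(3)] c1[OF that(4)] by algebra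
    ultimately show ?thesis using 1 by simp
  qed
  note cl = c1[OF g1(1)] c1[OF g2(1)] c1[OF g3(1)] c1[OF f1(1)] c1[OF f2(1)] c1[OF f3] c1[OF x(1)] c1[OF x(2)]
    c1[OF x(3)] c1[OF z(2)]
  have "f1 \<otimes> (x1 \<ominus> u \<otimes> g1) \<oplus> f2 \<otimes> (x2 \<ominus> u \<otimes> g2) \<oplus> f3 \<otimes> (x3 \<ominus> u \<otimes> g3)
    = (f1 \<otimes> x1 \<oplus> f2 \<otimes> x2 \<oplus> f3 \<otimes> x3) \<ominus> u \<otimes> (f1 \<otimes> g1 \<oplus> f2 \<otimes> g2 \<oplus> f3 \<otimes> g3)"
    using cl by algebra
  also have "\<dots> = f" unfolding rel f[symmetric] using cl f by (simp add: minus_eq)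
  finally show ?thesis
    using step[OF x(1) y(1) xy(1) g1] step[OF x(2) y(2) xy(2) g2] step[OF x(3) y(3) xy(3) g3] by metis
qed

text \<open>The Koszul complex of \<open>f1, f2\<close> is exact on the cover, and \<open>H\<^sup>1\<close> vanishes in large degrees.\<close>

lemma sections_generated:
  "\<exists>n0. \<forall>n\<ge>n0. \<forall>x\<in>D1 n \<inter> D2 n. \<exists>a\<in>D1 (n - int d1) \<inter> D2 (n - int d1).
    \<exists>b\<in>D1 (n - int d2) \<inter> D2 (n - int d2). x = f1 \<otimes> a \<oplus> f2 \<otimes> b"
proof -
  obtain n0 where n0: "\<And>n. n \<ge> n0 \<Longrightarrow> cech_spanned K (H n) (D1 n) (D2 n) []"
    using cech_vanish by blast
  note c1 = graded_familyD(5)[OF D1] and c2 = graded_familyD(5)[OF D2]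
  note m1 = graded_family_mult[OF D1] and m2 = graded_family_mult[OF D2] and mH = graded_family_mult[OF H]
  have "\<exists>a\<in>D1 (n - int d1) \<inter> D2 (n - int d1). \<exists>b\<in>D1 (n - int d2) \<inter> D2 (n - int d2). x = f1 \<otimes> a \<oplus> f2 \<otimes> b"
    if n: "n \<ge> n0 + int d1 + int d2" and x: "x \<in> D1 n" "x \<in> D2 n" for n x
  proof -
    \<comment> \<open>From \<open>x / (f1 f2) = u + v\<close> follow
      \<open>f2 v = x / f1 - f2 u\<close> and \<open>f1 u = x / f2 - f1 v\<close>. In each equation
      one side is regular on the first chart and the other on the second.\<close>
    have "i1 \<otimes> i2 \<in> H (- int d1 - int d2)" using i1(1) i2(1) D1_H D2_H by (intro mH) auto
    moreover have "x \<in> H n" using x D1_H by blast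
    ultimately have "i1 \<otimes> i2 \<otimes> x \<in> H (n - int d1 - int d2)" by (rule mH) simp
    then obtain u v where uv: "u \<in> D1 (n - int d1 - int d2)" "v \<in> D2 (n - int d1 - int d2)" "i1 \<otimes> i2 \<otimes> x = u \<oplus> v \<oplus> \<zero>"
      using n0[of "n - int d1 - int d2"] n unfolding cech_spanned_def by auto
    note cl = c1[OF x(1)] c1[OF uv(1)] c2[OF uv(2)] c1[OF f1(1)] c1[OF f2(1)] c1[OF i1(1)] c2[OF i2(1)]
    have eq: "i1 \<otimes> i2 \<otimes> x = u \<oplus> v" using uv(3) cl by simp
    define a where "a = f2 \<otimes> v"
    define b where "b = f1 \<otimes> u"
    have "a = f2 \<otimes> ((i1 \<otimes> i2 \<otimes> x) \<ominus> u)" unfolding a_def eq using cl by algebra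
    also have "\<dots> = (f2 \<otimes> i2) \<otimes> (i1 \<otimes> x) \<ominus> f2 \<otimes> u" using cl by algebra
    also have "\<dots> = i1 \<otimes> x \<ominus> f2 \<otimes> u" unfolding i2(2) using cl by simp
    finally have a1: "a = i1 \<otimes> x \<ominus> f2 \<otimes> u" .
    have "b = f1 \<otimes> ((i1 \<otimes> i2 \<otimes> x) \<ominus> v)" unfolding b_def eq using cl by algebra
    also have "\<dots> = (f1 \<otimes> i1) \<otimes> (i2 \<otimes> x) \<ominus> f1 \<otimes> v" using cl by algebra
    also have "\<dots> = i2 \<otimes> x \<ominus> f1 \<otimes> v" unfolding i1(2) using cl by simp
    finally have b2: "b = i2 \<otimes> x \<ominus> f1 \<otimes> v" .
    have "a \<in> D2 (n - int d1)" unfolding a_def by (rule m2[OF f2(2) uv(2)]) simp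
    moreover have "a \<in> D1 (n - int d1)" unfolding a1
      by (intro graded_familyD(8)[OF D1] m1[OF i1(1) x(1)] m1[OF f2(1) uv(1)]) simp_all
    moreover have "b \<in> D1 (n - int d2)" unfolding b_def by (rule m1[OF f1(1) uv(1)]) simp
    moreover have "b \<in> D2 (n - int d2)" unfolding b2
      by (intro graded_familyD(8)[OF D2] m2[OF i2(1) x(2)] m2[OF f1(2) uv(2)]) simp_all
    moreover have "x = f1 \<otimes> a \<oplus> f2 \<otimes> b"
    proof -
      have "f1 \<otimes> a \<oplus> f2 \<otimes> b = f1 \<otimes> f2 \<otimes> (u \<oplus> v)" unfolding a_def b_def using cl by algebra
      also have "\<dots> = (f1 \<otimes> i1) \<otimes> (f2 \<otimes> i2) \<otimes> x" unfolding eq[symmetric] using cl by algebra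
      finally show ?thesis unfolding i1(2) i2(2) using cl by simp
    qed
    ultimately show ?thesis by blast
  qed
  then show ?thesis by (intro exI[of _ "n0 + int d1 + int d2"]) auto
qed

end

text \<open>Where \<open>f\<close> is invertible, the relation expresses \<open>g\<close> through
  \<open>g'\<close> and \<open>g3\<close>. Substituting this into a power of \<open>f\<close> that
  lies in \<open>(g, g', g3)\<close> and dividing by that power leaves a Bezout identity in
  \<open>g'\<close> and \<open>g3\<close>. It is applied on both charts, with \<open>f1\<close> and
  \<open>f2\<close> exchanged.\<close>

lemma (in cring) eliminate_unimodular:
  fixes d d' e3 k :: int
  assumes E: "graded_family E" and f: "f \<in> E d" and i: "i \<in> E (- d)" "f \<otimes> i = \<one>"
    and f': "f' \<in> E d'" and f3: "f3 \<in> E e3"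
    and g: "g \<in> E (k - d)" "g' \<in> E (k - d')" "g3 \<in> E (k - e3)"
    and rel: "f \<otimes> g \<oplus> f' \<otimes> g' \<oplus> f3 \<otimes> g3 = \<zero>"
    and a: "a \<in> E (int N * d - (k - d))" "a' \<in> E (int N * d - (k - d'))" "a3 \<in> E (int N * d - (k - e3))"
    and pow: "f [^] N = a \<otimes> g \<oplus> a' \<otimes> g' \<oplus> a3 \<otimes> g3"
  shows "\<exists>b\<in>E (d' - k). \<exists>c\<in>E (e3 - k). b \<otimes> g' \<oplus> c \<otimes> g3 = \<one>"
proof -
  note c = graded_familyD(5)[OF E] and m = graded_family_mult[OF E]
  have iN: "i [^] N \<in> E (int N * (- d))" by (rule graded_family_pow[OF E i(1)])
  note cl = c[OF f] c[OF i(1)] c[OF f'] c[OF f3] c[OF g(1)] c[OF g(2)] c[OF g(3)] c[OF a(1)] c[OF a(2)] c[OF a(3)] c[OF iN]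
  have ai: "a \<otimes> i \<in> E (int N * d - k)" by (rule m[OF a(1) i(1)]) simp
  define b where "b = i [^] N \<otimes> (a' \<ominus> a \<otimes> i \<otimes> f')"
  define c' where "c' = i [^] N \<otimes> (a3 \<ominus> a \<otimes> i \<otimes> f3)"
  have "a \<otimes> i \<otimes> f' \<in> E (int N * d - (k - d'))" by (rule m[OF ai f']) simp
  then have "a' \<ominus> a \<otimes> i \<otimes> f' \<in> E (int N * d - (k - d'))" by (rule graded_familyD(8)[OF E a(2)])
  then have b: "b \<in> E (d' - k)" unfolding b_def by (rule m[OF iN]) simp
  have "a \<otimes> i \<otimes> f3 \<in> E (int N * d - (k - e3))" by (rule m[OF ai f3]) simp
  then have "a3 \<ominus> a \<otimes> i \<otimes> f3 \<in> E (int N * d - (k - e3))" by (rule graded_familyD(8)[OF E a(3)])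
  then have c': "c' \<in> E (e3 - k)" unfolding c'_def by (rule m[OF iN]) simp
  have "b \<otimes> g' \<oplus> c' \<otimes> g3 = i [^] N \<otimes> (a \<otimes> ((f \<otimes> i) \<otimes> g) \<oplus> a' \<otimes> g' \<oplus> a3 \<otimes> g3)
      \<ominus> i [^] N \<otimes> a \<otimes> i \<otimes> (f \<otimes> g \<oplus> f' \<otimes> g' \<oplus> f3 \<otimes> g3)"
    unfolding b_def c'_def using cl by algebra
  also have "\<dots> = i [^] N \<otimes> (a \<otimes> g \<oplus> a' \<otimes> g' \<oplus> a3 \<otimes> g3)"
    unfolding rel i(2) using cl by (simp add: minus_eq)
  also have "\<dots> = (f \<otimes> i) [^] N" unfolding pow[symmetric] using cl by (simp add: nat_pow_distrib m_comm)
  finally have "b \<otimes> g' \<oplus> c' \<otimes> g3 = \<one>" unfolding i(2) by simp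
  then show ?thesis using b c' by blast
qed

text \<open>The state of the iteration: the fixed graded ring \<open>R\<close>, embedded by
  \<open>\<phi>\<close> into the ambient ring of the current cover. Since \<open>f1\<close> and
  \<open>f2\<close> are kept as elements of \<open>R\<close>, the same data describe every
  stage.\<close>

locale covered_algebra =
  B: graded_cring R G + C: chart_cover T "\<phi> ` K" p H D1 D2 "\<phi> f1" "\<phi> f2" i1 i2 d1 d2
  for R (structure) and G and T (structure) and K p H D1 D2 \<phi> f1 f2 i1 i2 d1 d2 +
  assumes \<phi>: "\<phi> \<in> ring_hom R T" and inj: "inj_on \<phi> (carrier R)" and K_R: "K \<subseteq> carrier R"
    and \<phi>_D1: "\<phi> ` G n \<subseteq> D1 (int n)" and \<phi>_D2: "\<phi> ` G n \<subseteq> D2 (int n)"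
    and f1_G: "f1 \<in> G d1" and f2_G: "f2 \<in> G d2"
begin

sublocale hom: ring_hom_cring R T \<phi>
  by unfold_locales (rule \<phi>)

lemma G_carrier: "x \<in> G n \<Longrightarrow> x \<in> carrier R"
  using additive_subgroup.a_subset[OF B.component_subgroup] by blast

lemma component_D: "x \<in> component R G z \<Longrightarrow> \<phi> x \<in> D1 z \<inter> D2 z"
proof (cases "z < 0")
  case True
  then show "x \<in> component R G z \<Longrightarrow> ?thesis"
    using C.graded_familyD(4)[OF C.D1] C.graded_familyD(4)[OF C.D2] by (simp add: component_def)
next
  case False
  then show "x \<in> component R G z \<Longrightarrow> ?thesis"
    using \<phi>_D1[of "nat z"] \<phi>_D2[of "nat z"] by (auto simp: component_def)
qed

lemma component_carrier: "x \<in> component R G z \<Longrightarrow> x \<in> carrier R"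
  using G_carrier by (auto simp: component_def split: if_splits)

text \<open>\<open>kill_class\<close> for the composite embedding of \<open>R\<close>. The type of
  the new ring stays a parameter, so that it may also be the type of the old one.\<close>

lemma kill:
  fixes enc :: "(nat \<Rightarrow> 'c) \<Rightarrow> 'u"
  assumes enc: "inj enc" and c: "c \<in> H e" and e: "e \<ge> 0"
  obtains S :: "'u ring" and h H' D1' D2' where "h \<in> ring_hom T S"
    "covered_algebra R G S K p H' D1' D2' (h \<circ> \<phi>) f1 f2 (h i1) (h i2) d1 d2"
    "\<And>n. h ` D1 n \<subseteq> D1' n" "\<And>n. h ` D2 n \<subseteq> D2' n"
    "\<exists>u\<in>D1' e. \<exists>v\<in>D2' e. h c = u \<oplus>\<^bsub>S\<^esub> v"
proof -
  obtain S :: "'u ring" and h H' D1' D2' where h: "h \<in> ring_hom T S" "inj_on h (carrier T)"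
    and cov: "chart_cover S (h ` \<phi> ` K) p H' D1' D2' (h (\<phi> f1)) (h (\<phi> f2)) (h i1) (h i2) d1 d2"
    and D: "\<And>n. h ` D1 n \<subseteq> D1' n" "\<And>n. h ` D2 n \<subseteq> D2' n"
    and dec: "\<exists>u\<in>D1' e. \<exists>v\<in>D2' e. h c = u \<oplus>\<^bsub>S\<^esub> v"
    by (rule C.kill_class[OF enc c e], rule that)
  have "covered_algebra R G S K p H' D1' D2' (h \<circ> \<phi>) f1 f2 (h i1) (h i2) d1 d2"
  proof (intro covered_algebra.intro covered_algebra_axioms.intro)
    show "graded_cring R G" by unfold_locales
    show "chart_cover S ((h \<circ> \<phi>) ` K) p H' D1' D2' ((h \<circ> \<phi>) f1) ((h \<circ> \<phi>) f2) (h i1) (h i2) d1 d2"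
      using cov by (simp add: image_comp)
    show "h \<circ> \<phi> \<in> ring_hom R S" by (rule ring_hom_trans[OF \<phi> h(1)])
    show "inj_on (h \<circ> \<phi>) (carrier R)"
      using inj h(2) hom.hom_closed by (intro comp_inj_on) (auto intro: inj_on_subset)
    show "K \<subseteq> carrier R" "f1 \<in> G d1" "f2 \<in> G d2" by (rule K_R f1_G f2_G)+
    show "(h \<circ> \<phi>) ` G n \<subseteq> D1' (int n)" "(h \<circ> \<phi>) ` G n \<subseteq> D2' (int n)" for n
      using \<phi>_D1[of n] \<phi>_D2[of n] D[of "int n"] by (auto simp: image_subset_iff subset_iff)
  qed
  then show thesis using that h(1) D dec by blast
qed

text \<open>The degrees of the three coefficients are left open; for ideal membership it only
  matters that they are homogeneous global sections.\<close>

definition solved :: "'a \<Rightarrow> 'a \<Rightarrow> bool" where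
  "solved f3 x \<longleftrightarrow> (\<exists>m1 m2 m3. \<exists>s1\<in>D1 m1 \<inter> D2 m1. \<exists>s2\<in>D1 m2 \<inter> D2 m2. \<exists>s3\<in>D1 m3 \<inter> D2 m3.
     \<phi> x = \<phi> f1 \<otimes>\<^bsub>T\<^esub> s1 \<oplus>\<^bsub>T\<^esub> \<phi> f2 \<otimes>\<^bsub>T\<^esub> s2 \<oplus>\<^bsub>T\<^esub> \<phi> f3 \<otimes>\<^bsub>T\<^esub> s3)"

end

text \<open>Solutions survive further extensions, so the homogeneous components of one element can
  be treated one after the other.\<close>

lemma solved_mono:
  assumes "covered_algebra R G T K p H D1 D2 \<phi> f1 f2 i1 i2 d1 d2"
    and "covered_algebra R G S K p H' D1' D2' (h \<circ> \<phi>) f1 f2 i1' i2' d1 d2"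
    and h: "h \<in> ring_hom T S" and D: "\<And>n. h ` D1 n \<subseteq> D1' n" "\<And>n. h ` D2 n \<subseteq> D2' n"
    and f3: "f3 \<in> carrier R"
    and sol: "covered_algebra.solved T D1 D2 \<phi> f1 f2 f3 x"
  shows "covered_algebra.solved S D1' D2' (h \<circ> \<phi>) f1 f2 f3 x"
proof -
  interpret A: covered_algebra R G T K p H D1 D2 \<phi> f1 f2 i1 i2 d1 d2 by fact
  interpret B: covered_algebra R G S K p H' D1' D2' "h \<circ> \<phi>" f1 f2 i1' i2' d1 d2 by fact
  interpret h: ring_hom_cring T S h by unfold_locales (rule h)
  obtain m1 m2 m3 s1 s2 s3 where s: "s1 \<in> D1 m1 \<inter> D2 m1" "s2 \<in> D1 m2 \<inter> D2 m2" "s3 \<in> D1 m3 \<inter> D2 m3"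
    and eq: "\<phi> x = \<phi> f1 \<otimes>\<^bsub>T\<^esub> s1 \<oplus>\<^bsub>T\<^esub> \<phi> f2 \<otimes>\<^bsub>T\<^esub> s2 \<oplus>\<^bsub>T\<^esub> \<phi> f3 \<otimes>\<^bsub>T\<^esub> s3"
    using sol unfolding A.solved_def by blast
  have sc: "s1 \<in> carrier T" "s2 \<in> carrier T" "s3 \<in> carrier T"
    using s A.C.graded_familyD(5)[OF A.C.D1] by blast+
  have fc: "\<phi> f1 \<in> carrier T" "\<phi> f2 \<in> carrier T" "\<phi> f3 \<in> carrier T"
    using A.G_carrier[OF A.f1_G] A.G_carrier[OF A.f2_G] f3 by auto
  have "h s1 \<in> D1' m1 \<inter> D2' m1" "h s2 \<in> D1' m2 \<inter> D2' m2" "h s3 \<in> D1' m3 \<inter> D2' m3" using s D by blast+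
  moreover have "(h \<circ> \<phi>) x = (h \<circ> \<phi>) f1 \<otimes>\<^bsub>S\<^esub> h s1 \<oplus>\<^bsub>S\<^esub> (h \<circ> \<phi>) f2 \<otimes>\<^bsub>S\<^esub> h s2 \<oplus>\<^bsub>S\<^esub> (h \<circ> \<phi>) f3 \<otimes>\<^bsub>S\<^esub> h s3"
    using sc fc eq by simp
  ultimately show ?thesis unfolding B.solved_def by blast
qed

text \<open>Two adjunctions in succession, as the second class exists only after the first has been
  killed. The inequalities for \<open>n\<close> make both classes have nonnegative degree. The
  \<open>a\<close> and \<open>b\<close> record that powers of \<open>f1\<close> and
  \<open>f2\<close> lie in \<open>(g1, g2, g3)\<close>: on the charts \<open>g\<close> is a nowhere
  vanishing section of the syzygy bundle.\<close>

lemma (in covered_algebra) solve_step: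
  fixes enc :: "(nat \<Rightarrow> 'c) \<Rightarrow> 'c"
  assumes enc: "inj enc" and f3: "f3 \<in> G d3"
    and g: "g1 \<in> component R G (int k - int d1)" "g2 \<in> component R G (int k - int d2)"
      "g3 \<in> component R G (int k - int d3)"
    and rel: "f1 \<otimes> g1 \<oplus> f2 \<otimes> g2 \<oplus> f3 \<otimes> g3 = \<zero>"
    and a: "a1 \<in> component R G (int N * int d1 - (int k - int d1))"
      "a2 \<in> component R G (int N * int d1 - (int k - int d2))"
      "a3 \<in> component R G (int N * int d1 - (int k - int d3))"
      "f1 [^] N = a1 \<otimes> g1 \<oplus> a2 \<otimes> g2 \<oplus> a3 \<otimes> g3"
    and b: "b1 \<in> component R G (int M * int d2 - (int k - int d1))"
      "b2 \<in> component R G (int M * int d2 - (int k - int d2))"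
      "b3 \<in> component R G (int M * int d2 - (int k - int d3))"
      "f2 [^] M = b1 \<otimes> g1 \<oplus> b2 \<otimes> g2 \<oplus> b3 \<otimes> g3"
    and x: "x \<in> G n" and n: "k \<le> n" "d1 + d2 + d3 \<le> n + k"
  shows "\<exists>(S :: 'c ring) h H' D1' D2' i1' i2'. h \<in> ring_hom T S \<and>
    covered_algebra R G S K p H' D1' D2' (h \<circ> \<phi>) f1 f2 i1' i2' d1 d2 \<and>
    (\<forall>n. h ` D1 n \<subseteq> D1' n) \<and> (\<forall>n. h ` D2 n \<subseteq> D2' n) \<and>
    covered_algebra.solved S D1' D2' (h \<circ> \<phi>) f1 f2 f3 x"
proof -
  let ?e = "int n + int k - int d1 - int d2 - int d3"
  let ?c = "i1 \<otimes>\<^bsub>T\<^esub> i2 \<otimes>\<^bsub>T\<^esub> \<phi> x \<otimes>\<^bsub>T\<^esub> \<phi> g3"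
  have c: "?c \<in> H ?e"
  proof -
    note mH = C.graded_family_mult[OF C.H]
    have "i1 \<in> H (- int d1)" "i2 \<in> H (- int d2)" "\<phi> x \<in> H (int n)" "\<phi> g3 \<in> H (int k - int d3)"
      using C.i1(1) C.i2(1) C.D1_H C.D2_H \<phi>_D1 x component_D[OF g(3)] by blast+
    note mem = this
    have "i1 \<otimes>\<^bsub>T\<^esub> i2 \<in> H (- int d1 - int d2)" by (rule mH[OF mem(1,2)]) simp
    then have "i1 \<otimes>\<^bsub>T\<^esub> i2 \<otimes>\<^bsub>T\<^esub> \<phi> x \<in> H (int n - int d1 - int d2)" by (rule mH[OF _ mem(3)]) simp
    then show ?thesis by (rule mH[OF _ mem(4)]) simp
  qed
  have e: "?e \<ge> 0" using n(2) by linarith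
  \<comment> \<open>First adjunction: it splits the obstruction in the quotient line bundle.\<close>
  obtain S1 :: "'c ring" and h1 H1 E1 E2 where h1: "h1 \<in> ring_hom T S1"
    and cov1: "covered_algebra R G S1 K p H1 E1 E2 (h1 \<circ> \<phi>) f1 f2 (h1 i1) (h1 i2) d1 d2"
    and D1: "\<And>n. h1 ` D1 n \<subseteq> E1 n" "\<And>n. h1 ` D2 n \<subseteq> E2 n"
    and dec1: "\<exists>u\<in>E1 ?e. \<exists>v\<in>E2 ?e. h1 ?c = u \<oplus>\<^bsub>S1\<^esub> v"
    by (rule kill[OF enc c e], rule that)
  define \<phi>1 where "\<phi>1 = h1 \<circ> \<phi>"
  interpret A: covered_algebra R G S1 K p H1 E1 E2 \<phi>1 f1 f2 "h1 i1" "h1 i2" d1 d2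
    unfolding \<phi>1_def by (rule cov1)
  interpret h1: ring_hom_cring T S1 h1 by unfold_locales (rule h1)
  note [simp] = G_carrier[OF x] G_carrier[OF f3] G_carrier[OF f1_G] G_carrier[OF f2_G]
  note gc [simp] = component_carrier[OF g(1)] component_carrier[OF g(2)] component_carrier[OF g(3)]
  have rel1: "\<phi>1 f1 \<otimes>\<^bsub>S1\<^esub> \<phi>1 g1 \<oplus>\<^bsub>S1\<^esub> \<phi>1 f2 \<otimes>\<^bsub>S1\<^esub> \<phi>1 g2 \<oplus>\<^bsub>S1\<^esub> \<phi>1 f3 \<otimes>\<^bsub>S1\<^esub> \<phi>1 g3 = \<zero>\<^bsub>S1\<^esub>"
    using arg_cong[OF rel, of \<phi>1] by simp
  have \<phi>1E: "\<phi>1 y \<in> E1 z" "\<phi>1 y \<in> E2 z" if "y \<in> component R G z" for y z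
    using A.component_D[OF that] by auto
  have G\<phi>1E: "\<phi>1 y \<in> E1 (int j)" "\<phi>1 y \<in> E2 (int j)" if "y \<in> G j" for y j
    using A.\<phi>_D1[of j] A.\<phi>_D2[of j] that by auto
  obtain u v where uv: "u \<in> E1 ?e" "v \<in> E2 ?e" "h1 ?c = u \<oplus>\<^bsub>S1\<^esub> v" using dec1 by blast
  have i12: "i1 \<in> carrier T" "i2 \<in> carrier T"
    using C.graded_familyD(5)[OF C.D1 C.i1(1)] C.graded_familyD(5)[OF C.D2 C.i2(1)] .
  have uv': "h1 i1 \<otimes>\<^bsub>S1\<^esub> h1 i2 \<otimes>\<^bsub>S1\<^esub> \<phi>1 x \<otimes>\<^bsub>S1\<^esub> \<phi>1 g3 = u \<oplus>\<^bsub>S1\<^esub> v"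
    using uv(3) i12 unfolding \<phi>1_def by simp
  have pow1: "\<phi>1 f1 [^]\<^bsub>S1\<^esub> N = \<phi>1 a1 \<otimes>\<^bsub>S1\<^esub> \<phi>1 g1 \<oplus>\<^bsub>S1\<^esub> \<phi>1 a2 \<otimes>\<^bsub>S1\<^esub> \<phi>1 g2 \<oplus>\<^bsub>S1\<^esub> \<phi>1 a3 \<otimes>\<^bsub>S1\<^esub> \<phi>1 g3"
    using component_carrier[OF a(1)] component_carrier[OF a(2)] component_carrier[OF a(3)] arg_cong[OF a(4), of \<phi>1]
    by (simp add: A.hom.hom_pow)
  have pow2: "\<phi>1 f2 [^]\<^bsub>S1\<^esub> M = \<phi>1 b2 \<otimes>\<^bsub>S1\<^esub> \<phi>1 g2 \<oplus>\<^bsub>S1\<^esub> \<phi>1 b1 \<otimes>\<^bsub>S1\<^esub> \<phi>1 g1 \<oplus>\<^bsub>S1\<^esub> \<phi>1 b3 \<otimes>\<^bsub>S1\<^esub> \<phi>1 g3"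
    using component_carrier[OF b(1)] component_carrier[OF b(2)] component_carrier[OF b(3)] arg_cong[OF b(4), of \<phi>1]
    by (simp add: A.hom.hom_pow A.C.a_comm)
  have rel2: "\<phi>1 f2 \<otimes>\<^bsub>S1\<^esub> \<phi>1 g2 \<oplus>\<^bsub>S1\<^esub> \<phi>1 f1 \<otimes>\<^bsub>S1\<^esub> \<phi>1 g1 \<oplus>\<^bsub>S1\<^esub> \<phi>1 f3 \<otimes>\<^bsub>S1\<^esub> \<phi>1 g3 = \<zero>\<^bsub>S1\<^esub>"
    using rel1 by (simp add: A.C.a_comm)
  have f12: "\<phi>1 f1 \<otimes>\<^bsub>S1\<^esub> h1 i1 = \<one>\<^bsub>S1\<^esub>" "\<phi>1 f2 \<otimes>\<^bsub>S1\<^esub> h1 i2 = \<one>\<^bsub>S1\<^esub>"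
    using A.C.i1(2) A.C.i2(2) .
  obtain b c where bc: "b \<in> E1 (int d2 - int k)" "c \<in> E1 (int d3 - int k)"
    "b \<otimes>\<^bsub>S1\<^esub> \<phi>1 g2 \<oplus>\<^bsub>S1\<^esub> c \<otimes>\<^bsub>S1\<^esub> \<phi>1 g3 = \<one>\<^bsub>S1\<^esub>"
    using A.C.eliminate_unimodular[OF A.C.D1 G\<phi>1E(1)[OF f1_G] A.C.i1(1) f12(1) G\<phi>1E(1)[OF f2_G] G\<phi>1E(1)[OF f3]
        \<phi>1E(1)[OF g(1)] \<phi>1E(1)[OF g(2)] \<phi>1E(1)[OF g(3)] rel1 \<phi>1E(1)[OF a(1)] \<phi>1E(1)[OF a(2)] \<phi>1E(1)[OF a(3)] pow1]
    by blast
  obtain b' c' where bc': "b' \<in> E2 (int d1 - int k)" "c' \<in> E2 (int d3 - int k)"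
    "b' \<otimes>\<^bsub>S1\<^esub> \<phi>1 g1 \<oplus>\<^bsub>S1\<^esub> c' \<otimes>\<^bsub>S1\<^esub> \<phi>1 g3 = \<one>\<^bsub>S1\<^esub>"
    using A.C.eliminate_unimodular[OF A.C.D2 G\<phi>1E(2)[OF f2_G] A.C.i2(1) f12(2) G\<phi>1E(2)[OF f1_G] G\<phi>1E(2)[OF f3]
        \<phi>1E(2)[OF g(2)] \<phi>1E(2)[OF g(1)] \<phi>1E(2)[OF g(3)] rel2 \<phi>1E(2)[OF b(2)] \<phi>1E(2)[OF b(1)] \<phi>1E(2)[OF b(3)] pow2]
    by blast
  obtain x1 x2 x3 y1 y2 y3 z where loc:
    "x1 \<in> E1 (int n - int d1)" "x2 \<in> E1 (int n - int d2)" "x3 \<in> E1 (int n - int d3)"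
    "y1 \<in> E2 (int n - int d1)" "y2 \<in> E2 (int n - int d2)" "y3 \<in> E2 (int n - int d3)" "z \<in> H1 (int n - int k)"
    "\<phi>1 x = \<phi>1 f1 \<otimes>\<^bsub>S1\<^esub> x1 \<oplus>\<^bsub>S1\<^esub> \<phi>1 f2 \<otimes>\<^bsub>S1\<^esub> x2 \<oplus>\<^bsub>S1\<^esub> \<phi>1 f3 \<otimes>\<^bsub>S1\<^esub> x3"
    "x1 = y1 \<oplus>\<^bsub>S1\<^esub> z \<otimes>\<^bsub>S1\<^esub> \<phi>1 g1" "x2 = y2 \<oplus>\<^bsub>S1\<^esub> z \<otimes>\<^bsub>S1\<^esub> \<phi>1 g2" "x3 = y3 \<oplus>\<^bsub>S1\<^esub> z \<otimes>\<^bsub>S1\<^esub> \<phi>1 g3"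
    using A.C.local_solutions[OF G\<phi>1E[OF x] G\<phi>1E[OF f3] \<phi>1E[OF g(1)] \<phi>1E[OF g(2)] \<phi>1E[OF g(3)]
      rel1 bc bc' uv(1,2) uv'] by blast
  have e2: "int n - int k \<ge> 0" using n(1) by simp
  \<comment> \<open>Second adjunction: it splits the discrepancy \<open>z\<close> of the corrected
    local solutions, of degree \<open>n - k\<close>.\<close>
  obtain S2 :: "'c ring" and h2 H2 F1 F2 where h2: "h2 \<in> ring_hom S1 S2"
    and cov2: "covered_algebra R G S2 K p H2 F1 F2 (h2 \<circ> \<phi>1) f1 f2 (h2 (h1 i1)) (h2 (h1 i2)) d1 d2"
    and D2: "\<And>n. h2 ` E1 n \<subseteq> F1 n" "\<And>n. h2 ` E2 n \<subseteq> F2 n"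
    and dec2: "\<exists>u\<in>F1 (int n - int k). \<exists>v\<in>F2 (int n - int k). h2 z = u \<oplus>\<^bsub>S2\<^esub> v"
    by (rule A.kill[OF enc loc(7) e2], rule that)
  interpret B2: covered_algebra R G S2 K p H2 F1 F2 "h2 \<circ> \<phi>1" f1 f2 "h2 (h1 i1)" "h2 (h1 i2)" d1 d2 by (rule cov2)
  interpret h2: ring_hom_cring S1 S2 h2 by unfold_locales (rule h2)
  obtain u2 v2 where uv2: "u2 \<in> F1 (int n - int k)" "v2 \<in> F2 (int n - int k)" "h2 z = u2 \<oplus>\<^bsub>S2\<^esub> v2"
    using dec2 by blast
  have F: "h2 w \<in> F1 m" if "w \<in> E1 m" for w m using D2(1) that by blast
  have F': "h2 w \<in> F2 m" if "w \<in> E2 m" for w m using D2(2) that by blast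
  note \<phi>2F = F[OF \<phi>1E(1)] F'[OF \<phi>1E(2)]
  have zc [simp]: "z \<in> carrier S1" by (rule A.C.graded_familyD(5)[OF A.C.H loc(7)])
  have \<phi>1c: "\<phi>1 w \<in> carrier S1" if "w \<in> carrier R" for w using that by simp
  note [simp] = A.C.graded_familyD(5)[OF A.C.D1 loc(1)] A.C.graded_familyD(5)[OF A.C.D1 loc(2)]
    A.C.graded_familyD(5)[OF A.C.D1 loc(3)] A.C.graded_familyD(5)[OF A.C.D2 loc(4)]
    A.C.graded_familyD(5)[OF A.C.D2 loc(5)] A.C.graded_familyD(5)[OF A.C.D2 loc(6)] \<phi>1c
  let ?\<psi> = "h2 \<circ> \<phi>1"
  have "\<exists>s1\<in>F1 (int n - int d1) \<inter> F2 (int n - int d1). \<exists>s2\<in>F1 (int n - int d2) \<inter> F2 (int n - int d2).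
    \<exists>s3\<in>F1 (int n - int d3) \<inter> F2 (int n - int d3).
    ?\<psi> x = ?\<psi> f1 \<otimes>\<^bsub>S2\<^esub> s1 \<oplus>\<^bsub>S2\<^esub> ?\<psi> f2 \<otimes>\<^bsub>S2\<^esub> s2 \<oplus>\<^bsub>S2\<^esub> ?\<psi> f3 \<otimes>\<^bsub>S2\<^esub> s3"
  proof (rule B2.C.glue_solutions[where k = "int k" and ?g1.0 = "?\<psi> g1" and ?g2.0 = "?\<psi> g2" and ?g3.0 = "?\<psi> g3"
      and ?x1.0 = "h2 x1" and ?x2.0 = "h2 x2" and ?x3.0 = "h2 x3" and ?y1.0 = "h2 y1" and ?y2.0 = "h2 y2" and ?y3.0 = "h2 y3"
      and z = "h2 z" and u = u2 and v = v2])
    show "?\<psi> g1 \<in> F1 (int k - int d1)" "?\<psi> g1 \<in> F2 (int k - int d1)" using \<phi>2F[OF g(1)] by simp_all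
    show "?\<psi> g2 \<in> F1 (int k - int d2)" "?\<psi> g2 \<in> F2 (int k - int d2)" using \<phi>2F[OF g(2)] by simp_all
    show "?\<psi> g3 \<in> F1 (int k - int d3)" "?\<psi> g3 \<in> F2 (int k - int d3)" using \<phi>2F[OF g(3)] by simp_all
    show "?\<psi> f3 \<in> F1 (int d3)" using F[OF G\<phi>1E(1)[OF f3]] by simp
    show "h2 x1 \<in> F1 (int n - int d1)" "h2 x2 \<in> F1 (int n - int d2)" "h2 x3 \<in> F1 (int n - int d3)"
      by (intro F loc)+
    show "h2 y1 \<in> F2 (int n - int d1)" "h2 y2 \<in> F2 (int n - int d2)" "h2 y3 \<in> F2 (int n - int d3)"
      by (intro F' loc)+
    show "?\<psi> f1 \<otimes>\<^bsub>S2\<^esub> ?\<psi> g1 \<oplus>\<^bsub>S2\<^esub> ?\<psi> f2 \<otimes>\<^bsub>S2\<^esub> ?\<psi> g2 \<oplus>\<^bsub>S2\<^esub> ?\<psi> f3 \<otimes>\<^bsub>S2\<^esub> ?\<psi> g3 = \<zero>\<^bsub>S2\<^esub>"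
      using arg_cong[OF rel1, of h2] by simp
    show "?\<psi> x = ?\<psi> f1 \<otimes>\<^bsub>S2\<^esub> h2 x1 \<oplus>\<^bsub>S2\<^esub> ?\<psi> f2 \<otimes>\<^bsub>S2\<^esub> h2 x2 \<oplus>\<^bsub>S2\<^esub> ?\<psi> f3 \<otimes>\<^bsub>S2\<^esub> h2 x3"
      using arg_cong[OF loc(8), of h2] by simp
    show "h2 x1 = h2 y1 \<oplus>\<^bsub>S2\<^esub> h2 z \<otimes>\<^bsub>S2\<^esub> ?\<psi> g1" using arg_cong[OF loc(9), of h2] by simp
    show "h2 x2 = h2 y2 \<oplus>\<^bsub>S2\<^esub> h2 z \<otimes>\<^bsub>S2\<^esub> ?\<psi> g2" using arg_cong[OF loc(10), of h2] by simp
    show "h2 x3 = h2 y3 \<oplus>\<^bsub>S2\<^esub> h2 z \<otimes>\<^bsub>S2\<^esub> ?\<psi> g3" using arg_cong[OF loc(11), of h2] by simp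
  qed (rule uv2)+
  then have "B2.solved f3 x" unfolding B2.solved_def by blast
  moreover have "h2 \<circ> \<phi>1 = (h2 \<circ> h1) \<circ> \<phi>" by (simp add: \<phi>1_def comp_assoc)
  moreover have "h2 \<circ> h1 \<in> ring_hom T S2" by (rule ring_hom_trans[OF h1 h2])
  moreover have "(h2 \<circ> h1) ` D1 m \<subseteq> F1 m" "(h2 \<circ> h1) ` D2 m \<subseteq> F2 m" for m
    using D1[of m] D2[of m] by (auto simp: image_subset_iff)
  ultimately show ?thesis using cov2 by metis
qed

section \<open>The ring of global sections is a finite graded extension\<close>

context covered_algebra
begin

definition B :: "int \<Rightarrow> 'c set" where
  "B n = D1 n \<inter> D2 n"

lemma B: "C.graded_family B"
  unfolding C.graded_family_def
proof (intro conjI allI ballI)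
  show "additive_subgroup (B n) T" for n
    unfolding B_def
    by (rule C.additive_subgroupI')
      (auto intro: C.graded_familyD[OF C.D1] C.graded_familyD[OF C.D2])
  show "\<one>\<^bsub>T\<^esub> \<in> B 0" unfolding B_def using C.graded_familyD(2)[OF C.D1] C.graded_familyD(2)[OF C.D2] by simp
  fix m n a b assume "a \<in> B m" "b \<in> B n"
  then show "a \<otimes>\<^bsub>T\<^esub> b \<in> B (m + n)"
    unfolding B_def using C.graded_familyD(3)[OF C.D1] C.graded_familyD(3)[OF C.D2] by simp
qed

lemma B_closed: "x \<in> B n \<Longrightarrow> x \<in> carrier T"
  by (rule C.graded_familyD(5)[OF B])

lemma B_negative: "n < 0 \<Longrightarrow> x \<in> B n \<Longrightarrow> x = \<zero>\<^bsub>T\<^esub>"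
  using C.negative unfolding B_def by blast

lemma B_H: "x \<in> B n \<Longrightarrow> x \<in> H n"
  using C.D1_H unfolding B_def by blast

lemma \<phi>_B: "x \<in> G n \<Longrightarrow> \<phi> x \<in> B (int n)"
  using \<phi>_D1 \<phi>_D2 unfolding B_def by blast

text \<open>Only nonnegative degrees are summed, so that the ring is graded by \<open>nat\<close>;
  nothing is lost, as \<open>B n\<close> is zero for negative \<open>n\<close>.\<close>

definition sections_carrier :: "'c set" where
  "sections_carrier = {x. \<exists>F c. finite (F :: nat set) \<and> (\<forall>n. c n \<in> B (int n)) \<and> x = (\<Oplus>\<^bsub>T\<^esub>n\<in>F. c n)}"

abbreviation "S \<equiv> T\<lparr>carrier := sections_carrier\<rparr>"

lemma sections_carrier_repr:
  assumes "x \<in> sections_carrier"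
  shows "\<exists>F c. finite F \<and> (\<forall>n. c n \<in> B (int n)) \<and> (\<forall>n. n \<notin> F \<longrightarrow> c n = \<zero>\<^bsub>T\<^esub>) \<and> x = (\<Oplus>\<^bsub>T\<^esub>n\<in>F. c n)"
proof -
  obtain F c where F: "finite F" "\<And>n. c n \<in> B (int n)" "x = (\<Oplus>\<^bsub>T\<^esub>n\<in>F. c n)"
    using assms unfolding sections_carrier_def by blast
  define c' where "c' n = (if n \<in> F then c n else \<zero>\<^bsub>T\<^esub>)" for n
  have "(\<Oplus>\<^bsub>T\<^esub>n\<in>F. c' n) = (\<Oplus>\<^bsub>T\<^esub>n\<in>F. c n)"
    using F(2) B_closed by (intro C.finsum_cong') (auto simp: c'_def)
  then show ?thesis
    using F C.graded_familyD(4)[OF B] by (intro exI[of _ F] exI[of _ c']) (auto simp: c'_def)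
qed

lemma sections_carrier_subset: "sections_carrier \<subseteq> carrier T"
proof
  fix x assume "x \<in> sections_carrier"
  then obtain F :: "nat set" and c where "\<And>n. c n \<in> B (int n)" "x = (\<Oplus>\<^bsub>T\<^esub>n\<in>F. c n)"
    unfolding sections_carrier_def by blast
  then show "x \<in> carrier T" using B_closed by (metis C.finsum_closed Pi_I)
qed

lemma B_sections: "x \<in> B (int n) \<Longrightarrow> x \<in> sections_carrier"
proof -
  assume x: "x \<in> B (int n)"
  define c where "c m = (if m = n then x else \<zero>\<^bsub>T\<^esub>)" for m
  have "(\<Oplus>\<^bsub>T\<^esub>m\<in>{n}. c m) = x" using x B_closed by (simp add: c_def)
  moreover have "c m \<in> B (int m)" for m using x C.graded_familyD(4)[OF B] by (simp add: c_def)
  ultimately show ?thesis unfolding sections_carrier_def by (intro CollectI exI[of _ "{n}"] exI[of _ c]) auto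
qed

lemma sections_carrier_add:
  assumes "x \<in> sections_carrier" "y \<in> sections_carrier"
  shows "x \<oplus>\<^bsub>T\<^esub> y \<in> sections_carrier"
proof -
  obtain F c where F: "finite F" "\<And>n. c n \<in> B (int n)" "\<And>n. n \<notin> F \<Longrightarrow> c n = \<zero>\<^bsub>T\<^esub>" "x = (\<Oplus>\<^bsub>T\<^esub>n\<in>F. c n)"
    using sections_carrier_repr[OF assms(1)] by blast
  obtain F' c' where F': "finite F'" "\<And>n. c' n \<in> B (int n)" "\<And>n. n \<notin> F' \<Longrightarrow> c' n = \<zero>\<^bsub>T\<^esub>" "y = (\<Oplus>\<^bsub>T\<^esub>n\<in>F'. c' n)"
    using sections_carrier_repr[OF assms(2)] by blast
  have cc: "c n \<in> carrier T" "c' n \<in> carrier T" for n using F(2) F'(2) B_closed by blast+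
  have "x = (\<Oplus>\<^bsub>T\<^esub>n\<in>F \<union> F'. c n)" unfolding F(4)
    using F F' cc by (intro C.add.finprod_mono_neutral_cong_left) auto
  moreover have "y = (\<Oplus>\<^bsub>T\<^esub>n\<in>F \<union> F'. c' n)" unfolding F'(4)
    using F F' cc by (intro C.add.finprod_mono_neutral_cong_left) auto
  ultimately have "x \<oplus>\<^bsub>T\<^esub> y = (\<Oplus>\<^bsub>T\<^esub>n\<in>F \<union> F'. c n \<oplus>\<^bsub>T\<^esub> c' n)"
    using cc by (simp add: C.finsum_addf Pi_iff)
  moreover have "c n \<oplus>\<^bsub>T\<^esub> c' n \<in> B (int n)" for n using F(2) F'(2) C.graded_familyD(7)[OF B] by blast
  ultimately show ?thesis unfolding sections_carrier_def using F(1) F'(1)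
    by (intro CollectI exI[of _ "F \<union> F'"] exI[of _ "\<lambda>n. c n \<oplus>\<^bsub>T\<^esub> c' n"]) auto
qed

lemma sections_carrier_zero: "\<zero>\<^bsub>T\<^esub> \<in> sections_carrier"
  using B_sections[of "\<zero>\<^bsub>T\<^esub>" 0] C.graded_familyD(4)[OF B] by simp

lemma sections_carrier_finsum:
  assumes "finite F" "\<And>n. n \<in> F \<Longrightarrow> x n \<in> sections_carrier"
  shows "(\<Oplus>\<^bsub>T\<^esub>n\<in>F. x n) \<in> sections_carrier"
  using assms
proof (induction F rule: finite_induct)
  case empty
  then show ?case using sections_carrier_zero by simp
next
  case (insert n F)
  have "(\<Oplus>\<^bsub>T\<^esub>n\<in>insert n F. x n) = x n \<oplus>\<^bsub>T\<^esub> (\<Oplus>\<^bsub>T\<^esub>n\<in>F. x n)"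
    using insert sections_carrier_subset by (intro C.finsum_insert) auto
  then show ?case using insert sections_carrier_add by simp
qed

lemma sections_carrier_mult:
  assumes "x \<in> sections_carrier" "y \<in> sections_carrier"
  shows "x \<otimes>\<^bsub>T\<^esub> y \<in> sections_carrier"
proof -
  obtain F c where F: "finite F" "\<And>n. c n \<in> B (int n)" "x = (\<Oplus>\<^bsub>T\<^esub>n\<in>F. c n)"
    using sections_carrier_repr[OF assms(1)] by blast
  obtain F' c' where F': "finite F'" "\<And>n. c' n \<in> B (int n)" "y = (\<Oplus>\<^bsub>T\<^esub>n\<in>F'. c' n)"
    using sections_carrier_repr[OF assms(2)] by blast
  have yc: "y \<in> carrier T" using assms(2) sections_carrier_subset by blast
  have cc: "c n \<in> carrier T" "c' n \<in> carrier T" for n using F(2) F'(2) B_closed by blast+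
  have "c n \<otimes>\<^bsub>T\<^esub> c' m \<in> sections_carrier" for n m
    using C.graded_familyD(3)[OF B F(2)[of n] F'(2)[of m]] B_sections[of _ "n + m"] by simp
  then have "(\<Oplus>\<^bsub>T\<^esub>m\<in>F'. c n \<otimes>\<^bsub>T\<^esub> c' m) \<in> sections_carrier" for n
    using F'(1) by (intro sections_carrier_finsum)
  then have "c n \<otimes>\<^bsub>T\<^esub> y \<in> sections_carrier" for n
    unfolding F'(3) using F'(1) cc by (subst C.finsum_rdistr) auto
  then have "(\<Oplus>\<^bsub>T\<^esub>n\<in>F. c n \<otimes>\<^bsub>T\<^esub> y) \<in> sections_carrier"
    using F(1) by (intro sections_carrier_finsum)
  then show ?thesis unfolding F(3) using F(1) cc yc by (subst C.finsum_ldistr) auto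
qed

lemma sections_carrier_neg:
  assumes "x \<in> sections_carrier"
  shows "\<ominus>\<^bsub>T\<^esub> x \<in> sections_carrier"
proof -
  have "\<ominus>\<^bsub>T\<^esub> \<one>\<^bsub>T\<^esub> \<in> sections_carrier"
    using B_sections[of _ 0] C.graded_familyD(2,6)[OF B] by simp
  from sections_carrier_mult[OF this assms] show ?thesis
    using assms sections_carrier_subset by (auto simp: C.l_minus)
qed

lemma S_subcring: "subcring sections_carrier T"
proof (rule C.subcringI')
  show "subring sections_carrier T"
    using sections_carrier_subset sections_carrier_neg sections_carrier_mult sections_carrier_add
      B_sections[of _ 0] C.graded_familyD(2)[OF B]
    by (intro C.subringI) auto
qed

sublocale S: cring S
  using C.subcring_iff[OF sections_carrier_subset] S_subcring by simp

lemma S_finsum: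
  assumes "\<And>i. i \<in> F \<Longrightarrow> x i \<in> sections_carrier"
  shows "(\<Oplus>\<^bsub>S\<^esub>i\<in>F. x i) = (\<Oplus>\<^bsub>T\<^esub>i\<in>F. x i)"
proof -
  have "(\<lambda>x. x) \<in> ring_hom S T"
    using sections_carrier_subset by (intro ring_hom_memI) auto
  then interpret incl: ring_hom_cring S T "\<lambda>x. x" by unfold_locales
  show ?thesis using incl.hom_finsum[of x F] assms by (simp add: Pi_iff comp_def)
qed

text \<open>Existence of components is built into the carrier; uniqueness comes from the
  independence of degrees inside \<open>H\<close>.\<close>

lemma sections_graded: "graded_cring S (\<lambda>n. B (int n))"
proof (intro graded_cring.intro graded_cring_axioms.intro)
  show "cring S" by (rule S.is_cring)
  show "additive_subgroup (B (int n)) S" for n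
  proof (rule S.additive_subgroupI')
    show "B (int n) \<subseteq> carrier S" using B_sections by auto
    show "\<ominus>\<^bsub>S\<^esub> a \<in> B (int n)" if "a \<in> B (int n)" for a
    proof -
      have "\<ominus>\<^bsub>S\<^esub> a = \<ominus>\<^bsub>T\<^esub> a"
        using that B_sections B_closed C.graded_familyD(6)[OF B that] C.r_neg[of a]
        by (intro S.minus_equality) (auto simp: C.l_neg)
      then show ?thesis using C.graded_familyD(6)[OF B that] by simp
    qed
  qed (use C.graded_familyD(4,7)[OF B] in auto)
  show "\<one>\<^bsub>S\<^esub> \<in> B (int 0)" using C.graded_familyD(2)[OF B] by simp
  show "a \<otimes>\<^bsub>S\<^esub> b \<in> B (int (i + j))" if "a \<in> B (int i)" "b \<in> B (int j)" for a b i j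
    using C.graded_familyD(3)[OF B that] by simp
next
  fix x assume "x \<in> carrier S"
  then have "x \<in> sections_carrier" by simp
  from sections_carrier_repr[OF this]
  obtain F c where F: "finite F" "\<And>n. c n \<in> B (int n)" "\<And>n. n \<notin> F \<Longrightarrow> c n = \<zero>\<^bsub>T\<^esub>" "x = (\<Oplus>\<^bsub>T\<^esub>n\<in>F. c n)"
    by blast
  have supp: "(\<Oplus>\<^bsub>S\<^esub>n\<in>{n. c n \<noteq> \<zero>\<^bsub>S\<^esub>}. c n) = (\<Oplus>\<^bsub>T\<^esub>n\<in>{n. c n \<noteq> \<zero>\<^bsub>T\<^esub>}. c n)"
    if "\<And>n. c n \<in> B (int n)" for c
    using that B_sections by (subst S_finsum) auto
  have sum_supp: "(\<Oplus>\<^bsub>T\<^esub>n\<in>{n. c n \<noteq> \<zero>\<^bsub>T\<^esub>}. c n) = (\<Oplus>\<^bsub>T\<^esub>n\<in>A. c n)"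
    if "finite A" "{n. c n \<noteq> \<zero>\<^bsub>T\<^esub>} \<subseteq> A" "\<And>n. c n \<in> B (int n)" for A c
    using that B_closed by (intro C.add.finprod_mono_neutral_cong_left) auto
  show "\<exists>!c. (\<forall>n. c n \<in> B (int n)) \<and> finite {n. c n \<noteq> \<zero>\<^bsub>S\<^esub>} \<and> x = (\<Oplus>\<^bsub>S\<^esub>n\<in>{n. c n \<noteq> \<zero>\<^bsub>S\<^esub>}. c n)"
  proof (rule ex1I[of _ c])
    have sub: "{n. c n \<noteq> \<zero>\<^bsub>T\<^esub>} \<subseteq> F" using F(3) by blast
    then show "(\<forall>n. c n \<in> B (int n)) \<and> finite {n. c n \<noteq> \<zero>\<^bsub>S\<^esub>} \<and> x = (\<Oplus>\<^bsub>S\<^esub>n\<in>{n. c n \<noteq> \<zero>\<^bsub>S\<^esub>}. c n)"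
      using F finite_subset[OF sub F(1)] sum_supp[OF F(1) sub F(2)] supp[OF F(2)] by simp
  next
    fix c' assume c': "(\<forall>n. c' n \<in> B (int n)) \<and> finite {n. c' n \<noteq> \<zero>\<^bsub>S\<^esub>} \<and> x = (\<Oplus>\<^bsub>S\<^esub>n\<in>{n. c' n \<noteq> \<zero>\<^bsub>S\<^esub>}. c' n)"
    then have c'B: "\<And>n. c' n \<in> B (int n)" and fin: "finite {n. c' n \<noteq> \<zero>\<^bsub>T\<^esub>}" by auto
    define A where "A = F \<union> {n. c' n \<noteq> \<zero>\<^bsub>T\<^esub>}"
    have A: "finite A" "{n. c n \<noteq> \<zero>\<^bsub>T\<^esub>} \<subseteq> A" "{n. c' n \<noteq> \<zero>\<^bsub>T\<^esub>} \<subseteq> A" using F(1,3) fin by (auto simp: A_def)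
    have cc: "c n \<in> carrier T" "c' n \<in> carrier T" for n using F(2) c'B B_closed by blast+
    have xA: "x = (\<Oplus>\<^bsub>T\<^esub>n\<in>A. c n)" unfolding F(4)
      using A F cc by (intro C.add.finprod_mono_neutral_cong_left) (auto simp: A_def)
    have xA': "x = (\<Oplus>\<^bsub>T\<^esub>n\<in>A. c' n)" using c' supp[OF c'B] sum_supp[OF A(1,3) c'B] by simp
    have diff: "c n \<oplus>\<^bsub>T\<^esub> (\<ominus>\<^bsub>T\<^esub> \<one>\<^bsub>T\<^esub>) \<otimes>\<^bsub>T\<^esub> c' n \<in> B (int n)" for n
      using C.graded_familyD(7)[OF B F(2)] C.graded_familyD(6)[OF B c'B] cc by (simp add: C.l_minus)
    have "(\<Oplus>\<^bsub>T\<^esub>n\<in>A. c n \<oplus>\<^bsub>T\<^esub> (\<ominus>\<^bsub>T\<^esub> \<one>\<^bsub>T\<^esub>) \<otimes>\<^bsub>T\<^esub> c' n) = x \<oplus>\<^bsub>T\<^esub> (\<ominus>\<^bsub>T\<^esub> \<one>\<^bsub>T\<^esub>) \<otimes>\<^bsub>T\<^esub> x"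
    proof -
      have "(\<Oplus>\<^bsub>T\<^esub>n\<in>A. c n \<oplus>\<^bsub>T\<^esub> (\<ominus>\<^bsub>T\<^esub> \<one>\<^bsub>T\<^esub>) \<otimes>\<^bsub>T\<^esub> c' n)
          = (\<Oplus>\<^bsub>T\<^esub>n\<in>A. c n) \<oplus>\<^bsub>T\<^esub> (\<Oplus>\<^bsub>T\<^esub>n\<in>A. (\<ominus>\<^bsub>T\<^esub> \<one>\<^bsub>T\<^esub>) \<otimes>\<^bsub>T\<^esub> c' n)"
        using cc by (intro C.finsum_addf) auto
      also have "(\<Oplus>\<^bsub>T\<^esub>n\<in>A. (\<ominus>\<^bsub>T\<^esub> \<one>\<^bsub>T\<^esub>) \<otimes>\<^bsub>T\<^esub> c' n) = (\<ominus>\<^bsub>T\<^esub> \<one>\<^bsub>T\<^esub>) \<otimes>\<^bsub>T\<^esub> (\<Oplus>\<^bsub>T\<^esub>n\<in>A. c' n)"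
        using cc A(1) by (intro C.finsum_rdistr[symmetric]) auto
      finally show ?thesis using xA xA' by simp
    qed
    also have "\<dots> = \<zero>\<^bsub>T\<^esub>"
    proof -
      have "x \<in> carrier T" unfolding xA using cc by auto
      then show ?thesis by (simp add: C.l_minus C.r_neg)
    qed
    finally have sum0: "(\<Oplus>\<^bsub>T\<^esub>n\<in>A. c n \<oplus>\<^bsub>T\<^esub> (\<ominus>\<^bsub>T\<^esub> \<one>\<^bsub>T\<^esub>) \<otimes>\<^bsub>T\<^esub> c' n) = \<zero>\<^bsub>T\<^esub>" .
    \<comment> \<open>The differences of two decompositions, transferred to the integer indices of
      \<open>C.indep\<close>.\<close>
    define w where "w m = c (nat m) \<oplus>\<^bsub>T\<^esub> (\<ominus>\<^bsub>T\<^esub> \<one>\<^bsub>T\<^esub>) \<otimes>\<^bsub>T\<^esub> c' (nat m)" for m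
    have wc: "w m \<in> carrier T" for m unfolding w_def using cc by simp
    have "(\<Oplus>\<^bsub>T\<^esub>m\<in>int ` A. w m) = (\<Oplus>\<^bsub>T\<^esub>n\<in>A. w (int n))"
      using wc by (intro C.finsum_reindex) auto
    then have "(\<Oplus>\<^bsub>T\<^esub>m\<in>int ` A. w m) = \<zero>\<^bsub>T\<^esub>" using sum0 by (simp add: w_def)
    then have wz: "w (int n) = \<zero>\<^bsub>T\<^esub>" if "n \<in> A" for n
      using A(1) that diff B_H by (intro C.indep[of "int ` A" w]) (auto simp: w_def)
    have "c' n = c n" for n
    proof (cases "n \<in> A")
      case True
      have "c n \<ominus>\<^bsub>T\<^esub> c' n = \<zero>\<^bsub>T\<^esub>"
        using wz[OF True] cc[of n] by (simp add: w_def C.l_minus C.minus_eq)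
      then show ?thesis using cc by (simp add: C.r_right_minus_eq)
    next
      case False
      then have "c n = \<zero>\<^bsub>T\<^esub>" "c' n = \<zero>\<^bsub>T\<^esub>" using A(2,3) by blast+
      then show ?thesis by simp
    qed
    then show "c' = c" by blast
  qed
qed

definition module_span :: "'c set \<Rightarrow> 'c set" where
  "module_span Bs = {x. \<exists>c \<in> Bs \<rightarrow> carrier R. x = (\<Oplus>\<^bsub>T\<^esub>b\<in>Bs. \<phi> (c b) \<otimes>\<^bsub>T\<^esub> b)}"

lemma
  assumes Bs: "Bs \<subseteq> carrier T" "finite Bs"
  shows module_span_add: "x \<in> module_span Bs \<Longrightarrow> y \<in> module_span Bs \<Longrightarrow> x \<oplus>\<^bsub>T\<^esub> y \<in> module_span Bs"
    and module_span_smult: "r \<in> carrier R \<Longrightarrow> x \<in> module_span Bs \<Longrightarrow> \<phi> r \<otimes>\<^bsub>T\<^esub> x \<in> module_span Bs"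
    and module_span_base: "b \<in> Bs \<Longrightarrow> b \<in> module_span Bs"
    and module_span_zero: "\<zero>\<^bsub>T\<^esub> \<in> module_span Bs"
proof -
  show "x \<oplus>\<^bsub>T\<^esub> y \<in> module_span Bs" if xy: "x \<in> module_span Bs" "y \<in> module_span Bs" for x y
  proof -
    obtain c c' where c: "c \<in> Bs \<rightarrow> carrier R" "x = (\<Oplus>\<^bsub>T\<^esub>b\<in>Bs. \<phi> (c b) \<otimes>\<^bsub>T\<^esub> b)"
      and c': "c' \<in> Bs \<rightarrow> carrier R" "y = (\<Oplus>\<^bsub>T\<^esub>b\<in>Bs. \<phi> (c' b) \<otimes>\<^bsub>T\<^esub> b)"
      using xy unfolding module_span_def by blast
    have cc: "c b \<in> carrier R" "c' b \<in> carrier R" "b \<in> carrier T" if "b \<in> Bs" for b using that c c' Bs by auto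
    have "(\<Oplus>\<^bsub>T\<^esub>b\<in>Bs. \<phi> (c b \<oplus> c' b) \<otimes>\<^bsub>T\<^esub> b) = (\<Oplus>\<^bsub>T\<^esub>b\<in>Bs. \<phi> (c b) \<otimes>\<^bsub>T\<^esub> b \<oplus>\<^bsub>T\<^esub> \<phi> (c' b) \<otimes>\<^bsub>T\<^esub> b)"
      using cc by (intro C.finsum_cong') (auto simp: C.l_distr)
    also have "\<dots> = x \<oplus>\<^bsub>T\<^esub> y"
      unfolding c(2) c'(2) using cc by (intro C.finsum_addf) auto
    finally show ?thesis
      unfolding module_span_def using cc by (intro CollectI bexI[of _ "\<lambda>b. c b \<oplus> c' b"]) auto
  qed
  show smult: "\<phi> r \<otimes>\<^bsub>T\<^esub> x \<in> module_span Bs" if r: "r \<in> carrier R" and x: "x \<in> module_span Bs" for r x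
  proof -
    obtain c where c: "c \<in> Bs \<rightarrow> carrier R" "x = (\<Oplus>\<^bsub>T\<^esub>b\<in>Bs. \<phi> (c b) \<otimes>\<^bsub>T\<^esub> b)"
      using x unfolding module_span_def by blast
    have cc: "c b \<in> carrier R" "b \<in> carrier T" if "b \<in> Bs" for b using that c Bs by auto
    have "\<phi> r \<otimes>\<^bsub>T\<^esub> x = (\<Oplus>\<^bsub>T\<^esub>b\<in>Bs. \<phi> r \<otimes>\<^bsub>T\<^esub> (\<phi> (c b) \<otimes>\<^bsub>T\<^esub> b))"
      unfolding c(2) using cc r Bs by (intro C.finsum_rdistr) auto
    also have "\<dots> = (\<Oplus>\<^bsub>T\<^esub>b\<in>Bs. \<phi> (r \<otimes> c b) \<otimes>\<^bsub>T\<^esub> b)"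
      using cc r by (intro C.finsum_cong') (auto simp: C.m_assoc)
    finally show ?thesis
      unfolding module_span_def using cc r by (intro CollectI bexI[of _ "\<lambda>b. r \<otimes> c b"]) auto
  qed
  show base: "b \<in> module_span Bs" if b: "b \<in> Bs" for b
  proof -
    have "(\<Oplus>\<^bsub>T\<^esub>b'\<in>Bs. \<phi> (if b' = b then \<one> else \<zero>) \<otimes>\<^bsub>T\<^esub> b') = (\<Oplus>\<^bsub>T\<^esub>b'\<in>Bs. if b = b' then b' else \<zero>\<^bsub>T\<^esub>)"
      using Bs by (intro C.finsum_cong') auto
    also have "\<dots> = b" using Bs b by (intro C.finsum_singleton) auto
    finally show ?thesis
      unfolding module_span_def by (intro CollectI bexI[of _ "\<lambda>b'. if b' = b then \<one> else \<zero>"]) auto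
  qed
  show "\<zero>\<^bsub>T\<^esub> \<in> module_span Bs"
  proof -
    have "(\<Oplus>\<^bsub>T\<^esub>b\<in>Bs. \<phi> \<zero> \<otimes>\<^bsub>T\<^esub> b) = (\<Oplus>\<^bsub>T\<^esub>b\<in>Bs. \<zero>\<^bsub>T\<^esub>)"
      using Bs by (intro C.finsum_cong') auto
    then show ?thesis unfolding module_span_def by (intro CollectI bexI[of _ "\<lambda>_. \<zero>"]) auto
  qed
qed

lemma B_basis: "\<exists>Vs. set Vs \<subseteq> B n \<and> C.Span (\<phi> ` K) Vs = B n"
proof -
  have "subalgebra (\<phi> ` K) (B n) T"
  proof (intro subalgebra.intro subalgebra_axioms.intro)
    show "subgroup (B n) (add_monoid T)"
      using additive_subgroup.a_subgroup[OF C.graded_familyD(1)[OF B]] .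
    show "k \<otimes>\<^bsub>T\<^esub> v \<in> B n" if "k \<in> \<phi> ` K" "v \<in> B n" for k v
      using C.graded_familyD(3)[OF B, of k 0 v n] that C.K_D1 C.K_D2 by (auto simp: B_def)
  qed
  then show ?thesis
    using C.sections_finite[of n] C.subalgebra_in_Span_obtain[OF C.K] unfolding B_def by metis
qed

text \<open>Above \<open>n0\<close> every section is \<open>f1 a + f2 b\<close> with sections of
  smaller degree, so finite bases in the degrees from \<open>0\<close> to \<open>n0\<close> generate
  the module over \<open>R\<close>.\<close>

lemma module_finite:
  "\<exists>Bs. finite Bs \<and> Bs \<subseteq> sections_carrier \<and> sections_carrier \<subseteq> module_span Bs"
proof -
  obtain n0 where n0: "\<And>n x. n \<ge> n0 \<Longrightarrow> x \<in> B n \<Longrightarrow> \<exists>a\<in>B (n - int d1). \<exists>b\<in>B (n - int d2).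
      x = \<phi> f1 \<otimes>\<^bsub>T\<^esub> a \<oplus>\<^bsub>T\<^esub> \<phi> f2 \<otimes>\<^bsub>T\<^esub> b"
    using C.sections_generated unfolding B_def by blast
  have "\<forall>n. \<exists>Vs. set Vs \<subseteq> B n \<and> C.Span (\<phi> ` K) Vs = B n" using B_basis by blast
  then obtain Vs where Vs: "\<And>n. set (Vs n) \<subseteq> B n" "\<And>n. C.Span (\<phi> ` K) (Vs n) = B n" by metis
  define Bs where "Bs = (\<Union>n\<in>{0..n0}. set (Vs n))"
  have fin: "finite Bs" by (simp add: Bs_def)
  have BsS: "Bs \<subseteq> sections_carrier"
  proof
    fix x assume "x \<in> Bs"
    then obtain n where "0 \<le> n" "x \<in> set (Vs n)" unfolding Bs_def by auto
    then have "0 \<le> n" "x \<in> B n" using Vs(1) by blast+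
    then show "x \<in> sections_carrier" using B_sections[of x "nat n"] by simp
  qed
  then have BsT: "Bs \<subseteq> carrier T" using sections_carrier_subset by blast
  note madd = module_span_add[OF BsT fin] and msm = module_span_smult[OF BsT fin]
    and mbase = module_span_base[OF BsT fin] and mz = module_span_zero[OF BsT fin]
  have mc: "module_span Bs \<subseteq> carrier T"
  proof
    fix x assume "x \<in> module_span Bs"
    then obtain c where "c \<in> Bs \<rightarrow> carrier R" "x = (\<Oplus>\<^bsub>T\<^esub>b\<in>Bs. \<phi> (c b) \<otimes>\<^bsub>T\<^esub> b)"
      unfolding module_span_def by blast
    then show "x \<in> carrier T" using BsT by (auto intro!: C.finsum_closed)
  qed
  have mneg: "\<ominus>\<^bsub>T\<^esub> x \<in> module_span Bs" if "x \<in> module_span Bs" for x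
  proof -
    have xc: "x \<in> carrier T" using that mc by blast
    have "\<phi> (\<ominus> \<one>) \<otimes>\<^bsub>T\<^esub> x \<in> module_span Bs" by (rule msm[OF _ that]) simp
    then show ?thesis using xc by (simp add: C.l_minus)
  qed
  have msub: "subalgebra (\<phi> ` K) (module_span Bs) T"
  proof (intro subalgebra.intro subalgebra_axioms.intro)
    show "subgroup (module_span Bs) (add_monoid T)"
      by (rule additive_subgroup.a_subgroup[OF C.additive_subgroupI'[OF mc mz mneg madd]])
    show "k \<otimes>\<^bsub>T\<^esub> v \<in> module_span Bs" if "k \<in> \<phi> ` K" "v \<in> module_span Bs" for k v
      using msm that K_R by blast
  qed
  have small: "B n \<subseteq> module_span Bs" if "n \<le> n0" for n
  proof (cases "n < 0")
    case True
    then show ?thesis using B_negative mz by blast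
  next
    case False
    then have "n \<in> {0..n0}" using that by simp
    then have "set (Vs n) \<subseteq> Bs" unfolding Bs_def by (rule UN_upper)
    then have "set (Vs n) \<subseteq> module_span Bs" using mbase by blast
    then show ?thesis using C.subalgebra_Span_incl[OF C.K msub] Vs(2) by metis
  qed
  have all: "B n \<subseteq> module_span Bs" for n
  \<comment> \<open>Above \<open>n0\<close> the measure decreases because \<open>d1\<close> and
    \<open>d2\<close> are positive; at or below \<open>n0\<close> it is zero and
    \<open>small\<close> applies.\<close>
  proof (induction "nat (n - n0)" arbitrary: n rule: less_induct)
    case less
    show ?case
    proof (cases "n \<le> n0")
      case True
      then show ?thesis by (rule small)
    next
      case False
      show ?thesis
      proof
        fix x assume x: "x \<in> B n"
        then obtain a b where ab: "a \<in> B (n - int d1)" "b \<in> B (n - int d2)"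
          "x = \<phi> f1 \<otimes>\<^bsub>T\<^esub> a \<oplus>\<^bsub>T\<^esub> \<phi> f2 \<otimes>\<^bsub>T\<^esub> b" using n0[of n x] False by auto
        have "a \<in> module_span Bs" "b \<in> module_span Bs"
          using less[of "n - int d1"] less[of "n - int d2"] ab(1,2) C.d_pos False by auto
        then show "x \<in> module_span Bs"
          unfolding ab(3) using G_carrier[OF f1_G] G_carrier[OF f2_G] by (intro madd msm)
      qed
    qed
  qed
  have "sections_carrier \<subseteq> module_span Bs"
  proof
    fix x assume "x \<in> sections_carrier"
    from sections_carrier_repr[OF this]
    obtain F c where F: "finite F" "\<And>n. c n \<in> B (int n)" "x = (\<Oplus>\<^bsub>T\<^esub>n\<in>F. c n)" by blast
    show "x \<in> module_span Bs" unfolding F(3)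
      using F all by (intro C.additive_subgroup_finsum[OF C.additive_subgroupI'[OF mc mz mneg madd]]) auto
  qed
  then show ?thesis using fin BsS by blast
qed

lemma \<phi>_sections: "r \<in> carrier R \<Longrightarrow> \<phi> r \<in> sections_carrier"
proof -
  assume r: "r \<in> carrier R"
  obtain c where c: "\<And>n. c n \<in> G n" "finite {n. c n \<noteq> \<zero>}" "r = (\<Oplus>n\<in>{n. c n \<noteq> \<zero>}. c n)"
    using ex1_implies_ex[OF B.decomposition[OF r]] by blast
  have cc: "c n \<in> carrier R" for n using c(1) G_carrier by blast
  have "\<phi> r = (\<Oplus>\<^bsub>T\<^esub>n\<in>{n. c n \<noteq> \<zero>}. \<phi> (c n))"
    unfolding c(3) using cc by (subst hom.hom_finsum) (auto simp: comp_def)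
  then show "\<phi> r \<in> sections_carrier"
    unfolding sections_carrier_def using c(1,2) \<phi>_B
    by (intro CollectI exI[of _ "{n. c n \<noteq> \<zero>}"] exI[of _ "\<lambda>n. \<phi> (c n)"]) auto
qed

lemma sections_extension: "finite_graded_extension R G S (\<lambda>n. B (int n)) \<phi>"
proof (intro finite_graded_extension.intro finite_graded_extension_axioms.intro)
  show "graded_cring R G" by unfold_locales
  show "graded_cring S (\<lambda>n. B (int n))" by (rule sections_graded)
  show "\<phi> \<in> ring_hom R S"
    using \<phi>_sections hom.hom_mult hom.hom_add by (intro ring_hom_memI) auto
  show "inj_on \<phi> (carrier R)" by (rule inj)
  show "\<phi> ` G n \<subseteq> B (int n)" for n using \<phi>_B by blast
  obtain Bs where Bs: "finite Bs" "Bs \<subseteq> sections_carrier" "sections_carrier \<subseteq> module_span Bs"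
    using module_finite by blast
  have "\<exists>c. c \<in> Bs \<rightarrow> carrier R \<and> s = (\<Oplus>\<^bsub>S\<^esub>b\<in>Bs. \<phi> (c b) \<otimes>\<^bsub>S\<^esub> b)" if s: "s \<in> carrier S" for s
  proof -
    obtain c where c: "c \<in> Bs \<rightarrow> carrier R" "s = (\<Oplus>\<^bsub>T\<^esub>b\<in>Bs. \<phi> (c b) \<otimes>\<^bsub>T\<^esub> b)"
      using s Bs(3) unfolding module_span_def by auto
    have "(\<Oplus>\<^bsub>S\<^esub>b\<in>Bs. \<phi> (c b) \<otimes>\<^bsub>T\<^esub> b) = (\<Oplus>\<^bsub>T\<^esub>b\<in>Bs. \<phi> (c b) \<otimes>\<^bsub>T\<^esub> b)"
      using c(1) Bs(2) \<phi>_sections by (intro S_finsum sections_carrier_mult) auto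
    then show ?thesis using c by (intro exI[of _ c]) simp
  qed
  then show "\<exists>Bs. finite Bs \<and> Bs \<subseteq> carrier S \<and>
      (\<forall>s\<in>carrier S. \<exists>c. c \<in> Bs \<rightarrow> carrier R \<and> s = (\<Oplus>\<^bsub>S\<^esub>b\<in>Bs. \<phi> (c b) \<otimes>\<^bsub>S\<^esub> b))"
    using Bs(1,2) by (intro exI[of _ Bs]) auto
qed

lemma solved_in_ideal:
  assumes "solved f3 x" and f3: "f3 \<in> carrier R"
  shows "\<phi> x \<in> Idl\<^bsub>S\<^esub> (\<phi> ` {f1, f2, f3})"
proof -
  obtain m1 m2 m3 s1 s2 s3 where s: "s1 \<in> B m1" "s2 \<in> B m2" "s3 \<in> B m3"
    and eq: "\<phi> x = \<phi> f1 \<otimes>\<^bsub>T\<^esub> s1 \<oplus>\<^bsub>T\<^esub> \<phi> f2 \<otimes>\<^bsub>T\<^esub> s2 \<oplus>\<^bsub>T\<^esub> \<phi> f3 \<otimes>\<^bsub>T\<^esub> s3"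
    using assms(1) unfolding solved_def B_def by blast
  have sS: "s \<in> carrier S" if "s \<in> B m" for s m
  proof (cases "m < 0")
    case True
    then show ?thesis using B_negative[OF True that] sections_carrier_zero by simp
  next
    case False
    then show ?thesis using B_sections[of s "nat m"] that by simp
  qed
  define J where "J = Idl\<^bsub>S\<^esub> (\<phi> ` {f1, f2, f3})"
  have sub: "\<phi> ` {f1, f2, f3} \<subseteq> carrier S"
    using \<phi>_sections G_carrier[OF f1_G] G_carrier[OF f2_G] f3 by auto
  interpret J: ideal J S unfolding J_def by (rule S.genideal_ideal[OF sub])
  have "\<phi> f1 \<in> J" "\<phi> f2 \<in> J" "\<phi> f3 \<in> J" using S.genideal_self[OF sub] unfolding J_def by auto
  then have "\<phi> f1 \<otimes>\<^bsub>S\<^esub> s1 \<oplus>\<^bsub>S\<^esub> \<phi> f2 \<otimes>\<^bsub>S\<^esub> s2 \<oplus>\<^bsub>S\<^esub> \<phi> f3 \<otimes>\<^bsub>S\<^esub> s3 \<in> J"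
    using s sS by (intro J.a_closed J.I_r_closed)
  then show ?thesis unfolding eq J_def by simp
qed

end

section \<open>Homogeneous components\<close>

context graded_cring
begin

lemma G_subset: "x \<in> G n \<Longrightarrow> x \<in> carrier R"
  using additive_subgroup.a_subset[OF component_subgroup] by blast

lemma G_zero: "\<zero> \<in> G n"
  by (rule additive_subgroup.zero_closed[OF component_subgroup])

lemma G_add: "x \<in> G n \<Longrightarrow> y \<in> G n \<Longrightarrow> x \<oplus> y \<in> G n"
  by (rule additive_subgroup.a_closed[OF component_subgroup])

lemma G_neg: "x \<in> G n \<Longrightarrow> \<ominus> x \<in> G n"
  using additive_subgroup.a_inv_closed[OF component_subgroup] by blast

lemma G_pow: "a \<in> G n \<Longrightarrow> a [^] (k :: nat) \<in> G (k * n)"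
proof (induction k)
  case 0
  then show ?case using one_component by simp
next
  case (Suc k)
  then show ?case using mult_component[OF Suc.IH Suc.prems] by (simp add: add.commute)
qed

definition proj :: "nat \<Rightarrow> 'a \<Rightarrow> 'a" where
  "proj n x = (THE c. (\<forall>n. c n \<in> G n) \<and> finite {n. c n \<noteq> \<zero>} \<and> x = (\<Oplus>n\<in>{n. c n \<noteq> \<zero>}. c n)) n"

lemma proj_props:
  assumes "x \<in> carrier R"
  shows "proj n x \<in> G n" "finite {n. proj n x \<noteq> \<zero>}" "x = (\<Oplus>n\<in>{n. proj n x \<noteq> \<zero>}. proj n x)"
  using theI'[OF decomposition[OF assms]] unfolding proj_def by blast+

lemma proj_closed [simp]: "x \<in> carrier R \<Longrightarrow> proj n x \<in> carrier R"
  using proj_props(1) G_subset by blast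

lemma proj_unique:
  assumes "\<And>n. c n \<in> G n" "finite A" "\<And>n. n \<notin> A \<Longrightarrow> c n = \<zero>" "x = (\<Oplus>n\<in>A. c n)"
  shows "proj n x = c n"
proof -
  have cc: "c n \<in> carrier R" for n using assms(1) G_subset by blast
  then have x: "x \<in> carrier R" using assms(4) by auto
  have sub: "{n. c n \<noteq> \<zero>} \<subseteq> A" using assms(3) by blast
  have "x = (\<Oplus>n\<in>{n. c n \<noteq> \<zero>}. c n)"
    unfolding assms(4) using assms(2) sub cc by (intro add.finprod_mono_neutral_cong_right) auto
  moreover have "finite {n. c n \<noteq> \<zero>}" using sub assms(2) by (rule finite_subset)
  ultimately have "(THE c. (\<forall>n. c n \<in> G n) \<and> finite {n. c n \<noteq> \<zero>} \<and> x = (\<Oplus>n\<in>{n. c n \<noteq> \<zero>}. c n)) = c"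
    using assms(1) by (intro the1_equality[OF decomposition[OF x]]) blast
  then show ?thesis unfolding proj_def by simp
qed

lemma proj_sum:
  assumes "x \<in> carrier R" "finite A" "\<And>n. n \<notin> A \<Longrightarrow> proj n x = \<zero>"
  shows "x = (\<Oplus>n\<in>A. proj n x)"
proof -
  have "(\<Oplus>n\<in>{n. proj n x \<noteq> \<zero>}. proj n x) = (\<Oplus>n\<in>A. proj n x)"
    using assms by (intro add.finprod_mono_neutral_cong_left) auto
  then show ?thesis using proj_props(3)[OF assms(1)] by simp
qed

lemma proj_homogeneous: "x \<in> G n \<Longrightarrow> proj m x = (if m = n then x else \<zero>)"
  using G_subset G_zero by (intro proj_unique[where c = "\<lambda>m. if m = n then x else \<zero>" and A = "{n}"]) auto

lemma proj_add:
  assumes "x \<in> carrier R" "y \<in> carrier R"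
  shows "proj n (x \<oplus> y) = proj n x \<oplus> proj n y"
proof (rule proj_unique)
  let ?A = "{n. proj n x \<noteq> \<zero>} \<union> {n. proj n y \<noteq> \<zero>}"
  show fin: "finite ?A" using proj_props(2) assms by simp
  show "proj n x \<oplus> proj n y \<in> G n" for n using proj_props(1) assms G_add by blast
  show "proj n x \<oplus> proj n y = \<zero>" if "n \<notin> ?A" for n using that by simp
  have "x = (\<Oplus>n\<in>?A. proj n x)" "y = (\<Oplus>n\<in>?A. proj n y)"
    using proj_sum[OF assms(1) fin] proj_sum[OF assms(2) fin] by auto
  then show "x \<oplus> y = (\<Oplus>n\<in>?A. proj n x \<oplus> proj n y)"
    using assms by (simp add: finsum_addf Pi_iff)
qed

lemma proj_zero [simp]: "proj n \<zero> = \<zero>"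
  using proj_homogeneous[OF G_zero] by simp

lemma proj_eq_zero: "x \<in> carrier R \<Longrightarrow> (\<And>n. proj n x = \<zero>) \<Longrightarrow> x = \<zero>"
  using proj_sum[of x "{}"] by simp

lemma proj_mult:
  assumes "x \<in> carrier R" "y \<in> G j"
  shows "proj n (x \<otimes> y) = (if n < j then \<zero> else proj (n - j) x \<otimes> y)"
proof (rule proj_unique)
  let ?F = "{n. proj n x \<noteq> \<zero>}"
  let ?A = "(\<lambda>n. n + j) ` ?F"
  have yc [simp]: "y \<in> carrier R" using assms(2) G_subset by blast
  show "finite ?A" using proj_props(2) assms by simp
  show "(if n < j then \<zero> else proj (n - j) x \<otimes> y) \<in> G n" for n
    using mult_component[OF proj_props(1)[OF assms(1)] assms(2), of "n - j"] G_zero by (cases "n < j") simp_all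
  show "(if n < j then \<zero> else proj (n - j) x \<otimes> y) = \<zero>" if "n \<notin> ?A" for n
  proof (cases "n < j")
    case False
    then have "n - j \<notin> ?F" using that by (metis (no_types, lifting) image_eqI le_add_diff_inverse2 not_less)
    then show ?thesis by simp
  qed simp
  have "x \<otimes> y = (\<Oplus>n\<in>?F. proj n x \<otimes> y)"
    using proj_props(3)[OF assms(1)] finsum_ldistr[OF proj_props(2)[OF assms(1)] yc, of "\<lambda>n. proj n x"] assms(1)
    by simp
  also have "\<dots> = (\<Oplus>n\<in>?F. if n + j < j then \<zero> else proj (n + j - j) x \<otimes> y)"
    using assms by (intro finsum_cong') auto
  also have "\<dots> = (\<Oplus>n\<in>?A. if n < j then \<zero> else proj (n - j) x \<otimes> y)"
    using assms by (intro finsum_reindex[symmetric]) (auto simp: inj_on_def)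
  finally show "x \<otimes> y = (\<Oplus>n\<in>?A. if n < j then \<zero> else proj (n - j) x \<otimes> y)" .
qed

text \<open>The companion of \<open>component\<close>: with \<open>proj\<close> extended by zero to
  negative degrees, \<open>cproj_mult\<close> holds for all integers.\<close>

definition cproj :: "int \<Rightarrow> 'a \<Rightarrow> 'a" where
  "cproj z x = (if z < 0 then \<zero> else proj (nat z) x)"

lemma cproj_component: "x \<in> carrier R \<Longrightarrow> cproj z x \<in> component R G z"
  unfolding cproj_def component_def using proj_props(1) by simp

lemma component_closed: "x \<in> component R G z \<Longrightarrow> x \<in> carrier R"
  using G_subset by (auto simp: component_def split: if_splits)

lemma component_int [simp]: "component R G (int n) = G n"
  by (simp add: component_def)

lemma component_subgroup: "additive_subgroup (component R G z) R"
proof (rule additive_subgroupI')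
  show "component R G z \<subseteq> carrier R" using component_closed by blast
qed (auto simp: component_def G_zero G_neg G_add split: if_splits)

lemma component_mult: "x \<in> component R G i \<Longrightarrow> y \<in> component R G j \<Longrightarrow> x \<otimes> y \<in> component R G (i + j)"
proof -
  assume a: "x \<in> component R G i" "y \<in> component R G j"
  have c: "x \<in> carrier R" "y \<in> carrier R" using a component_closed by blast+
  show ?thesis
  proof (cases "i < 0 \<or> j < 0")
    case True
    then have "x \<otimes> y = \<zero>" using a c by (auto simp: component_def)
    then show ?thesis using additive_subgroup.zero_closed[OF component_subgroup] by simp
  next
    case False
    then have "nat (i + j) = nat i + nat j" by (simp add: nat_add_distrib)
    then show ?thesis using a False mult_component[of x "nat i" y "nat j"] by (simp add: component_def)
  qed
qed

lemma cproj_mult: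
  assumes "x \<in> carrier R" "y \<in> component R G j"
  shows "cproj (z + j) (x \<otimes> y) = cproj z x \<otimes> y"
proof (cases "j < 0")
  case True
  then show ?thesis using assms by (simp add: component_def cproj_def)
next
  case False
  then have y: "y \<in> G (nat j)" using assms(2) by (simp add: component_def)
  show ?thesis
  proof (cases "z < 0")
    case True
    then have "z + j < 0 \<or> nat (z + j) < nat j" using False by linarith
    then show ?thesis using True proj_mult[OF assms(1) y] G_subset[OF y] by (auto simp: cproj_def)
  next
    case zpos: False
    then have "nat (z + j) - nat j = nat z" "\<not> nat (z + j) < nat j" using False by linarith+
    then show ?thesis using zpos False proj_mult[OF assms(1) y] by (simp add: cproj_def)
  qed
qed

lemma cproj_add: "x \<in> carrier R \<Longrightarrow> y \<in> carrier R \<Longrightarrow> cproj z (x \<oplus> y) = cproj z x \<oplus> cproj z y"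
  by (simp add: cproj_def proj_add)

lemma cproj_homogeneous: "x \<in> component R G z \<Longrightarrow> cproj z x = x"
  using proj_homogeneous[of x "nat z" "nat z"] by (auto simp: component_def cproj_def split: if_splits)

text \<open>An ideal generated by three elements consists of their combinations. As \<open>x\<close>
  and the generators are homogeneous, suitable components of the coefficients already give
  \<open>x\<close>.\<close>

lemma homogeneous_combination:
  assumes x: "x \<in> component R G n" and g: "g1 \<in> component R G k1" "g2 \<in> component R G k2" "g3 \<in> component R G k3"
    and mem: "x \<in> Idl {g1, g2, g3}"
  obtains a1 a2 a3 where "a1 \<in> component R G (n - k1)" "a2 \<in> component R G (n - k2)" "a3 \<in> component R G (n - k3)"
    "x = a1 \<otimes> g1 \<oplus> a2 \<otimes> g2 \<oplus> a3 \<otimes> g3"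
proof -
  note gc [simp] = g[THEN component_closed]
  define J where "J = {b1 \<otimes> g1 \<oplus> b2 \<otimes> g2 \<oplus> b3 \<otimes> g3 | b1 b2 b3. b1 \<in> carrier R \<and> b2 \<in> carrier R \<and> b3 \<in> carrier R}"
  have JI: "b1 \<otimes> g1 \<oplus> b2 \<otimes> g2 \<oplus> b3 \<otimes> g3 \<in> J" if "b1 \<in> carrier R" "b2 \<in> carrier R" "b3 \<in> carrier R" for b1 b2 b3
    using that unfolding J_def by blast
  have "ideal J R"
  proof (intro idealI[OF ring_axioms] additive_subgroup.a_subgroup[OF additive_subgroupI'])
    show "J \<subseteq> carrier R" unfolding J_def by auto
    show "\<zero> \<in> J" using JI[of \<zero> \<zero> \<zero>] by simp
  next
    fix a assume "a \<in> J"
    then obtain b1 b2 b3 where b: "b1 \<in> carrier R" "b2 \<in> carrier R" "b3 \<in> carrier R"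
      "a = b1 \<otimes> g1 \<oplus> b2 \<otimes> g2 \<oplus> b3 \<otimes> g3" unfolding J_def by blast
    have "\<ominus> a = \<ominus> b1 \<otimes> g1 \<oplus> \<ominus> b2 \<otimes> g2 \<oplus> \<ominus> b3 \<otimes> g3" unfolding b(4) using b gc by algebra
    then show "\<ominus> a \<in> J" using JI[of "\<ominus> b1" "\<ominus> b2" "\<ominus> b3"] b by simp
    fix x assume x: "x \<in> carrier R"
    have "x \<otimes> a = x \<otimes> b1 \<otimes> g1 \<oplus> x \<otimes> b2 \<otimes> g2 \<oplus> x \<otimes> b3 \<otimes> g3" unfolding b(4) using b x gc by algebra
    then show "x \<otimes> a \<in> J" using JI[of "x \<otimes> b1" "x \<otimes> b2" "x \<otimes> b3"] b x by simp
    then show "a \<otimes> x \<in> J" using x b by (simp add: m_comm)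
  next
    fix a a' assume "a \<in> J" "a' \<in> J"
    then obtain b1 b2 b3 c1 c2 c3 where b: "b1 \<in> carrier R" "b2 \<in> carrier R" "b3 \<in> carrier R"
      "a = b1 \<otimes> g1 \<oplus> b2 \<otimes> g2 \<oplus> b3 \<otimes> g3" and c: "c1 \<in> carrier R" "c2 \<in> carrier R" "c3 \<in> carrier R"
      "a' = c1 \<otimes> g1 \<oplus> c2 \<otimes> g2 \<oplus> c3 \<otimes> g3" unfolding J_def by blast
    have "a \<oplus> a' = (b1 \<oplus> c1) \<otimes> g1 \<oplus> (b2 \<oplus> c2) \<otimes> g2 \<oplus> (b3 \<oplus> c3) \<otimes> g3"
      unfolding b(4) c(4) using b(1-3) c(1-3) gc by algebra
    then show "a \<oplus> a' \<in> J" using JI[of "b1 \<oplus> c1" "b2 \<oplus> c2" "b3 \<oplus> c3"] b c by simp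
  qed
  moreover have "{g1, g2, g3} \<subseteq> J"
    using JI[of \<one> \<zero> \<zero>] JI[of \<zero> \<one> \<zero>] JI[of \<zero> \<zero> \<one>] by simp
  ultimately have "x \<in> J" using mem genideal_minimal by blast
  then obtain b1 b2 b3 where b: "b1 \<in> carrier R" "b2 \<in> carrier R" "b3 \<in> carrier R"
    "x = b1 \<otimes> g1 \<oplus> b2 \<otimes> g2 \<oplus> b3 \<otimes> g3" unfolding J_def by blast
  have "x = cproj n x" using cproj_homogeneous[OF x] by simp
  also have "\<dots> = cproj (n - k1) b1 \<otimes> g1 \<oplus> cproj (n - k2) b2 \<otimes> g2 \<oplus> cproj (n - k3) b3 \<otimes> g3"
    using cproj_mult[OF b(1) g(1), of "n - k1"] cproj_mult[OF b(2) g(2), of "n - k2"]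
      cproj_mult[OF b(3) g(3), of "n - k3"] b by (simp add: cproj_add)
  finally show thesis
    using that[of "cproj (n - k1) b1" "cproj (n - k2) b2" "cproj (n - k3) b3"] cproj_component b by blast
qed

lemma primary_power:
  assumes "primary R G A" "f \<in> G d" "d > 0"
  obtains N where "f [^] (N :: nat) \<in> Idl A"
proof -
  have "f \<in> graded_ge R G 1"
    unfolding graded_ge_def using assms(2,3) G_subset
    by (intro CollectI exI[of _ "{d}"] exI[of _ "\<lambda>_. f"]) auto
  then show thesis using assms(1) that unfolding primary_def ideal_radical_def by blast
qed

end

section \<open>Standard graded algebras\<close>

text \<open>Distributivity, checked with a generator on the left before the general case. It turns
  the additive span of scaled words or monomials into a subring.\<close>

lemma (in cring) generate_add_mult_closed:
  assumes W: "W \<subseteq> carrier R" "\<And>a b. a \<in> W \<Longrightarrow> b \<in> W \<Longrightarrow> a \<otimes> b \<in> W"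
    and x: "x \<in> generate (add_monoid R) W" and y: "y \<in> generate (add_monoid R) W"
  shows "x \<otimes> y \<in> generate (add_monoid R) W"
proof -
  let ?E = "generate (add_monoid R) W"
  have sub: "subgroup ?E (add_monoid R)" by (rule add.generate_is_subgroup) (use W in auto)
  have E: "additive_subgroup ?E R" by (rule additive_subgroup.intro[OF sub])
  have Ec: "a \<in> carrier R" if "a \<in> ?E" for a using additive_subgroup.a_subset[OF E] that by blast
  have neg: "\<ominus> a \<in> ?E" if "a \<in> ?E" for a using additive_subgroup.a_inv_closed[OF E that] .
  have left: "a \<otimes> b \<in> ?E" if a: "a \<in> W" and "b \<in> ?E" for a b
    using that(2)
  proof (induction rule: generate.induct)
    case one
    then show ?case using a W additive_subgroup.zero_closed[OF E] by (auto simp: subset_iff)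
  next
    case (incl b)
    then show ?case using W(2)[OF a] by (blast intro: generate.incl)
  next
    case (inv b)
    have "a \<otimes> \<ominus> b = \<ominus> (a \<otimes> b)" using a inv W by (auto simp: r_minus subset_iff)
    moreover have "\<ominus> (a \<otimes> b) \<in> ?E" using W(2)[OF a inv] by (intro neg generate.incl)
    ultimately show ?case by (simp add: a_inv_def)
  next
    case (eng b c)
    have "a \<otimes> (b \<oplus> c) = a \<otimes> b \<oplus> a \<otimes> c" using a W Ec[OF eng(1)] Ec[OF eng(2)] by (intro r_distr) auto
    then show ?case using eng additive_subgroup.a_closed[OF E] by simp
  qed
  show ?thesis
    using x
  proof (induction rule: generate.induct)
    case one
    then show ?case using Ec[OF y] additive_subgroup.zero_closed[OF E] by simp
  next
    case (incl a)
    then show ?case using left y by blast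
  next
    case (inv a)
    have "\<ominus> a \<otimes> y = \<ominus> (a \<otimes> y)" using Ec[OF y] inv W by (auto simp: l_minus)
    moreover have "\<ominus> (a \<otimes> y) \<in> ?E" using left[OF inv y] by (rule neg)
    ultimately show ?case by (simp add: a_inv_def)
  next
    case (eng b c)
    have "(b \<oplus> c) \<otimes> y = b \<otimes> y \<oplus> c \<otimes> y" using Ec[OF y] Ec[OF eng(1)] Ec[OF eng(2)] by (intro l_distr) auto
    then show ?case using eng additive_subgroup.a_closed[OF E] by simp
  qed
qed

lemma (in ring) generate_add_induct [consumes 2, case_names zero incl neg add]:
  assumes "x \<in> generate (add_monoid R) W" "W \<subseteq> carrier R"
    and "Q \<zero>" "\<And>a. a \<in> W \<Longrightarrow> Q a" "\<And>a. a \<in> W \<Longrightarrow> Q a \<Longrightarrow> Q (\<ominus> a)"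
    "\<And>a b. a \<in> carrier R \<Longrightarrow> b \<in> carrier R \<Longrightarrow> Q a \<Longrightarrow> Q b \<Longrightarrow> Q (a \<oplus> b)"
  shows "Q x"
proof -
  have "x \<in> carrier R \<and> Q x"
    using assms(1)
  proof (induction rule: generate.induct)
    case (inv a)
    then show ?case using assms(2,4,5) by (auto simp flip: a_inv_def)
  qed (use assms in auto)
  then show ?thesis ..
qed

context cring
begin

definition mprod :: "'a list \<Rightarrow> 'a" where
  "mprod w = foldr (\<otimes>) w \<one>"

lemma mprod_simps [simp]: "mprod [] = \<one>" "mprod (a # w) = a \<otimes> mprod w"
  by (simp_all add: mprod_def)

lemma mprod_closed: "set w \<subseteq> carrier R \<Longrightarrow> mprod w \<in> carrier R"
  by (induction w) auto

lemma mprod_append: "set v \<subseteq> carrier R \<Longrightarrow> set w \<subseteq> carrier R \<Longrightarrow> mprod (v @ w) = mprod v \<otimes> mprod w"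
  by (induction v) (auto simp: mprod_closed m_assoc)

text \<open>Collects the occurrences of one letter into a power, in preparation for a pigeonhole
  argument.\<close>

lemma mprod_count:
  assumes "set w \<subseteq> carrier R" "a \<in> carrier R"
  shows "mprod w = a [^] count_list w a \<otimes> mprod (filter (\<lambda>b. b \<noteq> a) w)"
  using assms(1)
proof (induction w)
  case (Cons b w)
  have "mprod (filter (\<lambda>b. b \<noteq> a) w) \<in> carrier R" using Cons.prems by (intro mprod_closed) auto
  then show ?case using Cons assms(2) by (auto simp: m_ac)
qed simp

end

context standard_graded_algebra
begin

lemma K_carrier: "K \<subseteq> carrier R"
  by (rule subfieldE(3)[OF subfield_base])

lemma K_G0: "k \<in> K \<longleftrightarrow> k \<in> G 0"
  by (simp add: degree_zero)

lemma scalar_mult: "k \<in> K \<Longrightarrow> x \<in> G n \<Longrightarrow> k \<otimes> x \<in> G n"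
  using mult_component[of k 0 x n] by (simp add: K_G0)

text \<open>Every ring element is a sum of scaled words in the generators, and a word is homogeneous
  of degree its length. Projecting to degree \<open>n\<close> keeps exactly the words of length
  \<open>n\<close>.\<close>

lemma words_span:
  assumes As: "set As \<subseteq> G 1" "generate_ring R (K \<union> set As) = carrier R"
  shows "G n \<subseteq> Span K (map mprod (List.n_lists n As))"
proof
  fix x assume x: "x \<in> G n"
  have Ac: "set As \<subseteq> carrier R" using As(1) G_subset by blast
  note subr = subringE[OF subfieldE(1)[OF subfield_base]]
  define W where "W = {k \<otimes> mprod w | k w. k \<in> K \<and> set w \<subseteq> set As}"
  have WI: "k \<otimes> mprod w \<in> W" if "k \<in> K" "set w \<subseteq> set As" for k w using that unfolding W_def by blast
  have mc: "mprod w \<in> carrier R" if "set w \<subseteq> set As" for w using that Ac by (intro mprod_closed) blast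
  have Wc: "W \<subseteq> carrier R" using mc K_carrier unfolding W_def by auto
  have Wm: "a \<otimes> b \<in> W" if "a \<in> W" "b \<in> W" for a b
  proof -
    obtain k v l w where "k \<in> K" "set v \<subseteq> set As" "a = k \<otimes> mprod v" "l \<in> K" "set w \<subseteq> set As" "b = l \<otimes> mprod w"
      using \<open>a \<in> W\<close> \<open>b \<in> W\<close> unfolding W_def by blast
    note kv = this
    have c: "k \<in> carrier R" "l \<in> carrier R" "mprod v \<in> carrier R" "mprod w \<in> carrier R"
      using kv K_carrier mc by auto
    have "a \<otimes> b = (k \<otimes> l) \<otimes> mprod (v @ w)"
      using c kv(2,5) Ac mprod_append[of v w] unfolding kv(3,6) by (simp add: m_ac)
    then show ?thesis using WI[of "k \<otimes> l" "v @ w"] kv subr(6) by simp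
  qed
  have Wneg: "\<ominus> a \<in> W" if "a \<in> W" for a
  proof -
    obtain k v where kv: "k \<in> K" "set v \<subseteq> set As" "a = k \<otimes> mprod v" using \<open>a \<in> W\<close> unfolding W_def by blast
    have "\<ominus> a = \<ominus> k \<otimes> mprod v" using kv K_carrier mc by (auto simp: l_minus)
    then show ?thesis using WI kv subr(5) by simp
  qed
  let ?E = "generate (add_monoid R) W"
  have E: "additive_subgroup ?E R"
    by (rule additive_subgroup.intro[OF add.generate_is_subgroup]) (use Wc in auto)
  have gen: "z \<in> ?E" if "z \<in> generate_ring R (K \<union> set As)" for z
    using that
  proof (induction rule: generate_ring.induct)
    case one
    show ?case using WI[of \<one> "[]"] subr(3) generate.incl[of \<one> W "add_monoid R"] by simp
  next
    case (incl z)
    then consider "z \<in> K" | "z \<in> set As" by blast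
    then have "z \<in> W"
    proof cases
      case 1
      then show ?thesis using WI[of z "[]"] K_carrier by auto
    next
      case 2
      then show ?thesis using WI[of \<one> "[z]"] subr(3) Ac by auto
    qed
    then show ?case by (rule generate.incl)
  next
    case (a_inv z)
    show ?case by (rule additive_subgroup.a_inv_closed[OF E a_inv(2)])
  next
    case (eng_add y z)
    show ?case by (rule additive_subgroup.a_closed[OF E eng_add(3,4)])
  next
    case (eng_mult y z)
    show ?case by (rule generate_add_mult_closed[OF Wc Wm eng_mult(3,4)])
  qed
  let ?Us = "\<lambda>n. map mprod (List.n_lists n As)"
  have Us: "set (?Us n) \<subseteq> carrier R" for n using mc by (auto simp: set_n_lists)
  have mG: "mprod w \<in> G (length w)" if "set w \<subseteq> set As" for w
    using that
  proof (induction w)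
    case (Cons a w)
    then show ?case using mult_component[of a 1 "mprod w" "length w"] As(1) by auto
  qed (simp add: one_component)
  have W_span: "proj n a \<in> Span K (?Us n)" if "a \<in> W" for a n
  proof -
    obtain k w where kw: "k \<in> K" "set w \<subseteq> set As" "a = k \<otimes> mprod w" using \<open>a \<in> W\<close> unfolding W_def by blast
    have aG: "a \<in> G (length w)" unfolding kw(3) by (rule scalar_mult[OF kw(1) mG[OF kw(2)]])
    show ?thesis
    proof (cases "n = length w")
      case True
      have "mprod w \<in> set (?Us n)" using kw(2) True by (auto simp: set_n_lists)
      then have "mprod w \<in> Span K (?Us n)" using Span_base_incl[OF subfield_base Us] by blast
      then have "a \<in> Span K (?Us n)" unfolding kw(3) by (rule Span_smult_closed[OF subfield_base Us kw(1)])
      then show ?thesis using proj_homogeneous[OF aG] True by simp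
    next
      case False
      then show ?thesis using proj_homogeneous[OF aG] Span_subgroup_props(2)[OF subfield_base Us] by simp
    qed
  qed
  have "x \<in> ?E" using gen x G_subset As(2) by blast
  then have "proj n x \<in> Span K (?Us n)"
    using Wc
  proof (induction rule: generate_add_induct)
    case zero
    show ?case using Span_subgroup_props(2)[OF subfield_base Us] by simp
  next
    case (incl a)
    then show ?case by (rule W_span)
  next
    case (neg a)
    then show ?case using W_span[OF Wneg] by blast
  next
    case (add a b)
    then show ?case using Span_subgroup_props(3)[OF subfield_base Us] by (simp add: proj_add)
  qed
  then show "x \<in> Span K (?Us n)" using proj_homogeneous[OF x] by simp
qed

lemma generators: "\<exists>As. set As \<subseteq> G 1 \<and> generate_ring R (K \<union> set As) = carrier R"
  using generated_in_degree_one finite_list by metis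

lemma words_G:
  assumes "set As \<subseteq> G 1"
  shows "set (map mprod (List.n_lists n As)) \<subseteq> G n"
proof -
  have "mprod w \<in> G (length w)" if "set w \<subseteq> set As" for w
    using that
  proof (induction w)
    case (Cons a w)
    then show ?case using mult_component[of a 1 "mprod w" "length w"] assms by auto
  qed (simp add: one_component)
  then show ?thesis by (auto simp: set_n_lists)
qed

lemma G_finite_dimensional: "\<exists>Us. set Us \<subseteq> G n \<and> G n \<subseteq> Span K Us"
  using generators words_span words_G by meson

text \<open>Pigeonhole: a sufficiently long word contains some generator at least \<open>N\<close>
  times, and the \<open>N\<close>-th power of every generator lies in \<open>I\<close>.\<close>

lemma large_degree_in_ideal:
  assumes I: "ideal I R" and rad: "\<And>a. a \<in> G 1 \<Longrightarrow> \<exists>N. a [^] (N :: nat) \<in> I"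
  shows "\<exists>M. \<forall>n\<ge>M. G n \<subseteq> I"
proof -
  interpret I: ideal I R by (rule I)
  obtain As where As: "set As \<subseteq> G 1" "generate_ring R (K \<union> set As) = carrier R" using generators by blast
  have Ac: "set As \<subseteq> carrier R" using As(1) G_subset by blast
  have "\<forall>a\<in>set As. \<exists>N. a [^] (N :: nat) \<in> I" using rad As(1) by blast
  then obtain e :: "'a \<Rightarrow> nat" where e: "\<And>a. a \<in> set As \<Longrightarrow> a [^] e a \<in> I" by metis
  define N where "N = Max (insert 0 (e ` set As))"
  have N: "a [^] m \<in> I" if "a \<in> set As" "m \<ge> N" for a m
  proof -
    have "e a \<le> N" unfolding N_def using that(1) by (intro Max_ge) auto
    then have "a [^] m = a [^] (m - e a) \<otimes> a [^] e a" using that Ac by (auto simp: nat_pow_mult)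
    then show ?thesis using I.I_l_closed[OF e[OF that(1)]] that(1) Ac by auto
  qed
  have "G n \<subseteq> I" if n: "n \<ge> Suc (card (set As) * N)" for n
  proof -
    have "mprod w \<in> I" if w: "set w \<subseteq> set As" "length w = n" for w
    proof -
      have "\<exists>a\<in>set As. count_list w a \<ge> N"
      proof (rule ccontr)
        assume "\<not> ?thesis"
        then have "(\<Sum>a\<in>set As. count_list w a) \<le> (\<Sum>a\<in>set As. N)" by (intro sum_mono) auto
        moreover have "(\<Sum>a\<in>set As. count_list w a) = n" using sum_count_set[OF w(1)] w(2) by simp
        ultimately show False using n by simp
      qed
      then obtain a where a: "a \<in> set As" "count_list w a \<ge> N" by blast
      have "mprod (filter (\<lambda>b. b \<noteq> a) w) \<in> carrier R" using w(1) Ac by (intro mprod_closed) auto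
      moreover have "a \<in> carrier R" "set w \<subseteq> carrier R" using a w Ac by auto
      ultimately show ?thesis using mprod_count[of w a] I.I_r_closed[OF N[OF a]] by simp
    qed
    then have "set (map mprod (List.n_lists n As)) \<subseteq> I" by (auto simp: set_n_lists)
    then have "Span K (map mprod (List.n_lists n As)) \<subseteq> I"
      by (rule subalgebra_Span_incl[OF subfield_base ideal_is_subalgebra[OF K_carrier I]])
    then show ?thesis using words_span[OF As] by blast
  qed
  then show ?thesis by blast
qed

lemma primary_ideal_large:
  assumes "primary R G A" "A \<subseteq> carrier R"
  shows "\<exists>M. \<forall>n\<ge>M. G n \<subseteq> Idl A"
proof -
  have "\<exists>N. a [^] (N :: nat) \<in> Idl A" if "a \<in> G 1" for a
    by (rule primary_power[OF assms(1) that zero_less_one], rule exI)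
  then show ?thesis by (rule large_degree_in_ideal[OF genideal_ideal[OF assms(2)]])
qed

lemma primary_large_degree:
  assumes "primary R G {f1, f2}" "f1 \<in> G d1" "f2 \<in> G d2"
  shows "\<exists>M. \<forall>n\<ge>M. \<forall>x\<in>G n. \<exists>a\<in>component R G (int n - int d1). \<exists>b\<in>component R G (int n - int d2).
    x = a \<otimes> f1 \<oplus> b \<otimes> f2"
proof -
  have sub: "{f1, f2} \<subseteq> carrier R" using assms G_subset by blast
  obtain M where M: "\<And>n. n \<ge> M \<Longrightarrow> G n \<subseteq> Idl {f1, f2}"
    using primary_ideal_large[OF assms(1) sub] by blast
  have "\<exists>a\<in>component R G (int n - int d1). \<exists>b\<in>component R G (int n - int d2). x = a \<otimes> f1 \<oplus> b \<otimes> f2"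
    if n: "n \<ge> M" and x: "x \<in> G n" for n x
  proof -
    \<comment> \<open>\<open>homogeneous_combination\<close> takes three generators;
      \<open>f2\<close> is repeated and its two coefficients are added up.\<close>
    have mem: "x \<in> Idl {f1, f2, f2}" using M[OF n] x by auto
    have comp: "f1 \<in> component R G (int d1)" "f2 \<in> component R G (int d2)" "x \<in> component R G (int n)"
      using assms x by simp_all
    obtain a1 a2 a3 where a: "a1 \<in> component R G (int n - int d1)" "a2 \<in> component R G (int n - int d2)"
      "a3 \<in> component R G (int n - int d2)" "x = a1 \<otimes> f1 \<oplus> a2 \<otimes> f2 \<oplus> a3 \<otimes> f2"
      by (rule homogeneous_combination[OF comp(3,1,2,2) mem], rule that)
    have "x = a1 \<otimes> f1 \<oplus> (a2 \<oplus> a3) \<otimes> f2"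
      using a sub by (simp add: component_closed l_distr a_assoc)
    moreover have "a2 \<oplus> a3 \<in> component R G (int n - int d2)"
      using a by (intro additive_subgroup.a_closed[OF graded_cring.component_subgroup[OF graded_cring_axioms]])
    ultimately show ?thesis using a(1) by blast
  qed
  then show ?thesis by blast
qed

text \<open>In large degrees multiplication by \<open>f\<close> maps \<open>G (n - d)\<close> onto
  \<open>G n\<close>, so spanning lists need not grow, and \<open>C\<close> can be the maximal
  length over the finitely many small degrees.\<close>

lemma principal_ideal_bounded:
  assumes large: "\<And>n. n \<ge> M \<Longrightarrow> G n \<subseteq> Idl {f}" and f: "f \<in> G d" "d > 0"
  shows "\<exists>C. \<forall>n. \<exists>Us. length Us \<le> C \<and> set Us \<subseteq> carrier R \<and> G n \<subseteq> Span K Us"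
proof -
  have fc: "f \<in> carrier R" using f G_subset by blast
  have "\<forall>n. \<exists>Us. set Us \<subseteq> G n \<and> G n \<subseteq> Span K Us" using G_finite_dimensional by blast
  then obtain V where V: "\<And>n. set (V n) \<subseteq> G n" "\<And>n. G n \<subseteq> Span K (V n)" by metis
  define N0 where "N0 = max M d"
  define C where "C = Max (insert 0 ((\<lambda>n. length (V n)) ` {..<N0}))"
  have "\<exists>Us. length Us \<le> C \<and> set Us \<subseteq> carrier R \<and> G n \<subseteq> Span K Us" for n
  proof (induction n rule: less_induct)
    case (less n)
    show ?case
    proof (cases "n < N0")
      case True
      then have "length (V n) \<le> C" unfolding C_def by (intro Max_ge) auto
      then show ?thesis using V[of n] G_subset by blast
    next
      case False
      then have n: "n \<ge> M" "n \<ge> d" unfolding N0_def by auto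
      then obtain Us where Us: "length Us \<le> C" "set Us \<subseteq> carrier R" "G (n - d) \<subseteq> Span K Us"
        using less[of "n - d"] f(2) by auto
      let ?Ws = "map (\<lambda>u. u \<otimes> f) Us"
      have "x \<in> Span K ?Ws" if x: "x \<in> G n" for x
      proof -
        have comp: "component R G (int n - int d) = G (n - d)" using n by (simp add: component_def nat_diff_distrib)
        have mem: "x \<in> Idl {f, f, f}" using large[OF n(1)] x by auto
        have fx: "f \<in> component R G (int d)" "x \<in> component R G (int n)" using f x by simp_all
        obtain a b c where abc: "a \<in> G (n - d)" "b \<in> G (n - d)" "c \<in> G (n - d)" "x = a \<otimes> f \<oplus> b \<otimes> f \<oplus> c \<otimes> f"
          by (rule homogeneous_combination[OF fx(2,1,1,1) mem, unfolded comp], rule that)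
        have "x = (a \<oplus> b \<oplus> c) \<otimes> f" using abc G_subset fc by (simp add: l_distr)
        moreover have "a \<oplus> b \<oplus> c \<in> Span K Us" using G_add[OF G_add[OF abc(1,2)] abc(3)] Us(3) by blast
        then have "(a \<oplus> b \<oplus> c) \<otimes> f \<in> Span ((\<lambda>x. x) ` K) ?Ws"
          by (intro Span_mult_right[where h = "\<lambda>x. x"] is_cring fc Us(2) K_carrier) (auto intro: ring_hom_memI)
        ultimately show ?thesis by simp
      qed
      then have "G n \<subseteq> Span K ?Ws" by blast
      moreover have "length ?Ws \<le> C" "set ?Ws \<subseteq> carrier R" using Us fc by auto
      ultimately show ?thesis by blast
    qed
  qed
  then show ?thesis by blast
qed

end

section \<open>Dimension two\<close>

text \<open>A chain of primes of length two yields two algebraically independent elements, so the Hilbert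
  function of a two-dimensional algebra cannot be bounded.\<close>

lemma krull_dim_two_chain:
  assumes "krull_dim R = 2"
  shows "\<exists>P0 P1 P2. primeideal P0 R \<and> primeideal P1 R \<and> primeideal P2 R \<and> P0 \<subset> P1 \<and> P1 \<subset> P2"
proof (rule ccontr)
  assume no: "\<not> ?thesis"
  have "x \<le> 1" if xin: "x \<in> {enat n | n. \<exists>P. (\<forall>i\<le>n. primeideal (P i) R) \<and> (\<forall>i<n. P i \<subset> P (Suc i))}" for x
  proof -
    obtain n P where n: "x = enat n" "\<forall>i\<le>n. primeideal (P i) R" "\<forall>i<n. P i \<subset> P (Suc i)" using xin by blast
    have "n \<le> 1"
    proof (rule ccontr)
      assume "\<not> n \<le> 1"
      then have "primeideal (P 0) R" "primeideal (P 1) R" "primeideal (P 2) R" "P 0 \<subset> P (Suc 0)" "P 1 \<subset> P (Suc 1)"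
        using n(2,3) by auto
      then show False using no by (metis One_nat_def Suc_1)
    qed
    then show ?thesis using n(1) by (simp add: one_enat_def)
  qed
  then have "krull_dim R \<le> 1" unfolding krull_dim_def by (rule Sup_least)
  then show False using assms by (simp add: numeral_eq_enat one_enat_def)
qed

lemma (in abelian_monoid) finsum_cartesian:
  assumes "finite A" "finite B" "\<And>a b. a \<in> A \<Longrightarrow> b \<in> B \<Longrightarrow> f (a, b) \<in> carrier G"
  shows "(\<Oplus>z\<in>A \<times> B. f z) = (\<Oplus>a\<in>A. \<Oplus>b\<in>B. f (a, b))"
  using assms(1,3)
proof (induction A rule: finite_induct)
  case (insert a A)
  have "(\<Oplus>z\<in>insert a A \<times> B. f z) = (\<Oplus>z\<in>Pair a ` B \<union> A \<times> B. f z)"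
    by (simp add: insert_Times_insert[symmetric] Sigma_def) (rule arg_cong[where f = "finsum G f"], auto)
  also have "\<dots> = (\<Oplus>z\<in>Pair a ` B. f z) \<oplus> (\<Oplus>z\<in>A \<times> B. f z)"
    using insert assms(2) by (intro finsum_Un_disjoint) auto
  also have "(\<Oplus>z\<in>Pair a ` B. f z) = (\<Oplus>b\<in>B. f (a, b))"
    using insert by (intro finsum_reindex) (auto simp: inj_on_def)
  finally show ?case using insert by (subst finsum_insert) auto
qed simp

context standard_graded_algebra
begin

lemma K_prime_zero:
  assumes "primeideal P R" "k \<in> K" "k \<in> P"
  shows "k = \<zero>"
proof (rule ccontr)
  interpret P: primeideal P R by fact
  assume "k \<noteq> \<zero>"
  then have "inv k \<otimes> k = \<one>" "inv k \<in> K" using subfield_m_inv[OF subfield_base, of k] assms(2) by auto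
  then have "\<one> \<in> P" using P.I_l_closed[OF assms(3)] K_carrier by (metis subsetD)
  then show False using P.one_imp_carrier P.I_notcarr by simp
qed

text \<open>Modulo \<open>P2\<close> only the constant term survives, and it vanishes because
  \<open>K\<close> meets a prime only in zero; then one factor \<open>y\<close>, not in the prime
  \<open>P1\<close>, can be cancelled. So \<open>y\<close> is transcendental over \<open>K\<close>
  modulo \<open>P1\<close>.\<close>

lemma prime_poly_one:
  assumes P: "primeideal P1 R" "primeideal P2 R" "P1 \<subseteq> P2" and y: "y \<in> P2" "y \<notin> P1"
    and k: "\<And>j. k j \<in> K" and mem: "(\<Oplus>j\<in>{..s::nat}. k j \<otimes> y [^] j) \<in> P1"
  shows "\<forall>j\<le>s. k j = \<zero>"
  using k mem
proof (induction s arbitrary: k)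
  interpret P1: primeideal P1 R by fact
  interpret P2: primeideal P2 R by fact
  have yc [simp]: "y \<in> carrier R" by (rule P2.Icarr[OF y(1)])
  {
    case 0
    have "k 0 \<in> P1" using 0 K_carrier by (auto simp: subset_iff)
    then show ?case using K_prime_zero[OF P(1)] 0(1) by simp
  next
    case (Suc s)
    have kc [simp]: "k j \<in> carrier R" for j using Suc.prems(1) K_carrier by blast
    let ?S = "\<Oplus>j\<in>{..s}. k (Suc j) \<otimes> y [^] j"
    have "(\<Oplus>j\<in>{..Suc s}. k j \<otimes> y [^] j) = (\<Oplus>j\<in>{..s}. k (Suc j) \<otimes> y [^] Suc j) \<oplus> k 0 \<otimes> y [^] (0::nat)"
      by (rule finsum_Suc2) auto
    also have "(\<Oplus>j\<in>{..s}. k (Suc j) \<otimes> y [^] Suc j) = (\<Oplus>j\<in>{..s}. y \<otimes> (k (Suc j) \<otimes> y [^] j))"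
      by (intro finsum_cong') (auto simp: m_ac)
    also have "\<dots> = y \<otimes> ?S" by (intro finsum_rdistr[symmetric]) auto
    finally have eq: "(\<Oplus>j\<in>{..Suc s}. k j \<otimes> y [^] j) = y \<otimes> ?S \<oplus> k 0" by simp
    have S [simp]: "?S \<in> carrier R" by auto
    have m1: "y \<otimes> ?S \<oplus> k 0 \<in> P2" using Suc.prems(2) P(3) unfolding eq by blast
    have m2: "\<ominus> (y \<otimes> ?S) \<in> P2" using P2.I_r_closed[OF y(1) S] by (rule P2.a_inv_closed)
    have "\<ominus> (y \<otimes> ?S) \<oplus> (y \<otimes> ?S \<oplus> k 0) \<in> P2" by (rule P2.a_closed[OF m2 m1])
    then have "k 0 \<in> P2" by (simp add: r_neg1)
    then have k0: "k 0 = \<zero>" using K_prime_zero[OF P(2)] Suc.prems(1) by blast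
    then have "y \<otimes> ?S \<in> P1" using Suc.prems(2) unfolding eq by simp
    then have "?S \<in> P1" using P1.I_prime[OF yc S] y(2) by blast
    then have "\<forall>j\<le>s. k (Suc j) = \<zero>" using Suc.IH[of "\<lambda>j. k (Suc j)"] Suc.prems(1) by blast
    then show ?case using k0 by (metis Suc_le_mono not0_implies_Suc)
  }
qed

text \<open>The same argument one step up, with polynomials in \<open>y\<close> as coefficients: the
  constant term in \<open>x\<close> is treated modulo \<open>P1\<close> by
  \<open>prime_poly_one\<close>, and \<open>x\<close> is cancelled modulo \<open>P0\<close>.\<close>

lemma prime_poly_two:
  assumes P: "primeideal P0 R" "primeideal P1 R" "primeideal P2 R" "P0 \<subseteq> P1" "P1 \<subseteq> P2"
    and x: "x \<in> P1" "x \<notin> P0" and y: "y \<in> P2" "y \<notin> P1"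
    and k: "\<And>i j. k i j \<in> K" and mem: "(\<Oplus>i\<in>{..m::nat}. x [^] i \<otimes> (\<Oplus>j\<in>{..s::nat}. k i j \<otimes> y [^] j)) \<in> P0"
  shows "\<forall>i\<le>m. \<forall>j\<le>s. k i j = \<zero>"
  using k mem
proof (induction m arbitrary: k)
  interpret P0: primeideal P0 R by fact
  interpret P1: primeideal P1 R by fact
  interpret P2: primeideal P2 R by fact
  have xc [simp]: "x \<in> carrier R" and yc [simp]: "y \<in> carrier R" using P1.Icarr x(1) P2.Icarr y(1) by blast+
  {
    case 0
    have kc [simp]: "k i j \<in> carrier R" for i j using 0(1) K_carrier by blast
    have "(\<Oplus>j\<in>{..s}. k 0 j \<otimes> y [^] j) \<in> P1" using 0(2) P(4) by auto
    then show ?case using prime_poly_one[OF P(2,3,5) y] 0(1) by auto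
  next
    case (Suc m)
    have kc [simp]: "k i j \<in> carrier R" for i j using Suc.prems(1) K_carrier by blast
    define r where "r i = (\<Oplus>j\<in>{..s}. k i j \<otimes> y [^] j)" for i
    have rc [simp]: "r i \<in> carrier R" for i by (auto simp: r_def)
    let ?S = "\<Oplus>i\<in>{..m}. x [^] i \<otimes> r (Suc i)"
    have "(\<Oplus>i\<in>{..Suc m}. x [^] i \<otimes> r i) = (\<Oplus>i\<in>{..m}. x [^] Suc i \<otimes> r (Suc i)) \<oplus> x [^] (0::nat) \<otimes> r 0"
      by (rule finsum_Suc2) auto
    also have "(\<Oplus>i\<in>{..m}. x [^] Suc i \<otimes> r (Suc i)) = (\<Oplus>i\<in>{..m}. x \<otimes> (x [^] i \<otimes> r (Suc i)))"
      by (intro finsum_cong') (auto simp: m_ac)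
    also have "\<dots> = x \<otimes> ?S" by (intro finsum_rdistr[symmetric]) auto
    finally have eq: "(\<Oplus>i\<in>{..Suc m}. x [^] i \<otimes> r i) = x \<otimes> ?S \<oplus> r 0" by simp
    have S [simp]: "?S \<in> carrier R" by auto
    have mem: "x \<otimes> ?S \<oplus> r 0 \<in> P0" using Suc.prems(2) eq unfolding r_def by simp
    have m1: "x \<otimes> ?S \<oplus> r 0 \<in> P1" using mem P(4) by blast
    have m2: "\<ominus> (x \<otimes> ?S) \<in> P1" using P1.I_r_closed[OF x(1) S] by (rule P1.a_inv_closed)
    have "\<ominus> (x \<otimes> ?S) \<oplus> (x \<otimes> ?S \<oplus> r 0) \<in> P1" by (rule P1.a_closed[OF m2 m1])
    then have "r 0 \<in> P1" by (simp add: r_neg1)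
    then have k0: "\<forall>j\<le>s. k 0 j = \<zero>"
      using prime_poly_one[OF P(2,3,5) y, of "k 0"] Suc.prems(1) unfolding r_def by blast
    have "r 0 = (\<Oplus>j\<in>{..s}. \<zero>)" unfolding r_def using k0 by (intro finsum_cong') auto
    then have "x \<otimes> ?S \<in> P0" using mem by simp
    then have "?S \<in> P0" using P0.I_prime[OF xc S] x(2) by blast
    then have "\<forall>i\<le>m. \<forall>j\<le>s. k (Suc i) j = \<zero>"
      using Suc.IH[of "\<lambda>i. k (Suc i)"] Suc.prems(1) unfolding r_def by blast
    then show ?case using k0 by (metis Suc_le_mono not0_implies_Suc)
  }
qed

lemma proj_neg: "x \<in> carrier R \<Longrightarrow> proj n (\<ominus> x) = \<ominus> proj n x"
  using proj_add[of "\<ominus> x" x n] by (intro minus_equality[symmetric]) (auto simp: l_neg)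

text \<open>Elements chosen from the primes of a chain need not be homogeneous, so their monomials
  are counted in the filtration by degree.\<close>

definition bounded_degree :: "nat \<Rightarrow> 'a set" where
  "bounded_degree n = {x \<in> carrier R. \<forall>i>n. proj i x = \<zero>}"

lemma bounded_degree_subgroup: "additive_subgroup (bounded_degree n) R"
  by (rule additive_subgroupI') (auto simp: bounded_degree_def proj_add proj_neg)

lemma bounded_degree_mult:
  assumes x: "x \<in> bounded_degree m" and y: "y \<in> bounded_degree n"
  shows "x \<otimes> y \<in> bounded_degree (m + n)"
proof -
  have c: "x \<in> carrier R" "y \<in> carrier R" using x y by (auto simp: bounded_degree_def)
  have "y = (\<Oplus>j\<in>{..n}. proj j y)" using y c by (intro proj_sum) (auto simp: bounded_degree_def)
  then have "x \<otimes> y = x \<otimes> (\<Oplus>j\<in>{..n}. proj j y)" by simp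
  also have "\<dots> = (\<Oplus>j\<in>{..n}. x \<otimes> proj j y)" using c by (intro finsum_rdistr) auto
  also have "\<dots> \<in> bounded_degree (m + n)"
  proof (rule additive_subgroup_finsum[OF bounded_degree_subgroup])
    fix j assume j: "j \<in> {..n}"
    have "proj i (x \<otimes> proj j y) = \<zero>" if "i > m + n" for i
    proof -
      have "i - j > m" "\<not> i < j" using that j by auto
      then have "proj (i - j) x = \<zero>" using x by (simp add: bounded_degree_def)
      then show ?thesis using proj_mult[OF c(1) proj_props(1)[OF c(2)], of i j] c by simp
    qed
    then show "x \<otimes> proj j y \<in> bounded_degree (m + n)" using c by (simp add: bounded_degree_def)
  qed simp
  finally show ?thesis .
qed

lemma bounded_degree_pow: "x \<in> bounded_degree m \<Longrightarrow> x [^] (k :: nat) \<in> bounded_degree (k * m)"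
proof (induction k)
  case 0
  then show ?case using proj_homogeneous[OF one_component] by (simp add: bounded_degree_def)
next
  case (Suc k)
  then show ?case using bounded_degree_mult[OF Suc.IH Suc.prems] by (simp add: add.commute)
qed

lemma bounded_degree_exists: "x \<in> carrier R \<Longrightarrow> \<exists>n. x \<in> bounded_degree n"
proof -
  assume x: "x \<in> carrier R"
  have fin: "finite {n. proj n x \<noteq> \<zero>}" by (rule proj_props(2)[OF x])
  have "proj i x = \<zero>" if "i > Max (insert 0 {n. proj n x \<noteq> \<zero>})" for i
  proof (rule ccontr)
    assume "proj i x \<noteq> \<zero>"
    then have "i \<le> Max (insert 0 {n. proj n x \<noteq> \<zero>})" using fin by (intro Max_ge) auto
    then show False using that by simp
  qed
  then have "x \<in> bounded_degree (Max (insert 0 {n. proj n x \<noteq> \<zero>}))"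
    unfolding bounded_degree_def using x by blast
  then show ?thesis by blast
qed

lemma bounded_degree_mono: "m \<le> n \<Longrightarrow> bounded_degree m \<subseteq> bounded_degree n"
  by (auto simp: bounded_degree_def)

lemma bounded_degree_span:
  assumes U: "\<And>n. length (U n) \<le> C" "\<And>n. set (U n) \<subseteq> carrier R" "\<And>n. G n \<subseteq> Span K (U n)"
  shows "\<exists>Vs. length Vs \<le> C * Suc n \<and> set Vs \<subseteq> carrier R \<and> bounded_degree n \<subseteq> Span K Vs"
proof -
  let ?Vs = "concat (map U [0..<Suc n])"
  have Vc: "set ?Vs \<subseteq> carrier R" using U(2) by auto
  have "length ?Vs = sum_list (map (\<lambda>i. length (U i)) [0..<Suc n])" by (simp add: length_concat comp_def)
  also have "\<dots> \<le> sum_list (map (\<lambda>i. C) [0..<Suc n])" using U(1) by (intro sum_list_mono)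
  also have "\<dots> = C * Suc n" by (simp add: sum_list_triv)
  finally have len: "length ?Vs \<le> C * Suc n" .
  have "x \<in> Span K ?Vs" if x: "x \<in> bounded_degree n" for x
  proof -
    have c: "x \<in> carrier R" using x by (simp add: bounded_degree_def)
    have sub: "additive_subgroup (Span K ?Vs) R"
      by (rule additive_subgroup.intro[OF Span_is_add_subgroup[OF subfield_base Vc]])
    have "proj i x \<in> Span K ?Vs" if "i \<in> {..n}" for i
    proof -
      have "i \<in> set [0..<Suc n]" using that by auto
      then have "set (U i) \<subseteq> set ?Vs" unfolding set_concat set_map by blast
      then show ?thesis using mono_Span_sublist[OF subfield_base _ Vc] U(3)[of i] proj_props(1)[OF c, of i] by blast
    qed
    then have "(\<Oplus>i\<in>{..n}. proj i x) \<in> Span K ?Vs" by (intro additive_subgroup_finsum[OF sub]) auto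
    moreover have "x = (\<Oplus>i\<in>{..n}. proj i x)" using x c by (intro proj_sum) (auto simp: bounded_degree_def)
    ultimately show ?thesis by simp
  qed
  then show ?thesis using len Vc by blast
qed

text \<open>The monomials \<open>x^i y^j\<close> with \<open>i, j \<le> s\<close> are independent
  and their number is quadratic in \<open>s\<close>, while a bounded Hilbert function lets the
  pieces of bounded degree grow only linearly.\<close>

lemma dim_two_not_bounded:
  assumes dim: "krull_dim R = 2"
  shows "\<nexists>C. \<forall>n. \<exists>Us. length Us \<le> C \<and> set Us \<subseteq> carrier R \<and> G n \<subseteq> Span K Us"
proof
  assume "\<exists>C. \<forall>n. \<exists>Us. length Us \<le> C \<and> set Us \<subseteq> carrier R \<and> G n \<subseteq> Span K Us"
  then obtain C U where U: "\<And>n. length (U n) \<le> C" "\<And>n. set (U n) \<subseteq> carrier R" "\<And>n. G n \<subseteq> Span K (U n)"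
    by metis
  obtain P0 P1 P2 where P: "primeideal P0 R" "primeideal P1 R" "primeideal P2 R" "P0 \<subset> P1" "P1 \<subset> P2"
    using krull_dim_two_chain[OF dim] by blast
  obtain x y where x: "x \<in> P1" "x \<notin> P0" and y: "y \<in> P2" "y \<notin> P1" using P(4,5) by blast
  have xc [simp]: "x \<in> carrier R" and yc [simp]: "y \<in> carrier R"
    using ideal.Icarr[OF primeideal.axioms(1)] P(2,3) x(1) y(1) by metis+
  obtain m n where mn: "x \<in> bounded_degree m" "y \<in> bounded_degree n"
    using bounded_degree_exists[OF xc] bounded_degree_exists[OF yc] by blast
  define D where "D = m + n"
  have xD: "x \<in> bounded_degree D" and yD: "y \<in> bounded_degree D"
    using mn bounded_degree_mono[of m D] bounded_degree_mono[of n D] by (auto simp: D_def)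
  \<comment> \<open>Chosen so that \<open>C (2 s D + 1) \<le> s (s + 1) < (s + 1)^2\<close>, the
    number of monomials.\<close>
  define s where "s = C * Suc (2 * D)"
  obtain Vs where Vs: "length Vs \<le> C * Suc (2 * s * D)" "set Vs \<subseteq> carrier R"
    "bounded_degree (2 * s * D) \<subseteq> Span K Vs" using bounded_degree_span[OF U] by blast
  define u where "u z = x [^] (fst z :: nat) \<otimes> y [^] (snd z :: nat)" for z
  let ?I = "{..s} \<times> {..s}"
  have "u z \<in> Span K Vs" if "z \<in> ?I" for z
  proof -
    have "x [^] fst z \<in> bounded_degree (fst z * D)" "y [^] snd z \<in> bounded_degree (snd z * D)"
      using bounded_degree_pow xD yD by blast+
    then have "u z \<in> bounded_degree (fst z * D + snd z * D)" unfolding u_def by (rule bounded_degree_mult)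
    moreover have "fst z * D + snd z * D \<le> 2 * s * D"
    proof -
      have "fst z * D \<le> s * D" "snd z * D \<le> s * D" using that by (auto intro: mult_right_mono)
      then show ?thesis by linarith
    qed
    ultimately show ?thesis using bounded_degree_mono Vs(3) by blast
  qed
  moreover have "length Vs < card ?I"
  proof -
    have "C * Suc (2 * s * D) \<le> C * (Suc s * Suc (2 * D))" by (intro mult_left_mono) auto
    also have "\<dots> = s * Suc s" by (simp only: s_def ac_simps)
    also have "\<dots> < Suc s * Suc s" by simp
    finally show ?thesis using Vs(1) by (simp add: card_cartesian_product)
  qed
  ultimately obtain k where k: "k \<in> ?I \<rightarrow> K" "\<exists>z\<in>?I. k z \<noteq> \<zero>" "(\<Oplus>z\<in>?I. k z \<otimes> u z) = \<zero>"
    using dependent_if_card_gt[OF subfield_base _ Vs(2), of ?I u] by auto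
  define k' where "k' i j = (if i \<le> s \<and> j \<le> s then k (i, j) else \<zero>)" for i j
  have k'K: "k' i j \<in> K" for i j
    using k(1) subringE(2)[OF subfieldE(1)[OF subfield_base]] by (auto simp: k'_def)
  have k'c [simp]: "k' i j \<in> carrier R" for i j using k'K K_carrier by blast
  have kc: "k z \<in> carrier R" if "z \<in> ?I" for z using k(1) that K_carrier by blast
  have "\<zero> = (\<Oplus>i\<in>{..s}. \<Oplus>j\<in>{..s}. k (i, j) \<otimes> u (i, j))"
  proof -
    have "u z \<in> carrier R" for z by (simp add: u_def)
    then show ?thesis using finsum_cartesian[of "{..s}" "{..s}" "\<lambda>z. k z \<otimes> u z"] kc k(3) by simp
  qed
  also have "\<dots> = (\<Oplus>i\<in>{..s}. x [^] i \<otimes> (\<Oplus>j\<in>{..s}. k' i j \<otimes> y [^] j))"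
  proof (intro finsum_cong' refl)
    fix i assume i: "i \<in> {..s}"
    have "(\<Oplus>j\<in>{..s}. k (i, j) \<otimes> u (i, j)) = (\<Oplus>j\<in>{..s}. x [^] i \<otimes> (k' i j \<otimes> y [^] j))"
      using i kc by (intro finsum_cong') (auto simp: u_def k'_def m_ac)
    also have "\<dots> = x [^] i \<otimes> (\<Oplus>j\<in>{..s}. k' i j \<otimes> y [^] j)" by (intro finsum_rdistr[symmetric]) auto
    finally show "(\<Oplus>j\<in>{..s}. k (i, j) \<otimes> u (i, j)) = x [^] i \<otimes> (\<Oplus>j\<in>{..s}. k' i j \<otimes> y [^] j)" .
  qed auto
  finally have mem: "(\<Oplus>i\<in>{..s}. x [^] i \<otimes> (\<Oplus>j\<in>{..s}. k' i j \<otimes> y [^] j)) \<in> P0"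
    using additive_subgroup.zero_closed[OF ideal.axioms(1)[OF primeideal.axioms(1)[OF P(1)]]] by simp
  have "P0 \<subseteq> P1" "P1 \<subseteq> P2" using P(4,5) by auto
  then have "\<forall>i\<le>s. \<forall>j\<le>s. k' i j = \<zero>"
    by (rule prime_poly_two[OF P(1-3) _ _ x y k'K mem])
  then show False using k(2) by (auto simp: k'_def)
qed

corollary dim_two_principal_not_large:
  assumes "krull_dim R = 2" "f \<in> G d" "d > 0"
  shows "\<not> (\<forall>n\<ge>M. G n \<subseteq> Idl {f})"
  using principal_ideal_bounded[OF _ assms(2,3)] dim_two_not_bounded[OF assms(1)] by metis

end

section \<open>A conductor for the saturation\<close>

context cring
begin

context
  fixes A :: "'a set"
  assumes A: "subring A R"
begin

lemma Span_subring_props: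
  assumes "set bs \<subseteq> carrier R"
  shows "\<zero> \<in> Span A bs" "x \<in> Span A bs \<Longrightarrow> y \<in> Span A bs \<Longrightarrow> x \<oplus> y \<in> Span A bs"
    "a \<in> A \<Longrightarrow> x \<in> Span A bs \<Longrightarrow> a \<otimes> x \<in> Span A bs"
proof -
  note s = subringE[OF A]
  have "\<zero> \<in> Span A bs \<and> (\<forall>x\<in>Span A bs. \<forall>y\<in>Span A bs. x \<oplus> y \<in> Span A bs) \<and>
    (\<forall>a\<in>A. \<forall>x\<in>Span A bs. a \<otimes> x \<in> Span A bs)"
    using assms
  proof (induction bs)
    case Nil
    show ?case using s(1) by auto
  next
    case (Cons b bs)
    have b [simp]: "b \<in> carrier R" and bs: "set bs \<subseteq> carrier R" using Cons.prems by auto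
    note IH = Cons.IH[OF bs]
    have Sc: "x \<in> carrier R" if "x \<in> Span A bs" for x using that Span_in_carrier[OF s(1) bs] by blast
    have Ac: "a \<in> carrier R" if "a \<in> A" for a using that s(1) by blast
    show ?case
    proof (intro conjI ballI)
      have "\<zero> = \<zero> \<otimes> b \<oplus> \<zero>" by simp
      then show "\<zero> \<in> Span A (b # bs)" unfolding Span_Cons_mem using IH s(2) by blast
    next
      fix x y assume "x \<in> Span A (b # bs)" "y \<in> Span A (b # bs)"
      then obtain k u l v where x: "k \<in> A" "u \<in> Span A bs" "x = k \<otimes> b \<oplus> u"
        and y: "l \<in> A" "v \<in> Span A bs" "y = l \<otimes> b \<oplus> v" unfolding Span_Cons_mem by blast
      have "x \<oplus> y = (k \<oplus> l) \<otimes> b \<oplus> (u \<oplus> v)"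
        unfolding x(3) y(3) using Ac[OF x(1)] Ac[OF y(1)] Sc[OF x(2)] Sc[OF y(2)] b by algebra
      then show "x \<oplus> y \<in> Span A (b # bs)" unfolding Span_Cons_mem using IH s(7) x y by blast
    next
      fix a x assume a: "a \<in> A" and "x \<in> Span A (b # bs)"
      then obtain k u where x: "k \<in> A" "u \<in> Span A bs" "x = k \<otimes> b \<oplus> u" unfolding Span_Cons_mem by blast
      have "a \<otimes> x = (a \<otimes> k) \<otimes> b \<oplus> a \<otimes> u"
        unfolding x(3) using Ac[OF x(1)] Ac[OF a] Sc[OF x(2)] b by algebra
      then show "a \<otimes> x \<in> Span A (b # bs)" unfolding Span_Cons_mem using IH s(6) x a by blast
    qed
  qed
  then show "\<zero> \<in> Span A bs" "x \<in> Span A bs \<Longrightarrow> y \<in> Span A bs \<Longrightarrow> x \<oplus> y \<in> Span A bs"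
    "a \<in> A \<Longrightarrow> x \<in> Span A bs \<Longrightarrow> a \<otimes> x \<in> Span A bs" by auto
qed

lemma Span_subring_Cons:
  assumes "set (b # bs) \<subseteq> carrier R"
  shows "Span A bs \<subseteq> Span A (b # bs)"
proof
  fix x assume x: "x \<in> Span A bs"
  have "x \<in> carrier R" using x Span_in_carrier[OF subringE(1)[OF A], of bs] assms by auto
  then have "x = \<zero> \<otimes> b \<oplus> x" using assms by simp
  then show "x \<in> Span A (b # bs)" unfolding Span_Cons_mem using x subringE(2)[OF A] by blast
qed

lemma Span_subring_base: "set bs \<subseteq> carrier R \<Longrightarrow> set bs \<subseteq> Span A bs"
proof (induction bs)
  case (Cons b bs)
  then have "b = \<one> \<otimes> b \<oplus> \<zero>" by simp
  moreover have "\<zero> \<in> Span A bs" using Cons.prems by (intro Span_subring_props(1)) simp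
  ultimately have "b \<in> Span A (b # bs)"
    unfolding Span_Cons_mem using subringE(3)[OF A] by blast
  moreover have "set bs \<subseteq> Span A bs" using Cons by simp
  ultimately show ?case using Span_subring_Cons[OF Cons.prems] by (simp only: list.set insert_subset) blast
qed simp

end

end

text \<open>\<open>f1, f2\<close> is a regular sequence on \<open>A\<close>, hence on free \<open>A\<close>-modules; a common denominator \<open>a\<close>
  maps the module spanned by \<open>bs\<close> into a free one.\<close>

lemma (in domain) conductor_exists:
  assumes A: "subring A R" and f: "f1 \<in> A" "f1 \<noteq> \<zero>" "f2 \<in> A"
    and reg: "\<And>\<alpha> \<beta> N. \<alpha> \<in> A \<Longrightarrow> \<beta> \<in> A \<Longrightarrow> f2 [^] (N::nat) \<otimes> \<alpha> = f1 [^] N \<otimes> \<beta> \<Longrightarrow> \<exists>\<gamma>\<in>A. \<alpha> = f1 [^] N \<otimes> \<gamma>"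
    and bs: "set bs \<subseteq> carrier R"
  shows "\<exists>a\<in>A. a \<noteq> \<zero> \<and> (\<forall>x\<in>Span A bs. \<forall>y\<in>Span A bs. \<forall>N.
    f2 [^] (N::nat) \<otimes> x = f1 [^] N \<otimes> y \<longrightarrow> (\<exists>z\<in>Span A bs. a \<otimes> x = f1 [^] N \<otimes> z))"
  using bs
proof (induction bs)
  case Nil
  have "\<one> \<in> A" "\<one> \<noteq> \<zero>" using subringE(3)[OF A] by auto
  moreover have "\<exists>z\<in>Span A []. \<one> \<otimes> x = f1 [^] N \<otimes> z" if "x \<in> Span A []" for x and N :: nat
    using that f subringE(1)[OF A] by auto
  ultimately show ?case by blast
next
  case (Cons b bs)
  note s = subringE[OF A]
  have bc [simp]: "b \<in> carrier R" and bs: "set bs \<subseteq> carrier R" using Cons.prems by auto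
  obtain a where a: "a \<in> A" "a \<noteq> \<zero>" and IH: "\<And>x y N. x \<in> Span A bs \<Longrightarrow> y \<in> Span A bs \<Longrightarrow>
    f2 [^] (N::nat) \<otimes> x = f1 [^] N \<otimes> y \<Longrightarrow> \<exists>z\<in>Span A bs. a \<otimes> x = f1 [^] N \<otimes> z"
    using Cons.IH[OF bs] by blast
  have Sc: "x \<in> carrier R" if "x \<in> Span A bs" for x using that Span_in_carrier[OF s(1) bs] by blast
  have Ac: "\<alpha> \<in> carrier R" if "\<alpha> \<in> A" for \<alpha> using that s(1) by blast
  note props = Span_subring_props[OF A bs]
  have powA: "g [^] N \<in> A" if "g \<in> A" for g and N :: nat
    using that s(3,6) by (induction N) auto
  note pow = powA[OF f(1)] powA[OF f(3)]
  have fc [simp]: "f1 \<in> carrier R" "f2 \<in> carrier R" "a \<in> carrier R" using f a Ac by auto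
  have neg: "\<ominus> x \<in> Span A bs" if "x \<in> Span A bs" for x
    using props(3)[OF s(5)[OF s(3)] that] Sc[OF that] by (simp add: l_minus)
  \<comment> \<open>Either \<open>b\<close> is torsion modulo the earlier span, and then
    \<open>\<alpha>\<close> moves everything back into it at the cost of one more factor of the
    conductor; or \<open>b\<close> is free over it, and coefficients of \<open>b\<close> can be
    compared.\<close>
  show ?case
  proof (cases "\<exists>\<alpha>\<in>A. \<alpha> \<noteq> \<zero> \<and> \<alpha> \<otimes> b \<in> Span A bs")
    case True
    then obtain \<alpha> where \<alpha>: "\<alpha> \<in> A" "\<alpha> \<noteq> \<zero>" "\<alpha> \<otimes> b \<in> Span A bs" by blast
    have into: "\<alpha> \<otimes> x \<in> Span A bs" and xc: "x \<in> carrier R" if xb: "x \<in> Span A (b # bs)" for x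
    proof -
      obtain k u where x: "k \<in> A" "u \<in> Span A bs" "x = k \<otimes> b \<oplus> u" using xb unfolding Span_Cons_mem by blast
      have "\<alpha> \<otimes> x = k \<otimes> (\<alpha> \<otimes> b) \<oplus> \<alpha> \<otimes> u"
        unfolding x(3) using Ac[OF x(1)] Ac[OF \<alpha>(1)] Sc[OF x(2)] bc by algebra
      then show "\<alpha> \<otimes> x \<in> Span A bs" using props(2)[OF props(3)[OF x(1) \<alpha>(3)] props(3)[OF \<alpha>(1) x(2)]] by simp
      show "x \<in> carrier R" unfolding x(3) using Ac[OF x(1)] Sc[OF x(2)] by simp
    qed
    have "\<exists>z\<in>Span A (b # bs). (a \<otimes> \<alpha>) \<otimes> x = f1 [^] N \<otimes> z"
      if xy: "x \<in> Span A (b # bs)" "y \<in> Span A (b # bs)" "f2 [^] N \<otimes> x = f1 [^] N \<otimes> y" for x y and N :: nat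
    proof -
      have c: "x \<in> carrier R" "y \<in> carrier R" "\<alpha> \<in> carrier R" using xc xy Ac[OF \<alpha>(1)] by auto
      have "f2 [^] N \<otimes> (\<alpha> \<otimes> x) = \<alpha> \<otimes> (f2 [^] N \<otimes> x)" using c by (simp add: m_ac)
      also have "\<dots> = f1 [^] N \<otimes> (\<alpha> \<otimes> y)" unfolding xy(3) using c by (simp add: m_ac)
      finally obtain z where z: "z \<in> Span A bs" "a \<otimes> (\<alpha> \<otimes> x) = f1 [^] N \<otimes> z"
        using IH[OF into[OF xy(1)] into[OF xy(2)]] by blast
      then show ?thesis using Span_subring_Cons[OF A Cons.prems] c by (auto simp: m_assoc)
    qed
    moreover have "a \<otimes> \<alpha> \<in> A" "a \<otimes> \<alpha> \<noteq> \<zero>"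
      using a \<alpha> s(6) Ac integral[of a \<alpha>] by auto
    ultimately show ?thesis by blast
  next
    case False
    then have indep: "\<alpha> = \<zero>" if "\<alpha> \<in> A" "\<alpha> \<otimes> b \<in> Span A bs" for \<alpha> using that by blast
    have "\<exists>z\<in>Span A (b # bs). a \<otimes> x = f1 [^] N \<otimes> z"
      if xy: "x \<in> Span A (b # bs)" "y \<in> Span A (b # bs)" "f2 [^] N \<otimes> x = f1 [^] N \<otimes> y" for x y and N :: nat
    proof -
      obtain k u where x: "k \<in> A" "u \<in> Span A bs" "x = k \<otimes> b \<oplus> u" using xy(1) unfolding Span_Cons_mem by blast
      obtain l v where y: "l \<in> A" "v \<in> Span A bs" "y = l \<otimes> b \<oplus> v" using xy(2) unfolding Span_Cons_mem by blast
      note c = Ac[OF x(1)] Ac[OF y(1)] Sc[OF x(2)] Sc[OF y(2)] bc nat_pow_closed[OF fc(1), of N] nat_pow_closed[OF fc(2), of N]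
      have "(f2 [^] N \<otimes> k \<ominus> f1 [^] N \<otimes> l) \<otimes> b
          = (f2 [^] N \<otimes> (k \<otimes> b \<oplus> u) \<ominus> f1 [^] N \<otimes> (l \<otimes> b \<oplus> v)) \<oplus> (f1 [^] N \<otimes> v \<oplus> \<ominus> (f2 [^] N \<otimes> u))"
        using c by algebra
      also have "\<dots> = f1 [^] N \<otimes> v \<oplus> \<ominus> (f2 [^] N \<otimes> u)"
        using xy(3) c unfolding x(3) y(3) by (simp add: minus_eq r_neg)
      also have "\<dots> \<in> Span A bs"
        by (rule props(2)[OF props(3)[OF pow(1) y(2)] neg[OF props(3)[OF pow(2) x(2)]]])
      finally have bS: "(f2 [^] N \<otimes> k \<ominus> f1 [^] N \<otimes> l) \<otimes> b \<in> Span A bs" .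
      have "f2 [^] N \<otimes> k \<ominus> f1 [^] N \<otimes> l \<in> A"
        unfolding minus_eq by (rule s(7)[OF s(6)[OF pow(2) x(1)] s(5)[OF s(6)[OF pow(1) y(1)]]])
      from indep[OF this bS] have "f2 [^] N \<otimes> k \<ominus> f1 [^] N \<otimes> l = \<zero>" .
      \<comment> \<open>The coefficients of \<open>b\<close> satisfy an equation in
        \<open>A\<close>, where \<open>reg\<close> makes \<open>k\<close> divisible by
        \<open>f1^N\<close>.\<close>
      then have kl: "f2 [^] N \<otimes> k = f1 [^] N \<otimes> l" using c by (simp add: r_right_minus_eq)
      then obtain \<gamma> where \<gamma>: "\<gamma> \<in> A" "k = f1 [^] N \<otimes> \<gamma>" using reg[OF x(1) y(1)] by blast
      have "f2 [^] N \<otimes> u = f2 [^] N \<otimes> (k \<otimes> b \<oplus> u) \<ominus> (f2 [^] N \<otimes> k) \<otimes> b" using c by algebra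
      also have "\<dots> = f1 [^] N \<otimes> (l \<otimes> b \<oplus> v) \<ominus> (f1 [^] N \<otimes> l) \<otimes> b" using xy(3) kl unfolding x(3) y(3) by simp
      also have "\<dots> = f1 [^] N \<otimes> v" using c by algebra
      finally obtain z where z: "z \<in> Span A bs" "a \<otimes> u = f1 [^] N \<otimes> z" using IH[OF x(2) y(2)] by blast
      have "a \<otimes> x = a \<otimes> ((f1 [^] N \<otimes> \<gamma>) \<otimes> b) \<oplus> a \<otimes> u" unfolding x(3) \<gamma>(2) using Ac[OF \<gamma>(1)] c by (simp add: r_distr)
      also have "\<dots> = f1 [^] N \<otimes> ((a \<otimes> \<gamma>) \<otimes> b \<oplus> z)"
        unfolding z(2) using Ac[OF \<gamma>(1)] c Sc[OF z(1)] by (simp add: r_distr m_ac)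
      finally have e: "a \<otimes> x = f1 [^] N \<otimes> ((a \<otimes> \<gamma>) \<otimes> b \<oplus> z)" .
      have "(a \<otimes> \<gamma>) \<otimes> b \<oplus> z \<in> Span A (b # bs)"
        unfolding Span_Cons_mem using z(1) s(6)[OF a(1) \<gamma>(1)] by blast
      with e show ?thesis by (rule bexI)
    qed
    then show ?thesis using a by blast
  qed
qed

section \<open>Homogeneous parameters \<open>f1\<close>, \<open>f2\<close> and the subring they
  generate\<close>

locale graded_surface = standard_graded_algebra K R G + "domain" R
  for K and R (structure) and G +
  fixes f1 f2 :: 'a and d1 d2 :: nat
  assumes dim: "krull_dim R = 2"
    and f1: "f1 \<in> G d1" and f2: "f2 \<in> G d2" and d_pos: "0 < d1" "0 < d2"
    and prim: "primary R G {f1, f2}"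
begin

lemma f_carrier [simp]: "f1 \<in> carrier R" "f2 \<in> carrier R"
  using f1 f2 G_subset by blast+

text \<open>The degree from which on \<open>f1\<close> and \<open>f2\<close> generate everything. It
  is fixed once because it bounds both the degrees of module generators over
  \<open>K[f1, f2]\<close> and the degrees in which the cover can have cohomology.\<close>

definition M0 :: nat where
  "M0 = (SOME M. \<forall>n\<ge>M. \<forall>x\<in>G n. \<exists>a\<in>component R G (int n - int d1). \<exists>b\<in>component R G (int n - int d2).
    x = a \<otimes> f1 \<oplus> b \<otimes> f2)"

lemma large_degree:
  "n \<ge> M0 \<Longrightarrow> x \<in> G n \<Longrightarrow> \<exists>a\<in>component R G (int n - int d1). \<exists>b\<in>component R G (int n - int d2). x = a \<otimes> f1 \<oplus> b \<otimes> f2"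
  using someI_ex[OF primary_large_degree[OF prim f1 f2]] unfolding M0_def by blast

text \<open>If \<open>f2^j\<close> were in \<open>(f1)\<close>, then rewriting a form of large
  degree as \<open>a f1 + b f2\<close>, and \<open>b\<close> again in the same way, \<open>j\<close>
  times in all, would put it into \<open>(f1)\<close>, contradicting dimension two.\<close>

lemma f2_pow_not_multiple: "f2 [^] (j :: nat) \<notin> Idl {f1}"
proof
  assume mem: "f2 [^] j \<in> Idl {f1}"
  interpret I: ideal "Idl {f1}" R by (rule genideal_ideal) simp
  have f1I: "f1 \<in> Idl {f1}" using genideal_self[of "{f1}"] by simp
  have "\<exists>c\<in>component R G (int n - int (i * d2)). x \<ominus> c \<otimes> f2 [^] i \<in> Idl {f1}"
    if "n \<ge> M0 + i * d2" "x \<in> G n" for i n x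
    using that
  proof (induction i arbitrary: n x)
    case 0
    then show ?case using I.zero_closed G_subset[OF 0(2)] by (intro bexI[of _ x]) (auto simp: minus_eq r_neg)
  next
    case (Suc i)
    then have "n \<ge> M0 + i * d2" by simp
    then obtain c where c: "c \<in> component R G (int n - int (i * d2))" "x \<ominus> c \<otimes> f2 [^] i \<in> Idl {f1}"
      using Suc.IH Suc.prems(2) by blast
    have pos: "int n - int (i * d2) = int (n - i * d2)" using Suc.prems(1) by simp
    have large: "n - i * d2 \<ge> M0" using Suc.prems(1) by simp
    obtain a b where ab: "a \<in> component R G (int (n - i * d2) - int d1)" "b \<in> component R G (int (n - i * d2) - int d2)"
      "c = a \<otimes> f1 \<oplus> b \<otimes> f2" using large_degree[OF large, of c] c(1) unfolding pos by auto
    note cl = component_closed[OF c(1)] component_closed[OF ab(1)] component_closed[OF ab(2)] G_subset[OF Suc.prems(2)]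
      f_carrier nat_pow_closed[OF f_carrier(2), of i]
    have "x \<ominus> b \<otimes> f2 [^] Suc i = (x \<ominus> (a \<otimes> f1 \<oplus> b \<otimes> f2) \<otimes> f2 [^] i) \<oplus> (a \<otimes> f2 [^] i) \<otimes> f1"
      unfolding nat_pow_Suc using cl by algebra
    also have "\<dots> \<in> Idl {f1}" unfolding ab(3)[symmetric] using c(2) I.I_l_closed[OF f1I] cl by (intro I.a_closed) auto
    finally have "x \<ominus> b \<otimes> f2 [^] Suc i \<in> Idl {f1}" .
    moreover have e: "int (n - i * d2) - int d2 = int n - int (Suc i * d2)"
      unfolding pos[symmetric] mult_Suc of_nat_add by linarith
    have "b \<in> component R G (int n - int (Suc i * d2))" using ab(2) unfolding e .
    ultimately show ?case by blast
  qed
  note approx = this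
  have "x \<in> Idl {f1}" if n: "n \<ge> M0 + j * d2" and x: "x \<in> G n" for n x
  proof -
    obtain c where c: "c \<in> component R G (int n - int (j * d2))" "x \<ominus> c \<otimes> f2 [^] j \<in> Idl {f1}"
      using approx[OF n x] by blast
    have cc: "c \<in> carrier R" "x \<in> carrier R" using component_closed[OF c(1)] G_subset[OF x] .
    have "(x \<ominus> c \<otimes> f2 [^] j) \<oplus> c \<otimes> f2 [^] j \<in> Idl {f1}"
      using c(2) I.I_l_closed[OF mem] cc by (intro I.a_closed) auto
    moreover have "(x \<ominus> c \<otimes> f2 [^] j) \<oplus> c \<otimes> f2 [^] j = x" using cc by (simp add: minus_eq a_assoc l_neg)
    ultimately show ?thesis by simp
  qed
  then show False using dim_two_principal_not_large[OF dim f1 d_pos(1), of "M0 + j * d2"] by blast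
qed

lemma f2_nonzero: "f2 \<noteq> \<zero>"
proof
  assume "f2 = \<zero>"
  then have "f2 [^] (1::nat) = \<zero>" by simp
  moreover have "\<zero> \<in> Idl {f1}"
    using additive_subgroup.zero_closed[OF ideal.axioms(1)[OF genideal_ideal[of "{f1}"]]] by simp
  ultimately show False using f2_pow_not_multiple[of 1] by simp
qed

end

lemma (in graded_surface) swap: "graded_surface K R G f2 f1 d2 d1"
  using dim f1 f2 d_pos prim by unfold_locales (auto simp: insert_commute)

context graded_surface
begin

lemma f1_nonzero: "f1 \<noteq> \<zero>"
  using graded_surface.f2_nonzero[OF swap] .

abbreviation "C2 \<equiv> generate (add_monoid R) {k \<otimes> f2 [^] (j::nat) | k j. k \<in> K}"

text \<open>\<open>A\<close> is the subring \<open>K[f1, f2]\<close> and \<open>C2\<close> is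
  \<open>K[f2]\<close>, both given as additive spans of scaled monomials so that their elements can
  be treated by induction on sums.\<close>

definition A :: "'a set" where
  "A = generate (add_monoid R) {k \<otimes> (f1 [^] (i::nat) \<otimes> f2 [^] (j::nat)) | k i j. k \<in> K}"

lemma K_closed: "k \<in> K \<Longrightarrow> k \<in> carrier R"
  using K_carrier by blast

lemmas K_sub = subringE[OF subfieldE(1)[OF subfield_base]]

lemma C2_gen_carrier: "{k \<otimes> f2 [^] (j::nat) | k j. k \<in> K} \<subseteq> carrier R"
  using K_closed by auto

lemma A_gen_carrier: "{k \<otimes> (f1 [^] (i::nat) \<otimes> f2 [^] (j::nat)) | k i j. k \<in> K} \<subseteq> carrier R"
  using K_closed by auto

lemma C2_subgroup: "additive_subgroup C2 R"
  by (rule additive_subgroup.intro[OF add.generate_is_subgroup]) (use C2_gen_carrier in auto)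

lemma A_subgroup: "additive_subgroup A R"
  unfolding A_def by (rule additive_subgroup.intro[OF add.generate_is_subgroup]) (use A_gen_carrier in auto)

lemma A_gen: "k \<in> K \<Longrightarrow> k \<otimes> (f1 [^] (i::nat) \<otimes> f2 [^] (j::nat)) \<in> A"
  unfolding A_def by (rule generate.incl) blast

lemma A_mult: "x \<in> A \<Longrightarrow> y \<in> A \<Longrightarrow> x \<otimes> y \<in> A"
  unfolding A_def
proof (rule generate_add_mult_closed[OF A_gen_carrier])
  fix a b assume "a \<in> {k \<otimes> (f1 [^] (i::nat) \<otimes> f2 [^] (j::nat)) | k i j. k \<in> K}"
    "b \<in> {k \<otimes> (f1 [^] (i::nat) \<otimes> f2 [^] (j::nat)) | k i j. k \<in> K}"
  then obtain k i j k' and i' j' :: nat where "k \<in> K" "k' \<in> K" "a = k \<otimes> (f1 [^] (i::nat) \<otimes> f2 [^] (j::nat))"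
    "b = k' \<otimes> (f1 [^] i' \<otimes> f2 [^] j')" by blast
  note ab = this
  have "a \<otimes> b = (k \<otimes> k') \<otimes> ((f1 [^] i \<otimes> f1 [^] i') \<otimes> (f2 [^] j \<otimes> f2 [^] j'))"
    unfolding ab(3,4) using ab(1,2) K_closed by (simp add: m_ac)
  also have "\<dots> = (k \<otimes> k') \<otimes> (f1 [^] (i + i') \<otimes> f2 [^] (j + j'))" by (simp add: nat_pow_mult)
  finally show "a \<otimes> b \<in> {k \<otimes> (f1 [^] (i::nat) \<otimes> f2 [^] (j::nat)) | k i j. k \<in> K}"
    using ab(1,2) K_sub(6) by blast
qed

lemma K_A: "K \<subseteq> A"
  using A_gen[of _ 0 0] K_closed by auto

lemma f_A: "f1 \<in> A" "f2 \<in> A"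
  using A_gen[OF K_sub(3), of 1 0] A_gen[OF K_sub(3), of 0 1] by auto

lemma A_subring: "subring A R"
  using additive_subgroup.a_subset[OF A_subgroup] additive_subgroup.a_inv_closed[OF A_subgroup]
    additive_subgroup.a_closed[OF A_subgroup] A_mult K_A K_sub(3)
  by (intro subringI) auto

lemma A_carrier: "x \<in> A \<Longrightarrow> x \<in> carrier R"
  using subringE(1)[OF A_subring] by blast

text \<open>Sorts the monomials by whether they contain \<open>f1\<close>.\<close>

lemma A_decomp: "\<alpha> \<in> A \<Longrightarrow> \<exists>\<kappa>\<in>C2. \<exists>\<alpha>'\<in>A. \<alpha> = \<kappa> \<oplus> f1 \<otimes> \<alpha>'"
  unfolding A_def[symmetric]
proof -
  assume "\<alpha> \<in> A"
  then have "\<alpha> \<in> generate (add_monoid R) {k \<otimes> (f1 [^] (i::nat) \<otimes> f2 [^] (j::nat)) | k i j. k \<in> K}"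
    unfolding A_def .
  then show ?thesis
    using A_gen_carrier
  proof (induction rule: generate_add_induct)
    case zero
    have "\<zero> = \<zero> \<oplus> f1 \<otimes> \<zero>" by simp
    then show ?case
      using additive_subgroup.zero_closed[OF C2_subgroup] additive_subgroup.zero_closed[OF A_subgroup] by blast
  next
    case (incl a)
    then obtain k i j where a: "k \<in> K" "a = k \<otimes> (f1 [^] (i::nat) \<otimes> f2 [^] (j::nat))" by blast
    show ?case
    proof (cases i)
      case 0
      have "k \<otimes> f2 [^] j \<in> C2" using a(1) by (intro generate.incl) blast
      moreover have "a = k \<otimes> f2 [^] j \<oplus> f1 \<otimes> \<zero>" using a 0 K_closed by simp
      ultimately show ?thesis using additive_subgroup.zero_closed[OF A_subgroup] by blast
    next
      case (Suc i')
      have "a = \<zero> \<oplus> f1 \<otimes> (k \<otimes> (f1 [^] i' \<otimes> f2 [^] j))" using a Suc K_closed by (simp add: m_ac)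
      then show ?thesis using A_gen[OF a(1)] additive_subgroup.zero_closed[OF C2_subgroup] by blast
    qed
  next
    case (neg a)
    then obtain \<kappa> \<alpha>' where h: "\<kappa> \<in> C2" "\<alpha>' \<in> A" "a = \<kappa> \<oplus> f1 \<otimes> \<alpha>'" by blast
    have "\<kappa> \<in> carrier R" using h(1) additive_subgroup.a_subset[OF C2_subgroup] by blast
    then have "\<ominus> a = \<ominus> \<kappa> \<oplus> f1 \<otimes> \<ominus> \<alpha>'" unfolding h(3) using A_carrier[OF h(2)] by (simp add: minus_add r_minus)
    then show ?case
      using additive_subgroup.a_inv_closed[OF C2_subgroup h(1)] additive_subgroup.a_inv_closed[OF A_subgroup h(2)] by blast
  next
    case (add a b)
    then obtain \<kappa> \<alpha>' \<mu> \<beta> where h: "\<kappa> \<in> C2" "\<alpha>' \<in> A" "a = \<kappa> \<oplus> f1 \<otimes> \<alpha>'" "\<mu> \<in> C2" "\<beta> \<in> A" "b = \<mu> \<oplus> f1 \<otimes> \<beta>" by blast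
    have c: "\<kappa> \<in> carrier R" "\<mu> \<in> carrier R" "\<alpha>' \<in> carrier R" "\<beta> \<in> carrier R"
      using h additive_subgroup.a_subset[OF C2_subgroup] A_carrier by blast+
    have "a \<oplus> b = (\<kappa> \<oplus> \<mu>) \<oplus> f1 \<otimes> (\<alpha>' \<oplus> \<beta>)" unfolding h(3,6) using c f_carrier by algebra
    then show ?case
      using additive_subgroup.a_closed[OF C2_subgroup h(1,4)] additive_subgroup.a_closed[OF A_subgroup h(2,5)] by blast
  qed
qed

text \<open>Powers of \<open>f2\<close> live in degrees divisible by \<open>d2\<close>. In all other
  degrees the component is zero and \<open>k = \<zero>\<close> serves, whatever the exponent
  \<open>n div d2\<close> is.\<close>

lemma C2_proj:
  assumes "\<kappa> \<in> C2"
  shows "\<exists>k\<in>K. proj n \<kappa> = k \<otimes> f2 [^] (n div d2)"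
  using assms C2_gen_carrier
proof (induction rule: generate_add_induct)
  case zero
  then show ?case using K_sub(2) by (intro bexI[of _ \<zero>]) auto
next
  case (incl a)
  then obtain k j where a: "k \<in> K" "a = k \<otimes> f2 [^] (j::nat)" by blast
  have "a \<in> G (j * d2)" unfolding a(2) by (rule scalar_mult[OF a(1) G_pow[OF f2]])
  then have "proj n a = (if n = j * d2 then a else \<zero>)" by (rule proj_homogeneous)
  moreover have "(j * d2) div d2 = j" using d_pos by simp
  ultimately show ?case using a K_sub(2) by (cases "n = j * d2") (auto intro: bexI[of _ \<zero>])
next
  case (neg a)
  then obtain k where k: "k \<in> K" "proj n a = k \<otimes> f2 [^] (n div d2)" by blast
  have "a \<in> carrier R" using neg(1) C2_gen_carrier by blast
  then have "proj n (\<ominus> a) = \<ominus> k \<otimes> f2 [^] (n div d2)" using k K_closed by (simp add: proj_neg l_minus)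
  then show ?case using K_sub(5)[OF k(1)] by blast
next
  case (add a b)
  then obtain k l where "k \<in> K" "proj n a = k \<otimes> f2 [^] (n div d2)" "l \<in> K" "proj n b = l \<otimes> f2 [^] (n div d2)" by blast
  then have "proj n (a \<oplus> b) = (k \<oplus> l) \<otimes> f2 [^] (n div d2)" "k \<oplus> l \<in> K"
    using add(1,2) K_closed K_sub(7) by (simp_all add: proj_add l_distr)
  then show ?case by blast
qed

text \<open>Each component of \<open>\<kappa>\<close> is a scalar multiple of a power of
  \<open>f2\<close> and, \<open>f1\<close> being homogeneous, lies in \<open>(f1)\<close>. A nonzero
  scalar would put that power itself into \<open>(f1)\<close>.\<close>

lemma C2_multiple_zero:
  assumes "\<kappa> \<in> C2" and r: "r \<in> carrier R" "\<kappa> = f1 \<otimes> r"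
  shows "\<kappa> = \<zero>"
proof (rule proj_eq_zero)
  show "\<kappa> \<in> carrier R" using r by simp
  fix n
  obtain k where k: "k \<in> K" "proj n \<kappa> = k \<otimes> f2 [^] (n div d2)" using C2_proj[OF assms(1)] by blast
  interpret I: ideal "Idl {f1}" R by (rule genideal_ideal) simp
  have f1I: "f1 \<in> Idl {f1}" using genideal_self[of "{f1}"] by simp
  have "proj n \<kappa> = (if n < d1 then \<zero> else proj (n - d1) r \<otimes> f1)"
    using proj_mult[OF r(1) f1] r by (simp add: m_comm)
  then have pI: "proj n \<kappa> \<in> Idl {f1}" using I.I_l_closed[OF f1I] r(1) I.zero_closed by (cases "n < d1") auto
  have "k = \<zero>"
  proof (rule ccontr)
    assume "k \<noteq> \<zero>"
    then have ik: "inv k \<in> K" "inv k \<otimes> k = \<one>" using subfield_m_inv[OF subfield_base, of k] k(1) by auto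
    have "inv k \<otimes> (k \<otimes> f2 [^] (n div d2)) \<in> Idl {f1}"
      using I.I_l_closed[OF pI] K_closed[OF ik(1)] unfolding k(2) by blast
    moreover have "inv k \<otimes> (k \<otimes> f2 [^] (n div d2)) = f2 [^] (n div d2)"
      using ik K_closed[OF ik(1)] K_closed[OF k(1)] by (simp add: m_assoc[symmetric])
    ultimately show False using f2_pow_not_multiple by simp
  qed
  then show "proj n \<kappa> = \<zero>" using k by simp
qed

lemma f2_C2:
  assumes "\<kappa> \<in> C2"
  shows "f2 \<otimes> \<kappa> \<in> C2"
  using assms C2_gen_carrier
proof (induction rule: generate_add_induct)
  case zero
  then show ?case using additive_subgroup.zero_closed[OF C2_subgroup] by simp
next
  case (incl a)
  then obtain k j where a: "k \<in> K" "a = k \<otimes> f2 [^] (j::nat)" by blast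
  then have "f2 \<otimes> a = k \<otimes> f2 [^] Suc j" using K_closed by (simp add: m_ac)
  then show ?case using a(1) by (intro generate.incl) blast
next
  case (neg a)
  have "a \<in> carrier R" using neg(1) C2_gen_carrier by blast
  then show ?case using additive_subgroup.a_inv_closed[OF C2_subgroup neg(2)] by (simp add: r_minus)
next
  case (add a b)
  then show ?case using additive_subgroup.a_closed[OF C2_subgroup add(3,4)] by (simp add: r_distr)
qed

text \<open>Write \<open>\<alpha> = \<kappa> + f1 \<alpha>'\<close> with \<open>\<kappa>\<close> in
  \<open>K[f2]\<close>. Then \<open>f2 \<kappa>\<close> lies in \<open>K[f2]\<close> and is a
  multiple of \<open>f1\<close> in \<open>R\<close>, hence zero.\<close>

lemma A_regular_step:
  assumes "\<alpha> \<in> A" "\<beta> \<in> A" "f2 \<otimes> \<alpha> = f1 \<otimes> \<beta>"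
  shows "\<exists>\<gamma>\<in>A. \<alpha> = f1 \<otimes> \<gamma>"
proof -
  obtain \<kappa> \<alpha>' where h: "\<kappa> \<in> C2" "\<alpha>' \<in> A" "\<alpha> = \<kappa> \<oplus> f1 \<otimes> \<alpha>'" using A_decomp[OF assms(1)] by blast
  have c: "\<kappa> \<in> carrier R" "\<alpha>' \<in> carrier R" "\<beta> \<in> carrier R"
    using h assms additive_subgroup.a_subset[OF C2_subgroup] A_carrier by blast+
  have "f2 \<otimes> \<kappa> = f2 \<otimes> (\<kappa> \<oplus> f1 \<otimes> \<alpha>') \<ominus> f1 \<otimes> (f2 \<otimes> \<alpha>')" using c f_carrier by algebra
  also have "\<dots> = f1 \<otimes> (\<beta> \<ominus> f2 \<otimes> \<alpha>')"
    unfolding h(3)[symmetric] assms(3) using c f_carrier by algebra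
  finally have "f2 \<otimes> \<kappa> = \<zero>" using C2_multiple_zero[OF f2_C2[OF h(1)]] c by simp
  then have "\<kappa> = \<zero>" using integral[of f2 \<kappa>] f2_nonzero c by simp
  then show ?thesis using h c by auto
qed

text \<open>From single factors to powers: an inner induction removes the factors \<open>f2\<close>,
  an outer one the factors \<open>f1\<close>.\<close>

lemma A_regular:
  assumes "\<alpha> \<in> A" "\<beta> \<in> A" "f2 [^] (m::nat) \<otimes> \<alpha> = f1 [^] (N::nat) \<otimes> \<beta>"
  shows "\<exists>\<gamma>\<in>A. \<alpha> = f1 [^] N \<otimes> \<gamma>"
  using assms
proof (induction N arbitrary: \<alpha>)
  case 0
  then show ?case using A_carrier by (intro bexI[of _ \<alpha>]) auto
next
  case (Suc N)
  have powA: "f1 [^] i \<in> A" for i :: nat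
    using f_A A_mult K_A K_sub(3) by (induction i) auto
  have step: "\<exists>\<gamma>\<in>A. \<alpha> = f1 \<otimes> \<gamma>" if "\<alpha> \<in> A" "\<beta> \<in> A" "f2 [^] i \<otimes> \<alpha> = f1 \<otimes> \<beta>" for i :: nat and \<alpha> \<beta>
    using that
  proof (induction i arbitrary: \<alpha>)
    case 0
    then show ?case using A_carrier by auto
  next
    case (Suc i)
    have "f2 [^] i \<otimes> (f2 \<otimes> \<alpha>) = f1 \<otimes> \<beta>" using Suc.prems A_carrier by (simp add: m_assoc)
    then obtain \<gamma> where "\<gamma> \<in> A" "f2 \<otimes> \<alpha> = f1 \<otimes> \<gamma>" using Suc.IH[of "f2 \<otimes> \<alpha>"] A_mult[OF f_A(2) Suc.prems(1)] Suc.prems(2) by blast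
    then show ?case using A_regular_step[OF Suc.prems(1)] by blast
  qed
  have "f2 [^] m \<otimes> \<alpha> = f1 \<otimes> (f1 [^] N \<otimes> \<beta>)" using Suc.prems A_carrier by (simp add: m_ac)
  then obtain \<gamma> where \<gamma>: "\<gamma> \<in> A" "\<alpha> = f1 \<otimes> \<gamma>"
    using step[OF Suc.prems(1) A_mult[OF powA Suc.prems(2)]] by blast
  note c = A_carrier[OF \<gamma>(1)] A_carrier[OF Suc.prems(2)]
  have "f1 \<otimes> (f2 [^] m \<otimes> \<gamma>) = f1 \<otimes> (f1 [^] N \<otimes> \<beta>)"
    using Suc.prems(3) c unfolding \<gamma>(2) by (simp add: m_ac)
  then have "f2 [^] m \<otimes> \<gamma> = f1 [^] N \<otimes> \<beta>" using m_lcancel[OF f1_nonzero, of "f2 [^] m \<otimes> \<gamma>"] c by simp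
  then obtain \<delta> where "\<delta> \<in> A" "\<gamma> = f1 [^] N \<otimes> \<delta>" using Suc.IH[OF \<gamma>(1) Suc.prems(2)] by blast
  then show ?case using \<gamma>(2) A_carrier by (intro bexI[of _ \<delta>]) (auto simp: m_ac)
qed

text \<open>Forms of degree below \<open>M0\<close> suffice as generators: a form of larger degree
  is \<open>f1 a + f2 b\<close> with forms of smaller degree, and \<open>f1\<close>,
  \<open>f2\<close> belong to \<open>A\<close>.\<close>

lemma generated_over_A: "\<exists>bs. set bs \<subseteq> carrier R \<and> Span A bs = carrier R"
proof -
  have "\<forall>n. \<exists>Us. set Us \<subseteq> G n \<and> G n \<subseteq> Span K Us" using G_finite_dimensional by blast
  then obtain U where U: "\<And>n. set (U n) \<subseteq> G n" "\<And>n. G n \<subseteq> Span K (U n)" by metis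
  define bs where "bs = concat (map U [0..<M0])"
  have bs: "set bs \<subseteq> carrier R" using U(1) G_subset by (auto simp: bs_def)
  note props = Span_subring_props[OF A_subring bs]
  have Sc: "Span A bs \<subseteq> carrier R" using Span_in_carrier[OF subringE(1)[OF A_subring] bs] .
  have neg: "\<ominus> x \<in> Span A bs" if x: "x \<in> Span A bs" for x
  proof -
    have "\<ominus> \<one> \<in> A" using subringE(3,5)[OF A_subring] by blast
    then have "\<ominus> \<one> \<otimes> x \<in> Span A bs" using props(3) x by blast
    then show ?thesis using x Sc by (auto simp: l_minus)
  qed
  have sub: "additive_subgroup (Span A bs) R"
    by (rule additive_subgroupI'[OF Sc props(1) neg props(2)])
  have alg: "subalgebra K (Span A bs) R"
    by (intro subalgebra.intro subalgebra_axioms.intro additive_subgroup.a_subgroup[OF sub]) (use props(3) K_A in blast)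
  have G_sub: "G n \<subseteq> Span A bs" for n
  proof (induction n rule: less_induct)
    case (less n)
    show ?case
    proof (cases "n < M0")
      case True
      then have "set (U n) \<subseteq> set bs" by (auto simp: bs_def)
      then have "set (U n) \<subseteq> Span A bs" using Span_subring_base[OF A_subring bs] by blast
      then show ?thesis using subalgebra_Span_incl[OF subfield_base alg] U(2) by blast
    next
      case False
      have comp: "component R G (int n - int d) \<subseteq> Span A bs" if "d > 0" for d
      proof (cases "n < d")
        case True
        then show ?thesis using props(1) by (auto simp: component_def)
      next
        case False
        then have "component R G (int n - int d) = G (n - d)" by (simp add: component_def nat_diff_distrib)
        then show ?thesis using less[of "n - d"] that False by simp
      qed
      show ?thesis
      proof
        fix x assume "x \<in> G n"
        then obtain a b where ab: "a \<in> Span A bs" "b \<in> Span A bs" "x = a \<otimes> f1 \<oplus> b \<otimes> f2"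
          using large_degree[of n x] False comp[OF d_pos(1)] comp[OF d_pos(2)] by (meson linorder_not_less subsetD)
        have "a \<in> carrier R" "b \<in> carrier R" using ab Sc by blast+
        then have "x = f1 \<otimes> a \<oplus> f2 \<otimes> b" unfolding ab(3) by (simp add: m_comm)
        then show "x \<in> Span A bs" using props(2)[OF props(3)[OF f_A(1) ab(1)] props(3)[OF f_A(2) ab(2)]] by simp
      qed
    qed
  qed
  have "x \<in> Span A bs" if x: "x \<in> carrier R" for x
  proof -
    have "(\<Oplus>n\<in>{n. proj n x \<noteq> \<zero>}. proj n x) \<in> Span A bs"
      using G_sub proj_props(1)[OF x] by (intro additive_subgroup_finsum[OF sub proj_props(2)[OF x]]) blast
    then show ?thesis using proj_props(3)[OF x] by simp
  qed
  then show ?thesis using bs Sc by blast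
qed

text \<open>The equation in \<open>u\<close> and \<open>v\<close> describes a section
  \<open>u / f1^N = v / f2^N\<close> of degree \<open>n\<close>, and \<open>a\<close> is a
  denominator common to all of them. \<open>conductor_exists\<close> yields one that need not be
  homogeneous; as \<open>u\<close> and \<open>f1\<close> are homogeneous, any nonzero component of
  it serves.\<close>

lemma homogeneous_conductor:
  "\<exists>m a. a \<in> G m \<and> a \<noteq> \<zero> \<and> (\<forall>n N u v. u \<in> component R G (n + int N * int d1) \<longrightarrow>
     v \<in> carrier R \<longrightarrow> f2 [^] N \<otimes> u = f1 [^] N \<otimes> v \<longrightarrow> (\<exists>z\<in>component R G (int m + n). a \<otimes> u = f1 [^] N \<otimes> z))"
proof -
  obtain bs where bs: "set bs \<subseteq> carrier R" "Span A bs = carrier R" using generated_over_A by blast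
  obtain a where a: "a \<in> A" "a \<noteq> \<zero>" and con: "\<And>x y N. x \<in> carrier R \<Longrightarrow> y \<in> carrier R \<Longrightarrow>
      f2 [^] (N::nat) \<otimes> x = f1 [^] N \<otimes> y \<Longrightarrow> \<exists>z\<in>carrier R. a \<otimes> x = f1 [^] N \<otimes> z"
  proof -
    have reg: "\<exists>\<gamma>\<in>A. \<alpha> = f1 [^] N \<otimes> \<gamma>" if "\<alpha> \<in> A" "\<beta> \<in> A" "f2 [^] N \<otimes> \<alpha> = f1 [^] N \<otimes> \<beta>" for \<alpha> \<beta> and N :: nat
      using A_regular[OF that] .
    have "\<exists>a\<in>A. a \<noteq> \<zero> \<and> (\<forall>x\<in>carrier R. \<forall>y\<in>carrier R. \<forall>N.
      f2 [^] (N::nat) \<otimes> x = f1 [^] N \<otimes> y \<longrightarrow> (\<exists>z\<in>carrier R. a \<otimes> x = f1 [^] N \<otimes> z))"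
      using conductor_exists[OF A_subring f_A(1) f1_nonzero f_A(2) reg bs(1)] unfolding bs(2) .
    then obtain a where a: "a \<in> A" "a \<noteq> \<zero>" "\<forall>x\<in>carrier R. \<forall>y\<in>carrier R. \<forall>N.
      f2 [^] (N::nat) \<otimes> x = f1 [^] N \<otimes> y \<longrightarrow> (\<exists>z\<in>carrier R. a \<otimes> x = f1 [^] N \<otimes> z)" by (elim bexE conjE)
    show thesis by (rule that[OF a(1,2)]) (use a(3) in simp)
  qed
  have ac: "a \<in> carrier R" using a(1) A_carrier by blast
  obtain m where m: "proj m a \<noteq> \<zero>" using proj_eq_zero[OF ac] a(2) by blast
  have "\<exists>z\<in>component R G (int m + n). proj m a \<otimes> u = f1 [^] N \<otimes> z"
    if u: "u \<in> component R G (n + int N * int d1)" and v: "v \<in> carrier R" "f2 [^] N \<otimes> u = f1 [^] N \<otimes> v" for n N u v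
  proof -
    obtain z where z: "z \<in> carrier R" "a \<otimes> u = f1 [^] N \<otimes> z" using con[OF component_closed[OF u] v] by blast
    have "cproj (int m + (n + int N * int d1)) (a \<otimes> u) = proj m a \<otimes> u"
      using cproj_mult[OF ac u, of "int m"] by (simp add: cproj_def)
    moreover have "cproj ((int m + n) + int (N * d1)) (z \<otimes> f1 [^] N) = cproj (int m + n) z \<otimes> f1 [^] N"
      using G_pow[OF f1, of N] by (intro cproj_mult[OF z(1)]) (simp only: component_int)
    ultimately have "proj m a \<otimes> u = f1 [^] N \<otimes> cproj (int m + n) z"
      using z component_closed[OF cproj_component[OF z(1)]] by (simp add: m_comm add.assoc)
    then show ?thesis using cproj_component[OF z(1)] by blast
  qed
  then have "proj m a \<in> G m \<and> proj m a \<noteq> \<zero> \<and> (\<forall>n N u v. u \<in> component R G (n + int N * int d1) \<longrightarrow>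
     v \<in> carrier R \<longrightarrow> f2 [^] N \<otimes> u = f1 [^] N \<otimes> v \<longrightarrow> (\<exists>z\<in>component R G (int m + n). proj m a \<otimes> u = f1 [^] N \<otimes> z))"
    using m proj_props(1)[OF ac] by simp
  then show ?thesis by (intro exI)
qed

end

section \<open>The cover of the punctured spectrum by two affine charts\<close>

text \<open>\<open>F\<close> contains a copy of \<open>R\<close> and is a common home for the
  localisations at \<open>f1\<close>, \<open>f2\<close> and \<open>f1 f2\<close>, so that sections
  over the two charts can be intersected.\<close>

locale fraction_cover = graded_surface K R G f1 f2 d1 d2 + F: field F
  for K and R (structure) and G f1 f2 d1 d2 and F (structure) +
  fixes p :: nat and \<epsilon>
  assumes \<epsilon>: "\<epsilon> \<in> ring_hom R F" and \<epsilon>_inj: "inj_on \<epsilon> (carrier R)"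
    and p: "Factorial_Ring.prime p" "add_pow R p \<one> = \<zero>"
begin

sublocale E: ring_hom_cring R F \<epsilon>
  by unfold_locales (rule \<epsilon>)

text \<open>The homogeneous elements of degree \<open>n\<close> of the localization \<open>R\<^sub>g\<close>.\<close>

definition L :: "'a \<Rightarrow> nat \<Rightarrow> int \<Rightarrow> 'c set" where
  "L g d n = {x \<in> carrier F. \<exists>N :: nat. \<epsilon> g [^]\<^bsub>F\<^esub> N \<otimes>\<^bsub>F\<^esub> x \<in> \<epsilon> ` component R G (n + int N * int d)}"

lemma L_carrier: "x \<in> L g d n \<Longrightarrow> x \<in> carrier F"
  unfolding L_def by blast

lemma \<epsilon>_zero: "x \<in> carrier R \<Longrightarrow> \<epsilon> x = \<zero>\<^bsub>F\<^esub> \<longleftrightarrow> x = \<zero>"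
  using inj_onD[OF \<epsilon>_inj, of x \<zero>] by auto

lemma L_I:
  assumes "x \<in> carrier F" "\<epsilon> g [^]\<^bsub>F\<^esub> N \<otimes>\<^bsub>F\<^esub> x = \<epsilon> u" "u \<in> component R G (n + int N * int d)"
  shows "x \<in> L g d n"
proof -
  have "\<epsilon> g [^]\<^bsub>F\<^esub> N \<otimes>\<^bsub>F\<^esub> x \<in> \<epsilon> ` component R G (n + int N * int d)"
    unfolding assms(2) by (rule imageI[OF assms(3)])
  then show ?thesis unfolding L_def using assms(1) by blast
qed

lemma pow_component: "g \<in> G d \<Longrightarrow> g [^] (N :: nat) \<in> component R G (int N * int d)"
  using G_pow[of g d N] component_int[of "N * d"] by simp

text \<open>Further powers of \<open>g\<close> may be multiplied in, so the exponent can be enlarged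
  at will and finitely many fractions acquire a common denominator.\<close>

lemma L_large:
  assumes g: "g \<in> G d" and x: "x \<in> L g d n"
  shows "\<exists>N0. \<forall>N\<ge>N0. \<exists>u\<in>component R G (n + int N * int d). \<epsilon> g [^]\<^bsub>F\<^esub> N \<otimes>\<^bsub>F\<^esub> x = \<epsilon> u"
proof -
  note gc = G_subset[OF g]
  obtain N0 u where u: "u \<in> component R G (n + int N0 * int d)" "\<epsilon> g [^]\<^bsub>F\<^esub> N0 \<otimes>\<^bsub>F\<^esub> x = \<epsilon> u" and xc: "x \<in> carrier F"
    using x unfolding L_def by auto
  have "\<exists>u\<in>component R G (n + int N * int d). \<epsilon> g [^]\<^bsub>F\<^esub> N \<otimes>\<^bsub>F\<^esub> x = \<epsilon> u" if N: "N \<ge> N0" for N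
  proof (rule bexI)
    have "\<epsilon> g [^]\<^bsub>F\<^esub> N = \<epsilon> g [^]\<^bsub>F\<^esub> (N - N0) \<otimes>\<^bsub>F\<^esub> \<epsilon> g [^]\<^bsub>F\<^esub> N0" using N gc by (simp add: F.nat_pow_mult)
    then have "\<epsilon> g [^]\<^bsub>F\<^esub> N \<otimes>\<^bsub>F\<^esub> x = \<epsilon> g [^]\<^bsub>F\<^esub> (N - N0) \<otimes>\<^bsub>F\<^esub> \<epsilon> u" using gc xc by (simp add: F.m_assoc u(2))
    also have "\<dots> = \<epsilon> (g [^] (N - N0) \<otimes> u)" using gc component_closed[OF u(1)] by simp
    finally show "\<epsilon> g [^]\<^bsub>F\<^esub> N \<otimes>\<^bsub>F\<^esub> x = \<epsilon> (g [^] (N - N0) \<otimes> u)" .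
    have "int (N - N0) * int d + (n + int N0 * int d) = n + int N * int d" using N by (simp add: of_nat_diff algebra_simps)
    from component_mult[OF pow_component[OF g, of "N - N0"] u(1), unfolded this]
    show "g [^] (N - N0) \<otimes> u \<in> component R G (n + int N * int d)" .
  qed
  then show ?thesis by blast
qed

lemma L_family:
  assumes g: "g \<in> G d"
  shows "F.graded_family (L g d)"
  unfolding F.graded_family_def
proof (intro conjI allI ballI)
  note gc [simp] = G_subset[OF g]
  fix n
  note sub = component_subgroup[of "n + int N * int d" for N]
  show "additive_subgroup (L g d n) F"
  proof (rule F.additive_subgroupI')
    show "L g d n \<subseteq> carrier F" using L_carrier by blast
    show "\<zero>\<^bsub>F\<^esub> \<in> L g d n" by (rule L_I[of _ _ 0 \<zero>]) (use additive_subgroup.zero_closed[OF sub[of 0]] in auto)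
    show "\<ominus>\<^bsub>F\<^esub> x \<in> L g d n" if x: "x \<in> L g d n" for x
    proof -
      obtain N u where u: "u \<in> component R G (n + int N * int d)" "\<epsilon> g [^]\<^bsub>F\<^esub> N \<otimes>\<^bsub>F\<^esub> x = \<epsilon> u"
        using L_large[OF g x] by blast
      show ?thesis
        using u(2) L_carrier[OF x] component_closed[OF u(1)] additive_subgroup.a_inv_closed[OF sub u(1)]
        by (intro L_I[of _ _ N "\<ominus> u"]) (auto simp: F.r_minus)
    qed
    show "x \<oplus>\<^bsub>F\<^esub> y \<in> L g d n" if xy: "x \<in> L g d n" "y \<in> L g d n" for x y
    proof -
      obtain N M where N: "\<forall>i\<ge>N. \<exists>u\<in>component R G (n + int i * int d). \<epsilon> g [^]\<^bsub>F\<^esub> i \<otimes>\<^bsub>F\<^esub> x = \<epsilon> u"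
        and M: "\<forall>i\<ge>M. \<exists>u\<in>component R G (n + int i * int d). \<epsilon> g [^]\<^bsub>F\<^esub> i \<otimes>\<^bsub>F\<^esub> y = \<epsilon> u"
        using L_large[OF g xy(1)] L_large[OF g xy(2)] by blast
      obtain u v where u: "u \<in> component R G (n + int (N + M) * int d)" "\<epsilon> g [^]\<^bsub>F\<^esub> (N + M) \<otimes>\<^bsub>F\<^esub> x = \<epsilon> u"
        and v: "v \<in> component R G (n + int (N + M) * int d)" "\<epsilon> g [^]\<^bsub>F\<^esub> (N + M) \<otimes>\<^bsub>F\<^esub> y = \<epsilon> v"
        using N[rule_format, of "N + M"] M[rule_format, of "N + M"] by auto
      show ?thesis
        using u(2) v(2) L_carrier[OF xy(1)] L_carrier[OF xy(2)] component_closed[OF u(1)] component_closed[OF v(1)]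
          additive_subgroup.a_closed[OF sub u(1) v(1)]
        by (intro L_I[of _ _ "N + M" "u \<oplus> v"]) (auto simp: F.r_distr)
    qed
  qed
next
  show "\<one>\<^bsub>F\<^esub> \<in> L g d 0"
    by (rule L_I[of _ _ 0 \<one>]) (use one_component in \<open>auto simp: component_def\<close>)
next
  note gc [simp] = G_subset[OF g]
  fix m n x y assume x: "x \<in> L g d m" and y: "y \<in> L g d n"
  obtain N u where u: "u \<in> component R G (m + int N * int d)" "\<epsilon> g [^]\<^bsub>F\<^esub> N \<otimes>\<^bsub>F\<^esub> x = \<epsilon> u"
    using L_large[OF g x] by blast
  obtain M v where v: "v \<in> component R G (n + int M * int d)" "\<epsilon> g [^]\<^bsub>F\<^esub> M \<otimes>\<^bsub>F\<^esub> y = \<epsilon> v"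
    using L_large[OF g y] by blast
  note c = L_carrier[OF x] L_carrier[OF y]
  have "\<epsilon> g [^]\<^bsub>F\<^esub> (N + M) \<otimes>\<^bsub>F\<^esub> (x \<otimes>\<^bsub>F\<^esub> y) = (\<epsilon> g [^]\<^bsub>F\<^esub> N \<otimes>\<^bsub>F\<^esub> x) \<otimes>\<^bsub>F\<^esub> (\<epsilon> g [^]\<^bsub>F\<^esub> M \<otimes>\<^bsub>F\<^esub> y)"
    using c by (simp add: F.nat_pow_mult[symmetric] F.m_ac)
  also have "\<dots> = \<epsilon> (u \<otimes> v)" using u v component_closed by simp
  finally have eq: "\<epsilon> g [^]\<^bsub>F\<^esub> (N + M) \<otimes>\<^bsub>F\<^esub> (x \<otimes>\<^bsub>F\<^esub> y) = \<epsilon> (u \<otimes> v)" .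
  have "m + int N * int d + (n + int M * int d) = m + n + int (N + M) * int d" by (simp add: algebra_simps)
  from component_mult[OF u(1) v(1), unfolded this]
  show "x \<otimes>\<^bsub>F\<^esub> y \<in> L g d (m + n)" using c by (intro L_I[OF _ eq]) auto
qed

lemma component_L: "u \<in> component R G n \<Longrightarrow> \<epsilon> u \<in> L g d n"
  using component_closed[of u n] by (intro L_I[of _ _ 0 u]) auto

lemma L_mult:
  assumes g: "g \<in> G d" "g' \<in> G d'" and x: "x \<in> L g d n"
  shows "x \<in> L (g \<otimes> g') (d + d') n"
proof -
  note [simp] = G_subset[OF g(1)] G_subset[OF g(2)]
  obtain N u where u: "u \<in> component R G (n + int N * int d)" "\<epsilon> g [^]\<^bsub>F\<^esub> N \<otimes>\<^bsub>F\<^esub> x = \<epsilon> u"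
    using L_large[OF g(1) x] by blast
  have "\<epsilon> (g \<otimes> g') [^]\<^bsub>F\<^esub> N \<otimes>\<^bsub>F\<^esub> x = \<epsilon> g' [^]\<^bsub>F\<^esub> N \<otimes>\<^bsub>F\<^esub> (\<epsilon> g [^]\<^bsub>F\<^esub> N \<otimes>\<^bsub>F\<^esub> x)"
    using L_carrier[OF x] by (simp add: F.nat_pow_distrib F.m_ac)
  also have "\<dots> = \<epsilon> (g' [^] N \<otimes> u)" unfolding u(2) using component_closed[OF u(1)] by simp
  finally have eq: "\<epsilon> (g \<otimes> g') [^]\<^bsub>F\<^esub> N \<otimes>\<^bsub>F\<^esub> x = \<epsilon> (g' [^] N \<otimes> u)" .
  have "int N * int d' + (n + int N * int d) = n + int N * int (d + d')" by (simp add: algebra_simps)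
  from component_mult[OF pow_component[OF g(2), of N] u(1), unfolded this]
  show ?thesis by (rule L_I[OF L_carrier[OF x] eq])
qed

lemma inv_nonzero:
  assumes "g \<in> carrier R" "g \<noteq> \<zero>"
  shows "inv\<^bsub>F\<^esub> \<epsilon> g \<in> carrier F" "\<epsilon> g \<otimes>\<^bsub>F\<^esub> inv\<^bsub>F\<^esub> \<epsilon> g = \<one>\<^bsub>F\<^esub>"
  using assms \<epsilon>_zero by (auto simp: F.field_Units)

lemma inv_L:
  assumes g: "g \<in> G d" "g \<noteq> \<zero>"
  shows "inv\<^bsub>F\<^esub> \<epsilon> g \<in> L g d (- int d)"
  using inv_nonzero[OF G_subset[OF g(1)] g(2)] G_subset[OF g(1)] one_component
  by (intro L_I[of _ _ 1 \<one>]) (auto simp: component_def)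

lemma cproj_other: "u \<in> component R G i \<Longrightarrow> i \<noteq> z \<Longrightarrow> cproj z u = \<zero>"
  using proj_homogeneous[of u "nat i" "nat z"] by (auto simp: component_def cproj_def split: if_splits)

lemma cproj_finsum:
  assumes "finite I" "\<And>m. m \<in> I \<Longrightarrow> u m \<in> component R G (m + c)"
  shows "cproj (n + c) (\<Oplus>m\<in>I. u m) = (if n \<in> I then u n else \<zero>)"
  using assms
proof (induction I rule: finite_induct)
  case empty
  then show ?case by (simp add: cproj_def)
next
  case (insert i I)
  have c: "u i \<in> carrier R" "(\<Oplus>m\<in>I. u m) \<in> carrier R"
    using insert.prems component_closed by (auto intro!: finsum_closed)
  have "cproj (n + c) (\<Oplus>m\<in>insert i I. u m) = cproj (n + c) (u i) \<oplus> (if n \<in> I then u n else \<zero>)"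
    using insert c component_closed by (subst finsum_insert) (auto simp: cproj_add Pi_iff)
  moreover have "cproj (n + c) (u i) = (if n = i then u i else \<zero>)"
    using cproj_homogeneous[of "u i" "i + c"] cproj_other[of "u i" "i + c" "n + c"] insert.prems by auto
  moreover have "u n \<in> carrier R" if "n \<in> I" using insert.prems component_closed that by blast
  ultimately show ?case using insert.hyps c by auto
qed

text \<open>Clearing a common denominator turns the sum into one of homogeneous elements of
  \<open>R\<close> of distinct degrees.\<close>

lemma L_independent:
  assumes g: "g \<in> G d" "g \<noteq> \<zero>" and fin: "finite I" and x: "\<And>n. n \<in> I \<Longrightarrow> x n \<in> L g d n"
    and sum: "(\<Oplus>\<^bsub>F\<^esub>n\<in>I. x n) = \<zero>\<^bsub>F\<^esub>" and n: "n \<in> I"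
  shows "x n = \<zero>\<^bsub>F\<^esub>"
proof -
  note gc [simp] = G_subset[OF g(1)]
  have xc: "x n \<in> carrier F" if "n \<in> I" for n using x[OF that] L_carrier by blast
  have "\<forall>n\<in>I. \<exists>N0. \<forall>N\<ge>N0. \<exists>u\<in>component R G (n + int N * int d). \<epsilon> g [^]\<^bsub>F\<^esub> N \<otimes>\<^bsub>F\<^esub> x n = \<epsilon> u"
    using L_large[OF g(1) x] by blast
  then obtain N0 where N0: "\<And>n N. n \<in> I \<Longrightarrow> N \<ge> N0 n \<Longrightarrow>
      \<exists>u\<in>component R G (n + int N * int d). \<epsilon> g [^]\<^bsub>F\<^esub> N \<otimes>\<^bsub>F\<^esub> x n = \<epsilon> u" by metis
  \<comment> \<open>Any common upper bound of the \<open>N0 n\<close> would do.\<close>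
  define N :: nat where "N = sum N0 I"
  have "N \<ge> N0 n" if "n \<in> I" for n unfolding N_def using fin that by (intro member_le_sum) auto
  then have "\<forall>n\<in>I. \<exists>u. u \<in> component R G (n + int N * int d) \<and> \<epsilon> g [^]\<^bsub>F\<^esub> N \<otimes>\<^bsub>F\<^esub> x n = \<epsilon> u" using N0 by blast
  then obtain u where u: "\<And>n. n \<in> I \<Longrightarrow> u n \<in> component R G (n + int N * int d)"
    "\<And>n. n \<in> I \<Longrightarrow> \<epsilon> g [^]\<^bsub>F\<^esub> N \<otimes>\<^bsub>F\<^esub> x n = \<epsilon> (u n)" by metis
  have uc: "u n \<in> carrier R" if "n \<in> I" for n using u(1)[OF that] component_closed by blast
  have "\<epsilon> (\<Oplus>n\<in>I. u n) = (\<Oplus>\<^bsub>F\<^esub>n\<in>I. \<epsilon> (u n))" using uc by (subst E.hom_finsum) (auto simp: comp_def)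
  also have "\<dots> = (\<Oplus>\<^bsub>F\<^esub>n\<in>I. \<epsilon> g [^]\<^bsub>F\<^esub> N \<otimes>\<^bsub>F\<^esub> x n)" using u(2) xc uc by (intro F.finsum_cong') auto
  also have "\<dots> = \<epsilon> g [^]\<^bsub>F\<^esub> N \<otimes>\<^bsub>F\<^esub> (\<Oplus>\<^bsub>F\<^esub>n\<in>I. x n)" using xc fin by (subst F.finsum_rdistr) auto
  also have "\<dots> = \<zero>\<^bsub>F\<^esub>" unfolding sum by simp
  finally have "\<epsilon> (\<Oplus>n\<in>I. u n) = \<zero>\<^bsub>F\<^esub>" .
  then have "(\<Oplus>n\<in>I. u n) = \<zero>" by (rule \<epsilon>_zero[THEN iffD1, rotated]) (use uc in auto)
  then have "u n = \<zero>" using cproj_finsum[OF fin u(1), of n] n by (simp add: cproj_def split: if_splits)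
  then have "\<epsilon> g [^]\<^bsub>F\<^esub> N \<otimes>\<^bsub>F\<^esub> x n = \<zero>\<^bsub>F\<^esub>" using u(2)[OF n] by simp
  moreover have "\<epsilon> g [^]\<^bsub>F\<^esub> N \<otimes>\<^bsub>F\<^esub> inv\<^bsub>F\<^esub> \<epsilon> g [^]\<^bsub>F\<^esub> N = \<one>\<^bsub>F\<^esub>"
    using inv_nonzero[OF gc g(2)] by (simp add: F.nat_pow_distrib[symmetric])
  ultimately show ?thesis
    using F.integral[of "\<epsilon> g [^]\<^bsub>F\<^esub> N" "x n"] xc[OF n] inv_nonzero[OF gc g(2)] by auto
qed

section \<open>The cover given by the localisations at \<open>f1\<close> and
  \<open>f2\<close>\<close>

abbreviation "i1 \<equiv> inv\<^bsub>F\<^esub> \<epsilon> f1"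
abbreviation "i2 \<equiv> inv\<^bsub>F\<^esub> \<epsilon> f2"
abbreviation "H \<equiv> L (f1 \<otimes> f2) (d1 + d2)"
abbreviation "D1 \<equiv> L f1 d1"
abbreviation "D2 \<equiv> L f2 d2"

lemma f12: "f1 \<otimes> f2 \<in> G (d1 + d2)" "f1 \<otimes> f2 \<noteq> \<zero>"
  using mult_component[OF f1 f2] integral[of f1 f2] f1_nonzero f2_nonzero by auto

lemma D_family: "F.graded_family H" "F.graded_family D1" "F.graded_family D2"
  by (rule L_family[OF f12(1)], rule L_family[OF f1], rule L_family[OF f2])

lemma D_H: "D1 n \<subseteq> H n" "D2 n \<subseteq> H n"
  using L_mult[OF f1 f2] L_mult[OF f2 f1] by (auto simp: m_comm add.commute)

lemma i12: "i1 \<in> D1 (- int d1)" "i2 \<in> D2 (- int d2)" "i1 \<in> carrier F" "i2 \<in> carrier F"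
  "\<epsilon> f1 \<otimes>\<^bsub>F\<^esub> i1 = \<one>\<^bsub>F\<^esub>" "\<epsilon> f2 \<otimes>\<^bsub>F\<^esub> i2 = \<one>\<^bsub>F\<^esub>"
  using inv_L[OF f1 f1_nonzero] inv_L[OF f2 f2_nonzero] inv_nonzero[OF f_carrier(1) f1_nonzero]
    inv_nonzero[OF f_carrier(2) f2_nonzero] by auto

lemma K': "subfield (\<epsilon> ` K) F"
proof (rule ring_hom_ring.img_is_subfield(2)[OF _ subfield_base])
  show "ring_hom_ring R F \<epsilon>" by unfold_locales (use \<epsilon> in \<open>auto\<close>)
qed (use F.one_not_zero in auto)

text \<open>An element of both localisations is \<open>u / f1^j = v / f2^j\<close> for one large
  \<open>j\<close>, which is the situation of \<open>homogeneous_conductor\<close>.\<close>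

lemma conductor: "\<exists>m a. a \<in> G m \<and> a \<noteq> \<zero> \<and> (\<forall>n. \<forall>x\<in>D1 n \<inter> D2 n. \<exists>z\<in>component R G (int m + n). \<epsilon> a \<otimes>\<^bsub>F\<^esub> x = \<epsilon> z)"
proof -
  obtain m a where a: "a \<in> G m" "a \<noteq> \<zero>" and con: "\<And>n N u v. u \<in> component R G (n + int N * int d1) \<Longrightarrow>
     v \<in> carrier R \<Longrightarrow> f2 [^] N \<otimes> u = f1 [^] N \<otimes> v \<Longrightarrow> \<exists>z\<in>component R G (int m + n). a \<otimes> u = f1 [^] N \<otimes> z"
    using homogeneous_conductor by (elim exE conjE) (rule that, assumption+, blast)
  note ac [simp] = G_subset[OF a(1)]
  have "\<exists>z\<in>component R G (int m + n). \<epsilon> a \<otimes>\<^bsub>F\<^esub> x = \<epsilon> z" if x: "x \<in> D1 n" "x \<in> D2 n" for n x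
  proof -
    note xc [simp] = L_carrier[OF x(1)]
    obtain N M where N: "\<forall>i\<ge>N. \<exists>u\<in>component R G (n + int i * int d1). \<epsilon> f1 [^]\<^bsub>F\<^esub> i \<otimes>\<^bsub>F\<^esub> x = \<epsilon> u"
      and M: "\<forall>i\<ge>M. \<exists>u\<in>component R G (n + int i * int d2). \<epsilon> f2 [^]\<^bsub>F\<^esub> i \<otimes>\<^bsub>F\<^esub> x = \<epsilon> u"
      using L_large[OF f1 x(1)] L_large[OF f2 x(2)] by blast
    define j where "j = N + M"
    obtain u v where u: "u \<in> component R G (n + int j * int d1)" "\<epsilon> f1 [^]\<^bsub>F\<^esub> j \<otimes>\<^bsub>F\<^esub> x = \<epsilon> u"
      and v: "v \<in> component R G (n + int j * int d2)" "\<epsilon> f2 [^]\<^bsub>F\<^esub> j \<otimes>\<^bsub>F\<^esub> x = \<epsilon> v"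
      using N[rule_format, of j] M[rule_format, of j] by (auto simp: j_def)
    note uv [simp] = component_closed[OF u(1)] component_closed[OF v(1)]
    have "\<epsilon> (f2 [^] j \<otimes> u) = \<epsilon> (f1 [^] j \<otimes> v)" by (simp add: u(2)[symmetric] v(2)[symmetric] F.m_lcomm)
    then have "f2 [^] j \<otimes> u = f1 [^] j \<otimes> v" by (rule inj_onD[OF \<epsilon>_inj]) auto
    then obtain z where z: "z \<in> component R G (int m + n)" "a \<otimes> u = f1 [^] j \<otimes> z" using con[OF u(1) uv(2)] by blast
    note zc [simp] = component_closed[OF z(1)]
    have "\<epsilon> f1 [^]\<^bsub>F\<^esub> j \<otimes>\<^bsub>F\<^esub> (\<epsilon> a \<otimes>\<^bsub>F\<^esub> x) = \<epsilon> (a \<otimes> u)" by (simp add: u(2)[symmetric] F.m_lcomm)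
    also have "\<dots> = \<epsilon> f1 [^]\<^bsub>F\<^esub> j \<otimes>\<^bsub>F\<^esub> \<epsilon> z" unfolding z(2) by simp
    finally have "i1 [^]\<^bsub>F\<^esub> j \<otimes>\<^bsub>F\<^esub> (\<epsilon> f1 [^]\<^bsub>F\<^esub> j \<otimes>\<^bsub>F\<^esub> (\<epsilon> a \<otimes>\<^bsub>F\<^esub> x)) = i1 [^]\<^bsub>F\<^esub> j \<otimes>\<^bsub>F\<^esub> (\<epsilon> f1 [^]\<^bsub>F\<^esub> j \<otimes>\<^bsub>F\<^esub> \<epsilon> z)" by simp
    moreover have "i1 [^]\<^bsub>F\<^esub> j \<otimes>\<^bsub>F\<^esub> \<epsilon> f1 [^]\<^bsub>F\<^esub> j = \<one>\<^bsub>F\<^esub>"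
      using i12 by (simp add: F.nat_pow_distrib[symmetric] F.m_comm)
    ultimately have "\<epsilon> a \<otimes>\<^bsub>F\<^esub> x = \<epsilon> z" using i12 by (simp add: F.m_assoc[symmetric])
    then show ?thesis using z(1) by blast
  qed
  then show ?thesis using a by blast
qed

text \<open>Powers of a section of negative degree have arbitrarily negative degree, yet their
  products with \<open>\<epsilon> a\<close> lie in \<open>R\<close>, which has no nonzero elements
  of negative degree.\<close>

lemma negative_sections: "n < 0 \<Longrightarrow> D1 n \<inter> D2 n \<subseteq> {\<zero>\<^bsub>F\<^esub>}"
proof
  fix x assume n: "n < 0" and x: "x \<in> D1 n \<inter> D2 n"
  obtain m a where a: "a \<in> G m" "a \<noteq> \<zero>" and con: "\<And>n x. x \<in> D1 n \<inter> D2 n \<Longrightarrow> \<exists>z\<in>component R G (int m + n). \<epsilon> a \<otimes>\<^bsub>F\<^esub> x = \<epsilon> z"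
    using conductor by blast
  note ac [simp] = G_subset[OF a(1)]
  have xc [simp]: "x \<in> carrier F" using x L_carrier by blast
  \<comment> \<open>With this exponent \<open>m + j n \<le> m - j < 0\<close>.\<close>
  define j where "j = m + 1"
  have "x [^]\<^bsub>F\<^esub> j \<in> D1 (int j * n) \<inter> D2 (int j * n)"
    using F.graded_family_pow[OF D_family(2), of x n j] F.graded_family_pow[OF D_family(3), of x n j] x by blast
  then obtain z where z: "z \<in> component R G (int m + int j * n)" "\<epsilon> a \<otimes>\<^bsub>F\<^esub> x [^]\<^bsub>F\<^esub> j = \<epsilon> z" using con by blast
  have "int j * n \<le> - int j" using mult_left_mono[of n "-1" "int j"] n by simp
  then have "int m + int j * n < 0" by (simp add: j_def)
  then have "\<epsilon> a \<otimes>\<^bsub>F\<^esub> x [^]\<^bsub>F\<^esub> j = \<zero>\<^bsub>F\<^esub>" using z by (simp add: component_def)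
  then have "x [^]\<^bsub>F\<^esub> j = \<zero>\<^bsub>F\<^esub>" using F.integral[of "\<epsilon> a" "x [^]\<^bsub>F\<^esub> j"] \<epsilon>_zero[of a] a(2) by simp
  moreover have "x [^]\<^bsub>F\<^esub> i \<noteq> \<zero>\<^bsub>F\<^esub>" if "x \<noteq> \<zero>\<^bsub>F\<^esub>" for i :: nat
    using that by (induction i) (auto dest: F.integral)
  ultimately show "x \<in> {\<zero>\<^bsub>F\<^esub>}" by blast
qed

lemma component_finite_dimensional: "\<exists>Us. set Us \<subseteq> component R G z \<and> component R G z \<subseteq> Span K Us"
proof (cases "z < 0")
  case True
  then show ?thesis by (intro exI[of _ "[]"]) (auto simp: component_def)
next
  case False
  then show ?thesis using G_finite_dimensional by (simp add: component_def)
qed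

text \<open>Multiplication by \<open>\<epsilon> a\<close> embeds the sections of degree
  \<open>n\<close> into the finite-dimensional component of degree \<open>m + n\<close>; a spanning
  list there, divided by \<open>\<epsilon> a\<close>, is the required one.\<close>

lemma finite_sections: "\<exists>Us. set Us \<subseteq> carrier F \<and> D1 n \<inter> D2 n \<subseteq> F.Span (\<epsilon> ` K) Us"
proof -
  obtain m a where a: "a \<in> G m" "a \<noteq> \<zero>" and con: "\<And>n x. x \<in> D1 n \<inter> D2 n \<Longrightarrow> \<exists>z\<in>component R G (int m + n). \<epsilon> a \<otimes>\<^bsub>F\<^esub> x = \<epsilon> z"
    using conductor by blast
  note ac [simp] = G_subset[OF a(1)]
  obtain Vs where V: "set Vs \<subseteq> component R G (int m + n)" "component R G (int m + n) \<subseteq> Span K Vs"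
    using component_finite_dimensional by blast
  have Vc: "set Vs \<subseteq> carrier R" using V(1) component_closed by blast
  note inv_a [simp] = inv_nonzero[OF ac a(2)]
  let ?Us = "map (\<lambda>u. \<epsilon> u \<otimes>\<^bsub>F\<^esub> inv\<^bsub>F\<^esub> \<epsilon> a) Vs"
  have "x \<in> F.Span (\<epsilon> ` K) ?Us" if x: "x \<in> D1 n \<inter> D2 n" for x
  proof -
    obtain z where z: "z \<in> component R G (int m + n)" "\<epsilon> a \<otimes>\<^bsub>F\<^esub> x = \<epsilon> z" using con[OF x] by blast
    have xc: "x \<in> carrier F" using x L_carrier by blast
    have "x = \<epsilon> z \<otimes>\<^bsub>F\<^esub> inv\<^bsub>F\<^esub> \<epsilon> a" unfolding z(2)[symmetric] using xc inv_a by (simp add: F.m_ac)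
    also have "\<dots> \<in> F.Span (\<epsilon> ` K) ?Us"
      by (rule Span_mult_right[OF F.is_cring \<epsilon> inv_a(1) Vc K_carrier]) (use V(2) z(1) in blast)
    finally show ?thesis .
  qed
  moreover have "set ?Us \<subseteq> carrier F" using Vc by auto
  ultimately show ?thesis by blast
qed

lemma H_form:
  assumes "t \<in> H n"
  obtains r N where "r \<in> component R G (n + int N * int d1 + int N * int d2)"
    "t = \<epsilon> r \<otimes>\<^bsub>F\<^esub> (i1 [^]\<^bsub>F\<^esub> N \<otimes>\<^bsub>F\<^esub> i2 [^]\<^bsub>F\<^esub> N)"
proof -
  obtain N r where r: "r \<in> component R G (n + int N * int (d1 + d2))" "\<epsilon> (f1 \<otimes> f2) [^]\<^bsub>F\<^esub> N \<otimes>\<^bsub>F\<^esub> t = \<epsilon> r"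
    using L_large[OF f12(1) assms] by blast
  have "n + int N * int (d1 + d2) = n + int N * int d1 + int N * int d2" by (simp add: algebra_simps)
  from r(1)[unfolded this] have r': "r \<in> component R G (n + int N * int d1 + int N * int d2)" .
  note i = i12(3-6)
  have "\<epsilon> (f1 \<otimes> f2) [^]\<^bsub>F\<^esub> N \<otimes>\<^bsub>F\<^esub> (i1 [^]\<^bsub>F\<^esub> N \<otimes>\<^bsub>F\<^esub> i2 [^]\<^bsub>F\<^esub> N)
      = ((\<epsilon> f1 \<otimes>\<^bsub>F\<^esub> i1) \<otimes>\<^bsub>F\<^esub> (\<epsilon> f2 \<otimes>\<^bsub>F\<^esub> i2)) [^]\<^bsub>F\<^esub> N"
    using i(1,2) by (simp add: F.nat_pow_distrib F.m_ac)
  also have "\<dots> = \<one>\<^bsub>F\<^esub>" using i by simp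
  finally have one: "\<epsilon> (f1 \<otimes> f2) [^]\<^bsub>F\<^esub> N \<otimes>\<^bsub>F\<^esub> (i1 [^]\<^bsub>F\<^esub> N \<otimes>\<^bsub>F\<^esub> i2 [^]\<^bsub>F\<^esub> N) = \<one>\<^bsub>F\<^esub>" .
  have c: "\<epsilon> (f1 \<otimes> f2) [^]\<^bsub>F\<^esub> N \<in> carrier F" "i1 [^]\<^bsub>F\<^esub> N \<otimes>\<^bsub>F\<^esub> i2 [^]\<^bsub>F\<^esub> N \<in> carrier F" "t \<in> carrier F"
    using i(1,2) L_carrier[OF assms] by auto
  have "t = (\<epsilon> (f1 \<otimes> f2) [^]\<^bsub>F\<^esub> N \<otimes>\<^bsub>F\<^esub> (i1 [^]\<^bsub>F\<^esub> N \<otimes>\<^bsub>F\<^esub> i2 [^]\<^bsub>F\<^esub> N)) \<otimes>\<^bsub>F\<^esub> t" unfolding one using c by simp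
  also have "\<dots> = (\<epsilon> (f1 \<otimes> f2) [^]\<^bsub>F\<^esub> N \<otimes>\<^bsub>F\<^esub> t) \<otimes>\<^bsub>F\<^esub> (i1 [^]\<^bsub>F\<^esub> N \<otimes>\<^bsub>F\<^esub> i2 [^]\<^bsub>F\<^esub> N)"
    using c by (simp only: F.m_ac F.m_closed)
  finally show thesis unfolding r(2) by (rule that[OF r'])
qed

lemma monomial_H:
  assumes "r \<in> component R G (n + int a * int d1 + int b * int d2)"
  shows "\<epsilon> r \<otimes>\<^bsub>F\<^esub> (i1 [^]\<^bsub>F\<^esub> a \<otimes>\<^bsub>F\<^esub> i2 [^]\<^bsub>F\<^esub> b) \<in> H n"
proof -
  note m = F.graded_familyD(3)[OF D_family(1)]
  have "i1 [^]\<^bsub>F\<^esub> a \<in> H (int a * - int d1)" "i2 [^]\<^bsub>F\<^esub> b \<in> H (int b * - int d2)"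
    using F.graded_family_pow[OF D_family(1)] i12(1,2) D_H by blast+
  from m[OF component_L[OF assms] m[OF this]] show ?thesis by simp
qed

lemma monomial_D:
  shows "r \<in> component R G (n + int a * int d1) \<Longrightarrow> \<epsilon> r \<otimes>\<^bsub>F\<^esub> i1 [^]\<^bsub>F\<^esub> a \<in> D1 n"
    "r \<in> component R G (n + int b * int d2) \<Longrightarrow> \<epsilon> r \<otimes>\<^bsub>F\<^esub> i2 [^]\<^bsub>F\<^esub> b \<in> D2 n"
proof -
  assume r: "r \<in> component R G (n + int a * int d1)"
  have "i1 [^]\<^bsub>F\<^esub> a \<in> D1 (int a * - int d1)" using F.graded_family_pow[OF D_family(2)] i12(1) by blast
  from F.graded_familyD(3)[OF D_family(2) component_L[OF r] this] show "\<epsilon> r \<otimes>\<^bsub>F\<^esub> i1 [^]\<^bsub>F\<^esub> a \<in> D1 n" by simp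
next
  assume r: "r \<in> component R G (n + int b * int d2)"
  have "i2 [^]\<^bsub>F\<^esub> b \<in> D2 (int b * - int d2)" using F.graded_family_pow[OF D_family(3)] i12(2) by blast
  from F.graded_familyD(3)[OF D_family(3) component_L[OF r] this] show "\<epsilon> r \<otimes>\<^bsub>F\<^esub> i2 [^]\<^bsub>F\<^esub> b \<in> D2 n" by simp
qed

text \<open>Since \<open>G n \<subseteq> f1 G (n - d1) + f2 G (n - d2)\<close> for large \<open>n\<close>, exponents of denominators can be lowered
  until the numerator has bounded degree.\<close>

lemma cech_reduction:
  assumes Us: "set Us \<subseteq> H n"
    and small: "\<And>a b r. n + int a * int d1 + int b * int d2 < int M0 \<Longrightarrow>
      r \<in> component R G (n + int a * int d1 + int b * int d2) \<Longrightarrow>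
      \<epsilon> r \<otimes>\<^bsub>F\<^esub> (i1 [^]\<^bsub>F\<^esub> a \<otimes>\<^bsub>F\<^esub> i2 [^]\<^bsub>F\<^esub> b) \<in> F.Span (\<epsilon> ` K) Us"
  shows "F.cech_spanned (\<epsilon> ` K) (H n) (D1 n) (D2 n) Us"
proof -
  define C where "C t \<longleftrightarrow> (\<exists>u\<in>D1 n. \<exists>v\<in>D2 n. \<exists>w\<in>F.Span (\<epsilon> ` K) Us. t = u \<oplus>\<^bsub>F\<^esub> v \<oplus>\<^bsub>F\<^esub> w)" for t
  note i = i12(3,4)
  have UsF: "set Us \<subseteq> carrier F" using Us L_carrier by blast
  note span = F.Span_subgroup_props[OF K' UsF]
  note zero = F.graded_familyD(4)[OF D_family(2), of n] F.graded_familyD(4)[OF D_family(3), of n] span(2)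
  have C_D1: "C t" if "t \<in> D1 n" for t
    unfolding C_def using that zero L_carrier[OF that] by (intro bexI[of _ t] bexI[of _ "\<zero>\<^bsub>F\<^esub>"]) auto
  have C_D2: "C t" if "t \<in> D2 n" for t
    unfolding C_def using that zero L_carrier[OF that] by (intro bexI[of _ t] bexI[of _ "\<zero>\<^bsub>F\<^esub>"]) auto
  have C_Span: "C t" if "t \<in> F.Span (\<epsilon> ` K) Us" for t
  proof -
    have "t \<in> carrier F" using that span(1) by blast
    then have "t = \<zero>\<^bsub>F\<^esub> \<oplus>\<^bsub>F\<^esub> \<zero>\<^bsub>F\<^esub> \<oplus>\<^bsub>F\<^esub> t" by simp
    then show ?thesis unfolding C_def using that zero by blast
  qed
  have C_add: "C (s \<oplus>\<^bsub>F\<^esub> t)" if st: "C s" "C t" for s t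
  proof -
    obtain u v w u' v' w' where s: "u \<in> D1 n" "v \<in> D2 n" "w \<in> F.Span (\<epsilon> ` K) Us" "s = u \<oplus>\<^bsub>F\<^esub> v \<oplus>\<^bsub>F\<^esub> w"
      and t: "u' \<in> D1 n" "v' \<in> D2 n" "w' \<in> F.Span (\<epsilon> ` K) Us" "t = u' \<oplus>\<^bsub>F\<^esub> v' \<oplus>\<^bsub>F\<^esub> w'"
      using st unfolding C_def by blast
    have "w \<in> carrier F" "w' \<in> carrier F" using s t span(1) by blast+
    then have "s \<oplus>\<^bsub>F\<^esub> t = (u \<oplus>\<^bsub>F\<^esub> u') \<oplus>\<^bsub>F\<^esub> (v \<oplus>\<^bsub>F\<^esub> v') \<oplus>\<^bsub>F\<^esub> (w \<oplus>\<^bsub>F\<^esub> w')"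
      unfolding s(4) t(4) using s(1,2) t(1,2) L_carrier by (simp add: F.a_ac)
    then show ?thesis
      unfolding C_def using F.graded_familyD(7)[OF D_family(2) s(1) t(1)] F.graded_familyD(7)[OF D_family(3) s(2) t(2)]
        span(3)[OF s(3) t(3)] by blast
  qed
  have main: "C (\<epsilon> r \<otimes>\<^bsub>F\<^esub> (i1 [^]\<^bsub>F\<^esub> a \<otimes>\<^bsub>F\<^esub> i2 [^]\<^bsub>F\<^esub> b))"
    if "r \<in> component R G (n + int a * int d1 + int b * int d2)" for a b :: nat and r
    using that
  proof (induction "a + b" arbitrary: a b r)
    case 0
    then show ?case using C_D1[OF monomial_D(1)[of r n 0]] component_closed[OF 0(2)] by simp
  next
    case (Suc s)
    let ?d = "n + int a * int d1 + int b * int d2"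
    note rc [simp] = component_closed[OF Suc.prems]
    \<comment> \<open>With one exponent zero the fraction lives on a single chart; otherwise its
      numerator either has small degree or can be split to lower an exponent.\<close>
    consider "a = 0" | "b = 0" | a' b' where "a = Suc a'" "b = Suc b'" by (cases a; cases b) auto
    then show ?case
    proof cases
      case 1
      then show ?thesis using C_D2[OF monomial_D(2)[of r n b]] Suc.prems i by simp
    next
      case 2
      then show ?thesis using C_D1[OF monomial_D(1)[of r n a]] Suc.prems i by simp
    next
      case 3
      show ?thesis
      proof (cases "?d < int M0")
        case True
        then show ?thesis using C_Span[OF small[OF True Suc.prems]] by blast
      next
        case False
        have d: "int (nat ?d) = ?d" "nat ?d \<ge> M0" using False by auto
        have "r \<in> G (nat ?d)" using Suc.prems False by (simp add: component_def)
        then obtain r1 r2 where r: "r1 \<in> component R G (?d - int d1)" "r2 \<in> component R G (?d - int d2)"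
          "r = r1 \<otimes> f1 \<oplus> r2 \<otimes> f2" using large_degree[OF d(2), of r] unfolding d(1) by blast
        have e: "?d - int d1 = n + int a' * int d1 + int b * int d2" "?d - int d2 = n + int a * int d1 + int b' * int d2"
          using 3 by (simp_all add: algebra_simps)
        note r12 = r(1)[unfolded e(1)] r(2)[unfolded e(2)]
        note c = component_closed[OF r(1)] component_closed[OF r(2)]
        have C1: "C (\<epsilon> r1 \<otimes>\<^bsub>F\<^esub> (i1 [^]\<^bsub>F\<^esub> a' \<otimes>\<^bsub>F\<^esub> i2 [^]\<^bsub>F\<^esub> b))" by (rule Suc.hyps(1)[OF _ r12(1)]) (use Suc.hyps(2) 3 in simp)
        have C2: "C (\<epsilon> r2 \<otimes>\<^bsub>F\<^esub> (i1 [^]\<^bsub>F\<^esub> a \<otimes>\<^bsub>F\<^esub> i2 [^]\<^bsub>F\<^esub> b'))" by (rule Suc.hyps(1)[OF _ r12(2)]) (use Suc.hyps(2) 3 in simp)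
        let ?P1 = "i1 [^]\<^bsub>F\<^esub> a'" and ?P2 = "i2 [^]\<^bsub>F\<^esub> b'"
        have pc: "?P1 \<in> carrier F" "?P2 \<in> carrier F" "\<epsilon> r1 \<in> carrier F" "\<epsilon> r2 \<in> carrier F" "\<epsilon> f1 \<in> carrier F" "\<epsilon> f2 \<in> carrier F"
          using i c by auto
        have "\<epsilon> r \<otimes>\<^bsub>F\<^esub> (i1 [^]\<^bsub>F\<^esub> a \<otimes>\<^bsub>F\<^esub> i2 [^]\<^bsub>F\<^esub> b)
            = (\<epsilon> r1 \<otimes>\<^bsub>F\<^esub> \<epsilon> f1 \<oplus>\<^bsub>F\<^esub> \<epsilon> r2 \<otimes>\<^bsub>F\<^esub> \<epsilon> f2) \<otimes>\<^bsub>F\<^esub> ((?P1 \<otimes>\<^bsub>F\<^esub> i1) \<otimes>\<^bsub>F\<^esub> (?P2 \<otimes>\<^bsub>F\<^esub> i2))"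
          unfolding r(3) 3 using c by simp
        also have "\<dots> = (\<epsilon> f1 \<otimes>\<^bsub>F\<^esub> i1) \<otimes>\<^bsub>F\<^esub> (\<epsilon> r1 \<otimes>\<^bsub>F\<^esub> (?P1 \<otimes>\<^bsub>F\<^esub> (?P2 \<otimes>\<^bsub>F\<^esub> i2)))
            \<oplus>\<^bsub>F\<^esub> (\<epsilon> f2 \<otimes>\<^bsub>F\<^esub> i2) \<otimes>\<^bsub>F\<^esub> (\<epsilon> r2 \<otimes>\<^bsub>F\<^esub> ((?P1 \<otimes>\<^bsub>F\<^esub> i1) \<otimes>\<^bsub>F\<^esub> ?P2))"
          using pc i by algebra
        also have "\<dots> = \<epsilon> r1 \<otimes>\<^bsub>F\<^esub> (i1 [^]\<^bsub>F\<^esub> a' \<otimes>\<^bsub>F\<^esub> i2 [^]\<^bsub>F\<^esub> b) \<oplus>\<^bsub>F\<^esub> \<epsilon> r2 \<otimes>\<^bsub>F\<^esub> (i1 [^]\<^bsub>F\<^esub> a \<otimes>\<^bsub>F\<^esub> i2 [^]\<^bsub>F\<^esub> b')"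
          unfolding i12(5,6) 3 using pc i by simp
        finally show ?thesis using C_add[OF C1 C2] by simp
      qed
    qed
  qed
  have "C t" if t: "t \<in> H n" for t
  proof -
    obtain r N where r: "r \<in> component R G (n + int N * int d1 + int N * int d2)"
      "t = \<epsilon> r \<otimes>\<^bsub>F\<^esub> (i1 [^]\<^bsub>F\<^esub> N \<otimes>\<^bsub>F\<^esub> i2 [^]\<^bsub>F\<^esub> N)" by (rule H_form[OF t])
    show ?thesis using main[OF r(1)] unfolding r(2) .
  qed
  then show ?thesis using Us unfolding F.cech_spanned_def C_def by blast
qed

text \<open>Numerators have degree at least \<open>n\<close>, hence never below \<open>M0\<close>,
  and the reduction ends on the charts without any spanning class.\<close>

lemma cech_vanishing: "n \<ge> int M0 \<Longrightarrow> F.cech_spanned (\<epsilon> ` K) (H n) (D1 n) (D2 n) []"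
proof (rule cech_reduction)
  fix a b :: nat and r assume "n \<ge> int M0" "n + int a * int d1 + int b * int d2 < int M0"
  moreover have "0 \<le> int a * int d1 + int b * int d2" by simp
  ultimately have False by linarith
  then show "\<epsilon> r \<otimes>\<^bsub>F\<^esub> (i1 [^]\<^bsub>F\<^esub> a \<otimes>\<^bsub>F\<^esub> i2 [^]\<^bsub>F\<^esub> b) \<in> F.Span (\<epsilon> ` K) []" ..
qed simp

text \<open>Only finitely many pairs of exponents have numerators of degree below \<open>M0\<close>,
  and each pair contributes a finite-dimensional space of numerators.\<close>

lemma cech_finite_dimensional: "\<exists>Us. F.cech_spanned (\<epsilon> ` K) (H n) (D1 n) (D2 n) Us"
proof -
  have "\<forall>z. \<exists>Us. set Us \<subseteq> component R G z \<and> component R G z \<subseteq> Span K Us" using component_finite_dimensional by blast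
  then obtain V where V: "\<And>z. set (V z) \<subseteq> component R G z" "\<And>z. component R G z \<subseteq> Span K (V z)" by metis
  have Vc: "set (V z) \<subseteq> carrier R" for z using V(1) component_closed by blast
  define deg where "deg a b = n + int a * int d1 + int b * int d2" for a b
  define W where "W a b = map (\<lambda>u. \<epsilon> u \<otimes>\<^bsub>F\<^esub> (i1 [^]\<^bsub>F\<^esub> a \<otimes>\<^bsub>F\<^esub> i2 [^]\<^bsub>F\<^esub> b)) (V (deg a b))" for a b :: nat
  \<comment> \<open>Since \<open>d1, d2 \<ge> 1\<close>, both exponents are below \<open>q\<close>
    when the numerator has degree below \<open>M0\<close>.\<close>
  define q where "q = nat (int M0 - n)"
  define Us where "Us = concat (map (\<lambda>a. concat (map (W a) [0..<q])) [0..<q])"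
  have W_H: "set (W a b) \<subseteq> H n" for a b
    using monomial_H[OF subsetD[OF V(1)]] by (auto simp: W_def deg_def)
  have Us: "set Us \<subseteq> H n" using W_H by (auto simp: Us_def)
  have UsF: "set Us \<subseteq> carrier F" using Us L_carrier by blast
  have "F.cech_spanned (\<epsilon> ` K) (H n) (D1 n) (D2 n) Us"
  proof (rule cech_reduction[OF Us])
    fix a b :: nat and r
    assume small: "n + int a * int d1 + int b * int d2 < int M0" and r: "r \<in> component R G (n + int a * int d1 + int b * int d2)"
    have "int a \<le> int a * int d1" "int b \<le> int b * int d2"
      using mult_left_mono[of 1 "int d1" "int a"] mult_left_mono[of 1 "int d2" "int b"] d_pos by simp_all
    moreover have "0 \<le> int a" "0 \<le> int b" by simp_all
    ultimately have "int a < int M0 - n" "int b < int M0 - n" using small by linarith+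
    then have ab: "a \<in> {0..<q}" "b \<in> {0..<q}" by (simp_all add: q_def)
    have concat: "set y \<subseteq> set (concat zs)" if "y \<in> set zs" for y and zs :: "'c list list" using that by auto
    have "set (W a b) \<subseteq> set (concat (map (W a) [0..<q]))"
      by (rule concat) (unfold set_map set_upt, rule imageI[OF ab(2)])
    also have "\<dots> \<subseteq> set Us"
      unfolding Us_def by (rule concat) (unfold set_map set_upt, rule imageI[OF ab(1)])
    finally have "set (W a b) \<subseteq> set Us" .
    then have "F.Span (\<epsilon> ` K) (W a b) \<subseteq> F.Span (\<epsilon> ` K) Us" by (rule F.mono_Span_sublist[OF K' _ UsF])
    moreover have "\<epsilon> r \<otimes>\<^bsub>F\<^esub> (i1 [^]\<^bsub>F\<^esub> a \<otimes>\<^bsub>F\<^esub> i2 [^]\<^bsub>F\<^esub> b) \<in> F.Span (\<epsilon> ` K) (W a b)"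
      unfolding W_def
      by (rule Span_mult_right[OF F.is_cring \<epsilon> _ Vc K_carrier]) (use i12 V(2) r in \<open>auto simp: deg_def simp del: Span.simps\<close>)
    ultimately show "\<epsilon> r \<otimes>\<^bsub>F\<^esub> (i1 [^]\<^bsub>F\<^esub> a \<otimes>\<^bsub>F\<^esub> i2 [^]\<^bsub>F\<^esub> b) \<in> F.Span (\<epsilon> ` K) Us" by blast
  qed
  then show ?thesis by blast
qed

lemma p_F: "add_pow F p \<one>\<^bsub>F\<^esub> = \<zero>\<^bsub>F\<^esub>"
  using E.hom_add_pow_one[of p] p(2) by simp

lemma \<epsilon>_D: "\<epsilon> ` G n \<subseteq> D1 (int n)" "\<epsilon> ` G n \<subseteq> D2 (int n)"
  using component_L[of _ "int n"] by auto

lemma \<epsilon>_K: "\<epsilon> ` K \<subseteq> D1 0" "\<epsilon> ` K \<subseteq> D2 0"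
  using \<epsilon>_D[of 0] degree_zero by auto

theorem covered: "covered_algebra R G F K p H D1 D2 \<epsilon> f1 f2 i1 i2 d1 d2"
proof (intro covered_algebra.intro covered_algebra_axioms.intro chart_cover.intro chart_cover_axioms.intro)
  show "graded_cring R G" by unfold_locales
  show "cring F" by (rule F.is_cring)
  show "subfield (\<epsilon> ` K) F" by (rule K')
  show "Factorial_Ring.prime p" "add_pow F p \<one>\<^bsub>F\<^esub> = \<zero>\<^bsub>F\<^esub>" by (rule p(1), rule p_F)
  show "F.graded_family H" "F.graded_family D1" "F.graded_family D2" by (rule D_family)+
  show "D1 n \<subseteq> H n" "D2 n \<subseteq> H n" for n by (rule D_H)+
  show "\<epsilon> ` K \<subseteq> D1 0" "\<epsilon> ` K \<subseteq> D2 0" by (rule \<epsilon>_K)+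
  show "x n = \<zero>\<^bsub>F\<^esub>" if "finite I" "\<And>n. n \<in> I \<Longrightarrow> x n \<in> H n" "(\<Oplus>\<^bsub>F\<^esub>n\<in>I. x n) = \<zero>\<^bsub>F\<^esub>" "n \<in> I" for I x n
    by (rule L_independent[OF f12 that])
  show "\<epsilon> f1 \<in> D1 (int d1)" "\<epsilon> f1 \<in> D2 (int d1)" "\<epsilon> f2 \<in> D1 (int d2)" "\<epsilon> f2 \<in> D2 (int d2)"
    using \<epsilon>_D f1 f2 by blast+
  show "0 < d1" "0 < d2" by (rule d_pos)+
  show "i1 \<in> D1 (- int d1)" "i2 \<in> D2 (- int d2)" "\<epsilon> f1 \<otimes>\<^bsub>F\<^esub> i1 = \<one>\<^bsub>F\<^esub>" "\<epsilon> f2 \<otimes>\<^bsub>F\<^esub> i2 = \<one>\<^bsub>F\<^esub>"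
    by (rule i12)+
  show "D1 n \<inter> D2 n \<subseteq> {\<zero>\<^bsub>F\<^esub>}" if "n < 0" for n by (rule negative_sections[OF that])
  show "\<exists>Us. set Us \<subseteq> carrier F \<and> D1 n \<inter> D2 n \<subseteq> F.Span (\<epsilon> ` K) Us" for n by (rule finite_sections)
  show "\<exists>Us. F.cech_spanned (\<epsilon> ` K) (H n) (D1 n) (D2 n) Us" for n by (rule cech_finite_dimensional)
  show "\<exists>n0. \<forall>n\<ge>n0. F.cech_spanned (\<epsilon> ` K) (H n) (D1 n) (D2 n) []" using cech_vanishing by blast
  show "\<epsilon> \<in> ring_hom R F" "inj_on \<epsilon> (carrier R)" "K \<subseteq> carrier R" by (rule \<epsilon>, rule \<epsilon>_inj, rule K_carrier)
  show "\<epsilon> ` G n \<subseteq> D1 (int n)" "\<epsilon> ` G n \<subseteq> D2 (int n)" for n by (rule \<epsilon>_D)+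
  show "f1 \<in> G d1" "f2 \<in> G d2" by (rule f1, rule f2)
qed

end

section \<open>Characteristic, degenerate cases and assembly\<close>

lemma (in domain) ring_char_prime:
  assumes "ring_char R > 0"
  shows "Factorial_Ring.prime (ring_char R)" "add_pow R (ring_char R) \<one> = \<zero>"
proof -
  have iff: "add_pow R n \<one> = \<zero> \<longleftrightarrow> ring_char R dvd n" for n :: nat
    unfolding ring_char_def using add.pow_eq_id[of \<one> n] by (simp add: add_pow_def)
  show "add_pow R (ring_char R) \<one> = \<zero>" unfolding iff by simp
  have "prime_elem (ring_char R)"
  proof (rule prime_elemI)
    show "ring_char R \<noteq> 0" using assms by simp
    show "\<not> ring_char R dvd 1" unfolding iff[symmetric] by simp
    fix a b assume "ring_char R dvd a * b"
    then have "add_pow R (a * b) \<one> = \<zero>" by (simp only: iff)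
    moreover have "add_pow R a \<one> \<otimes> add_pow R b \<one> = add_pow R (a * b) \<one>"
      by (simp add: add_pow_ldistr add.nat_pow_pow mult.commute)
    ultimately have "add_pow R a \<one> = \<zero> \<or> add_pow R b \<one> = \<zero>" using integral by simp
    then show "ring_char R dvd a \<or> ring_char R dvd b" unfolding iff .
  qed
  then show "Factorial_Ring.prime (ring_char R)" by (rule iffD1[OF prime_elem_nat_iff])
qed

lemma (in standard_graded_algebra) base_char_prime:
  assumes "ring_char (R\<lparr>carrier := K\<rparr>) = p" "p > 0"
  shows "Factorial_Ring.prime p" "add_pow R p \<one> = \<zero>"
proof -
  interpret B: field "R\<lparr>carrier := K\<rparr>" by (rule subfield_iff(2)[OF subfield_base])
  show "Factorial_Ring.prime p" using B.ring_char_prime(1) assms by simp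
  show "add_pow R p \<one> = \<zero>" using B.ring_char_prime(2) assms by (simp add: add_pow_def nat_pow_def)
qed

text \<open>Witnessed by the trivial extension \<open>R\<close> of itself; it settles the case in
  which \<open>f1\<close> or \<open>f2\<close> is a unit.\<close>

lemma (in graded_cring) ideal_in_plus_closure:
  assumes "A \<subseteq> carrier R"
  shows "Idl A \<subseteq> gr_plus_closure R G A"
proof
  fix x assume x: "x \<in> Idl A"
  have "x \<in> carrier R" using x ideal.Icarr[OF genideal_ideal[OF assms]] by blast
  moreover have "finite_graded_extension R G R G id"
  proof (intro finite_graded_extension.intro finite_graded_extension_axioms.intro)
    show "graded_cring R G" "graded_cring R G" by unfold_locales
    show "id \<in> ring_hom R R" by (simp add: ring_hom_def)
    have "\<exists>c. c \<in> {\<one>} \<rightarrow> carrier R \<and> s = (\<Oplus>b\<in>{\<one>}. id (c b) \<otimes> b)" if "s \<in> carrier R" for s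
      using that by (intro exI[of _ "\<lambda>_. s"]) auto
    then show "\<exists>B. finite B \<and> B \<subseteq> carrier R \<and> (\<forall>s\<in>carrier R. \<exists>c. c \<in> B \<rightarrow> carrier R \<and> s = (\<Oplus>b\<in>B. id (c b) \<otimes> b))"
      by (intro exI[of _ "{\<one>}"]) auto
  qed auto
  ultimately show "x \<in> gr_plus_closure R G A"
    using assms x by (intro gr_plus_closureI[where S = R and \<phi> = id]) auto
qed

text \<open>The ideal is principal, which dimension two forbids. The disjunction excludes a nonzero
  constant \<open>f\<close>, for which the pair would be primary.\<close>

lemma (in standard_graded_algebra) not_primary_zero:
  assumes dim: "krull_dim R = 2" and f: "f \<in> G d" "f = \<zero> \<or> d > 0"
  shows "\<not> primary R G {\<zero>, f}"
proof
  assume prim: "primary R G {\<zero>, f}"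
  have fc: "f \<in> carrier R" using f(1) G_subset by blast
  then obtain M where M: "\<forall>n\<ge>M. G n \<subseteq> Idl {\<zero>, f}" using primary_ideal_large[OF prim] by auto
  have id: "ideal (Idl {f}) R" using fc by (intro genideal_ideal) simp
  have "{\<zero>, f} \<subseteq> Idl {f}"
    using genideal_self[of "{f}"] fc additive_subgroup.zero_closed[OF ideal.axioms(1)[OF id]] by simp
  then have "\<forall>n\<ge>M. G n \<subseteq> Idl {f}" using M genideal_minimal[OF id] by blast
  \<comment> \<open>Zero is homogeneous of every degree, in particular of degree
    \<open>1\<close>.\<close>
  moreover obtain e where "f \<in> G e" "e > 0" using f G_zero[of 1] by (cases "f = \<zero>") auto
  ultimately show False using dim_two_principal_not_large[OF dim] by blast
qed

text \<open>The restriction on the type of \<open>T\<close> is harmless, as sequences over a type of sequences can be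
  encoded in that type.\<close>

lemma solve_finitely_many:
  fixes T :: "'c ring" and enc :: "(nat \<Rightarrow> 'c) \<Rightarrow> 'c"
  assumes enc: "inj enc" and cov: "covered_algebra R G T K p H D1 D2 \<phi> f1 f2 i1 i2 d1 d2" and f3: "f3 \<in> G d3"
    and g: "g1 \<in> component R G (int k - int d1)" "g2 \<in> component R G (int k - int d2)"
      "g3 \<in> component R G (int k - int d3)"
    and rel: "f1 \<otimes>\<^bsub>R\<^esub> g1 \<oplus>\<^bsub>R\<^esub> f2 \<otimes>\<^bsub>R\<^esub> g2 \<oplus>\<^bsub>R\<^esub> f3 \<otimes>\<^bsub>R\<^esub> g3 = \<zero>\<^bsub>R\<^esub>"
    and a: "a1 \<in> component R G (int N * int d1 - (int k - int d1))"
      "a2 \<in> component R G (int N * int d1 - (int k - int d2))"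
      "a3 \<in> component R G (int N * int d1 - (int k - int d3))"
      "f1 [^]\<^bsub>R\<^esub> N = a1 \<otimes>\<^bsub>R\<^esub> g1 \<oplus>\<^bsub>R\<^esub> a2 \<otimes>\<^bsub>R\<^esub> g2 \<oplus>\<^bsub>R\<^esub> a3 \<otimes>\<^bsub>R\<^esub> g3"
    and b: "b1 \<in> component R G (int M * int d2 - (int k - int d1))"
      "b2 \<in> component R G (int M * int d2 - (int k - int d2))"
      "b3 \<in> component R G (int M * int d2 - (int k - int d3))"
      "f2 [^]\<^bsub>R\<^esub> M = b1 \<otimes>\<^bsub>R\<^esub> g1 \<oplus>\<^bsub>R\<^esub> b2 \<otimes>\<^bsub>R\<^esub> g2 \<oplus>\<^bsub>R\<^esub> b3 \<otimes>\<^bsub>R\<^esub> g3"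
    and I: "finite I" "\<forall>n\<in>I. x n \<in> G n \<and> k \<le> n \<and> d1 + d2 + d3 \<le> n + k"
  shows "\<exists>(S :: 'c ring) H' D1' D2' \<phi>' i1' i2'. covered_algebra R G S K p H' D1' D2' \<phi>' f1 f2 i1' i2' d1 d2 \<and>
    (\<forall>n\<in>I. covered_algebra.solved S D1' D2' \<phi>' f1 f2 f3 (x n))"
  using I
proof (induction I rule: finite_induct)
  case empty
  then show ?case using cov by blast
next
  case (insert n I)
  obtain S :: "'c ring" and H' D1' D2' \<phi>' i1' i2' where
    S: "covered_algebra R G S K p H' D1' D2' \<phi>' f1 f2 i1' i2' d1 d2"
      "\<forall>n\<in>I. covered_algebra.solved S D1' D2' \<phi>' f1 f2 f3 (x n)"
    using insert.IH insert.prems by blast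
  interpret S: covered_algebra R G S K p H' D1' D2' \<phi>' f1 f2 i1' i2' d1 d2 by (rule S(1))
  obtain S2 :: "'c ring" and h H2 E1 E2 j1 j2 where S2: "h \<in> ring_hom S S2"
    "covered_algebra R G S2 K p H2 E1 E2 (h \<circ> \<phi>') f1 f2 j1 j2 d1 d2"
    "\<forall>n. h ` D1' n \<subseteq> E1 n" "\<forall>n. h ` D2' n \<subseteq> E2 n"
    "covered_algebra.solved S2 E1 E2 (h \<circ> \<phi>') f1 f2 f3 (x n)"
  proof -
    have "x n \<in> G n" "k \<le> n" "d1 + d2 + d3 \<le> n + k" using insert.prems by simp_all
    from S.solve_step[OF enc f3 g rel a b this] show thesis by (elim exE conjE) (rule that)
  qed
  have "covered_algebra.solved S2 E1 E2 (h \<circ> \<phi>') f1 f2 f3 (x i)" if "i \<in> I" for i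
    by (rule solved_mono[OF S(1) S2(2) S2(1) S2(3)[rule_format] S2(4)[rule_format] S.G_carrier[OF f3]])
      (use S(2) that in blast)
  then have "\<forall>i\<in>insert n I. covered_algebra.solved S2 E1 E2 (h \<circ> \<phi>') f1 f2 f3 (x i)" using S2(5) by blast
  then show ?case using S2(2) by blast
qed

lemma (in graded_cring) homogeneous_power_combination:
  assumes f: "f \<in> G d" "d > 0" and prim: "primary R G {g1, g2, g3}"
    and g: "g1 \<in> component R G k1" "g2 \<in> component R G k2" "g3 \<in> component R G k3"
  obtains N a1 a2 a3 where "a1 \<in> component R G (int N * int d - k1)" "a2 \<in> component R G (int N * int d - k2)"
    "a3 \<in> component R G (int N * int d - k3)" "f [^] N = a1 \<otimes> g1 \<oplus> a2 \<otimes> g2 \<oplus> a3 \<otimes> g3"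
proof -
  obtain N where N: "f [^] (N :: nat) \<in> Idl {g1, g2, g3}" by (rule primary_power[OF prim f])
  have "f [^] N \<in> component R G (int N * int d)" using G_pow[OF f(1), of N] component_int[of "N * d"] by simp
  then show thesis by (rule homogeneous_combination[OF _ g N]) (rule that)
qed

text \<open>The base cover lives in the fraction field. All components are solved in one extension
  of it, whose ring of global sections is the finite graded extension required.\<close>

lemma (in graded_surface) large_degree_in_plus_closure:
  fixes p :: nat
  assumes p: "Factorial_Ring.prime p" "add_pow R p \<one> = \<zero>" and f3: "f3 \<in> G d3"
    and g: "g1 \<in> component R G (int k - int d1)" "g2 \<in> component R G (int k - int d2)"
      "g3 \<in> component R G (int k - int d3)"
    and rel: "f1 \<otimes> g1 \<oplus> f2 \<otimes> g2 \<oplus> f3 \<otimes> g3 = \<zero>" and gprim: "primary R G {g1, g2, g3}"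
    and I: "finite I" "\<forall>n\<in>I. x n \<in> G n \<and> k \<le> n \<and> d1 + d2 + d3 \<le> n + k"
  shows "(\<Oplus>n\<in>I. x n) \<in> gr_plus_closure R G {f1, f2, f3}"
proof -
  let ?F = "fraction_field R"
  have field: "field ?F" by (rule fraction_field_is_field)
  interpret C: fraction_cover K R G f1 f2 d1 d2 ?F p "fraction_embed R"
    by (intro fraction_cover.intro fraction_cover_axioms.intro graded_surface_axioms field
        fraction_embed_hom fraction_embed_inj p)
  interpret V: covered_algebra R G ?F K p C.H C.D1 C.D2 "fraction_embed R" f1 f2 C.i1 C.i2 d1 d2
    by (rule C.covered)
  \<comment> \<open>The zero class is killed merely to pass from the type of the fraction field to a
    type of sequences over it, which all later extensions can share.\<close>
  have z: "\<zero>\<^bsub>?F\<^esub> \<in> C.H 0" by (rule C.F.graded_familyD(4)[OF C.D_family(1)])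
  obtain S :: "(nat \<Rightarrow> ('a \<times> 'a) set) ring" and h H' D1' D2' where
    S: "covered_algebra R G S K p H' D1' D2' (h \<circ> fraction_embed R) f1 f2 (h C.i1) (h C.i2) d1 d2"
    by (rule V.kill[OF inj_on_id z order_refl], rule that)
  \<comment> \<open>The pairing of natural numbers turns a sequence of sequences into one
    sequence.\<close>
  define enc :: "(nat \<Rightarrow> (nat \<Rightarrow> ('a \<times> 'a) set)) \<Rightarrow> nat \<Rightarrow> ('a \<times> 'a) set" where
    "enc s = (\<lambda>n. case prod_decode n of (i, j) \<Rightarrow> s i j)" for s
  have enc: "inj enc"
  proof (rule injI, intro ext)
    fix s t i j assume "enc s = enc t"
    then have "enc s (prod_encode (i, j)) = enc t (prod_encode (i, j))" by simp
    then show "s i j = t i j" by (simp add: enc_def)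
  qed
  obtain N a1 a2 a3 where a: "a1 \<in> component R G (int N * int d1 - (int k - int d1))"
    "a2 \<in> component R G (int N * int d1 - (int k - int d2))" "a3 \<in> component R G (int N * int d1 - (int k - int d3))"
    "f1 [^] N = a1 \<otimes> g1 \<oplus> a2 \<otimes> g2 \<oplus> a3 \<otimes> g3"
    by (rule homogeneous_power_combination[OF f1 d_pos(1) gprim g], rule that)
  obtain M b1 b2 b3 where b: "b1 \<in> component R G (int M * int d2 - (int k - int d1))"
    "b2 \<in> component R G (int M * int d2 - (int k - int d2))" "b3 \<in> component R G (int M * int d2 - (int k - int d3))"
    "f2 [^] M = b1 \<otimes> g1 \<oplus> b2 \<otimes> g2 \<oplus> b3 \<otimes> g3"
    by (rule homogeneous_power_combination[OF f2 d_pos(2) gprim g], rule that)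
  obtain S2 :: "(nat \<Rightarrow> ('a \<times> 'a) set) ring" and H2 E1 E2 \<phi> j1 j2 where
    S2: "covered_algebra R G S2 K p H2 E1 E2 \<phi> f1 f2 j1 j2 d1 d2"
      "\<forall>n\<in>I. covered_algebra.solved S2 E1 E2 \<phi> f1 f2 f3 (x n)"
    using solve_finitely_many[OF enc S f3 g rel a b I] by (elim exE conjE) (rule that)
  interpret W: covered_algebra R G S2 K p H2 E1 E2 \<phi> f1 f2 j1 j2 d1 d2 by (rule S2(1))
  have f3c: "f3 \<in> carrier R" using f3 G_subset by blast
  have xc: "x n \<in> carrier R" if "n \<in> I" for n using I(2) that G_subset by blast
  show ?thesis
  proof (rule gr_plus_closureI[OF W.sections_extension])
    let ?S = "S2\<lparr>carrier := W.sections_carrier\<rparr>"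
    let ?J = "Idl\<^bsub>?S\<^esub> (\<phi> ` {f1, f2, f3})"
    interpret E: finite_graded_extension R G ?S "\<lambda>n. W.B (int n)" \<phi> by (rule W.sections_extension)
    interpret Q: ring_hom_ring R ?S \<phi> by (intro ring_hom_ringI2 E.embed_hom) unfold_locales
    show sum: "(\<Oplus>n\<in>I. x n) \<in> carrier R" using xc by (auto intro!: finsum_closed)
    show "{f1, f2, f3} \<subseteq> carrier R" using f3c by simp
    \<comment> \<open>The ideal is pulled back to \<open>R\<close>, so that membership of the sum
      follows from that of its summands.\<close>
    have "ideal ?J ?S"
      by (rule ring.genideal_ideal[OF ring_hom_ring.axioms(2)[OF Q.ring_hom_ring_axioms]]) (use Q.hom_closed f3c in \<open>auto simp del: Q.hom_closed\<close>)
    then have "ideal {r \<in> carrier R. \<phi> r \<in> ?J} R" by (rule Q.ideal_vimage)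
    then interpret J: ideal "{r \<in> carrier R. \<phi> r \<in> ?J}" R .
    have "x n \<in> {r \<in> carrier R. \<phi> r \<in> ?J}" if "n \<in> I" for n
      by (intro CollectI conjI W.solved_in_ideal[OF S2(2)[rule_format, OF that] f3c] xc[OF that])
    then have "(\<Oplus>n\<in>I. x n) \<in> {r \<in> carrier R. \<phi> r \<in> ?J}"
      by (rule additive_subgroup_finsum[OF J.additive_subgroup_axioms I(1)])
    then show "\<phi> (\<Oplus>n\<in>I. x n) \<in> ?J" by blast
  qed
qed

lemma (in standard_graded_algebra) scalar_ideal:
  assumes "u \<in> A" "A \<subseteq> carrier R" "u \<in> K" "u \<noteq> \<zero>"
  shows "Idl A = carrier R"
proof -
  have I: "ideal (Idl A) R" by (rule genideal_ideal[OF assms(2)])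
  have u: "inv u \<in> carrier R" "inv u \<otimes> u = \<one>"
    using subfield_m_inv[OF subfield_base, of u] assms(3,4) K_carrier by auto
  have "inv u \<otimes> u \<in> Idl A" using ideal.I_l_closed[OF I _ u(1)] genideal_self[OF assms(2)] assms(1) by blast
  then show ?thesis unfolding u(2) by (rule ideal.one_imp_carrier[OF I])
qed

theorem theorem10p7:
  fixes R :: "('a, 'm) ring_scheme" and K :: "'a set" and G :: "nat \<Rightarrow> 'a set"
    and p d1 d2 d3 k :: nat and f1 f2 f3 g1 g2 g3 :: 'a
  assumes "standard_graded_algebra K R G"
    and "algebraically_closed (R\<lparr>carrier := K\<rparr>)"
    and "ring_char (R\<lparr>carrier := K\<rparr>) = p" and "p > 0"
    and "normal_domain R"
    and "krull_dim R = 2"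
    and "f1 \<in> G d1" and "f2 \<in> G d2" and "f3 \<in> G d3"
    and "primary R G {f1, f2}" and "primary R G {f1, f3}" and "primary R G {f2, f3}"
    and "primary_relation R G (f1, f2, f3) (d1, d2, d3) k (g1, g2, g3)"
  shows "graded_ge R G (nat (max (int k) (int d1 + int d2 + int d3 - int k)))
           \<subseteq> gr_plus_closure R G {f1, f2, f3}"
proof
  interpret A: standard_graded_algebra K R G by fact
  interpret D: "domain" R using assms(5) unfolding normal_domain_def by blast
  fix x assume "x \<in> graded_ge R G (nat (max (int k) (int d1 + int d2 + int d3 - int k)))"
  then obtain I c where I: "finite I" "I \<subseteq> {nat (max (int k) (int d1 + int d2 + int d3 - int k))..}"
    "\<forall>n\<in>I. c n \<in> G n" and x: "x = (\<Oplus>\<^bsub>R\<^esub>n\<in>I. c n)" unfolding graded_ge_def by blast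
  have f: "{f1, f2, f3} \<subseteq> carrier R" using assms(7-9) A.G_subset by blast
  have xc: "x \<in> carrier R" unfolding x using I(3) A.G_subset by (auto intro!: A.finsum_closed)
  \<comment> \<open>A nonzero constant among \<open>f1\<close>, \<open>f2\<close> makes the ideal
    all of \<open>R\<close>. Otherwise each of the two has positive degree or is zero, and zero is
    ruled out by dimension two.\<close>
  show "x \<in> gr_plus_closure R G {f1, f2, f3}"
  proof (cases "\<exists>u\<in>{f1, f2}. u \<in> K \<and> u \<noteq> \<zero>\<^bsub>R\<^esub>")
    case True
    then have "Idl\<^bsub>R\<^esub> {f1, f2, f3} = carrier R" using A.scalar_ideal[OF _ f] by blast
    then show ?thesis using A.ideal_in_plus_closure[OF f] xc by blast
  next
    case False
    have d1: "f1 = \<zero>\<^bsub>R\<^esub> \<or> d1 > 0" and d2: "f2 = \<zero>\<^bsub>R\<^esub> \<or> d2 > 0"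
      using False assms(7,8) A.degree_zero by (cases d1; cases d2; auto)+
    have "f1 \<noteq> \<zero>\<^bsub>R\<^esub>" using A.not_primary_zero[OF assms(6,8) d2] assms(10) by blast
    moreover have "f2 \<noteq> \<zero>\<^bsub>R\<^esub>"
      using A.not_primary_zero[OF assms(6,7) d1] assms(10) by (auto simp: insert_commute)
    ultimately interpret S: graded_surface K R G f1 f2 d1 d2
      using assms(6-8,10) d1 d2 by unfold_locales auto
    have g: "g1 \<in> component R G (int k - int d1)" "g2 \<in> component R G (int k - int d2)"
      "g3 \<in> component R G (int k - int d3)"
      and rel: "f1 \<otimes>\<^bsub>R\<^esub> g1 \<oplus>\<^bsub>R\<^esub> f2 \<otimes>\<^bsub>R\<^esub> g2 \<oplus>\<^bsub>R\<^esub> f3 \<otimes>\<^bsub>R\<^esub> g3 = \<zero>\<^bsub>R\<^esub>"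
      and gprim: "primary R G {g1, g2, g3}" using assms(13) by (auto simp: primary_relation_def)
    \<comment> \<open>One part of the maximum for each obstruction class:
      \<open>n \<ge> d1 + d2 + d3 - k\<close> for the first, \<open>n \<ge> k\<close> for the
      second.\<close>
    have "\<forall>n\<in>I. c n \<in> G n \<and> k \<le> n \<and> d1 + d2 + d3 \<le> n + k" using I(2,3) by fastforce
    then show ?thesis
      unfolding x by (rule S.large_degree_in_plus_closure[OF A.base_char_prime[OF assms(3,4)] assms(9) g rel gprim I(1)])
  qed
qed

end
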